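(* Let $T\in\mathcal{K}(V)$ be bisectorial of angle $\omega\in(0,\frac{\pi}{2})$, let $\theta\in(\omega,\frac{\pi}{2})$, $g\in\mathcal{N}^{\mathrm{reg}}(D_\theta)$, and let $p$ be an intrinsic polynomial. Then $p\circ g\in\mathcal{N}^{\mathrm{reg}}(D_\theta)$ and $$(p\circ g)(T)\supseteq p[g(T)],$$ where $(p\circ g)(T)$ and $g(T)$ are given by the $H^\infty$-functional calculus.
   Context: Clifford setting. Fix an integer $n\geq 1$. $\mathbb{R}_n$ is the real Clifford algebra generated by $e_1,\dots,e_n$ with $e_i^2=-1$, $e_ie_j=-e_je_i$ ($i\neq j$), with basis $e_A=e_{i_1}\cdots e_{i_r}$ for $A=(i_1<\dots<i_r)$, $e_\emptyset=1$, and $|s|^2=\sum_As_A^2$ for $s=\sum_As_Ae_A$. Paravectors: $\mathbb{R}^{n+1}=\{s_0+s_1e_1+\dots+s_ne_n\}\subseteq\mathbb{R}_n$ with $\overline{s}=s_0-s_1e_1-\dots-s_ne_n$. $\mathbb{S}=\{s\in\mathbb{R}^{n+1}: s_0=0,|s|=1\}$ and $\mathbb{C}_J=\{x+Jy: x,y\in\mathbb{R}\}$ for $J\in\mathbb{S}$. $U\subseteq\mathbb{R}^{n+1}$ is axially symmetric if $x+Jy\in U$ ($x,y\in\mathbb{R}$, $J\in\mathbb{S}$) implies $x+Iy\in U$ for all $I\in\mathbb{S}$. Slice hyperholomorphic functions. For $U$ open and axially symmetric, $f:U\to\mathbb{R}_n$ is left slice hyperholomorphic ($f\in\mathcal{SH}_L(U)$)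 if there are continuously differentiable $f_0,f_1:\{(x,y)\in\mathbb{R}^2: x+\mathbb{S}y\subseteq U\}\to\mathbb{R}_n$ with $f(x+Jy)=f_0(x,y)+Jf_1(x,y)$ for all $J\in\mathbb{S}$, $f_0(x,-y)=f_0(x,y)$, $f_1(x,-y)=-f_1(x,y)$, $\partial_xf_0=\partial_yf_1$, $\partial_yf_0=-\partial_xf_1$. If $f_0,f_1$ are real valued, $f$ is called intrinsic ($f\in\mathcal{N}(U)$). Operators. $V_\mathbb{R}$ is a real Banach space, $V=\{\sum_Av_A\otimes e_A: v_A\in V_\mathbb{R}\}$ the corresponding Clifford module with norm $\|v\|^2=\sum_A\|v_A\|^2$ and the natural left and right multiplications by $\mathbb{R}_n$. $\mathcal{B}(V)$: bounded everywhere defined right-linear operators; $\mathcal{K}(V)$: closed right-linear operators $T:\operatorname{dom}(T)\to V$ with right-linear domain $\operatorname{dom}(T)\subseteq V$. A Clifford number $a$ is identified with the operator $v\mapsto av$, so $(aT)v=a(Tv)$, $(Ta)v=T(av)$. For operators, $A\subseteq B$ means $\operatorname{dom}(A)\subseteq\operatorname{dom}(B)$ and $Av=Bv$ for $v\in\operatorname{dom}(A)$; products have their natural domains. For $s\in\mathbb{R}^{n+1}$, $Q_s[T]=T^2-2s_0T+|s|^2$ on $\operatorname{dom}(T^2)$; $\rho_S(T)=\{s\in\mathbb{R}^{n+1}: Q_s[T]^{-1}\in\mathcal{B}(V)\}$, $\sigma_S(T)=\mathbb{R}^{n+1}\setminus\rho_S(T)$, and $S_L^{-1}(s,T)=Q_s[T]^{-1}\overline{s}-TQ_s[T]^{-1}$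 for $s\in\rho_S(T)$. Bisectorial operators. For $\omega\in(0,\frac{\pi}{2})$, $I_\omega=(-\omega,\omega)\cup(\pi-\omega,\pi+\omega)$ and $D_\omega=\{re^{J\phi}: r>0,\,J\in\mathbb{S},\,\phi\in I_\omega\}\subseteq\mathbb{R}^{n+1}$. $T\in\mathcal{K}(V)$ is bisectorial of angle $\omega$ if $\sigma_S(T)\subseteq\overline{D_\omega}$ and for every $\varphi\in(\omega,\frac{\pi}{2})$ there is $C_\varphi\geq 0$ with $\|S_L^{-1}(s,T)\|\leq\frac{C_\varphi}{|s|}$ for all $s\in\mathbb{R}^{n+1}\setminus(D_\varphi\cup\{0\})$. $\omega$-functional calculus. $\mathcal{SH}_L^0(D_\theta)$ is the set of bounded $f\in\mathcal{SH}_L(D_\theta)$ with $\int_0^\infty|f(te^{J\phi})|\frac{dt}{t}<\infty$ for all $J\in\mathbb{S}$, $\phi\in I_\theta$; $\mathcal{N}^0(D_\theta)$ is the set of intrinsic such functions. For $T$ bisectorial of angle $\omega$, $\theta\in(\omega,\frac{\pi}{2})$ and $f\in\mathcal{SH}_L^0(D_\theta)$, $$f(T)=\frac{1}{2\pi}\int_{\partial D_\varphi\cap\mathbb{C}_J}S_L^{-1}(s,T)ds_Jf(s):=\frac{1}{2\pi}\sum_\pm\int_\mathbb{R}S_L^{-1}(\gamma_\pm(t),T)\frac{\gamma_\pm'(t)}{J}f(\gamma_\pm(t))dt\in\mathcal{B}(V),$$ with $\gamma_\pm(t)=\pm|t|e^{-\operatorname{sgn}(t)J\varphi}$; it does not depend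 on the choice of $\varphi\in(\omega,\theta)$ and $J\in\mathbb{S}$. Extended $\omega$-functional calculus. $\mathcal{N}^{\mathrm{bnd}}(D_\theta)$ is the set of functions $g(s)=g_\infty+\frac{1}{1+s^2}(g_0-g_\infty)+\widetilde{g}(s)$ on $D_\theta$ with $g_0,g_\infty\in\mathbb{R}$, $\widetilde{g}\in\mathcal{N}^0(D_\theta)$ (unique components). For such $g$, $g(T):=g_\infty+(1+T^2)^{-1}(g_0-g_\infty)+\widetilde{g}(T)\in\mathcal{B}(V)$; here $1+T^2$ is boundedly invertible since $\mathbb{S}\subseteq\rho_S(T)$. $H^\infty$-functional calculus. $\mathcal{N}^{\mathrm{reg}}(D_\theta)$ is the set of $g\in\mathcal{N}(D_\theta)$ for which there exists $e\in\mathcal{N}^{\mathrm{bnd}}(D_\theta)$ (a regularizer of $g$) with $eg\in\mathcal{N}^{\mathrm{bnd}}(D_\theta)$ and $e(T)$ injective. For such $g$, $g(T):=e(T)^{-1}(eg)(T)$ with its natural domain $\operatorname{dom}(g(T))=\{v\in V: (eg)(T)v\in\operatorname{ran}(e(T))\}$; this closed operator is independent of the regularizer $e$. Polynomials. An intrinsic polynomial of degree $m$ is $p(s)=p_0+p_1s+\dots+p_ms^m$ with real coefficients, $p_m\neq 0$; for an operator $A\in\mathcal{K}(V)$, $p[A]=p_0+p_1A+\dots+p_mA^m$ with $\operatorname{dom}(p[A])=\operatorname{dom}(A^m)$. *)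

theory Defs
  imports "HOL-Analysis.Analysis" "HOL-Computational_Algebra.Polynomial"
begin

subsection \<open>The Clifford algebra and Clifford modules\<close>

text \<open>
  The generators \<open>e\<^sub>1, \<dots>, e\<^sub>n\<close> are indexed by a finite linearly ordered type \<open>'n\<close>, so
  \<open>n = CARD('n)\<close> is an arbitrary positive integer. A family indexed by the subsets of \<open>'n\<close> collects
  the coefficients with respect to the basis \<open>e\<^sub>A\<close>. The library norm of \<^typ>\<open>'v ^ 'n set\<close> is
  \<open>(\<Sum>A. \<parallel>v\<^sub>A\<parallel>\<^sup>2)\<^sup>1\<^sup>/\<^sup>2\<close>, both for \<open>\<real>\<^sub>n\<close> and for the module \<open>V\<close> over a real Banach space \<open>'v\<close>.
  The componentwise product of the library on \<^typ>\<open>real ^ 'n set\<close> is never used.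
\<close>

type_synonym 'n clifford = "(real, 'n set) vec"
type_synonym ('v, 'n) cmodule = "('v, 'n set) vec"

text \<open>
  \<open>e\<^sub>A e\<^sub>B = csign A B \<cdot> e\<^bsub>A \<triangle> B\<^esub>\<close>: sorting the concatenated word costs one sign for every pair
  \<open>i \<in> A\<close>, \<open>j \<in> B\<close> with \<open>i > j\<close>, and each common index contributes \<open>e\<^sub>i\<^sup>2 = -1\<close>.
\<close>

definition csign :: "'n::{finite,linorder} set \<Rightarrow> 'n set \<Rightarrow> real" where
  "csign A B = (- 1) ^ card {(i, j). i \<in> A \<and> j \<in> B \<and> j \<le> i}"

definition cl_mult :: "'n::{finite,linorder} clifford \<Rightarrow> 'n clifford \<Rightarrow> 'n clifford"
    (infixl "\<odot>" 70) where
  "a \<odot> b = (\<Sum>A\<in>UNIV. \<Sum>B\<in>UNIV. axis (sym_diff A B) (csign A B * (a $ A) * (b $ B)))"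

definition cl_left :: "'n::{finite,linorder} clifford \<Rightarrow> ('v::real_vector, 'n) cmodule \<Rightarrow> ('v, 'n) cmodule"
    (infixr "\<triangleright>" 70) where
  "a \<triangleright> v = (\<Sum>A\<in>UNIV. \<Sum>B\<in>UNIV. axis (sym_diff A B) ((csign A B * (a $ A)) *\<^sub>R (v $ B)))"

definition cl_right :: "('v::real_vector, 'n) cmodule \<Rightarrow> 'n::{finite,linorder} clifford \<Rightarrow> ('v, 'n) cmodule"
    (infixl "\<triangleleft>" 70) where
  "v \<triangleleft> a = (\<Sum>A\<in>UNIV. \<Sum>B\<in>UNIV. axis (sym_diff A B) ((csign A B * (a $ B)) *\<^sub>R (v $ A)))"

definition cl_of_real :: "real \<Rightarrow> 'n::finite clifford" where
  "cl_of_real r = axis {} r"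

abbreviation cl_one :: "'n::finite clifford" where
  "cl_one \<equiv> cl_of_real 1"

primrec cl_pow :: "'n::{finite,linorder} clifford \<Rightarrow> nat \<Rightarrow> 'n clifford" where
  "cl_pow a 0 = cl_one"
| "cl_pow a (Suc k) = a \<odot> cl_pow a k"

definition cl_poly :: "real poly \<Rightarrow> 'n::{finite,linorder} clifford \<Rightarrow> 'n clifford" where
  "cl_poly p a = (\<Sum>i\<le>degree p. coeff p i *\<^sub>R cl_pow a i)"

definition paravectors :: "'n::finite clifford set" where
  "paravectors = {s. \<forall>A. 2 \<le> card A \<longrightarrow> s $ A = 0}"

text \<open>Conjugate and inverse are only meant for paravectors, where \<open>s \<odot> cl_conj s = \<bar>s\<bar>\<^sup>2\<close>.\<close>

definition cl_conj :: "'n::finite clifford \<Rightarrow> 'n clifford" where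
  "cl_conj s = (\<chi> A. if A = {} then s $ A else - (s $ A))"

definition cl_inv :: "'n::finite clifford \<Rightarrow> 'n clifford" where
  "cl_inv s = (1 / (norm s)\<^sup>2) *\<^sub>R cl_conj s"

definition imag_sphere :: "'n::finite clifford set" where
  "imag_sphere = {s \<in> paravectors. s $ {} = 0 \<and> norm s = 1}"

definition slice_pt :: "'n::finite clifford \<Rightarrow> real \<Rightarrow> real \<Rightarrow> 'n clifford" where
  "slice_pt J x y = cl_of_real x + y *\<^sub>R J"

definition cl_exp :: "'n::finite clifford \<Rightarrow> real \<Rightarrow> 'n clifford" where
  "cl_exp J \<phi> = slice_pt J (cos \<phi>) (sin \<phi>)"


lemma csign_generator: "csign {i} {j} = (if j \<le> i then - 1 else 1)"
proof -
  have "{(a, b). a \<in> {i} \<and> b \<in> {j} \<and> b \<le> a} = (if j \<le> i then {(i, j)} else {})"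
    by auto
  then show ?thesis by (simp add: csign_def)
qed

lemma csign_prod: "csign A B = (\<Prod>i\<in>A. \<Prod>j\<in>B. if j \<le> i then - 1 else 1)"
proof -
  have "(\<Prod>i\<in>A. \<Prod>j\<in>B. if j \<le> i then - 1 else (1::real))
      = (\<Prod>p\<in>A\<times>B. if snd p \<le> fst p then - 1 else 1)"
    by (simp add: prod.cartesian_product case_prod_unfold)
  also have "\<dots> = (\<Prod>p\<in>{p\<in>A\<times>B. snd p \<le> fst p}. - 1)"
    by (subst prod.inter_filter) auto
  also have "{p\<in>A\<times>B. snd p \<le> fst p} = {(i, j). i \<in> A \<and> j \<in> B \<and> j \<le> i}"
    by auto
  finally show ?thesis by (simp add: csign_def)
qed

lemma prod_sym_diff_sign:
  fixes f :: "'a::finite \<Rightarrow> real"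
  assumes "\<And>x. f x * f x = 1"
  shows "prod f (sym_diff A B) = prod f A * prod f B"
proof -
  have s: "prod f (A \<inter> B) * prod f (A \<inter> B) = 1"
    using assms by (simp add: prod.distrib[symmetric])
  have "prod f A = prod f (A - B) * prod f (A \<inter> B)"
    by (subst prod.union_disjoint[symmetric]) (auto intro: prod.cong)
  moreover have "prod f B = prod f (B - A) * prod f (A \<inter> B)"
    by (subst prod.union_disjoint[symmetric]) (auto intro: prod.cong)
  moreover have "prod f (sym_diff A B) = prod f (A - B) * prod f (B - A)"
    by (subst prod.union_disjoint[symmetric]) auto
  ultimately show ?thesis using s by (simp add: algebra_simps)
qed

lemma csign_sym_diff:
  "csign (sym_diff A B) C = csign A C * csign B C"
  "csign C (sym_diff A B) = csign C A * csign C B"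
proof -
  have sq: "(\<Prod>j\<in>D. if j \<le> i then - 1 else (1::real)) * (\<Prod>j\<in>D. if j \<le> i then - 1 else 1) = 1"
    for D and i :: 'a
    unfolding prod.distrib[symmetric] by (rule prod.neutral) simp
  show "csign (sym_diff A B) C = csign A C * csign B C"
    unfolding csign_prod by (rule prod_sym_diff_sign) (rule sq)
  show "csign C (sym_diff A B) = csign C A * csign C B"
    unfolding csign_prod prod.distrib[symmetric]
    by (intro prod.cong refl prod_sym_diff_sign) auto
qed

lemma cl_left_nth:
  fixes a :: "'n::{finite,linorder} clifford" and v :: "('v::real_vector, 'n) cmodule"
  shows "(a \<triangleright> v) $ C = (\<Sum>A\<in>UNIV. (csign A (sym_diff A C) * (a $ A)) *\<^sub>R (v $ sym_diff A C))"
proof -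
  have eq: "C = sym_diff A B \<longleftrightarrow> B = sym_diff A C" for A B :: "'n set" by blast
  show ?thesis
    unfolding cl_left_def by (simp add: axis_def eq)
qed

lemma cl_mult_eq_left: "a \<odot> b = a \<triangleright> b"
  by (simp add: cl_mult_def cl_left_def)

lemma cl_left_assoc:
  fixes a b :: "'n::{finite,linorder} clifford" and v :: "('v::real_vector, 'n) cmodule"
  shows "(a \<odot> b) \<triangleright> v = a \<triangleright> b \<triangleright> v"
proof (rule vec_eq_iff[THEN iffD2], rule allI)
  fix D
  have bij: "bij (sym_diff A)" for A :: "'n set"
    by (rule o_bij[of "sym_diff A"]) (auto simp: fun_eq_iff)
  have "((a \<odot> b) \<triangleright> v) $ D = (\<Sum>E\<in>UNIV. \<Sum>A\<in>UNIV.
     (csign E (sym_diff E D) * csign A (sym_diff A E) * a $ A * b $ sym_diff A E) *\<^sub>R v $ sym_diff E D)"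
    by (simp add: cl_left_nth cl_mult_eq_left sum_distrib_left scaleR_sum_left mult_ac)
  also have "\<dots> = (\<Sum>A\<in>UNIV. \<Sum>E\<in>UNIV.
     (csign E (sym_diff E D) * csign A (sym_diff A E) * a $ A * b $ sym_diff A E) *\<^sub>R v $ sym_diff E D)"
    by (rule sum.swap)
  also have "\<dots> = (\<Sum>A\<in>UNIV. \<Sum>B\<in>UNIV.
     (csign A (sym_diff A D) * csign B (sym_diff B (sym_diff A D)) * a $ A * b $ B) *\<^sub>R
       v $ sym_diff B (sym_diff A D))"
  proof (rule sum.cong[OF refl])
    fix A :: "'n set"
    show "(\<Sum>E\<in>UNIV. (csign E (sym_diff E D) * csign A (sym_diff A E) * a $ A * b $ sym_diff A E) *\<^sub>R
        v $ sym_diff E D) = (\<Sum>B\<in>UNIV. (csign A (sym_diff A D) * csign B (sym_diff B (sym_diff A D)) *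
        a $ A * b $ B) *\<^sub>R v $ sym_diff B (sym_diff A D))"
    proof (rule sum.reindex_bij_betw[OF bij[of A], symmetric, THEN trans], rule sum.cong[OF refl])
      fix B :: "'n set"
      let ?X = "sym_diff B (sym_diff A D)"
      have 1: "sym_diff (sym_diff A B) D = ?X" "sym_diff A (sym_diff A B) = B" "sym_diff A D = sym_diff B ?X"
        by blast+
      show "(csign (sym_diff A B) (sym_diff (sym_diff A B) D) * csign A (sym_diff A (sym_diff A B)) *
          a $ A * b $ sym_diff A (sym_diff A B)) *\<^sub>R v $ sym_diff (sym_diff A B) D =
        (csign A (sym_diff A D) * csign B ?X * a $ A * b $ B) *\<^sub>R v $ ?X"
        unfolding 1(1,2) unfolding csign_sym_diff(1)
        by (subst 1(3)) (simp add: csign_sym_diff mult_ac)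
    qed
  qed
  also have "\<dots> = (a \<triangleright> b \<triangleright> v) $ D"
    by (simp add: cl_left_nth scaleR_sum_right mult_ac)
  finally show "((a \<odot> b) \<triangleright> v) $ D = (a \<triangleright> b \<triangleright> v) $ D" .
qed

lemma cl_basis_mult:
  fixes A B :: "'n::{finite,linorder} set"
  shows "axis A 1 \<odot> axis B 1 = axis (sym_diff A B) (csign A B)"
proof -
  have "axis (sym_diff C D) (csign C D * axis A 1 $ C * axis B 1 $ D) =
      (if C = A then if D = B then axis (sym_diff A B) (csign A B) else 0 else 0)" for C D
    by (cases "C = A"; cases "D = B") (simp_all add: axis_def zero_vec_def)
  then have "axis A 1 \<odot> axis B 1 = (\<Sum>C\<in>UNIV. \<Sum>D\<in>UNIV.
      if C = A then if D = B then axis (sym_diff A B) (csign A B) else 0 else 0)"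
    unfolding cl_mult_def by (simp only:)
  also have "\<dots> = (\<Sum>C\<in>UNIV. if C = A then
      (\<Sum>D\<in>UNIV. if D = B then axis (sym_diff A B) (csign A B) else 0) else 0)"
    by (intro sum.cong refl) simp
  also have "\<dots> = axis (sym_diff A B) (csign A B)" by simp
  finally show ?thesis .
qed

lemma cl_generator_square: "axis {i} 1 \<odot> axis {i} 1 = - cl_one"
  unfolding cl_basis_mult csign_generator cl_of_real_def by (simp add: axis_def vec_eq_iff)

lemma cl_generator_anticommute:
  "i \<noteq> j \<Longrightarrow> axis {i} 1 \<odot> axis {j} 1 = - (axis {j} 1 \<odot> axis {i} 1)"
  unfolding cl_basis_mult csign_generator by (auto simp: axis_def vec_eq_iff)

lemma cl_mult_conj:
  fixes s :: "'n::{finite,linorder} clifford"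
  assumes "s \<in> paravectors"
  shows "s \<odot> cl_conj s = cl_of_real ((norm s)\<^sup>2)"
proof -
  define F where "F A B = axis (sym_diff A B) (csign A B * s $ A * cl_conj s $ B)" for A B
  have cases: "s $ A = 0 \<or> A = {} \<or> (\<exists>i. A = {i})" for A
  proof (cases "2 \<le> card A")
    case False
    then have "card A = 0 \<or> card A = 1" by linarith
    then show ?thesis by (auto simp: card_1_singleton_iff)
  qed (use assms in \<open>simp add: paravectors_def\<close>)
  have empty: "csign {} B = 1" "csign B {} = 1" for B :: "'n set"
    by (simp_all add: csign_prod)
  have anti: "F A B + F B A = 0" if "A \<noteq> B" for A B
  proof -
    have "csign A B * s $ A * cl_conj s $ B + csign B A * s $ B * cl_conj s $ A = 0"
      using cases[of A] cases[of B] that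
      by (elim disjE exE) (auto simp: cl_conj_def csign_generator empty)
    moreover have "F B A = axis (sym_diff A B) (csign B A * s $ B * cl_conj s $ A)"
      unfolding F_def by (simp only: Un_commute)
    ultimately show ?thesis
      unfolding F_def by (simp add: axis_def vec_eq_iff)
  qed
  have diag: "F A A = cl_of_real ((s $ A)\<^sup>2)" for A
  proof -
    have "csign A A * s $ A * cl_conj s $ A = (s $ A)\<^sup>2"
      using cases[of A]
      by (elim disjE exE) (simp_all add: cl_conj_def csign_generator empty power2_eq_square)
    then show ?thesis unfolding F_def cl_of_real_def by simp
  qed
  have "2 *\<^sub>R (\<Sum>A\<in>UNIV. \<Sum>B\<in>UNIV. F A B) = (\<Sum>A\<in>UNIV. \<Sum>B\<in>UNIV. F A B + F B A)"
    by (simp add: sum.distrib scaleR_2) (rule sum.swap)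
  also have "\<dots> = (\<Sum>A\<in>UNIV. \<Sum>B\<in>UNIV. if B = A then 2 *\<^sub>R F A A else 0)"
    by (intro sum.cong refl) (use anti in \<open>auto simp: scaleR_2\<close>)
  also have "\<dots> = 2 *\<^sub>R (\<Sum>A\<in>UNIV. F A A)"
    by (simp add: scaleR_sum_right)
  finally have "s \<odot> cl_conj s = (\<Sum>A\<in>UNIV. F A A)"
    by (simp add: cl_mult_def F_def)
  also have "\<dots> = cl_of_real (\<Sum>A\<in>UNIV. (s $ A)\<^sup>2)"
    by (auto simp: diag cl_of_real_def axis_def vec_eq_iff)
  also have "(\<Sum>A\<in>UNIV. (s $ A)\<^sup>2) = (norm s)\<^sup>2"
    by (simp add: norm_vec_def L2_set_def sum_nonneg)
  finally show ?thesis .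
qed


subsection \<open>Slice hyperholomorphic functions\<close>

text \<open>
  Functions on \<open>U\<close> are total functions of which only the values on \<open>U\<close> matter. The set \<open>U\<close> is meant
  to be axially symmetric and open in the space of paravectors. The partial derivatives are the
  values of the total derivative on \<open>(1, 0)\<close> and \<open>(0, 1)\<close>.
\<close>

definition slice_domain :: "'n::finite clifford set \<Rightarrow> (real \<times> real) set" where
  "slice_domain U = {(x, y). \<forall>J\<in>imag_sphere. slice_pt J x y \<in> U}"

definition slice_components ::
  "'n::{finite,linorder} clifford set \<Rightarrow> ('n clifford \<Rightarrow> 'n clifford) \<Rightarrow>
    (real \<times> real \<Rightarrow> 'n clifford) \<Rightarrow> (real \<times> real \<Rightarrow> 'n clifford) \<Rightarrow> bool" where
  "slice_components U f f0 f1 \<longleftrightarrow>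
    (\<forall>(x, y)\<in>slice_domain U.
       (\<forall>J\<in>imag_sphere. f (slice_pt J x y) = f0 (x, y) + J \<odot> f1 (x, y)) \<and>
       f0 (x, - y) = f0 (x, y) \<and> f1 (x, - y) = - f1 (x, y)) \<and>
    (\<exists>f0' f1' :: real \<times> real \<Rightarrow> (real \<times> real) \<Rightarrow>\<^sub>L 'n clifford.
       continuous_on (slice_domain U) f0' \<and> continuous_on (slice_domain U) f1' \<and>
       (\<forall>z\<in>slice_domain U.
          (f0 has_derivative blinfun_apply (f0' z)) (at z) \<and>
          (f1 has_derivative blinfun_apply (f1' z)) (at z) \<and>
          blinfun_apply (f0' z) (1, 0) = blinfun_apply (f1' z) (0, 1) \<and>
          blinfun_apply (f0' z) (0, 1) = - blinfun_apply (f1' z) (1, 0)))"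

definition slice_hyperhol :: "'n::{finite,linorder} clifford set \<Rightarrow> ('n clifford \<Rightarrow> 'n clifford) set" where
  "slice_hyperhol U = {f. \<exists>f0 f1. slice_components U f f0 f1}"

definition slice_intrinsic :: "'n::{finite,linorder} clifford set \<Rightarrow> ('n clifford \<Rightarrow> 'n clifford) set" where
  "slice_intrinsic U = {f. \<exists>f0 f1. slice_components U f f0 f1 \<and>
     (\<forall>z\<in>slice_domain U. f0 z \<in> range cl_of_real \<and> f1 z \<in> range cl_of_real)}"

definition sector_angles :: "real \<Rightarrow> real set" where
  "sector_angles \<omega> = {- \<omega> <..< \<omega>} \<union> {pi - \<omega> <..< pi + \<omega>}"

definition double_sector :: "real \<Rightarrow> 'n::finite clifford set" where
  "double_sector \<omega> = {r *\<^sub>R cl_exp J \<phi> | r J \<phi>. 0 < r \<and> J \<in> imag_sphere \<and> \<phi> \<in> sector_angles \<omega>}"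

definition SHL0 :: "real \<Rightarrow> ('n::{finite,linorder} clifford \<Rightarrow> 'n clifford) set" where
  "SHL0 \<theta> = {f \<in> slice_hyperhol (double_sector \<theta>).
     bounded (f ` double_sector \<theta>) \<and>
     (\<forall>J\<in>imag_sphere. \<forall>\<phi>\<in>sector_angles \<theta>.
        (\<integral>\<^sup>+ t\<in>{0<..}. ennreal (norm (f (t *\<^sub>R cl_exp J \<phi>)) / t) \<partial>lborel) < \<infinity>)}"

definition N0 :: "real \<Rightarrow> ('n::{finite,linorder} clifford \<Rightarrow> 'n clifford) set" where
  "N0 \<theta> = SHL0 \<theta> \<inter> slice_intrinsic (double_sector \<theta>)"

definition bnd_components ::
  "real \<Rightarrow> ('n::{finite,linorder} clifford \<Rightarrow> 'n clifford) \<Rightarrow> real \<Rightarrow> real \<Rightarrow> ('n clifford \<Rightarrow> 'n clifford) \<Rightarrow> bool" where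
  "bnd_components \<theta> g g0 ginf gt \<longleftrightarrow> gt \<in> N0 \<theta> \<and>
     (\<forall>s\<in>double_sector \<theta>.
        g s = cl_of_real ginf + (g0 - ginf) *\<^sub>R cl_inv (cl_one + s \<odot> s) + gt s)"

definition Nbnd :: "real \<Rightarrow> ('n::{finite,linorder} clifford \<Rightarrow> 'n clifford) set" where
  "Nbnd \<theta> = {g. \<exists>g0 ginf gt. bnd_components \<theta> g g0 ginf gt}"


subsection \<open>Unbounded operators\<close>

text \<open>
  An operator in \<open>V\<close> is a partial map. Its domain is \<^const>\<open>dom\<close>, extension of operators is
  \<open>\<subseteq>\<^sub>m\<close>, the identity is \<^const>\<open>Some\<close>, and \<open>\<circ>\<^sub>m\<close> is the product with its natural domain.
\<close>

type_synonym ('v, 'n) oper = "('v, 'n) cmodule \<rightharpoonup> ('v, 'n) cmodule"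

definition op_add :: "('a::plus \<rightharpoonup> 'a) \<Rightarrow> ('a \<rightharpoonup> 'a) \<Rightarrow> ('a \<rightharpoonup> 'a)" where
  "op_add A B = (\<lambda>v. if v \<in> dom A \<inter> dom B then Some (the (A v) + the (B v)) else None)"

definition op_scale :: "real \<Rightarrow> ('a::real_vector \<rightharpoonup> 'a) \<Rightarrow> ('a \<rightharpoonup> 'a)" where
  "op_scale r A = (\<lambda>v. map_option (scaleR r) (A v))"

definition op_cl :: "'n::{finite,linorder} clifford \<Rightarrow> ('v::real_vector, 'n) oper" where
  "op_cl a = (\<lambda>v. Some (a \<triangleright> v))"

primrec op_pow :: "('a \<rightharpoonup> 'a) \<Rightarrow> nat \<Rightarrow> ('a \<rightharpoonup> 'a)" where
  "op_pow A 0 = Some"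
| "op_pow A (Suc k) = A \<circ>\<^sub>m op_pow A k"

definition op_poly :: "real poly \<Rightarrow> ('a::real_vector \<rightharpoonup> 'a) \<Rightarrow> ('a \<rightharpoonup> 'a)" where
  "op_poly p A = (\<lambda>v. if v \<in> dom (op_pow A (degree p))
     then Some (\<Sum>i\<le>degree p. coeff p i *\<^sub>R the (op_pow A i v)) else None)"

definition op_inj :: "('a \<rightharpoonup> 'a) \<Rightarrow> bool" where
  "op_inj A \<longleftrightarrow> inj_on A (dom A)"

text \<open>Only meant for injective \<open>A\<close>; then \<open>dom (op_inv A) = ran A\<close>.\<close>

definition op_inv :: "('a \<rightharpoonup> 'a) \<Rightarrow> ('a \<rightharpoonup> 'a)" where
  "op_inv A = (\<lambda>w. if w \<in> ran A then Some (SOME v. A v = Some w) else None)"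

definition right_linear :: "('v::real_normed_vector, 'n::{finite,linorder}) oper \<Rightarrow> bool" where
  "right_linear A \<longleftrightarrow> 0 \<in> dom A \<and>
     (\<forall>v\<in>dom A. \<forall>w\<in>dom A. A (v + w) = Some (the (A v) + the (A w))) \<and>
     (\<forall>v\<in>dom A. \<forall>a. A (v \<triangleleft> a) = Some (the (A v) \<triangleleft> a))"

definition bounded_ops :: "('v::real_normed_vector, 'n::{finite,linorder}) oper set" where
  "bounded_ops = {A. right_linear A \<and> dom A = UNIV \<and> bounded_linear (\<lambda>v. the (A v))}"

definition closed_ops :: "('v::real_normed_vector, 'n::{finite,linorder}) oper set" where
  "closed_ops = {A. right_linear A \<and> closed {(v, w). A v = Some w}}"

text \<open>
  Members of \<open>\<B>(V)\<close>, viewed as elements of the Banach space of bounded linear maps with the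
  operator norm, and back.
\<close>

definition to_blinfun :: "('a::real_normed_vector \<rightharpoonup> 'a) \<Rightarrow> 'a \<Rightarrow>\<^sub>L 'a" where
  "to_blinfun A = Blinfun (\<lambda>v. the (A v))"

definition of_blinfun :: "('a::real_normed_vector \<Rightarrow>\<^sub>L 'a) \<Rightarrow> ('a \<rightharpoonup> 'a)" where
  "of_blinfun B = (\<lambda>v. Some (blinfun_apply B v))"

definition Q_op :: "'n clifford \<Rightarrow> ('v::banach, 'n::{finite,linorder}) oper \<Rightarrow> ('v, 'n) oper" where
  "Q_op s T = op_add (op_add (op_pow T 2) (op_scale (- 2 * s $ {}) T)) (op_scale ((norm s)\<^sup>2) Some)"

definition S_resolvent_set :: "('v::banach, 'n::{finite,linorder}) oper \<Rightarrow> 'n clifford set" where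
  "S_resolvent_set T = {s \<in> paravectors. op_inj (Q_op s T) \<and> op_inv (Q_op s T) \<in> bounded_ops}"

definition S_spectrum :: "('v::banach, 'n::{finite,linorder}) oper \<Rightarrow> 'n clifford set" where
  "S_spectrum T = paravectors - S_resolvent_set T"

definition S_resolvent :: "'n clifford \<Rightarrow> ('v::banach, 'n::{finite,linorder}) oper \<Rightarrow> ('v, 'n) oper" where
  "S_resolvent s T =
     op_add (op_inv (Q_op s T) \<circ>\<^sub>m op_cl (cl_conj s)) (op_scale (- 1) (T \<circ>\<^sub>m op_inv (Q_op s T)))"

definition bisectorial :: "real \<Rightarrow> ('v::banach, 'n::{finite,linorder}) oper \<Rightarrow> bool" where
  "bisectorial \<omega> T \<longleftrightarrow> S_spectrum T \<subseteq> closure (double_sector \<omega>) \<and>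
     (\<forall>\<phi>\<in>{\<omega><..<pi/2}. \<exists>C\<ge>0. \<forall>s\<in>paravectors - (double_sector \<phi> \<union> {0}).
        norm (to_blinfun (S_resolvent s T)) \<le> C / norm s)"


subsection \<open>The functional calculi\<close>

definition bisector_path :: "real \<Rightarrow> 'n::finite clifford \<Rightarrow> real \<Rightarrow> real \<Rightarrow> 'n clifford" where
  "bisector_path \<phi> J \<epsilon> t = (\<epsilon> * \<bar>t\<bar>) *\<^sub>R cl_exp J (- sgn t * \<phi>)"

text \<open>
  The integral is the gauge integral of a function with values in the bounded linear maps of \<open>V\<close>,
  since the Bochner integral of the library needs a separable space. The integrand is continuous
  and absolutely integrable away from \<open>t = 0\<close>, where \<open>\<gamma>\<^sub>\<plusminus>\<close> is not differentiable. Division by \<open>J\<close>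
  is unambiguous because \<open>\<gamma>\<^sub>\<plusminus>'(t)\<close> commutes with \<open>J\<close>.
\<close>

definition omega_integral ::
  "real \<Rightarrow> 'n clifford \<Rightarrow> ('v::banach, 'n::{finite,linorder}) oper \<Rightarrow> ('n clifford \<Rightarrow> 'n clifford) \<Rightarrow>
    ('v, 'n) cmodule \<Rightarrow>\<^sub>L ('v, 'n) cmodule" where
  "omega_integral \<phi> J T f = (1 / (2 * pi)) *\<^sub>R (\<Sum>\<epsilon>\<in>{1, - 1}. integral UNIV (\<lambda>t.
     to_blinfun (S_resolvent (bisector_path \<phi> J \<epsilon> t) T \<circ>\<^sub>m
       op_cl (vector_derivative (bisector_path \<phi> J \<epsilon>) (at t) \<odot> cl_inv J) \<circ>\<^sub>m
       op_cl (f (bisector_path \<phi> J \<epsilon> t)))))"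

text \<open>
  The integral does not depend on the angle \<open>\<phi> \<in> (\<omega>, \<theta>)\<close> and the imaginary unit \<open>J\<close>, the components
  of \<open>g\<close> in \<open>bnd_calc\<close> are unique on the double sector, and \<open>H_calc\<close> does not depend on the
  regularizer; so the choices below are immaterial.
\<close>

definition omega_calc ::
  "real \<Rightarrow> real \<Rightarrow> ('v::banach, 'n::{finite,linorder}) oper \<Rightarrow> ('n clifford \<Rightarrow> 'n clifford) \<Rightarrow>
    ('v, 'n) cmodule \<Rightarrow>\<^sub>L ('v, 'n) cmodule" where
  "omega_calc \<omega> \<theta> T f =
     omega_integral (SOME \<phi>. \<phi> \<in> {\<omega><..<\<theta>}) (SOME J. J \<in> imag_sphere) T f"

definition bnd_calc ::
  "real \<Rightarrow> real \<Rightarrow> ('v::banach, 'n::{finite,linorder}) oper \<Rightarrow> ('n clifford \<Rightarrow> 'n clifford) \<Rightarrow>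
    ('v, 'n) cmodule \<Rightarrow>\<^sub>L ('v, 'n) cmodule" where
  "bnd_calc \<omega> \<theta> T g =
     (let (g0, ginf, gt) = (SOME (g0, ginf, gt). bnd_components \<theta> g g0 ginf gt) in
        ginf *\<^sub>R id_blinfun + (g0 - ginf) *\<^sub>R to_blinfun (op_inv (op_add Some (op_pow T 2)))
          + omega_calc \<omega> \<theta> T gt)"

definition regularizer ::
  "real \<Rightarrow> real \<Rightarrow> ('v::banach, 'n::{finite,linorder}) oper \<Rightarrow> ('n clifford \<Rightarrow> 'n clifford) \<Rightarrow>
    ('n clifford \<Rightarrow> 'n clifford) \<Rightarrow> bool" where
  "regularizer \<omega> \<theta> T g e \<longleftrightarrow> e \<in> Nbnd \<theta> \<and> (\<lambda>s. e s \<odot> g s) \<in> Nbnd \<theta> \<and>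
     inj (blinfun_apply (bnd_calc \<omega> \<theta> T e))"

definition Nreg ::
  "real \<Rightarrow> real \<Rightarrow> ('v::banach, 'n::{finite,linorder}) oper \<Rightarrow> ('n clifford \<Rightarrow> 'n clifford) set" where
  "Nreg \<omega> \<theta> T = {g \<in> slice_intrinsic (double_sector \<theta>). \<exists>e. regularizer \<omega> \<theta> T g e}"

definition H_calc ::
  "real \<Rightarrow> real \<Rightarrow> ('v::banach, 'n::{finite,linorder}) oper \<Rightarrow> ('n clifford \<Rightarrow> 'n clifford) \<Rightarrow>
    ('v, 'n) oper" where
  "H_calc \<omega> \<theta> T g =
     (let e = (SOME e. regularizer \<omega> \<theta> T g e) in
        op_inv (of_blinfun (bnd_calc \<omega> \<theta> T e)) \<circ>\<^sub>m of_blinfun (bnd_calc \<omega> \<theta> T (\<lambda>s. e s \<odot> g s)))"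

end

theory Submission
  imports Defs "HOL-Complex_Analysis.Complex_Analysis" "HOL-Real_Asymp.Real_Asymp"
begin

text \<open>
  Right multiplication by a generator makes \<open>V\<close> a complex space on which \<open>T\<close> is complex linear with
  resolvent \<open>R\<close>. For intrinsic \<open>f\<close>, represented by a holomorphic \<open>F\<close> on a planar double cone with
  \<open>F (cnj z) = cnj (F z)\<close>, adding the integrand of the slice integral at \<open>t\<close> and \<open>- t\<close> turns the left
  multiplications by \<open>f\<close> into right multiplications, so that \<open>f(T)\<close> is the planar integral of \<open>F R\<close> divided
  by \<open>2 \<pi> i\<close>. The resolvent equation and Cauchy's formula make this calculus multiplicative, first
  on \<open>N\<^sup>0\<close> and then on \<open>N\<^sup>b\<^sup>n\<^sup>d\<close>; hence \<open>g(T)\<close> does not depend on the regularizer of \<open>g\<close>.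
  Let \<open>e\<close> regularize \<open>g\<close> and \<open>m = degree p\<close>. Then \<open>e\<^sup>m\<close> regularizes \<open>p \<circ> g\<close>, because
  \<open>e\<^sup>m (p \<circ> g) = (\<Sum>i\<le>m. p\<^sub>i e\<^sup>m\<^sup>-\<^sup>i (e g)\<^sup>i)\<close>. If \<open>w\<^sub>i = g(T)\<^sup>i v\<close> for \<open>i \<le> m\<close>, then
  \<open>(e g)(T)\<^sup>i v = e(T)\<^sup>i w\<^sub>i\<close>, so \<open>(e\<^sup>m (p \<circ> g))(T) v = e(T)\<^sup>m (\<Sum>i\<le>m. p\<^sub>i w\<^sub>i)\<close>, which says that
  \<open>(p \<circ> g)(T) v = (\<Sum>i\<le>m. p\<^sub>i w\<^sub>i)\<close>.
\<close>

subsection \<open>Integrals over the half-line and over rays\<close>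

text \<open>\<open>T\<close> commutes with right but not with left multiplications, so the
  S-resolvent obeys no resolvent equation of the usual form; on the right complex space
  \<open>(cnj z - T) q z\<close> is an ordinary resolvent, and holomorphy, commutation and products
  become available. The contour runs through 0 and to infinity, where \<open>F R\<close> is only
  known to be of order \<open>1 / |z|\<close>: closing arcs stay bounded but need not be small.
  Changes of contour therefore go through \<open>rays_eq\<close>, which inserts damping factors and
  removes them by dominated convergence. Constants and \<open>1 / (1 + z^2)\<close> have in general
  no absolutely convergent contour integral, so their products must be treated separately. The
  critical one is the square of \<open>(1 + T^2)^-1\<close>; it comes from evaluating the contour
  integral of \<open>z / (1 + z^2)\<close> as \<open>T (1 + T^2)^-1\<close>.\<close>

lemma has_integral_improper:
  fixes F P :: "real \<Rightarrow> 'b::banach"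
  assumes P: "\<And>x. 0 < x \<Longrightarrow> (P has_vector_derivative F x) (at x)"
    and L0: "(P \<longlongrightarrow> L0) (at_right 0)" and L1: "(P \<longlongrightarrow> L1) at_top"
  shows "(F has_integral (L1 - L0)) {0<..}"
proof -
  \<comment> \<open>Extending \<open>P\<close> by its limit \<open>L0\<close> to the left of 0 makes
    it continuous on every \<open>{0..b}\<close>, so the fundamental theorem with interior
    derivative covers intervals that touch 0.\<close>
  define Q where "Q x = (if x \<le> 0 then L0 else P x)" for x :: real
  have Qd: "(Q has_vector_derivative F x) (at x)" if "0 < x" for x
  proof (rule has_vector_derivative_transform_within_open[OF P[OF that], of "{0<..}"])
    show "\<And>y. y \<in> {0<..} \<Longrightarrow> P y = Q y" by (simp add: Q_def)
  qed (use that in auto)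
  have Q0: "(Q \<longlongrightarrow> L0) (at_right 0)"
    by (rule Lim_transform_eventually[OF L0]) (auto simp: eventually_at_right_field Q_def intro: exI[of _ 1])
  have cont: "continuous_on {0..b} Q" for b
    unfolding continuous_on_def
  proof
    fix x assume x: "x \<in> {0..b}"
    show "(Q \<longlongrightarrow> Q x) (at x within {0..b})"
    proof (cases "x = 0")
      case True
      have "(Q \<longlongrightarrow> L0) (at 0 within {0..b})"
      proof (cases "b \<le> 0")
        case True
        then have "{0..b} = {} \<or> {0..b} = {0}" by auto
        then show ?thesis by (auto simp: tendsto_def at_within_def)
      next
        case False
        then have "at 0 within {0..b} = at_right 0"
          by (simp add: at_within_Icc_at_right)
        then show ?thesis using Q0 by simp
      qed
      then show ?thesis using True by (simp add: Q_def)
    next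
      case False
      then have "(Q has_vector_derivative F x) (at x)" using x by (intro Qd) auto
      then have "isCont Q x" by (rule has_vector_derivative_continuous)
      then show ?thesis by (simp add: isCont_def tendsto_within_subset[of Q _ x UNIV])
    qed
  qed
  have ab: "((\<lambda>x. if x \<in> {0<..} then F x else 0) has_integral (Q b - Q (max 0 a))) {a..b}"
    if "0 < b" "a \<le> b" for a b
  proof -
    have "(F has_integral (Q b - Q (max 0 a))) {max 0 a..b}"
    proof (rule fundamental_theorem_of_calculus_interior)
      show "continuous_on {max 0 a..b} Q" by (rule continuous_on_subset[OF cont[of b]]) auto
    qed (use that Qd in auto)
    then have "(F has_integral (Q b - Q (max 0 a))) ({0<..} \<inter> {a..b})"
      by (rule has_integral_spike_set_eq[THEN iffD1, rotated 2])
        (auto intro: negligible_subset[of "{0}"])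
    then show ?thesis by (subst has_integral_restrict_Int)
  qed
  show ?thesis
    unfolding has_integral_alt'[of F]
  proof (intro conjI allI impI)
    fix a b :: real
    show "(\<lambda>x. if x \<in> {0<..} then F x else 0) integrable_on cbox a b"
    proof (cases "0 < b \<and> a \<le> b")
      case True then show ?thesis using ab by (auto simp: integrable_on_def)
    next
      case False
      then have "(\<lambda>x. if x \<in> {0<..} then F x else 0) integrable_on {a..b} \<longleftrightarrow> (\<lambda>x. 0::'b) integrable_on {a..b}"
        by (intro integrable_cong) auto
      then show ?thesis using integrable_0 by auto
    qed
  next
    fix e :: real assume "e > 0"
    with L1 have "\<forall>\<^sub>F x in at_top. dist (P x) L1 < e" by (rule tendstoD)
    then obtain B where B: "\<And>x. x \<ge> B \<Longrightarrow> dist (P x) L1 < e" by (auto simp: eventually_at_top_linorder)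
    show "\<exists>B>0. \<forall>a b. ball 0 B \<subseteq> cbox a b \<longrightarrow>
       norm (integral (cbox a b) (\<lambda>x. if x \<in> {0<..} then F x else 0) - (L1 - L0)) < e"
    proof (intro exI[of _ "max B 1"] conjI allI impI)
      fix a b :: real assume s: "ball 0 (max B 1) \<subseteq> cbox a b"
      have "{- max B 1 <..< max B 1} \<subseteq> {a..b}" using s by (simp add: ball_eq_greaterThanLessThan)
      then have c: "a \<le> - max B 1" "max B 1 \<le> b"
        by (subst (asm) greaterThanLessThan_subseteq_atLeastAtMost_iff; simp)+
      then have "integral {a..b} (\<lambda>x. if x \<in> {0<..} then F x else 0) = Q b - Q (max 0 a)"
        by (intro integral_unique ab) auto
      also have "\<dots> = P b - L0" using c by (auto simp: Q_def)
      finally show "norm (integral (cbox a b) (\<lambda>x. if x \<in> {0<..} then F x else 0) - (L1 - L0)) < e"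
        using B[of b] c by (simp add: dist_norm)
    qed auto
  qed
qed

lemma Cauchy_at_top_converges:
  fixes P :: "real \<Rightarrow> 'b::banach"
  assumes C: "\<And>e. 0 < e \<Longrightarrow> \<exists>B. \<forall>x\<ge>B. \<forall>y\<ge>B. norm (P x - P y) \<le> e"
  obtains L where "(P \<longlongrightarrow> L) at_top"
proof -
  have "Cauchy (\<lambda>n. P (real n))"
  proof (rule CauchyI)
    fix e :: real assume "e > 0"
    then obtain B where B: "\<And>x y. x \<ge> B \<Longrightarrow> y \<ge> B \<Longrightarrow> norm (P x - P y) \<le> e / 2" using C[of "e/2"] by auto
    obtain M where "real M \<ge> B" using real_arch_simple by blast
    then show "\<exists>M. \<forall>m\<ge>M. \<forall>n\<ge>M. norm (P (real m) - P (real n)) < e"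
      using \<open>e > 0\<close> by (intro exI[of _ M] allI impI le_less_trans[OF B]) auto
  qed
  then obtain L where L: "(\<lambda>n. P (real n)) \<longlonglongrightarrow> L" using Cauchy_convergent convergent_def by blast
  have "(P \<longlongrightarrow> L) at_top"
  proof (rule tendstoI)
    fix e :: real assume "e > 0"
    then obtain B where B: "\<And>x y. x \<ge> B \<Longrightarrow> y \<ge> B \<Longrightarrow> norm (P x - P y) \<le> e / 2" using C[of "e/2"] by auto
    have "dist (P x) L < e" if "x \<ge> B" for x
    proof -
      have "(\<lambda>n. norm (P x - P (real n))) \<longlonglongrightarrow> norm (P x - L)" by (intro tendsto_intros L)
      moreover have "\<forall>\<^sub>F n in sequentially. norm (P x - P (real n)) \<le> e / 2"
      proof -
        obtain M where "real M \<ge> B" using real_arch_simple by blast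
        then show ?thesis using that B by (auto simp: eventually_sequentially intro!: exI[of _ M] B)
      qed
      ultimately have "norm (P x - L) \<le> e / 2" by (rule tendsto_upperbound) simp
      then show ?thesis using \<open>e > 0\<close> by (simp add: dist_norm)
    qed
    then show "\<forall>\<^sub>F x in at_top. dist (P x) L < e" by (auto simp: eventually_at_top_linorder)
  qed
  then show ?thesis by (rule that)
qed

text \<open>
  The Bochner integral of the library needs a separable range, so domination by an integrable
  function is turned into gauge integrability through the convergence of a primitive.
\<close>

lemma integrable_dominated:
  fixes F :: "real \<Rightarrow> 'b::banach" and h :: "real \<Rightarrow> real"
  assumes cF: "continuous_on {0<..} F" and h: "h integrable_on {0<..}"
    and le: "\<And>t. 0 < t \<Longrightarrow> norm (F t) \<le> h t"
  shows "F integrable_on {0<..}"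
    and "(\<lambda>n. integral {1 / (real n + 1)..real n + 1} F) \<longlonglongrightarrow> integral {0<..} F"
proof -
  \<comment> \<open>The base point 1 keeps the primitive away from both improper ends.\<close>
  define P where "P x = (if 1 \<le> x then integral {1..x} F else - integral {x..1} F)" for x :: real
  have iF: "F integrable_on {a..b}" if "0 < a" for a b
    by (rule integrable_continuous_real, rule continuous_on_subset[OF cF]) (use that in auto)
  have Pdiff: "P y - P x = integral {x..y} F" if "0 < x" "x \<le> y" for x y
  proof -
    consider "1 \<le> x" | "x < 1" "1 \<le> y" | "y < 1" using that by linarith
    then show ?thesis
    proof cases
      case 1
      then have "integral {1..x} F + integral {x..y} F = integral {1..y} F"
        using that by (intro Henstock_Kurzweil_Integration.integral_combine iF) auto
      then show ?thesis using 1 that by (simp add: P_def algebra_simps)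
    next
      case 2
      then have "integral {x..1} F + integral {1..y} F = integral {x..y} F"
        using that by (intro Henstock_Kurzweil_Integration.integral_combine iF) auto
      then show ?thesis using 2 that by (simp add: P_def algebra_simps)
    next
      case 3
      then have "integral {x..y} F + integral {y..1} F = integral {x..1} F"
        using that by (intro Henstock_Kurzweil_Integration.integral_combine iF) auto
      then show ?thesis using 3 that by (simp add: P_def algebra_simps)
    qed
  qed
  have Pd: "(P has_vector_derivative F x) (at x)" if x: "0 < x" for x
  proof -
    define a where "a = x / 2"
    have a: "0 < a" "a < x" using x by (auto simp: a_def)
    have "((\<lambda>u. integral {a..u} F) has_vector_derivative F x) (at x within {a..x+1})"
      by (rule integral_has_vector_derivative, rule continuous_on_subset[OF cF]) (use a in auto)
    then have "((\<lambda>u. integral {a..u} F) has_vector_derivative F x) (at x)"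
      using a by (simp add: at_within_Icc_at)
    then have "((\<lambda>u. P a + integral {a..u} F) has_vector_derivative F x) (at x)"
      by (auto intro!: derivative_eq_intros)
    moreover have "P a + integral {a..u} F = P u" if "u \<in> {a<..}" for u
    proof -
      have "P u - P a = integral {a..u} F" using that a by (intro Pdiff) auto
      then show ?thesis by (metis add.commute diff_add_cancel)
    qed
    ultimately show ?thesis
      using a by (elim has_vector_derivative_transform_within_open[where S = "{a<..}"]) auto
  qed
  define k where "k t = (if t \<in> {0<..} then h t else 0)" for t
  have h0: "0 \<le> h t" if "0 < t" for t using le[OF that] norm_ge_zero order_trans by blast
  have k: "k integrable_on UNIV" using h integrable_restrict_UNIV[of "{0<..}" h] unfolding k_def by blast
  have kc: "k integrable_on {a..b}" for a b
    using integrable_on_subcbox[OF k, of a b] by simp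
  have k0: "0 \<le> k t" for t using h0 by (simp add: k_def)
  \<comment> \<open>\<open>J\<close> is monotone and bounded and its increments dominate those of
    \<open>P\<close>; this makes \<open>P\<close> Cauchy at both ends.\<close>
  define J where "J x = integral {0..x} k" for x
  have Jmono: "J x \<le> J y" if "x \<le> y" for x y
    unfolding J_def by (rule integral_subset_le) (use that k0 kc in auto)
  have Jb: "J x \<le> integral UNIV k" for x
    unfolding J_def by (rule integral_subset_le) (use k k0 kc in auto)
  have J0: "0 \<le> J x" for x unfolding J_def by (intro integral_nonneg kc k0)
  have PJ: "norm (P y - P x) \<le> J y - J x" if "0 < x" "x \<le> y" for x y
  proof -
    have "norm (integral {x..y} F) \<le> integral {x..y} k"
      by (rule integral_norm_bound_integral) (use that iF kc le in \<open>auto simp: k_def\<close>)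
    also have "\<dots> = J y - J x"
      using Henstock_Kurzweil_Integration.integral_combine[of 0 x y k] that kc by (simp add: J_def)
    finally show ?thesis using Pdiff[OF that] by simp
  qed
  have "\<exists>B. \<forall>x\<ge>B. \<forall>y\<ge>B. norm (P x - P y) \<le> e" if e0: "0 < e" for e
  proof -
    define S where "S = Sup (range J)"
    have bdd: "bdd_above (range J)" using Jb by (auto simp: bdd_above_def)
    obtain x0 where x0: "S - e < J x0"
      using less_cSup_iff[of "range J" "S - e"] bdd e0 by (auto simp: S_def)
    have *: "norm (P y - P x) \<le> e" if "max 1 x0 \<le> x" "x \<le> y" for x y
    proof -
      have "norm (P y - P x) \<le> J y - J x" using that by (intro PJ) auto
      also have "\<dots> \<le> S - J x0"
        using that Jmono[of x0 x] cSup_upper[OF _ bdd, of "J y"] by (auto simp: S_def intro!: diff_mono)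
      finally show ?thesis using x0 by simp
    qed
    show ?thesis
      by (rule exI[of _ "max 1 x0"]) (metis * linorder_linear norm_minus_commute)
  qed
  then obtain L1 where L1: "(P \<longlongrightarrow> L1) at_top" by (rule Cauchy_at_top_converges)
  \<comment> \<open>The end at 0 is moved to infinity by inversion, so that the same Cauchy
    criterion applies.\<close>
  have "\<exists>B. \<forall>x\<ge>B. \<forall>y\<ge>B. norm (P (inverse x) - P (inverse y)) \<le> e" if e0: "0 < e" for e
  proof -
    define S where "S = Inf (J ` {0<..})"
    have bdd: "bdd_below (J ` {0<..})" using J0 by (auto simp: bdd_below_def)
    obtain x0 where x0: "J x0 < S + e" "0 < x0"
      using cInf_less_iff[of "J ` {0<..}" "S + e"] bdd e0 by (auto simp: S_def)
    have *: "norm (P x - P y) \<le> e" if "0 < y" "y \<le> x" "x \<le> x0" for x y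
    proof -
      have "norm (P x - P y) \<le> J x - J y" using that by (intro PJ) auto
      also have "\<dots> \<le> J x0 - S"
        using that Jmono[of x x0] cInf_lower[OF _ bdd, of "J y"] by (auto simp: S_def intro!: diff_mono)
      finally show ?thesis using x0 by simp
    qed
    have **: "norm (P (inverse x) - P (inverse y)) \<le> e" if "inverse x0 \<le> x" "x \<le> y" for x y
    proof (rule *)
      have x: "0 < x" using that x0(2) by (meson inverse_positive_iff_positive less_le_trans)
      then show "0 < inverse y" "inverse y \<le> inverse x" using that by (auto intro: le_imp_inverse_le)
      show "inverse x \<le> x0" using le_imp_inverse_le[OF that(1)] x0(2) by simp
    qed
    show ?thesis
      by (rule exI[of _ "inverse x0"]) (metis ** linorder_linear norm_minus_commute)
  qed
  then obtain L0 where "((\<lambda>x. P (inverse x)) \<longlongrightarrow> L0) at_top" by (rule Cauchy_at_top_converges)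
  then have L0: "(P \<longlongrightarrow> L0) (at_right 0)" by (simp add: filterlim_at_right_to_top)
  have I: "(F has_integral (L1 - L0)) {0<..}"
    using Pd L0 L1 by (rule has_integral_improper)
  then show "F integrable_on {0<..}" by auto
  have "filterlim (\<lambda>n. real n + 1) at_top sequentially"
    by real_asymp
  from filterlim_compose[OF L1 this] have 1: "(\<lambda>n. P (real n + 1)) \<longlonglongrightarrow> L1" .
  have "filterlim (\<lambda>n. 1 / (real n + 1)) (at_right 0) sequentially"
    by real_asymp
  from filterlim_compose[OF L0 this] have 2: "(\<lambda>n. P (1 / (real n + 1))) \<longlonglongrightarrow> L0" .
  have "(\<lambda>n. P (real n + 1) - P (1 / (real n + 1))) \<longlonglongrightarrow> L1 - L0"
    by (intro tendsto_diff 1 2)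
  moreover have "P (real n + 1) - P (1 / (real n + 1)) = integral {1 / (real n + 1)..real n + 1} F" for n
    by (rule Pdiff) (auto intro: order_trans[of _ 1])
  ultimately show "(\<lambda>n. integral {1 / (real n + 1)..real n + 1} F) \<longlonglongrightarrow> integral {0<..} F"
    using I by (simp add: integral_unique)
qed

section \<open>Absolutely integrable functions on rays and contour shifts between rays\<close>

lemma LIMSEQ_norm_le_null:
  assumes "\<And>n. norm (f n) \<le> g n" "g \<longlonglongrightarrow> (0::real)"
  shows "f \<longlonglongrightarrow> 0"
  using assms by (intro Lim_null_comparison[of f g]) simp_all

text \<open>Absolute integrability against \<open>dt\<close>. A condition against
  \<open>dt / t\<close> is expressed by dividing the function by its argument.\<close>

definition ray_ok :: "(complex \<Rightarrow> 'b::banach) \<Rightarrow> real \<Rightarrow> bool" where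
  "ray_ok F \<alpha> \<longleftrightarrow> continuous_on {0<..} (\<lambda>t. F (of_real t * cis \<alpha>)) \<and>
     (\<lambda>t. norm (F (of_real t * cis \<alpha>))) integrable_on {0<..}"

lemma ray_okI:
  assumes "continuous_on {0<..} (\<lambda>t. F (of_real t * cis \<alpha>))" "h integrable_on {0<..}"
    and "\<And>t. 0 < t \<Longrightarrow> norm (F (of_real t * cis \<alpha>)) \<le> h t"
  shows "ray_ok F \<alpha>"
  unfolding ray_ok_def
  by (intro conjI assms integrable_dominated(1)[where h = h] continuous_intros) (use assms in auto)

lemma ray_ok_bounded_by:
  assumes G: "ray_ok G \<alpha>" and c: "continuous_on {0<..} (\<lambda>t. F (of_real t * cis \<alpha>))"
    and le: "\<And>t. 0 < t \<Longrightarrow> norm (F (of_real t * cis \<alpha>)) \<le> C * norm (G (of_real t * cis \<alpha>))"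
  shows "ray_ok F \<alpha>"
  using G by (intro ray_okI[OF c _ le]) (auto simp: ray_ok_def intro: integrable_on_mult_right)

lemma ray_ok_add:
  assumes "ray_ok F \<alpha>" "ray_ok G \<alpha>"
  shows "ray_ok (\<lambda>z. F z + G z) \<alpha>"
  by (rule ray_okI[where h = "\<lambda>t. norm (F (of_real t * cis \<alpha>)) + norm (G (of_real t * cis \<alpha>))"])
    (use assms in \<open>auto simp: ray_ok_def intro: norm_triangle_ineq integrable_add continuous_on_add\<close>)

lemma ray_ok_bounded_linear:
  assumes "bounded_linear L" "ray_ok F \<alpha>"
  shows "ray_ok (\<lambda>z. L (F z)) \<alpha>"
proof -
  obtain K where K: "\<And>x. norm (L x) \<le> norm x * K"
    using bounded_linear.bounded[OF assms(1)] by blast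
  show ?thesis
    by (rule ray_ok_bounded_by[OF assms(2), of _ K])
      (use assms K in \<open>auto simp: ray_ok_def mult.commute intro: bounded_linear.continuous_on\<close>)
qed

lemma ray_ok_diff:
  assumes "ray_ok F \<alpha>" "ray_ok G \<alpha>"
  shows "ray_ok (\<lambda>z. F z - G z) \<alpha>"
  using ray_ok_add[OF assms(1) ray_ok_bounded_linear[OF bounded_linear_minus[OF bounded_linear_ident] assms(2)]]
  by simp

lemma ray_ok_cong:
  assumes "\<And>t. 0 < t \<Longrightarrow> F (of_real t * cis \<alpha>) = G (of_real t * cis \<alpha>)"
  shows "ray_ok F \<alpha> = ray_ok G \<alpha>"
  unfolding ray_ok_def
  by (intro arg_cong2[where f = "(\<and>)"] continuous_on_cong integrable_cong refl) (use assms in auto)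

text \<open>The angle is a free real number, not a principal value, so sectors around
  \<open>pi\<close> cause no branch cuts.\<close>

definition sector :: "real \<Rightarrow> real \<Rightarrow> complex set" where
  "sector a b = {of_real t * cis \<alpha> | t \<alpha>. 0 < t \<and> a \<le> \<alpha> \<and> \<alpha> \<le> b}"

lemma sectorI: "0 < t \<Longrightarrow> a \<le> \<alpha> \<Longrightarrow> \<alpha> \<le> b \<Longrightarrow> of_real t * cis \<alpha> \<in> sector a b"
  by (auto simp: sector_def)

text \<open>Only boundedness of the multiplication is assumed: the complex scalars that act on
  \<open>V\<close> from the right are in general not compatible with its norm. The same development
  serves complex functions (\<open>cx\<close>) and operator-valued functions
  (\<open>op\<close>).\<close>

locale complex_module = bounded_bilinear m for m :: "complex \<Rightarrow> 'b::banach \<Rightarrow> 'b" +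
  assumes one: "m 1 x = x" and assoc: "m (a * b) x = m a (m b x)"
begin

text \<open>The contour integral of \<open>F z dz\<close> from 0 to infinity;
  \<open>cis \<alpha>\<close> is the derivative of the parametrisation.\<close>

definition ray :: "(complex \<Rightarrow> 'b) \<Rightarrow> real \<Rightarrow> 'b" where
  "ray F \<alpha> = integral {0<..} (\<lambda>t. m (cis \<alpha>) (F (of_real t * cis \<alpha>)))"

text \<open>Complex differentiability: the real derivative sends an increment \<open>h\<close> to
  the complex multiple of the fixed vector \<open>D\<close> by \<open>h\<close>.\<close>

abbreviation mderiv :: "(complex \<Rightarrow> 'b) \<Rightarrow> 'b \<Rightarrow> complex \<Rightarrow> bool" where
  "mderiv F D z \<equiv> (F has_derivative (\<lambda>h. m h D)) (at z)"

lemma ray_cong: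
  assumes "\<And>t. 0 < t \<Longrightarrow> F (of_real t * cis \<alpha>) = G (of_real t * cis \<alpha>)"
  shows "ray F \<alpha> = ray G \<alpha>"
  unfolding ray_def by (rule integral_cong) (use assms in auto)

lemma ray_integrand:
  assumes "ray_ok F \<alpha>"
  shows "(\<lambda>t. m (cis \<alpha>) (F (of_real t * cis \<alpha>))) integrable_on {0<..}"
    and "(\<lambda>n. integral {1 / (real n + 1)..real n + 1} (\<lambda>t. m (cis \<alpha>) (F (of_real t * cis \<alpha>))))
           \<longlonglongrightarrow> ray F \<alpha>"
proof -
  obtain K where K: "\<And>a b. norm (m a b) \<le> norm a * norm b * K" using nonneg_bounded by blast
  have c: "continuous_on {0<..} (\<lambda>t. m (cis \<alpha>) (F (of_real t * cis \<alpha>)))"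
    using assms by (intro continuous_on continuous_intros) (auto simp: ray_ok_def)
  have i: "(\<lambda>t. K * norm (F (of_real t * cis \<alpha>))) integrable_on {0<..}"
    using assms by (auto simp: ray_ok_def intro: integrable_on_mult_right)
  have b: "norm (m (cis \<alpha>) (F (of_real t * cis \<alpha>))) \<le> K * norm (F (of_real t * cis \<alpha>))" for t
    using K[of "cis \<alpha>" "F (of_real t * cis \<alpha>)"] by (simp add: mult.commute)
  from integrable_dominated[OF c i b] show
    "(\<lambda>t. m (cis \<alpha>) (F (of_real t * cis \<alpha>))) integrable_on {0<..}"
    "(\<lambda>n. integral {1 / (real n + 1)..real n + 1} (\<lambda>t. m (cis \<alpha>) (F (of_real t * cis \<alpha>))))
           \<longlonglongrightarrow> ray F \<alpha>"
    by (auto simp: ray_def)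
qed

lemma norm_ray_le:
  assumes K: "\<And>a b. norm (m a b) \<le> norm a * norm b * K" and "ray_ok F \<alpha>"
  shows "norm (ray F \<alpha>) \<le> K * integral {0<..} (\<lambda>t. norm (F (of_real t * cis \<alpha>)))"
proof -
  have "norm (ray F \<alpha>) \<le> integral {0<..} (\<lambda>t. K * norm (F (of_real t * cis \<alpha>)))"
    unfolding ray_def
    by (rule integral_norm_bound_integral[OF ray_integrand(1)[OF assms(2)]])
      (use assms(2) K[of "cis \<alpha>"] in \<open>auto simp: ray_ok_def mult.commute[of _ K] intro!: integrable_on_mult_right\<close>)
  then show ?thesis by simp
qed

lemma ray_add:
  assumes "ray_ok F \<alpha>" "ray_ok G \<alpha>"
  shows "ray (\<lambda>z. F z + G z) \<alpha> = ray F \<alpha> + ray G \<alpha>"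
  unfolding ray_def add_right
  by (rule integral_add[OF ray_integrand(1)[OF assms(1)] ray_integrand(1)[OF assms(2)]])

lemma ray_diff:
  assumes "ray_ok F \<alpha>" "ray_ok G \<alpha>"
  shows "ray (\<lambda>z. F z - G z) \<alpha> = ray F \<alpha> - ray G \<alpha>"
  unfolding ray_def diff_right
  by (rule integral_diff[OF ray_integrand(1)[OF assms(1)] ray_integrand(1)[OF assms(2)]])

lemma chain:
  assumes F: "mderiv F D (\<gamma> t)" and g: "(\<gamma> has_vector_derivative \<gamma>') (at t within S)"
  shows "((\<lambda>t. F (\<gamma> t)) has_vector_derivative m \<gamma>' D) (at t within S)"
proof -
  have "(F \<circ> \<gamma> has_derivative (\<lambda>h. m h D) \<circ> (\<lambda>h. h *\<^sub>R \<gamma>')) (at t within S)"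
    by (rule diff_chain_within[OF g[unfolded has_vector_derivative_def] has_derivative_at_withinI[OF F]])
  then show ?thesis
    by (simp add: has_vector_derivative_def o_def scaleR_left)
qed

lemma mderiv_mult:
  assumes f: "(f has_field_derivative f') (at z)" and F: "mderiv F D z"
  shows "mderiv (\<lambda>z. m (f z) (F z)) (m f' (F z) + m (f z) D) z"
proof -
  have "((\<lambda>z. m (f z) (F z)) has_derivative (\<lambda>h. m (f z) (m h D) + m (f' * h) (F z))) (at z)"
    using FDERIV[OF f[unfolded has_field_derivative_def] F] .
  moreover have "m (f z) (m h D) + m (f' * h) (F z) = m h (m f' (F z) + m (f z) D)" for h
    by (simp add: add_right assoc[symmetric] mult.commute)
  ultimately show ?thesis by simp
qed

lemma mderiv_add: "mderiv F D z \<Longrightarrow> mderiv G E z \<Longrightarrow> mderiv (\<lambda>z. F z + G z) (D + E) z"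
  by (simp add: add_right has_derivative_add)

lemma mderiv_diff: "mderiv F D z \<Longrightarrow> mderiv G E z \<Longrightarrow> mderiv (\<lambda>z. F z - G z) (D - E) z"
  by (simp add: diff_right has_derivative_diff)

text \<open>Cauchy's theorem for an annular sector in polar coordinates. The function
  \<open>D\<close> is the angular derivative of \<open>cis \<alpha> F\<close> and at the same time
  the radial derivative of \<open>i t cis \<alpha> F\<close>; integrating it over the rectangle in
  both orders yields the two sides.\<close>

lemma truncated_rays:
  assumes ab: "0 < a" "a \<le> b" "\<alpha>1 \<le> \<alpha>2"
    and F: "\<And>z. z \<in> sector \<alpha>1 \<alpha>2 \<Longrightarrow> mderiv F (F' z) z"
    and F': "continuous_on (sector \<alpha>1 \<alpha>2) F'"
  shows "integral {a..b} (\<lambda>t. m (cis \<alpha>2) (F (of_real t * cis \<alpha>2)))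
       - integral {a..b} (\<lambda>t. m (cis \<alpha>1) (F (of_real t * cis \<alpha>1)))
       = integral {\<alpha>1..\<alpha>2} (\<lambda>\<alpha>. m (\<i> * (of_real b * cis \<alpha>)) (F (of_real b * cis \<alpha>))
                              - m (\<i> * (of_real a * cis \<alpha>)) (F (of_real a * cis \<alpha>)))"
proof -
  define D where "D t \<alpha> = m (\<i> * cis \<alpha>) (F (of_real t * cis \<alpha>))
      + m (\<i> * of_real t * cis \<alpha> * cis \<alpha>) (F' (of_real t * cis \<alpha>))" for t \<alpha>
  have Fc: "continuous_on (sector \<alpha>1 \<alpha>2) F"
    using F by (auto intro!: continuous_at_imp_continuous_on has_derivative_continuous)
  have pc: "continuous_on S (\<lambda>x. F (of_real (g x) * cis (h x)))"
    "continuous_on S (\<lambda>x. F' (of_real (g x) * cis (h x)))"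
    if "continuous_on S g" "continuous_on S h" "\<And>x. x \<in> S \<Longrightarrow> g x > 0 \<and> h x \<in> {\<alpha>1..\<alpha>2}" for S :: "'c::topological_space set" and g h
    by (rule continuous_on_compose2[OF Fc] continuous_on_compose2[OF F'];
        use that in \<open>auto intro!: continuous_intros sectorI\<close>)+
  have Dc: "continuous_on (cbox (a, \<alpha>1) (b, \<alpha>2)) (\<lambda>(t, \<alpha>). D t \<alpha>)"
    unfolding D_def case_prod_unfold
    by (intro continuous_intros continuous_on pc) (use ab in \<open>auto simp: cbox_Pair_eq\<close>)
  have inner: "integral {\<alpha>1..\<alpha>2} (D t) = m (cis \<alpha>2) (F (of_real t * cis \<alpha>2)) - m (cis \<alpha>1) (F (of_real t * cis \<alpha>1))"
    if "t \<in> {a..b}" for t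
  proof (rule integral_unique, rule fundamental_theorem_of_calculus[OF ab(3)])
    fix \<alpha> assume al: "\<alpha> \<in> {\<alpha>1..\<alpha>2}"
    have c: "(cis has_vector_derivative \<i> * cis \<alpha>) (at \<alpha> within {\<alpha>1..\<alpha>2})"
      unfolding has_vector_derivative_def by (rule has_derivative_cis) (rule has_derivative_ident)
    have "((\<lambda>\<alpha>. of_real t * cis \<alpha>) has_vector_derivative of_real t * (\<i> * cis \<alpha>)) (at \<alpha> within {\<alpha>1..\<alpha>2})"
      by (rule has_vector_derivative_mult_right[OF c])
    from chain[OF F this, OF sectorI] that al ab
    have "((\<lambda>\<alpha>. F (of_real t * cis \<alpha>)) has_vector_derivative m (of_real t * (\<i> * cis \<alpha>)) (F' (of_real t * cis \<alpha>))) (at \<alpha> within {\<alpha>1..\<alpha>2})"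
      by auto
    from has_vector_derivative[OF c this]
    show "((\<lambda>\<alpha>. m (cis \<alpha>) (F (of_real t * cis \<alpha>))) has_vector_derivative D t \<alpha>) (at \<alpha> within {\<alpha>1..\<alpha>2})"
      by (simp add: D_def assoc[symmetric] add.commute mult_ac)
  qed
  have outer: "integral {a..b} (\<lambda>t. D t \<alpha>) = m (\<i> * (of_real b * cis \<alpha>)) (F (of_real b * cis \<alpha>))
                              - m (\<i> * (of_real a * cis \<alpha>)) (F (of_real a * cis \<alpha>))"
    if al: "\<alpha> \<in> {\<alpha>1..\<alpha>2}" for \<alpha>
  proof (rule integral_unique, rule fundamental_theorem_of_calculus[OF ab(2)])
    fix t assume t: "t \<in> {a..b}"
    have c: "((\<lambda>t. of_real t * cis \<alpha>) has_vector_derivative cis \<alpha>) (at t within {a..b})"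
      by (auto intro!: derivative_eq_intros simp: has_vector_derivative_def scaleR_conv_of_real)
    have c2: "((\<lambda>t. \<i> * (of_real t * cis \<alpha>)) has_vector_derivative \<i> * cis \<alpha>) (at t within {a..b})"
      by (rule has_vector_derivative_mult_right[OF c])
    from chain[OF F c, OF sectorI] t al ab
    have "((\<lambda>t. F (of_real t * cis \<alpha>)) has_vector_derivative m (cis \<alpha>) (F' (of_real t * cis \<alpha>))) (at t within {a..b})"
      by auto
    from has_vector_derivative[OF c2 this]
    show "((\<lambda>t. m (\<i> * (of_real t * cis \<alpha>)) (F (of_real t * cis \<alpha>))) has_vector_derivative D t \<alpha>) (at t within {a..b})"
      by (simp add: D_def assoc[symmetric] add.commute mult_ac)
  qed
  have "integral {a..b} (\<lambda>t. m (cis \<alpha>2) (F (of_real t * cis \<alpha>2)))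
       - integral {a..b} (\<lambda>t. m (cis \<alpha>1) (F (of_real t * cis \<alpha>1)))
     = integral {a..b} (\<lambda>t. m (cis \<alpha>2) (F (of_real t * cis \<alpha>2)) - m (cis \<alpha>1) (F (of_real t * cis \<alpha>1)))"
    by (rule integral_diff[symmetric]; rule integrable_continuous_real; intro continuous_on continuous_intros pc)
      (use ab in auto)
  also have "\<dots> = integral {a..b} (\<lambda>t. integral {\<alpha>1..\<alpha>2} (D t))"
    by (rule integral_cong) (simp add: inner)
  also have "\<dots> = integral {\<alpha>1..\<alpha>2} (\<lambda>\<alpha>. integral {a..b} (\<lambda>t. D t \<alpha>))"
    using integral_swap_continuous[OF Dc] by simp
  also have "\<dots> = integral {\<alpha>1..\<alpha>2} (\<lambda>\<alpha>. m (\<i> * (of_real b * cis \<alpha>)) (F (of_real b * cis \<alpha>))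
                              - m (\<i> * (of_real a * cis \<alpha>)) (F (of_real a * cis \<alpha>)))"
    by (rule integral_cong) (simp add: outer)
  finally show ?thesis .
qed

text \<open>The arcs of radius \<open>t\<close> contribute at most a multiple of
  \<open>C * t\<close> and of \<open>C / t\<close>, so they vanish when the radii
  \<open>1 / (n + 1)\<close> and \<open>n + 1\<close> tend to 0 and to infinity.\<close>

lemma rays_eq_power_decay:
  assumes al: "\<alpha>1 \<le> \<alpha>2"
    and F: "\<And>z. z \<in> sector \<alpha>1 \<alpha>2 \<Longrightarrow> mderiv F (F' z) z"
    and F': "continuous_on (sector \<alpha>1 \<alpha>2) F'"
    and K: "\<And>z. z \<in> sector \<alpha>1 \<alpha>2 \<Longrightarrow> norm z * norm (F z) \<le> C * norm z"
      "\<And>z. z \<in> sector \<alpha>1 \<alpha>2 \<Longrightarrow> norm z * norm (F z) \<le> C / norm z"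
    and ok: "ray_ok F \<alpha>1" "ray_ok F \<alpha>2"
  shows "ray F \<alpha>1 = ray F \<alpha>2"
proof -
  obtain k where k: "k \<ge> 0" "\<And>a b. norm (m a b) \<le> norm a * norm b * k" using nonneg_bounded by blast
  define P where "P t \<alpha> = m (\<i> * (of_real t * cis \<alpha>)) (F (of_real t * cis \<alpha>))" for t \<alpha>
  have Fc: "continuous_on (sector \<alpha>1 \<alpha>2) F"
    using F by (auto intro!: continuous_at_imp_continuous_on has_derivative_continuous)
  have Pc: "continuous_on {\<alpha>1..\<alpha>2} (P t)" if "0 < t" for t
    unfolding P_def
    by (intro continuous_on continuous_intros continuous_on_compose2[OF Fc]) (use that in \<open>auto intro!: sectorI\<close>)
  have P1: "norm (P t \<alpha>) \<le> k * (C * t)" "norm (P t \<alpha>) \<le> k * (C / t)" if "0 < t" "\<alpha> \<in> {\<alpha>1..\<alpha>2}" for t \<alpha>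
  proof -
    let ?z = "of_real t * cis \<alpha>"
    have z: "?z \<in> sector \<alpha>1 \<alpha>2" using that by (auto intro: sectorI)
    have nz: "norm ?z = t" using that by (simp add: norm_mult)
    have "norm (P t \<alpha>) \<le> k * (t * norm (F ?z))"
      using k(2)[of "\<i> * ?z" "F ?z"] nz by (simp add: P_def norm_mult mult_ac)
    then show "norm (P t \<alpha>) \<le> k * (C * t)" "norm (P t \<alpha>) \<le> k * (C / t)"
      using K[OF z] k(1) unfolding nz by (meson mult_left_mono order_trans)+
  qed
  have tr: "integral {1 / (real n + 1)..real n + 1} (\<lambda>t. m (cis \<alpha>2) (F (of_real t * cis \<alpha>2)))
       - integral {1 / (real n + 1)..real n + 1} (\<lambda>t. m (cis \<alpha>1) (F (of_real t * cis \<alpha>1)))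
       = integral {\<alpha>1..\<alpha>2} (\<lambda>\<alpha>. P (real n + 1) \<alpha> - P (1 / (real n + 1)) \<alpha>)" for n
    unfolding P_def by (rule truncated_rays[OF _ _ al F F']) (auto intro: order_trans[of _ 1])
  have "norm (integral {\<alpha>1..\<alpha>2} (\<lambda>\<alpha>. P (real n + 1) \<alpha> - P (1 / (real n + 1)) \<alpha>))
      \<le> (2 * (k * C) * (1 / (real n + 1))) * (\<alpha>2 - \<alpha>1)" for n
  proof (rule integral_bound[OF al])
    show "continuous_on {\<alpha>1..\<alpha>2} (\<lambda>\<alpha>. P (real n + 1) \<alpha> - P (1 / (real n + 1)) \<alpha>)"
      by (intro continuous_intros Pc) auto
    fix \<alpha> assume "\<alpha> \<in> {\<alpha>1..\<alpha>2}"
    then show "norm (P (real n + 1) \<alpha> - P (1 / (real n + 1)) \<alpha>) \<le> 2 * (k * C) * (1 / (real n + 1))"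
      using add_mono[OF P1(2)[of "real n + 1" \<alpha>] P1(1)[of "1 / (real n + 1)" \<alpha>]]
      by (intro order_trans[OF norm_triangle_ineq4]) (simp add: mult_ac)
  qed
  moreover have "(\<lambda>n. (2 * (k * C) * (1 / (real n + 1))) * (\<alpha>2 - \<alpha>1)) \<longlonglongrightarrow> 0"
    by real_asymp
  ultimately have "(\<lambda>n. integral {\<alpha>1..\<alpha>2} (\<lambda>\<alpha>. P (real n + 1) \<alpha> - P (1 / (real n + 1)) \<alpha>)) \<longlonglongrightarrow> 0"
    by (rule LIMSEQ_norm_le_null)
  moreover have "(\<lambda>n. integral {\<alpha>1..\<alpha>2} (\<lambda>\<alpha>. P (real n + 1) \<alpha> - P (1 / (real n + 1)) \<alpha>)) \<longlonglongrightarrow> ray F \<alpha>2 - ray F \<alpha>1"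
    unfolding tr[symmetric] by (intro tendsto_diff ray_integrand(2) ok)
  ultimately show ?thesis using LIMSEQ_unique by fastforce
qed

text \<open>The bound \<open>M\<close> is invariant under scaling, so the arcs need not tend to 0 by
  themselves. The angle \<open>\<mu>\<close> is the axis of a half-plane containing the sector:
  after rotation by \<open>- \<mu>\<close> real parts are nonnegative, which keeps the denominators
  of the damping factors away from 0.\<close>

lemma rays_eq:
  assumes al: "\<alpha>1 \<le> \<alpha>2" and mu: "\<And>\<alpha>. \<alpha>1 \<le> \<alpha> \<Longrightarrow> \<alpha> \<le> \<alpha>2 \<Longrightarrow> 0 \<le> cos (\<alpha> - \<mu>)"
    and F: "\<And>z. z \<in> sector \<alpha>1 \<alpha>2 \<Longrightarrow> mderiv F (F' z) z"
    and F': "continuous_on (sector \<alpha>1 \<alpha>2) F'"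
    and M: "\<And>z. z \<in> sector \<alpha>1 \<alpha>2 \<Longrightarrow> norm z * norm (F z) \<le> M"
    and ok: "ray_ok F \<alpha>1" "ray_ok F \<alpha>2"
  shows "ray F \<alpha>1 = ray F \<alpha>2"
proof -
  text \<open>The factors \<open>\<psi> n\<close> tend to 1, are bounded by 1 on the sector and add power decay at 0 and \<open>\<infinity>\<close>.\<close>
  define w where "w z = z * cis (- \<mu>)" for z
  define \<psi> where "\<psi> n z = (let N = complex_of_real (real n + 1) in N\<^sup>2 * w z / ((1 + N * w z) * (N + w z)))" for n z
  obtain k where k: "k \<ge> 0" "\<And>a b. norm (m a b) \<le> norm a * norm b * k" using nonneg_bounded by blast
  have nw: "norm (w z) = norm z" for z by (simp add: w_def norm_mult)
  have Rew: "Re (w z) \<ge> 0" if "z \<in> sector \<alpha>1 \<alpha>2" for z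
  proof -
    obtain t \<alpha> where z: "z = of_real t * cis \<alpha>" "0 < t" "\<alpha>1 \<le> \<alpha>" "\<alpha> \<le> \<alpha>2" using \<open>z \<in> _\<close> by (auto simp: sector_def)
    have "w z = of_real t * cis (\<alpha> - \<mu>)" using z by (simp add: w_def cis_mult)
    then show ?thesis using z mu[of \<alpha>] by simp
  qed
  have den: "norm (1 + of_real (real n + 1) * w z) \<ge> 1" "norm (1 + of_real (real n + 1) * w z) \<ge> (real n + 1) * norm z"
    "norm (of_real (real n + 1) + w z) \<ge> real n + 1" "norm (of_real (real n + 1) + w z) \<ge> norm z"
    if "z \<in> sector \<alpha>1 \<alpha>2" for n z
  proof -
    have add: "norm (of_real a + b) \<ge> a" "norm (of_real a + b) \<ge> norm b" if "a \<ge> 0" "Re b \<ge> 0" for a b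
    proof -
      show "norm (of_real a + b) \<ge> a"
        using that abs_Re_le_cmod[of "of_real a + b"] by simp
      show "norm (of_real a + b) \<ge> norm b"
        using that by (auto simp: cmod_def power2_sum)
    qed
    show "norm (1 + of_real (real n + 1) * w z) \<ge> 1" "norm (1 + of_real (real n + 1) * w z) \<ge> (real n + 1) * norm z"
      using add[of 1 "of_real (real n + 1) * w z"] Rew[OF that] nw[of z] by (simp_all add: norm_mult del: of_real_add)
    show "norm (of_real (real n + 1) + w z) \<ge> real n + 1" "norm (of_real (real n + 1) + w z) \<ge> norm z"
      using add[of "real n + 1" "w z"] Rew[OF that] nw[of z] by (simp_all del: of_real_add)
  qed
  have \<psi>b: "norm (\<psi> n z) \<le> 1" "norm (\<psi> n z) \<le> (real n + 1) * norm z" "norm (\<psi> n z) \<le> (real n + 1) / norm z"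
    if z: "z \<in> sector \<alpha>1 \<alpha>2" for n z
  proof -
    define N where "N = real n + 1"
    have N: "N \<ge> 1" by (simp add: N_def)
    have nz: "norm z > 0" using z by (auto simp: sector_def norm_mult)
    let ?A = "norm (1 + of_real N * w z)" and ?B = "norm (of_real N + w z)"
    have AB: "?A \<ge> 1" "?A \<ge> N * norm z" "?B \<ge> N" "?B \<ge> norm z" using den[OF z, of n] by (simp_all add: N_def)
    have pos: "0 < ?A * ?B" using AB N by (intro mult_pos_pos) linarith+
    have e: "norm (\<psi> n z) = N\<^sup>2 * norm z / (?A * ?B)"
      unfolding \<psi>_def Let_def N_def[symmetric] using N by (simp add: norm_mult norm_divide norm_power nw)
    have "N\<^sup>2 * norm z = (N * norm z) * N" by (simp add: power2_eq_square)
    also have "\<dots> \<le> ?A * ?B" using AB N nz by (intro mult_mono) auto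
    finally show "norm (\<psi> n z) \<le> 1" unfolding e using AB N by (auto intro!: divide_le_eq_1[THEN iffD2])
    have "N * N \<le> N * (?A * ?B)" using mult_mono[OF AB(1,3)] N by (intro mult_left_mono) auto
    then have "N * N * norm z \<le> N * norm z * (?A * ?B)" using mult_right_mono[of _ _ "norm z"] nz by (metis less_imp_le mult.commute mult.left_commute)
    then show "norm (\<psi> n z) \<le> (real n + 1) * norm z" unfolding e N_def[symmetric] using AB N
      by (subst pos_divide_le_eq[OF pos]) (auto simp: power2_eq_square)
    have "N\<^sup>2 * norm z * norm z = N * ((N * norm z) * norm z)" by (simp add: power2_eq_square)
    also have "\<dots> \<le> N * (?A * ?B)" using AB N nz by (intro mult_left_mono mult_mono) auto
    finally show "norm (\<psi> n z) \<le> (real n + 1) / norm z" unfolding e N_def[symmetric] using nz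
      by (subst pos_divide_le_eq[OF pos]) (simp add: pos_le_divide_eq)
  qed
  have \<psi>_lim: "(\<lambda>n. \<psi> n z) \<longlonglongrightarrow> 1" if z: "z \<in> sector \<alpha>1 \<alpha>2" for z
  proof -
    have w0: "w z \<noteq> 0" using z by (auto simp: sector_def w_def)
    define i where "i = (\<lambda>n. complex_of_real (1 / (real n + 1)))"
    have "(\<lambda>n. 1 / (real n + 1)) \<longlonglongrightarrow> 0" by real_asymp
    then have "i \<longlonglongrightarrow> of_real 0" unfolding i_def by (rule tendsto_of_real)
    then have i: "i \<longlonglongrightarrow> 0" by simp
    have "\<psi> n z = w z / ((i n + w z) * (1 + i n * w z))" for n
    proof -
      define N where "N = complex_of_real (real n + 1)"
      have "N \<noteq> 0" unfolding N_def of_real_eq_0_iff by simp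
      moreover have "i n = 1 / N" by (simp add: i_def N_def)
      ultimately have "(i n + w z) = (1 + N * w z) / N" "1 + i n * w z = (N + w z) / N" by (simp_all add: add_divide_distrib)
      then show ?thesis unfolding \<psi>_def Let_def N_def[symmetric] using \<open>N \<noteq> 0\<close> by (simp add: power2_eq_square mult_ac)
    qed
    moreover have "(\<lambda>n. w z / ((i n + w z) * (1 + i n * w z))) \<longlonglongrightarrow> w z / ((0 + w z) * (1 + 0 * w z))"
      by (intro tendsto_intros i) (use w0 in auto)
    ultimately show ?thesis using w0 by simp
  qed
  \<comment> \<open>The sector is not open; holomorphy of \<open>\<psi> n\<close> is stated on the
    open set where its denominators do not vanish.\<close>
  define U where "U n = {z. 1 + complex_of_real (real n + 1) * w z \<noteq> 0} \<inter> {z. complex_of_real (real n + 1) + w z \<noteq> 0}" for n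
  have Uo: "open (U n)" for n
    unfolding U_def w_def by (intro open_Int open_Collect_neq continuous_intros)
  have Us: "sector \<alpha>1 \<alpha>2 \<subseteq> U n" for n
  proof
    fix z assume z: "z \<in> sector \<alpha>1 \<alpha>2"
    have "1 + complex_of_real (real n + 1) * w z \<noteq> 0" using den(1)[OF z, of n] by force
    moreover have "complex_of_real (real n + 1) + w z \<noteq> 0" using den(3)[OF z, of n] by force
    ultimately show "z \<in> U n" by (simp add: U_def)
  qed
  have \<psi>h: "\<psi> n holomorphic_on U n" for n
    unfolding \<psi>_def Let_def w_def by (intro holomorphic_intros) (auto simp: U_def w_def)
  have Fc: "continuous_on (sector \<alpha>1 \<alpha>2) F"
    using F by (auto intro!: continuous_at_imp_continuous_on has_derivative_continuous)
  have \<psi>c: "continuous_on (sector \<alpha>1 \<alpha>2) (\<psi> n)" for n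
    by (rule continuous_on_subset[OF holomorphic_on_imp_continuous_on[OF \<psi>h] Us])
  have rayc: "continuous_on {0<..} (\<lambda>t. G (of_real t * cis \<alpha>))" if "continuous_on (sector \<alpha>1 \<alpha>2) G" "\<alpha>1 \<le> \<alpha>" "\<alpha> \<le> \<alpha>2"
    for G :: "complex \<Rightarrow> 'c::topological_space" and \<alpha>
    by (rule continuous_on_compose2[OF that(1)]) (use that in \<open>auto intro!: continuous_intros sectorI\<close>)
  have kF: "norm (m (\<psi> n z) (F z)) \<le> norm (\<psi> n z) * norm (F z) * k" for n z by (rule k(2))
  have okn: "ray_ok (\<lambda>z. m (\<psi> n z) (F z)) \<alpha>" if "ray_ok F \<alpha>" "\<alpha>1 \<le> \<alpha>" "\<alpha> \<le> \<alpha>2" for n \<alpha>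
  proof (rule ray_ok_bounded_by[OF that(1), of _ k])
    show "continuous_on {0<..} (\<lambda>t. m (\<psi> n (complex_of_real t * cis \<alpha>)) (F (complex_of_real t * cis \<alpha>)))"
      using that by (intro continuous_on rayc[OF \<psi>c] rayc[OF Fc])
    fix t :: real assume "0 < t"
    then have z: "of_real t * cis \<alpha> \<in> sector \<alpha>1 \<alpha>2" using that by (auto intro: sectorI)
    have "norm (\<psi> n (of_real t * cis \<alpha>)) * norm (F (of_real t * cis \<alpha>)) * k \<le> 1 * norm (F (of_real t * cis \<alpha>)) * k"
      by (intro mult_right_mono \<psi>b z) (use k in auto)
    then show "norm (m (\<psi> n (of_real t * cis \<alpha>)) (F (of_real t * cis \<alpha>))) \<le> k * norm (F (of_real t * cis \<alpha>))"
      using kF[of n "of_real t * cis \<alpha>"] by (simp add: mult_ac)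
  qed
  have eqn: "ray (\<lambda>z. m (\<psi> n z) (F z)) \<alpha>1 = ray (\<lambda>z. m (\<psi> n z) (F z)) \<alpha>2" for n
  proof (rule rays_eq_power_decay[OF al, where F' = "\<lambda>z. m (deriv (\<psi> n) z) (F z) + m (\<psi> n z) (F' z)"
        and C = "k * (real n + 1) * M"])
    show "mderiv (\<lambda>z. m (\<psi> n z) (F z)) (m (deriv (\<psi> n) z) (F z) + m (\<psi> n z) (F' z)) z" if "z \<in> sector \<alpha>1 \<alpha>2" for z
      using holomorphic_derivI[OF \<psi>h Uo, of z n] Us that by (intro mderiv_mult F) auto
    show "continuous_on (sector \<alpha>1 \<alpha>2) (\<lambda>z. m (deriv (\<psi> n) z) (F z) + m (\<psi> n z) (F' z))"
      by (intro continuous_intros continuous_on Fc F' \<psi>c continuous_on_subset[OF holomorphic_on_imp_continuous_on[OF holomorphic_deriv[OF \<psi>h Uo]] Us])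
    show "norm z * norm (m (\<psi> n z) (F z)) \<le> k * (real n + 1) * M * norm z"
      "norm z * norm (m (\<psi> n z) (F z)) \<le> k * (real n + 1) * M / norm z" if z: "z \<in> sector \<alpha>1 \<alpha>2" for z
    proof -
      have M0: "0 \<le> M" using M[OF z] by (meson mult_nonneg_nonneg norm_ge_zero order_trans)
      have 1: "norm z * norm (m (\<psi> n z) (F z)) \<le> k * norm (\<psi> n z) * (norm z * norm (F z))"
        using mult_left_mono[OF kF[of n z], of "norm z"] by (simp add: mult_ac)
      also have "\<dots> \<le> k * norm (\<psi> n z) * M" using k by (intro mult_left_mono M z) auto
      finally have 2: "norm z * norm (m (\<psi> n z) (F z)) \<le> k * norm (\<psi> n z) * M" .
      also have "\<dots> \<le> k * ((real n + 1) * norm z) * M" using k M0 by (intro mult_left_mono mult_right_mono \<psi>b z) auto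
      finally show "norm z * norm (m (\<psi> n z) (F z)) \<le> k * (real n + 1) * M * norm z" by (simp add: mult_ac)
      note 2
      also have "k * norm (\<psi> n z) * M \<le> k * ((real n + 1) / norm z) * M" using k M0 by (intro mult_left_mono mult_right_mono \<psi>b z) auto
      finally show "norm z * norm (m (\<psi> n z) (F z)) \<le> k * (real n + 1) * M / norm z" by (simp add: mult_ac)
    qed
  qed (rule okn[OF ok(1) order_refl al] okn[OF ok(2) al order_refl])+
  have lim: "(\<lambda>n. ray (\<lambda>z. m (\<psi> n z) (F z)) \<alpha>) \<longlonglongrightarrow> ray F \<alpha>" if a: "ray_ok F \<alpha>" "\<alpha>1 \<le> \<alpha>" "\<alpha> \<le> \<alpha>2" for \<alpha>
  proof -
    let ?z = "\<lambda>t. complex_of_real t * cis \<alpha>"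
    have zs: "?z t \<in> sector \<alpha>1 \<alpha>2" if "0 < t" for t using that a by (auto intro: sectorI)
    have d: "ray_ok (\<lambda>z. m (\<psi> n z) (F z) - F z) \<alpha>" for n
      by (rule ray_ok_diff[OF okn[OF a] a(1)])
    have e: "m (\<psi> n z) (F z) - F z = m (\<psi> n z - 1) (F z)" for n z by (simp only: diff_left one)
    have gi: "(\<lambda>t. norm (m (\<psi> n (?z t)) (F (?z t)) - F (?z t))) integrable_on {0<..}" for n
      using d[of n] by (simp only: ray_ok_def)
    let ?g = "\<lambda>n t. norm (m (\<psi> n (?z t)) (F (?z t)) - F (?z t))"
    \<comment> \<open>The difference is \<open>(\<psi> n - 1) F\<close> with
      \<open>\<psi> n - 1\<close> bounded by 2 and tending to 0, so a multiple of the norm of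
      \<open>F\<close> dominates.\<close>
    have "(\<lambda>n. integral {0<..} (?g n)) \<longlonglongrightarrow> integral {0<..} (\<lambda>t::real. 0)"
    proof (rule dominated_convergence(2)[where f = ?g and g = "\<lambda>t::real. 0" and S = "{0<..}" and h = "\<lambda>t. (2 * k) * norm (F (?z t))"])
      show "?g n integrable_on {0<..}" for n by (rule gi)
      show "(\<lambda>t. (2 * k) * norm (F (?z t))) integrable_on {0<..}"
        using a by (auto simp: ray_ok_def intro: integrable_on_mult_right)
      fix n and t :: real assume "t \<in> {0<..}"
      then have t: "0 < t" by simp
      have "norm (m (\<psi> n (?z t) - 1) (F (?z t))) \<le> norm (\<psi> n (?z t) - 1) * norm (F (?z t)) * k" by (rule k(2))
      also have "\<dots> \<le> 2 * norm (F (?z t)) * k"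
        using \<psi>b(1)[OF zs[OF t], of n] norm_triangle_ineq4[of "\<psi> n (?z t)" 1] k(1)
        by (intro mult_right_mono) auto
      finally show "norm (norm (m (\<psi> n (?z t)) (F (?z t)) - F (?z t))) \<le> (2 * k) * norm (F (?z t))"
        by (simp add: e mult_ac)
    next
      fix t :: real assume "t \<in> {0<..}"
      then have "(\<lambda>n. norm (m (\<psi> n (?z t)) (F (?z t)) - F (?z t))) \<longlonglongrightarrow> norm (m 1 (F (?z t)) - F (?z t))"
        by (intro tendsto_intros tendsto \<psi>_lim zs) auto
      then show "(\<lambda>n. norm (m (\<psi> n (?z t)) (F (?z t)) - F (?z t))) \<longlonglongrightarrow> 0" by (simp add: one)
    qed
    then have "(\<lambda>n. k * integral {0<..} (\<lambda>t. norm (m (\<psi> n (?z t)) (F (?z t)) - F (?z t)))) \<longlonglongrightarrow> k * 0"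
      by (intro tendsto_intros) simp
    then have l0: "(\<lambda>n. k * integral {0<..} (\<lambda>t. norm (m (\<psi> n (?z t)) (F (?z t)) - F (?z t)))) \<longlonglongrightarrow> 0" by simp
    have "norm (ray (\<lambda>z. m (\<psi> n z) (F z)) \<alpha> - ray F \<alpha>)
        \<le> k * integral {0<..} (\<lambda>t. norm (m (\<psi> n (?z t)) (F (?z t)) - F (?z t)))" for n
      using norm_ray_le[OF k(2) d] by (simp add: ray_diff[OF okn[OF a] a(1)])
    then have "(\<lambda>n. ray (\<lambda>z. m (\<psi> n z) (F z)) \<alpha> - ray F \<alpha>) \<longlonglongrightarrow> 0"
      by (rule LIMSEQ_norm_le_null[OF _ l0])
    then show ?thesis by (rule LIM_zero_cancel)
  qed
  show ?thesis
    using lim[OF ok(1) order_refl al] lim[OF ok(2) al order_refl] unfolding eqn by (rule LIMSEQ_unique)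
qed

end

lemma integrable_inverse_one_plus_square: "(\<lambda>t::real. 1 / (1 + t\<^sup>2)) integrable_on {0<..}"
proof -
  have "((\<lambda>t::real. 1 / (1 + t\<^sup>2)) has_integral (pi / 2 - 0)) {0<..}"
  proof (rule has_integral_improper[where P = arctan])
    show "(arctan has_vector_derivative 1 / (1 + x\<^sup>2)) (at x)" for x
      using DERIV_arctan[of x] by (simp add: has_real_derivative_iff_has_vector_derivative inverse_eq_divide)
    have "(arctan \<longlongrightarrow> arctan 0) (at_right 0)"
      by (intro tendsto_intros)
    then show "(arctan \<longlongrightarrow> 0) (at_right 0)" by simp
    show "(arctan \<longlongrightarrow> pi / 2) at_top" by (rule tendsto_arctan_at_top)
  qed
  then show ?thesis by auto
qed

lemma ray_ok_quadratic_decay: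
  assumes "continuous_on {0<..} (\<lambda>t. F (of_real t * cis \<alpha>))"
    and "\<And>t. 0 < t \<Longrightarrow> norm (F (of_real t * cis \<alpha>)) \<le> C / (1 + t\<^sup>2)"
  shows "ray_ok F \<alpha>"
proof (rule ray_okI[OF assms(1)])
  show "(\<lambda>t. C * (1 / (1 + t\<^sup>2))) integrable_on {0<..}"
    by (rule integrable_on_mult_right[OF integrable_inverse_one_plus_square])
qed (use assms(2) in simp)

subsection \<open>Cauchy's formula for the boundary of a double cone\<close>

text \<open>The function \<open>|Im|\<close> is 1-Lipschitz, at most \<open>a |z|\<close> at
  \<open>z\<close> and at least \<open>b |s|\<close> at \<open>s\<close>. Hence
  \<open>b |s| - a |z|\<close> is at most \<open>|z - s|\<close>, and one norm can be traded for the
  other at the cost of a multiple of \<open>|z - s|\<close>.\<close>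

lemma cone_separation:
  fixes z s :: complex
  assumes "\<bar>Im z\<bar> \<le> a * norm z" "b * norm s \<le> \<bar>Im s\<bar>" "0 \<le> a" "a \<le> b"
  shows "(b - a) * norm s \<le> (1 + a) * norm (z - s)" "(b - a) * norm z \<le> (1 + b) * norm (z - s)"
proof -
  have 1: "b * norm s - a * norm z \<le> norm (z - s)"
    using abs_Im_le_cmod[of "z - s"] assms(1,2) by (simp add: abs_le_iff) linarith
  have "a * (norm z - norm s) \<le> a * norm (z - s)"
    using assms by (intro mult_left_mono norm_triangle_ineq2) auto
  then show "(b - a) * norm s \<le> (1 + a) * norm (z - s)" using 1 by (simp add: algebra_simps)
  have "b * (norm z - norm s) \<le> b * norm (z - s)"
    using assms by (intro mult_left_mono norm_triangle_ineq2) auto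
  then show "(b - a) * norm z \<le> (1 + b) * norm (z - s)" using 1 by (simp add: algebra_simps)
qed

lemma cone_separation_sum:
  fixes z s :: complex
  assumes "\<bar>Im z\<bar> \<le> a * norm z" "b * norm s \<le> \<bar>Im s\<bar>" "0 \<le> a" "a \<le> b" "b \<le> 1"
  shows "(b - a) * (norm z + norm s) \<le> 4 * norm (z - s)"
proof -
  have "(1 + a) * norm (z - s) \<le> 2 * norm (z - s)" "(1 + b) * norm (z - s) \<le> 2 * norm (z - s)"
    using assms by (intro mult_right_mono; simp)+
  then show ?thesis using cone_separation[OF assms(1-4)] by (simp add: algebra_simps)
qed

text \<open>The planar double sector of half-angle \<open>\<phi>\<close> is
  \<open>dcone (sin \<phi>)\<close>. The inequality avoids arguments, and its strictness excludes
  0.\<close>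

definition dcone :: "real \<Rightarrow> complex set" where
  "dcone a = {z. \<bar>Im z\<bar> < a * norm z}"

lemma open_dcone: "open (dcone a)"
  unfolding dcone_def by (intro open_Collect_less continuous_intros)

lemma dcone_nonzero: "z \<in> dcone a \<Longrightarrow> z \<noteq> 0"
  by (auto simp: dcone_def)

lemma ray_in_dcone: "0 < t \<Longrightarrow> \<bar>sin \<alpha>\<bar> < a \<Longrightarrow> of_real t * cis \<alpha> \<in> dcone a"
  by (simp add: dcone_def norm_mult abs_mult)

lemma abs_sin_le_sin:
  assumes "0 \<le> \<phi>" "\<phi> \<le> pi / 2" "\<bar>\<alpha>\<bar> \<le> \<phi>"
  shows "\<bar>sin \<alpha>\<bar> \<le> sin \<phi>"
  using assms sin_monotone_2pi_le[of \<alpha> \<phi>] sin_monotone_2pi_le[of "-\<phi>" \<alpha>] by (auto simp: abs_le_iff)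

text \<open>For \<open>\<mu>\<close> equal to 0 or \<open>pi\<close>, the number
  \<open>cos \<mu>\<close> is the sign that selects the right or the left half of the double
  cone.\<close>

lemma sector_in_dcone:
  assumes "z \<in> sector (\<mu> - \<phi>) (\<mu> + \<phi>)" "\<mu> \<in> {0, pi}" "0 < \<phi>" "\<phi> < pi / 2"
  shows "\<bar>Im z\<bar> \<le> sin \<phi> * norm z" "0 < cos \<mu> * Re z" "z \<noteq> 0"
proof -
  obtain t \<alpha> where z: "z = of_real t * cis \<alpha>" "0 < t" "\<mu> - \<phi> \<le> \<alpha>" "\<alpha> \<le> \<mu> + \<phi>"
    using assms(1) by (auto simp: sector_def)
  have s: "\<bar>sin (\<alpha> - \<mu>)\<bar> \<le> sin \<phi>" using assms z by (intro abs_sin_le_sin) auto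
  have c: "0 < cos (\<alpha> - \<mu>)" using assms z by (intro cos_gt_zero_pi) auto
  have e: "\<bar>sin (\<alpha> - \<mu>)\<bar> = \<bar>sin \<alpha>\<bar>" "cos (\<alpha> - \<mu>) = cos \<mu> * cos \<alpha>"
    using assms(2) by (auto simp: sin_diff cos_diff)
  show "\<bar>Im z\<bar> \<le> sin \<phi> * norm z" using s e z by (simp add: abs_mult norm_mult mult_left_mono mult.commute)
  show "0 < cos \<mu> * Re z" using c e z by (simp add: mult.left_commute)
  show "z \<noteq> 0" using z by auto
qed

interpretation cx: complex_module "(*) :: complex \<Rightarrow> complex \<Rightarrow> complex"
  by (intro complex_module.intro bounded_bilinear_mult complex_module_axioms.intro) auto

lemma cx_mderiv: "cx.mderiv F D z \<longleftrightarrow> (F has_field_derivative D) (at z)"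
proof -
  have "(\<lambda>h. h * D) = (*) D" by (auto simp: fun_eq_iff)
  then show ?thesis by (simp add: has_field_derivative_def)
qed

lemma cx_rays_eq_holomorphic:
  assumes "F holomorphic_on A" "open A" "sector \<alpha>1 \<alpha>2 \<subseteq> A"
    and "\<alpha>1 \<le> \<alpha>2" "\<And>\<alpha>. \<alpha>1 \<le> \<alpha> \<Longrightarrow> \<alpha> \<le> \<alpha>2 \<Longrightarrow> 0 \<le> cos (\<alpha> - \<mu>)"
    and "\<And>z. z \<in> sector \<alpha>1 \<alpha>2 \<Longrightarrow> norm z * norm (F z) \<le> M"
    and "ray_ok F \<alpha>1" "ray_ok F \<alpha>2"
  shows "cx.ray F \<alpha>1 = cx.ray F \<alpha>2"
proof (rule cx.rays_eq[OF assms(4,5), where F' = "deriv F"])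
  show "cx.mderiv F (deriv F z) z" if "z \<in> sector \<alpha>1 \<alpha>2" for z
    unfolding cx_mderiv using holomorphic_derivI[OF assms(1,2)] assms(3) that by auto
  show "continuous_on (sector \<alpha>1 \<alpha>2) (deriv F)"
    by (rule continuous_on_subset[OF holomorphic_on_imp_continuous_on[OF holomorphic_deriv[OF assms(1,2)]] assms(3)])
qed (use assms in auto)

text \<open>With \<open>u = cis \<alpha> / w\<close> the integrand is the derivative of a logarithm
  of \<open>q t = (t u - 1) / (t u + 1)\<close>, which runs from -1 to 1 inside the half-plane on
  the side \<open>s\<close> of the real axis. The factor \<open>- i s\<close> turns this half-plane
  into the right one, where \<open>Ln\<close> is differentiable; the end values are
  \<open>Ln (i s)\<close> and \<open>Ln (- i s)\<close>.\<close>

lemma ray_log: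
  assumes w: "w \<noteq> 0" and s: "s = 1 \<or> s = - 1" and im: "0 < s * Im (cis \<alpha> / w)"
  shows "cx.ray (\<lambda>z. 2 * w / (z\<^sup>2 - w\<^sup>2)) \<alpha> = - of_real s * of_real pi * \<i>"
proof -
  define u where "u = cis \<alpha> / w"
  define q where "q t = (of_real t * u - 1) / (of_real t * u + 1)" for t :: real
  define P where "P t = Ln (- \<i> * of_real s * q t)" for t
  have imu: "Im u \<noteq> 0" using im by (auto simp: u_def)
  have nz: "of_real t * u + 1 \<noteq> 0" "of_real t * u - 1 \<noteq> 0" for t
  proof -
    have "Im (of_real t * u + 1) \<noteq> 0 \<or> t = 0" "Im (of_real t * u - 1) \<noteq> 0 \<or> t = 0" using imu by auto
    then show "of_real t * u + 1 \<noteq> 0" "of_real t * u - 1 \<noteq> 0" by (auto simp: complex_eq_iff)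
  qed
  have Req: "0 < Re (- \<i> * of_real s * q t)" if "0 < t" for t
  proof -
    define c where "c = of_real t * u"
    have "q t = (c - 1) * cnj (c + 1) / of_real ((norm (c + 1))\<^sup>2)"
      unfolding q_def c_def[symmetric] by (subst complex_div_cnj) simp
    then have "Im (q t) = 2 * Im c / (norm (c + 1))\<^sup>2"
      by (simp add: algebra_simps)
    then have "Re (- \<i> * of_real s * q t) = 2 * t * (s * Im u) / (norm (c + 1))\<^sup>2"
      by (simp add: c_def)
    moreover have "0 < norm (c + 1)" using nz[of t] by (simp add: c_def)
    ultimately show ?thesis using im that by (simp add: u_def)
  qed
  have "((\<lambda>t. cis \<alpha> * (2 * w / ((of_real t * cis \<alpha>)\<^sup>2 - w\<^sup>2))) has_integral
      (Ln (- \<i> * of_real s) - Ln (\<i> * of_real s))) {0<..}"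
  proof (rule has_integral_improper[where P = P])
    fix t :: real assume t: "0 < t"
    have dq: "(q has_vector_derivative 2 * u / (of_real t * u + 1)\<^sup>2) (at t)"
    proof -
      have "((\<lambda>z. (z * u - 1) / (z * u + 1)) has_field_derivative 2 * u / (of_real t * u + 1)\<^sup>2) (at (of_real t))"
        using nz[of t] by (auto intro!: derivative_eq_intros simp: power2_eq_square field_simps)
      then show ?thesis
        unfolding q_def by (rule has_vector_derivative_real_field)
    qed
    have np: "- \<i> * of_real s * q t \<notin> \<real>\<^sub>\<le>\<^sub>0" using Req[OF t] by (simp add: complex_nonpos_Reals_iff)
    have qn: "q t \<noteq> 0" using nz[of t] by (simp add: q_def)
    have sn: "s \<noteq> 0" using s by auto
    have "(Ln has_field_derivative inverse (- \<i> * of_real s * q t)) (at (- \<i> * of_real s * q t))"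
      by (rule has_field_derivative_Ln[OF np])
    moreover have "((\<lambda>t. - \<i> * of_real s * q t) has_vector_derivative (- \<i> * of_real s) * (2 * u / (of_real t * u + 1)\<^sup>2)) (at t)"
      by (rule has_vector_derivative_mult_right[OF dq])
    ultimately have "(Ln \<circ> (\<lambda>t. - \<i> * of_real s * q t) has_vector_derivative
        ((- \<i> * of_real s) * (2 * u / (of_real t * u + 1)\<^sup>2)) * inverse (- \<i> * of_real s * q t)) (at t)"
      by (intro field_vector_diff_chain_at)
    moreover have "((- \<i> * of_real s) * (2 * u / (of_real t * u + 1)\<^sup>2)) * inverse (- \<i> * of_real s * q t)
      = (2 * u / (of_real t * u + 1)\<^sup>2) / q t" using qn sn by (simp add: field_simps)
    moreover have "(2 * u / (of_real t * u + 1)\<^sup>2) / q t = 2 * u / ((of_real t * u + 1) * (of_real t * u - 1))"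
      using nz[of t] by (simp add: q_def power2_eq_square)
    moreover have "\<dots> = cis \<alpha> * (2 * w / ((of_real t * cis \<alpha>)\<^sup>2 - w\<^sup>2))"
    proof -
      have "(of_real t * cis \<alpha>)\<^sup>2 - w\<^sup>2 = w\<^sup>2 * ((of_real t * u + 1) * (of_real t * u - 1))"
        using w by (simp add: u_def power2_eq_square field_simps)
      moreover have "cis \<alpha> = u * w" using w by (simp add: u_def)
      ultimately show ?thesis using w nz[of t] by (simp add: power2_eq_square)
    qed
    ultimately show "(P has_vector_derivative cis \<alpha> * (2 * w / ((of_real t * cis \<alpha>)\<^sup>2 - w\<^sup>2))) (at t)"
      by (simp add: P_def[abs_def] o_def)
  next
    have isr: "- \<i> * of_real s \<notin> \<real>\<^sub>\<le>\<^sub>0" "\<i> * of_real s \<notin> \<real>\<^sub>\<le>\<^sub>0" using s by (auto simp: complex_nonpos_Reals_iff)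
    have "(q \<longlongrightarrow> q 0) (at_right 0)"
      unfolding q_def by (intro tendsto_intros) (use nz[of 0] in auto)
    then have "((\<lambda>t. - \<i> * of_real s * q t) \<longlongrightarrow> - \<i> * of_real s * q 0) (at_right 0)"
      by (intro tendsto_intros)
    then have "((\<lambda>t. - \<i> * of_real s * q t) \<longlongrightarrow> \<i> * of_real s) (at_right 0)" by (simp add: q_def)
    then show "(P \<longlongrightarrow> Ln (\<i> * of_real s)) (at_right 0)"
      unfolding P_def[abs_def] by (intro tendsto_Ln isr)
    have q1: "(q \<longlongrightarrow> 1) at_top"
    proof -
      have u0: "u \<noteq> 0" using imu by auto
      have i: "((\<lambda>t. complex_of_real (inverse t)) \<longlongrightarrow> of_real 0) at_top"
        by (intro tendsto_of_real tendsto_inverse_0_at_top filterlim_ident)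
      have "((\<lambda>t. (u - of_real (inverse t)) / (u + of_real (inverse t))) \<longlongrightarrow> (u - of_real 0) / (u + of_real 0)) at_top"
        by (intro tendsto_intros i) (use imu in auto)
      then have "((\<lambda>t. (u - of_real (inverse t)) / (u + of_real (inverse t))) \<longlongrightarrow> 1) at_top" using u0 by simp
      moreover have "\<forall>\<^sub>F t in at_top. (u - of_real (inverse t)) / (u + of_real (inverse t)) = q t"
        using eventually_gt_at_top[of 0]
      proof eventually_elim
        case (elim t)
        then have "u - of_real (inverse t) = (of_real t * u - 1) / of_real t" "u + of_real (inverse t) = (of_real t * u + 1) / of_real t"
          by (auto simp: field_simps)
        then show ?case using elim by (simp add: q_def)
      qed
      ultimately show ?thesis by (rule Lim_transform_eventually)
    qed
    have "((\<lambda>t. - \<i> * of_real s * q t) \<longlongrightarrow> - \<i> * of_real s * 1) at_top"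
      by (intro tendsto_intros q1)
    then show "(P \<longlongrightarrow> Ln (- \<i> * of_real s)) at_top"
      unfolding P_def[abs_def] using isr by (intro tendsto_Ln) auto
  qed
  then have "cx.ray (\<lambda>z. 2 * w / (z\<^sup>2 - w\<^sup>2)) \<alpha> = Ln (- \<i> * of_real s) - Ln (\<i> * of_real s)"
    unfolding cx.ray_def by (rule integral_unique)
  also have "\<dots> = - of_real s * of_real pi * \<i>"
    using s by (auto simp: field_simps)
  finally show ?thesis .
qed


text \<open>The kernel equals \<open>1 / (z - w) - 1 / (z + w)\<close>: it has the pole of the
  Cauchy kernel at \<open>w\<close> but decays quadratically, and \<open>- w\<close> lies in the
  opposite half of the cone.\<close>

lemma ray_diff_log:
  assumes phi: "0 < \<phi>" "\<phi> < pi / 2" and mu: "\<mu> \<in> {0, pi}"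
    and w: "\<bar>Im w\<bar> < sin \<phi> * norm w" "0 < cos \<mu> * Re w"
  shows "cx.ray (\<lambda>z. 2 * w / (z\<^sup>2 - w\<^sup>2)) (\<mu> - \<phi>) - cx.ray (\<lambda>z. 2 * w / (z\<^sup>2 - w\<^sup>2)) (\<mu> + \<phi>) = 2 * of_real pi * \<i>"
    and "ray_ok (\<lambda>z. 2 * w / (z\<^sup>2 - w\<^sup>2)) (\<mu> - \<phi>)" "ray_ok (\<lambda>z. 2 * w / (z\<^sup>2 - w\<^sup>2)) (\<mu> + \<phi>)"
proof -
  define v where "v = of_real (cos \<mu>) * w"
  have cm: "cos \<mu> = 1 \<or> cos \<mu> = -1" "sin \<mu> = 0" using mu by auto
  have v: "\<bar>Im v\<bar> < sin \<phi> * norm v" "0 < Re v" using w cm by (auto simp: v_def norm_mult)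
  have sp: "0 < sin \<phi>" "0 < cos \<phi>" using phi by (auto intro: sin_gt_zero cos_gt_zero)
  \<comment> \<open>This says that the argument of \<open>v\<close> has modulus below
    \<open>\<phi>\<close>: the two boundary rays pass \<open>w\<close> on opposite sides, which
    decides the sign \<open>s\<close> in \<open>ray_log\<close>.\<close>
  have key: "\<bar>cos \<phi> * Im v\<bar> < sin \<phi> * Re v"
  proof (rule power2_less_imp_less)
    have "(Im v)\<^sup>2 < (sin \<phi> * norm v)\<^sup>2"
      using v(1) by (metis abs_ge_zero power2_abs power_strict_mono zero_less_numeral)
    also have "\<dots> = (sin \<phi>)\<^sup>2 * ((Re v)\<^sup>2 + (Im v)\<^sup>2)" by (simp add: power_mult_distrib cmod_power2)
    finally have "(1 - (sin \<phi>)\<^sup>2) * (Im v)\<^sup>2 < (sin \<phi>)\<^sup>2 * (Re v)\<^sup>2" by (simp add: algebra_simps)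
    then show "\<bar>cos \<phi> * Im v\<bar>\<^sup>2 < (sin \<phi> * Re v)\<^sup>2" by (simp add: cos_squared_eq power_mult_distrib)
  qed (use sp v in auto)
  have w0: "w \<noteq> 0" using w by auto
  have v0: "v \<noteq> 0" using v by auto
  have q: "cis (\<mu> + \<beta>) / w = cis \<beta> / v" for \<beta>
    using cm w0 by (auto simp: v_def complex_eq_iff cis.ctr cos_add sin_add Re_divide Im_divide)
  have im: "Im (cis \<beta> / v) = (sin \<beta> * Re v - cos \<beta> * Im v) / (norm v)\<^sup>2" for \<beta>
    by (simp add: Im_divide cmod_power2)
  have "0 < 1 * Im (cis (\<mu> + \<phi>) / w)"
    unfolding q im using key v0 by (auto simp: abs_less_iff)
  from ray_log[OF w0 _ this] have 1: "cx.ray (\<lambda>z. 2 * w / (z\<^sup>2 - w\<^sup>2)) (\<mu> + \<phi>) = - of_real pi * \<i>" by simp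
  have "0 < - 1 * Im (cis (\<mu> + - \<phi>) / w)"
    unfolding q im using key v0 by (auto simp: abs_less_iff zero_less_divide_iff)
  from ray_log[OF w0 _ this] have 2: "cx.ray (\<lambda>z. 2 * w / (z\<^sup>2 - w\<^sup>2)) (\<mu> - \<phi>) = of_real pi * \<i>" by simp
  show "cx.ray (\<lambda>z. 2 * w / (z\<^sup>2 - w\<^sup>2)) (\<mu> - \<phi>) - cx.ray (\<lambda>z. 2 * w / (z\<^sup>2 - w\<^sup>2)) (\<mu> + \<phi>) = 2 * of_real pi * \<i>"
    by (simp add: 1 2)
  have "ray_ok (\<lambda>z. 2 * w / (z\<^sup>2 - w\<^sup>2)) \<alpha>" if al: "\<bar>sin \<alpha>\<bar> = sin \<phi>" for \<alpha>
  proof -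
    define a where "a = \<bar>Im w\<bar> / norm w"
    have a: "0 \<le> a" "a < sin \<phi>" "\<bar>Im w\<bar> \<le> a * norm w" using w w0 by (auto simp: a_def divide_simps)
    define d where "d = sin \<phi> - a"
    have d: "0 < d" using a by (simp add: d_def)
    let ?z = "\<lambda>t. complex_of_real t * cis \<alpha>"
    have sep: "d * (norm w + t) \<le> 4 * norm (?z t - w)" "d * (norm w + t) \<le> 4 * norm (?z t + w)" if "0 < t" for t
    proof -
      have z: "sin \<phi> * norm (?z t) \<le> \<bar>Im (?z t)\<bar>" "norm (?z t) = t" using that al by (simp_all add: norm_mult abs_mult)
      show "d * (norm w + t) \<le> 4 * norm (?z t - w)"
        using cone_separation_sum[OF a(3) z(1) a(1)] a z(2) by (simp add: d_def norm_minus_commute)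
      show "d * (norm w + t) \<le> 4 * norm (?z t + w)"
      proof -
        have "norm (- w - ?z t) = norm (?z t + w)"
          by (metis add_uminus_conv_diff minus_add_distrib add.commute norm_minus_cancel)
        then show ?thesis
          using cone_separation_sum[of "-w", OF _ z(1) a(1)] a z(2) by (simp add: d_def)
      qed
    qed
    have nz: "(?z t)\<^sup>2 - w\<^sup>2 \<noteq> 0" if "0 < t" for t
    proof -
      have "0 < d * (norm w + t)" using d that by (simp add: add_nonneg_pos)
      then have "0 < norm (?z t - w)" "0 < norm (?z t + w)" using sep[OF that] by linarith+
      then show ?thesis by (simp add: power2_eq_square square_diff_square_factored del: zero_less_norm_iff) auto
    qed
    show ?thesis
    proof (rule ray_ok_quadratic_decay)
      show "continuous_on {0<..} (\<lambda>t. 2 * w / ((?z t)\<^sup>2 - w\<^sup>2))"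
        by (intro continuous_intros) (use nz in auto)
      fix t :: real assume t: "0 < t"
      have pos: "0 < norm w" using w0 by simp
      \<comment> \<open>Chosen so that \<open>m (1 + t\<^sup>2)\<close> is at most
        \<open>|w|\<^sup>2 + t\<^sup>2\<close>.\<close>
      define m where "m = min 1 ((norm w)\<^sup>2)"
      have m: "0 < m" using pos by (simp add: m_def)
      have "m * (1 + t\<^sup>2) \<le> (norm w)\<^sup>2 + t\<^sup>2"
        using mult_right_mono[of m 1 "t\<^sup>2"] by (simp add: m_def algebra_simps)
      also have "\<dots> \<le> (norm w + t) * (norm w + t)" using t pos by (simp add: power2_eq_square algebra_simps)
      finally have "d\<^sup>2 * (m * (1 + t\<^sup>2)) \<le> (d * (norm w + t)) * (d * (norm w + t))"
        using d by (simp add: power2_eq_square mult_ac mult_left_mono)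
      also have "\<dots> \<le> (4 * norm (?z t - w)) * (4 * norm (?z t + w))"
        by (rule mult_mono[OF sep(1)[OF t] sep(2)[OF t]]) (use d t pos in auto)
      also have "\<dots> = 16 * norm ((?z t)\<^sup>2 - w\<^sup>2)"
        by (simp add: norm_mult[symmetric] power2_eq_square square_diff_square_factored mult.commute)
      finally have le: "d\<^sup>2 * m * (1 + t\<^sup>2) \<le> 16 * norm ((?z t)\<^sup>2 - w\<^sup>2)" by (simp add: mult_ac)
      have p: "0 < d\<^sup>2 * m * (1 + t\<^sup>2)" using d m by (simp add: add_pos_nonneg)
      have "norm (2 * w / ((?z t)\<^sup>2 - w\<^sup>2)) = 32 * norm w / (16 * norm ((?z t)\<^sup>2 - w\<^sup>2))" by (simp add: norm_divide norm_mult)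
      also have "\<dots> \<le> 32 * norm w / (d\<^sup>2 * m * (1 + t\<^sup>2))"
        using le p by (intro divide_left_mono[OF le] mult_pos_pos[OF order_less_le_trans[OF p le] p]) auto
      finally show "norm (2 * w / ((?z t)\<^sup>2 - w\<^sup>2)) \<le> (32 * norm w / (d\<^sup>2 * m)) / (1 + t\<^sup>2)" by simp
    qed
  qed
  then show "ray_ok (\<lambda>z. 2 * w / (z\<^sup>2 - w\<^sup>2)) (\<mu> - \<phi>)" "ray_ok (\<lambda>z. 2 * w / (z\<^sup>2 - w\<^sup>2)) (\<mu> + \<phi>)"
    using cm sp by (auto simp: sin_diff sin_add)
qed

lemma half_cone_rays_eq:
  assumes phi: "0 < \<phi>" "\<phi> < pi / 2" and mu: "\<mu> \<in> {0, pi}" and a: "sin \<phi> < a"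
    and F: "F holomorphic_on (dcone a \<inter> {z. 0 < cos \<mu> * Re z})"
    and M: "\<And>z. \<bar>Im z\<bar> \<le> sin \<phi> * norm z \<Longrightarrow> 0 < cos \<mu> * Re z \<Longrightarrow> norm z * norm (F z) \<le> M"
    and ok: "ray_ok F (\<mu> - \<phi>)" "ray_ok F (\<mu> + \<phi>)"
  shows "cx.ray F (\<mu> - \<phi>) = cx.ray F (\<mu> + \<phi>)"
proof (rule cx_rays_eq_holomorphic[OF F, where \<mu> = \<mu>])
  show "open (dcone a \<inter> {z. 0 < cos \<mu> * Re z})"
    by (intro open_Int open_dcone open_Collect_less continuous_intros)
  show "sector (\<mu> - \<phi>) (\<mu> + \<phi>) \<subseteq> dcone a \<inter> {z. 0 < cos \<mu> * Re z}"
  proof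
    fix z assume z: "z \<in> sector (\<mu> - \<phi>) (\<mu> + \<phi>)"
    note s = sector_in_dcone[OF z mu phi]
    have "sin \<phi> * norm z < a * norm z" using a s(3) by simp
    from le_less_trans[OF s(1) this] show "z \<in> dcone a \<inter> {z. 0 < cos \<mu> * Re z}" using s(2) by (simp add: dcone_def)
  qed
  show "norm z * norm (F z) \<le> M" if "z \<in> sector (\<mu> - \<phi>) (\<mu> + \<phi>)" for z
    using sector_in_dcone[OF that mu phi] by (intro M)
  show "0 \<le> cos (\<alpha> - \<mu>)" if "\<mu> - \<phi> \<le> \<alpha>" "\<alpha> \<le> \<mu> + \<phi>" for \<alpha>
    using that phi by (intro cos_ge_zero) auto
qed (use phi ok in auto)

text \<open>Subtracting a multiple of the kernel of \<open>ray_diff_log\<close> removes the pole.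
  The remainder \<open>G\<close> is holomorphic in the half cone, so its two boundary rays cancel,
  and the subtracted part contributes \<open>2 pi i f w\<close>.\<close>

lemma half_cone_Cauchy:
  assumes phi: "0 < \<phi>" "\<phi> < pi / 2" and mu: "\<mu> \<in> {0, pi}" and a: "sin \<phi> < a"
    and f: "f holomorphic_on (dcone a \<inter> {z. 0 < cos \<mu> * Re z})"
    and M: "\<And>z. z \<in> dcone a \<Longrightarrow> 0 < cos \<mu> * Re z \<Longrightarrow> norm (f z) \<le> M"
    and w: "\<bar>Im w\<bar> < sin \<phi> * norm w" "0 < cos \<mu> * Re w"
    and ok: "ray_ok (\<lambda>z. f z / (z - w)) (\<mu> - \<phi>)" "ray_ok (\<lambda>z. f z / (z - w)) (\<mu> + \<phi>)"
  shows "cx.ray (\<lambda>z. f z / (z - w)) (\<mu> - \<phi>) - cx.ray (\<lambda>z. f z / (z - w)) (\<mu> + \<phi>) = 2 * of_real pi * \<i> * f w"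
proof -
  define A where "A = dcone a \<inter> {z. 0 < cos \<mu> * Re z}"
  \<comment> \<open>The factor \<open>2 w / (z + w)\<close> is 1 at \<open>w\<close> and decays at
    infinity. Subtracting the plain constant \<open>f w\<close> would leave
    \<open>f w / (z - w)\<close>, which is not absolutely integrable at infinity.\<close>
  define N where "N z = f z - f w * (2 * w / (z + w))" for z
  define G where "G z = (if z = w then deriv N w else (N z - N w) / (z - w))" for z
  have cm: "cos \<mu> = 1 \<or> cos \<mu> = -1" "sin \<mu> = 0" using mu by auto
  have Ao: "open A" unfolding A_def by (intro open_Int open_dcone open_Collect_less continuous_intros)
  have w0: "w \<noteq> 0" using w by auto
  have "sin \<phi> * norm w < a * norm w" using w0 a by simp
  then have wA: "w \<in> A" using w by (simp add: A_def dcone_def)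
  have Rew: "\<bar>Re w\<bar> > 0" using w by auto
  have zw: "norm (z + w) \<ge> \<bar>Re w\<bar>" if "0 < cos \<mu> * Re z" for z
    using abs_Re_le_cmod[of "z + w"] that w(2) cm by auto
  have zw0: "z + w \<noteq> 0" if "0 < cos \<mu> * Re z" for z using zw[OF that] Rew by auto
  have Nh: "N holomorphic_on A" unfolding N_def using zw0 f by (auto simp: A_def intro!: holomorphic_intros)
  have Gh: "G holomorphic_on A" unfolding G_def[abs_def] by (rule pole_lemma_open[OF Nh Ao])
  have Nw: "N w = 0" using w0 by (simp add: N_def)
  define M2 where "M2 = M + M * (2 * norm w / \<bar>Re w\<bar>)"
  have N: "norm (N z) \<le> M2" if "z \<in> A" for z
  proof -
    have "norm (N z) \<le> norm (f z) + norm (f w) * (norm (2 * w) / norm (z + w))"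
      unfolding N_def by (metis norm_triangle_ineq4 norm_mult norm_divide)
    also have "\<dots> \<le> M + M * (2 * norm w / \<bar>Re w\<bar>)"
      using that wA zw[of z] Rew M[of z] M[of w] by (intro add_mono mult_mono frac_le) (auto simp: A_def norm_mult intro: order_trans[OF norm_ge_zero])
    finally show ?thesis by (simp add: M2_def)
  qed
  have M20: "0 \<le> M2" using N[OF wA] norm_ge_zero order_trans by blast
  obtain \<delta> where \<delta>: "\<delta> > 0" "cball w \<delta> \<subseteq> A" using Ao wA open_contains_cball by blast
  have "compact (G ` cball w \<delta>)"
    by (intro compact_continuous_image compact_cball continuous_on_subset[OF holomorphic_on_imp_continuous_on[OF Gh] \<delta>(2)])
  then obtain B where B: "\<And>z. z \<in> cball w \<delta> \<Longrightarrow> norm (G z) \<le> B"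
    using compact_imp_bounded bounded_iff by (metis imageI)
  have B0: "0 \<le> B" using B[of w] \<delta> by (auto intro: order_trans[OF norm_ge_zero])
  \<comment> \<open>Near \<open>w\<close> compactness bounds \<open>G\<close>; elsewhere
    \<open>|z| / |z - w|\<close> is at most \<open>1 + |w| / \<delta>\<close>.\<close>
  have GA: "norm z * norm (G z) \<le> (norm w + \<delta>) * B + M2 * (1 + norm w / \<delta>)" if z: "z \<in> A" for z
  proof (cases "norm (z - w) \<le> \<delta>")
    case True
    then have "norm z * norm (G z) \<le> (norm w + \<delta>) * B"
      using norm_triangle_sub[of z w] by (intro mult_mono B) (use B0 \<delta> in \<open>auto simp: dist_norm norm_minus_commute\<close>)
    moreover have "0 \<le> M2 * (1 + norm w / \<delta>)" using M20 \<delta> by auto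
    ultimately show ?thesis by linarith
  next
    case False
    then have ne: "z \<noteq> w" and d: "norm (z - w) > \<delta>" using \<delta> by auto
    have "norm w / \<delta> * norm (z - w) \<ge> norm w / \<delta> * \<delta>" using d \<delta> by (intro mult_left_mono) auto
    then have z1: "norm z \<le> norm (z - w) * (1 + norm w / \<delta>)"
      using norm_triangle_sub[of z w] \<delta> by (simp add: algebra_simps)
    have "norm z * norm (G z) = norm z / norm (z - w) * norm (N z)" using ne by (simp add: G_def Nw norm_divide)
    also have "\<dots> \<le> (1 + norm w / \<delta>) * M2"
      using z1 ne M20 \<delta> by (intro mult_mono N z) (auto simp: divide_simps mult_ac)
    finally have "norm z * norm (G z) \<le> M2 * (1 + norm w / \<delta>)" by (simp add: mult.commute)
    moreover have "0 \<le> (norm w + \<delta>) * B" using B0 \<delta> by auto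
    ultimately show ?thesis by linarith
  qed
  have Geq: "G z = f z / (z - w) - f w * (2 * w / (z\<^sup>2 - w\<^sup>2))" if "z \<noteq> w" "z + w \<noteq> 0" for z
  proof -
    have e: "z\<^sup>2 - w\<^sup>2 = (z + w) * (z - w)" by (simp add: power2_eq_square algebra_simps)
    have "z - w \<noteq> 0" using that by simp
    then show ?thesis unfolding e using that w0 by (simp add: G_def Nw N_def diff_divide_distrib)
  qed
  note lok = ray_diff_log(2,3)[OF phi mu w]
  have rz: "of_real t * cis \<alpha> \<noteq> w \<and> of_real t * cis \<alpha> + w \<noteq> 0" if al: "\<alpha> \<in> {\<mu> - \<phi>, \<mu> + \<phi>}" for t \<alpha>
  proof -
    let ?z = "of_real t * cis \<alpha>"
    have z: "\<bar>Im ?z\<bar> = sin \<phi> * norm ?z"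
      using al cm sin_gt_zero[of \<phi>] phi by (auto simp: norm_mult abs_mult sin_diff sin_add)
    have "?z \<noteq> v" if "\<bar>Im v\<bar> < sin \<phi> * norm v" for v using z that by (metis less_irrefl)
    from this[of w] this[of "- w"] have "?z \<noteq> w" "?z \<noteq> - w" using w by simp_all
    then show ?thesis by (auto simp: add_eq_0_iff2)
  qed
  have ok2: "ray_ok (\<lambda>z. f w * (2 * w / (z\<^sup>2 - w\<^sup>2))) \<alpha>" if "\<alpha> \<in> {\<mu> - \<phi>, \<mu> + \<phi>}" for \<alpha>
    by (rule ray_ok_bounded_linear[OF bounded_linear_mult_right]) (use lok that in blast)
  have G_ok: "ray_ok G \<alpha>" if "\<alpha> \<in> {\<mu> - \<phi>, \<mu> + \<phi>}" for \<alpha>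
    using ray_ok_diff[OF _ ok2[OF that], of "\<lambda>z. f z / (z - w)"] ok that rz[OF that]
    by (subst ray_ok_cong[where G = "\<lambda>z. f z / (z - w) - f w * (2 * w / (z\<^sup>2 - w\<^sup>2))"]) (auto simp: Geq)
  have G_ray: "cx.ray G \<alpha> = cx.ray (\<lambda>z. f z / (z - w)) \<alpha> - f w * cx.ray (\<lambda>z. 2 * w / (z\<^sup>2 - w\<^sup>2)) \<alpha>"
    if al: "\<alpha> \<in> {\<mu> - \<phi>, \<mu> + \<phi>}" for \<alpha>
  proof -
    have "cx.ray G \<alpha> = cx.ray (\<lambda>z. f z / (z - w) - f w * (2 * w / (z\<^sup>2 - w\<^sup>2))) \<alpha>"
      by (rule cx.ray_cong) (use Geq rz[OF al] in auto)
    also have "\<dots> = cx.ray (\<lambda>z. f z / (z - w)) \<alpha> - cx.ray (\<lambda>z. f w * (2 * w / (z\<^sup>2 - w\<^sup>2))) \<alpha>"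
      by (rule cx.ray_diff[OF _ ok2[OF al]]) (use al ok in auto)
    also have "cx.ray (\<lambda>z. f w * (2 * w / (z\<^sup>2 - w\<^sup>2))) \<alpha> = f w * cx.ray (\<lambda>z. 2 * w / (z\<^sup>2 - w\<^sup>2)) \<alpha>"
      unfolding cx.ray_def by (subst integral_mult_right[symmetric]) (simp only: mult.left_commute)
    finally show ?thesis .
  qed
  have "cx.ray G (\<mu> - \<phi>) = cx.ray G (\<mu> + \<phi>)"
  proof (rule half_cone_rays_eq[OF phi mu a Gh[unfolded A_def]])
    fix z assume z: "\<bar>Im z\<bar> \<le> sin \<phi> * norm z" "0 < cos \<mu> * Re z"
    then have "sin \<phi> * norm z < a * norm z" using a by (intro mult_strict_right_mono) auto
    then have "z \<in> A" using z by (auto simp: A_def dcone_def)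
    then show "norm z * norm (G z) \<le> (norm w + \<delta>) * B + M2 * (1 + norm w / \<delta>)" by (rule GA)
  qed (use G_ok in auto)
  then have "cx.ray (\<lambda>z. f z / (z - w)) (\<mu> - \<phi>) - cx.ray (\<lambda>z. f z / (z - w)) (\<mu> + \<phi>)
    = f w * (cx.ray (\<lambda>z. 2 * w / (z\<^sup>2 - w\<^sup>2)) (\<mu> - \<phi>) - cx.ray (\<lambda>z. 2 * w / (z\<^sup>2 - w\<^sup>2)) (\<mu> + \<phi>))"
    using G_ray[of "\<mu> - \<phi>"] G_ray[of "\<mu> + \<phi>"] by (simp add: algebra_simps)
  also have "\<dots> = f w * (2 * of_real pi * \<i>)" by (simp only: ray_diff_log(1)[OF phi mu w])
  finally show ?thesis by (simp add: mult_ac)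
qed

section \<open>Integrals over the boundary of the double cone, and differentiation of Cauchy
  integrals\<close>

context complex_module
begin

lemma ray_scale:
  assumes "ray_ok F \<alpha>"
  shows "ray (\<lambda>z. m c (F z)) \<alpha> = m c (ray F \<alpha>)"
proof -
  have "m (cis \<alpha>) (m c (F z)) = m c (m (cis \<alpha>) (F z))" for z
    by (simp add: assoc[symmetric] mult.commute)
  then show ?thesis
    unfolding ray_def
    using integral_linear[OF ray_integrand(1)[OF assms] bounded_linear_right[of c]] by (simp add: o_def)
qed

lemma ray_ok_scale: "ray_ok F \<alpha> \<Longrightarrow> ray_ok (\<lambda>z. m c (F z)) \<alpha>"
  by (rule ray_ok_bounded_linear[OF bounded_linear_right])

text \<open>The boundary of the double sector, oriented so that the double sector lies to the left.\<close>

definition gam :: "(complex \<Rightarrow> 'b) \<Rightarrow> real \<Rightarrow> 'b" where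
  "gam F \<phi> = (ray F (- \<phi>) - ray F \<phi>) + (ray F (pi - \<phi>) - ray F (pi + \<phi>))"

definition gam_ok :: "(complex \<Rightarrow> 'b) \<Rightarrow> real \<Rightarrow> bool" where
  "gam_ok F \<phi> \<longleftrightarrow> (\<forall>\<alpha>\<in>{- \<phi>, \<phi>, pi - \<phi>, pi + \<phi>}. ray_ok F \<alpha>)"

lemma gam_add: "gam_ok F \<phi> \<Longrightarrow> gam_ok G \<phi> \<Longrightarrow> gam (\<lambda>z. F z + G z) \<phi> = gam F \<phi> + gam G \<phi>"
  by (simp add: gam_def gam_ok_def ray_add)

lemma gam_diff: "gam_ok F \<phi> \<Longrightarrow> gam_ok G \<phi> \<Longrightarrow> gam (\<lambda>z. F z - G z) \<phi> = gam F \<phi> - gam G \<phi>"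
  by (simp add: gam_def gam_ok_def ray_diff)

lemma gam_scale: "gam_ok F \<phi> \<Longrightarrow> gam (\<lambda>z. m c (F z)) \<phi> = m c (gam F \<phi>)"
  by (simp add: gam_def gam_ok_def ray_scale add_right diff_right)

lemma gam_ok_diff: "gam_ok F \<phi> \<Longrightarrow> gam_ok G \<phi> \<Longrightarrow> gam_ok (\<lambda>z. F z - G z) \<phi>"
  by (simp add: gam_ok_def ray_ok_diff)

lemma gam_ok_scale: "gam_ok F \<phi> \<Longrightarrow> gam_ok (\<lambda>z. m c (F z)) \<phi>"
  by (simp add: gam_ok_def ray_ok_scale)

text \<open>All four boundary rays lie on \<open>|Im z| = |sin \<phi>| |z|\<close>, so equality
  there suffices.\<close>

lemma gam_cong:
  assumes "\<And>z. z \<noteq> 0 \<Longrightarrow> \<bar>Im z\<bar> = \<bar>sin \<phi>\<bar> * norm z \<Longrightarrow> F z = G z"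
  shows "gam F \<phi> = gam G \<phi>"
proof -
  have "ray F \<alpha> = ray G \<alpha>" if "\<bar>sin \<alpha>\<bar> = \<bar>sin \<phi>\<bar>" for \<alpha>
    by (rule ray_cong, rule assms) (use that in \<open>auto simp: norm_mult abs_mult\<close>)
  then show ?thesis by (simp add: gam_def)
qed

lemma gam_ok_cong:
  assumes "\<And>z. z \<noteq> 0 \<Longrightarrow> \<bar>Im z\<bar> = \<bar>sin \<phi>\<bar> * norm z \<Longrightarrow> F z = G z"
  shows "gam_ok F \<phi> = gam_ok G \<phi>"
proof -
  have "ray_ok F \<alpha> = ray_ok G \<alpha>" if "\<bar>sin \<alpha>\<bar> = \<bar>sin \<phi>\<bar>" for \<alpha>
    by (rule ray_ok_cong, rule assms) (use that in \<open>auto simp: norm_mult abs_mult\<close>)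
  then show ?thesis by (simp add: gam_ok_def)
qed

lemma kernel_ok:
  assumes F: "ray_ok F \<alpha>" and k: "\<And>t. 0 < t \<Longrightarrow> norm (k (of_real t * cis \<alpha>)) \<le> B"
    and kc: "continuous_on {0<..} (\<lambda>t. k (of_real t * cis \<alpha>))"
  shows "ray_ok (\<lambda>s. m (k s) (F s)) \<alpha>"
    and "\<And>K. (\<And>a b. norm (m a b) \<le> norm a * norm b * K) \<Longrightarrow> 0 \<le> K \<Longrightarrow>
      norm (ray (\<lambda>s. m (k s) (F s)) \<alpha>) \<le> K * K * B * integral {0<..} (\<lambda>t. norm (F (of_real t * cis \<alpha>)))"
proof -
  have ok: "ray_ok (\<lambda>s. m (k s) (F s)) \<alpha> \<and>
      norm (ray (\<lambda>s. m (k s) (F s)) \<alpha>) \<le> K * K * B * integral {0<..} (\<lambda>t. norm (F (of_real t * cis \<alpha>)))"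
    if K: "\<And>a b. norm (m a b) \<le> norm a * norm b * K" "0 \<le> K" for K
  proof -
    let ?z = "\<lambda>t. complex_of_real t * cis \<alpha>"
    have le: "norm (m (k (?z t)) (F (?z t))) \<le> (K * B) * norm (F (?z t))" if "0 < t" for t
    proof -
      have "norm (m (k (?z t)) (F (?z t))) \<le> norm (k (?z t)) * norm (F (?z t)) * K" by (rule K)
      also have "\<dots> \<le> B * norm (F (?z t)) * K" using k[OF that] K by (intro mult_right_mono) auto
      finally show ?thesis by (simp add: mult_ac)
    qed
    have ok: "ray_ok (\<lambda>s. m (k s) (F s)) \<alpha>"
      by (rule ray_ok_bounded_by[OF F _ le], rule continuous_on) (use kc F in \<open>auto simp: ray_ok_def\<close>)
    have "norm (ray (\<lambda>s. m (k s) (F s)) \<alpha>) \<le> K * integral {0<..} (\<lambda>t. norm (m (k (?z t)) (F (?z t))))"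
      by (rule norm_ray_le[OF K(1) ok])
    also have "\<dots> \<le> K * integral {0<..} (\<lambda>t. (K * B) * norm (F (?z t)))"
      using ok F le K(2) by (intro mult_left_mono integral_le integrable_on_mult_right) (auto simp: ray_ok_def)
    finally show ?thesis using ok by (simp add: mult_ac)
  qed
  obtain K where "0 \<le> K" "\<And>a b. norm (m a b) \<le> norm a * norm b * K" using nonneg_bounded by blast
  then show "ray_ok (\<lambda>s. m (k s) (F s)) \<alpha>" using ok by blast
  show "norm (ray (\<lambda>s. m (k s) (F s)) \<alpha>) \<le> K * K * B * integral {0<..} (\<lambda>t. norm (F (of_real t * cis \<alpha>)))"
    if "\<And>a b. norm (m a b) \<le> norm a * norm b * K" "0 \<le> K" for K
    using ok that by blast
qed

text \<open>Differentiation under the integral by explicit remainders: with \<open>a = z - s\<close>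
  and \<open>b = z0 - s\<close>, the error of the linear approximation of \<open>1 / a\<close> is
  \<open>(a - b)\<^sup>2 / (a b\<^sup>2)\<close>. The distance \<open>2 * d\<close> from
  \<open>z0\<close> to the ray leaves distance \<open>d\<close> for all \<open>z\<close> closer than
  \<open>d\<close> to \<open>z0\<close>, so the remainders are bounded by powers of
  \<open>1 / d\<close> uniformly in \<open>s\<close>.\<close>

lemma kernel_mderiv:
  assumes F: "ray_ok F \<alpha>" and d: "0 < d" "\<And>t. 0 < t \<Longrightarrow> 2 * d \<le> norm (z0 - of_real t * cis \<alpha>)"
  shows "mderiv (\<lambda>z. ray (\<lambda>s. m (1 / (z - s)) (F s)) \<alpha>) (ray (\<lambda>s. m (- 1 / (z0 - s)\<^sup>2) (F s)) \<alpha>) z0"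
    and "isCont (\<lambda>z. ray (\<lambda>s. m (- 1 / (z - s)\<^sup>2) (F s)) \<alpha>) z0"
proof -
  obtain K where K: "0 \<le> K" "\<And>a b. norm (m a b) \<le> norm a * norm b * K" using nonneg_bounded by blast
  define C where "C = K * K * integral {0<..} (\<lambda>t. norm (F (of_real t * cis \<alpha>)))"
  have C: "0 \<le> C" unfolding C_def using K F by (intro mult_nonneg_nonneg integral_nonneg) (auto simp: ray_ok_def)
  let ?s = "\<lambda>t. complex_of_real t * cis \<alpha>"
  have far: "d \<le> norm (z - ?s t)" if "norm (z - z0) < d" "0 < t" for z t
    using d(2)[OF that(2)] that(1) norm_triangle_ineq2[of "z0 - ?s t" "z0 - z"] by (simp add: norm_minus_commute)
  have nz: "z - ?s t \<noteq> 0" if "norm (z - z0) < d" "0 < t" for z t using far[OF that] d by auto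
  have kc: "continuous_on {0<..} (\<lambda>t. 1 / (z - ?s t))" "continuous_on {0<..} (\<lambda>t. - 1 / (z - ?s t)\<^sup>2)"
    if "norm (z - z0) < d" for z
    using nz[OF that] by (auto intro!: continuous_intros)
  have kb: "norm (1 / (z - ?s t)) \<le> 1 / d" "norm (- 1 / (z - ?s t)\<^sup>2) \<le> 1 / d\<^sup>2" if "norm (z - z0) < d" "0 < t" for z t
    using far[OF that] nz[OF that] d(1) by (auto simp: norm_divide norm_power intro!: divide_left_mono power_mono mult_pos_pos)
  have ok: "ray_ok (\<lambda>s. m (1 / (z - s)) (F s)) \<alpha>" "ray_ok (\<lambda>s. m (- 1 / (z - s)\<^sup>2) (F s)) \<alpha>" if "norm (z - z0) < d" for z
    by (rule kernel_ok(1)[OF F], erule kb[OF that], rule kc[OF that])+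
  have z00: "norm (z0 - z0) < d" using d by simp
  let ?K1 = "\<lambda>z. ray (\<lambda>s. m (1 / (z - s)) (F s)) \<alpha>"
  let ?K2 = "\<lambda>z. ray (\<lambda>s. m (- 1 / (z - s)\<^sup>2) (F s)) \<alpha>"
  have est1: "norm (?K1 z - ?K1 z0 - m (z - z0) (?K2 z0)) \<le> (norm (z - z0))\<^sup>2 / d ^ 3 * C" if z: "norm (z - z0) < d" for z
  proof -
    define k where "k s = 1 / (z - s) - 1 / (z0 - s) - (z - z0) * (- 1 / (z0 - s)\<^sup>2)" for s
    have keq: "k (?s t) = (z - z0)\<^sup>2 / ((z - ?s t) * (z0 - ?s t)\<^sup>2)" if "0 < t" for t
    proof -
      define a b where "a = z - ?s t" and "b = z0 - ?s t"
      have ab: "a \<noteq> 0" "b \<noteq> 0" using nz[OF z that] nz[OF z00 that] by (auto simp: a_def b_def)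
      have "z - z0 = a - b" by (simp add: a_def b_def)
      moreover have "1 / a - 1 / b - (a - b) * (- 1 / b\<^sup>2) = (a - b)\<^sup>2 / (a * b\<^sup>2)"
        using ab by (simp add: field_simps power2_eq_square)
      ultimately show ?thesis by (simp add: k_def a_def[symmetric] b_def[symmetric])
    qed
    have "norm (ray (\<lambda>s. m (k s) (F s)) \<alpha>) \<le> K * K * ((norm (z - z0))\<^sup>2 / d ^ 3) * integral {0<..} (\<lambda>t. norm (F (?s t)))"
    proof (rule kernel_ok(2)[OF F _ _ K(2,1)])
      show "continuous_on {0<..} (\<lambda>t. k (?s t))"
        unfolding k_def by (intro continuous_intros) (use nz[OF z] nz[OF z00] in auto)
      fix t :: real assume t: "0 < t"
      have "d * d\<^sup>2 \<le> norm (z - ?s t) * (norm (z0 - ?s t))\<^sup>2"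
        using far[OF z t] far[OF z00 t] d by (intro mult_mono power_mono) auto
      then have "(norm (z - z0))\<^sup>2 / (norm (z - ?s t) * (norm (z0 - ?s t))\<^sup>2) \<le> (norm (z - z0))\<^sup>2 / (d * d\<^sup>2)"
        using d nz[OF z t] nz[OF z00 t] by (intro divide_left_mono mult_pos_pos) auto
      then show "norm (k (?s t)) \<le> (norm (z - z0))\<^sup>2 / d ^ 3"
        unfolding keq[OF t] by (simp add: norm_divide norm_mult norm_power power3_eq_cube power2_eq_square)
    qed
    moreover have "ray (\<lambda>s. m (k s) (F s)) \<alpha> = ?K1 z - ?K1 z0 - m (z - z0) (?K2 z0)"
    proof -
      have "ray (\<lambda>s. m (k s) (F s)) \<alpha> = ray (\<lambda>s. m (1 / (z - s)) (F s) - m (1 / (z0 - s)) (F s) - m (z - z0) (m (- 1 / (z0 - s)\<^sup>2) (F s))) \<alpha>"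
        by (simp only: k_def diff_left assoc[symmetric])
      also have "\<dots> = ray (\<lambda>s. m (1 / (z - s)) (F s) - m (1 / (z0 - s)) (F s)) \<alpha> - ray (\<lambda>s. m (z - z0) (m (- 1 / (z0 - s)\<^sup>2) (F s))) \<alpha>"
        by (rule ray_diff[OF ray_ok_diff[OF ok(1)[OF z] ok(1)[OF z00]] ray_ok_scale[OF ok(2)[OF z00]]])
      also have "ray (\<lambda>s. m (1 / (z - s)) (F s) - m (1 / (z0 - s)) (F s)) \<alpha> = ?K1 z - ?K1 z0"
        by (rule ray_diff[OF ok(1)[OF z] ok(1)[OF z00]])
      also have "ray (\<lambda>s. m (z - z0) (m (- 1 / (z0 - s)\<^sup>2) (F s))) \<alpha> = m (z - z0) (?K2 z0)"
        by (rule ray_scale[OF ok(2)[OF z00]])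
      finally show ?thesis .
    qed
    ultimately show ?thesis by (simp add: C_def mult_ac)
  qed
  show "mderiv ?K1 (?K2 z0) z0"
    unfolding has_derivative_at_alt
  proof (intro conjI bounded_linear_left allI impI)
    fix e :: real assume e: "0 < e"
    define r where "r = min d (e * d ^ 3 / (C + 1))"
    have r: "0 < r" using d e C by (auto simp: r_def)
    have "norm (?K1 z - ?K1 z0 - m (z - z0) (?K2 z0)) \<le> e * norm (z - z0)" if z: "norm (z - z0) < r" for z
    proof -
      have "norm (z - z0) * (C + 1) \<le> e * d ^ 3" using z C by (simp add: r_def pos_less_divide_eq)
      moreover have "norm (z - z0) * C \<le> norm (z - z0) * (C + 1)" by (intro mult_left_mono) auto
      ultimately have "norm (z - z0) * C \<le> e * d ^ 3" by linarith
      then have "norm (z - z0) * (norm (z - z0) * C) \<le> norm (z - z0) * (e * d ^ 3)" by (intro mult_left_mono) auto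
      then have "(norm (z - z0))\<^sup>2 / d ^ 3 * C \<le> e * norm (z - z0)"
        using d by (simp add: pos_divide_le_eq power2_eq_square mult_ac)
      then show ?thesis using est1[of z] z by (auto simp: r_def)
    qed
    then show "\<exists>r>0. \<forall>z. norm (z - z0) < r \<longrightarrow> norm (?K1 z - ?K1 z0 - m (z - z0) (?K2 z0)) \<le> e * norm (z - z0)"
      using r by blast
  qed
  have est2: "norm (?K2 z - ?K2 z0) \<le> 2 * norm (z - z0) / d ^ 3 * C" if z: "norm (z - z0) < d" for z
  proof -
    define k where "k s = - 1 / (z - s)\<^sup>2 - (- 1 / (z0 - s)\<^sup>2)" for s
    have keq: "k (?s t) = (z - z0) * (1 / ((z - ?s t)\<^sup>2 * (z0 - ?s t)) + 1 / ((z - ?s t) * (z0 - ?s t)\<^sup>2))" if "0 < t" for t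
    proof -
      define a b where "a = z - ?s t" and "b = z0 - ?s t"
      have ab: "a \<noteq> 0" "b \<noteq> 0" using nz[OF z that] nz[OF z00 that] by (auto simp: a_def b_def)
      have "z - z0 = a - b" by (simp add: a_def b_def)
      moreover have "- 1 / a\<^sup>2 - (- 1 / b\<^sup>2) = (a - b) * (1 / (a\<^sup>2 * b) + 1 / (a * b\<^sup>2))"
        using ab by (simp add: field_simps power2_eq_square)
      ultimately show ?thesis by (simp add: k_def a_def[symmetric] b_def[symmetric])
    qed
    have "norm (ray (\<lambda>s. m (k s) (F s)) \<alpha>) \<le> K * K * (2 * norm (z - z0) / d ^ 3) * integral {0<..} (\<lambda>t. norm (F (?s t)))"
    proof (rule kernel_ok(2)[OF F _ _ K(2,1)])
      show "continuous_on {0<..} (\<lambda>t. k (?s t))"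
        unfolding k_def by (intro continuous_intros) (use nz[OF z] nz[OF z00] in auto)
      fix t :: real assume t: "0 < t"
      have "d * d\<^sup>2 \<le> norm (z - ?s t) * (norm (z0 - ?s t))\<^sup>2" "d\<^sup>2 * d \<le> (norm (z - ?s t))\<^sup>2 * norm (z0 - ?s t)"
        using far[OF z t] far[OF z00 t] d by (intro mult_mono power_mono; auto)+
      then have "norm (1 / ((z - ?s t)\<^sup>2 * (z0 - ?s t))) \<le> 1 / d ^ 3" "norm (1 / ((z - ?s t) * (z0 - ?s t)\<^sup>2)) \<le> 1 / d ^ 3"
        using d nz[OF z t] nz[OF z00 t]
        by (auto simp: norm_divide norm_mult norm_power power3_eq_cube power2_eq_square intro!: divide_left_mono mult_pos_pos)
      then have "norm (1 / ((z - ?s t)\<^sup>2 * (z0 - ?s t)) + 1 / ((z - ?s t) * (z0 - ?s t)\<^sup>2)) \<le> 2 / d ^ 3"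
        using norm_triangle_le[of "1 / ((z - ?s t)\<^sup>2 * (z0 - ?s t))" "1 / ((z - ?s t) * (z0 - ?s t)\<^sup>2)" "2 / d ^ 3"] by simp
      then have "norm (z - z0) * norm (1 / ((z - ?s t)\<^sup>2 * (z0 - ?s t)) + 1 / ((z - ?s t) * (z0 - ?s t)\<^sup>2)) \<le> norm (z - z0) * (2 / d ^ 3)"
        by (intro mult_left_mono) auto
      then show "norm (k (?s t)) \<le> 2 * norm (z - z0) / d ^ 3"
        unfolding keq[OF t] by (simp add: norm_mult mult_ac)
    qed
    moreover have "ray (\<lambda>s. m (k s) (F s)) \<alpha> = ?K2 z - ?K2 z0"
      unfolding k_def diff_left by (rule ray_diff[OF ok(2)[OF z] ok(2)[OF z00]])
    ultimately show ?thesis by (simp add: C_def mult_ac)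
  qed
  have "((\<lambda>z. ?K2 z - ?K2 z0) \<longlongrightarrow> 0) (at z0)"
  proof (rule Lim_null_comparison)
    show "\<forall>\<^sub>F z in at z0. norm (?K2 z - ?K2 z0) \<le> 2 * norm (z - z0) / d ^ 3 * C"
      unfolding eventually_at using d est2 by (intro exI[of _ d]) (auto simp: dist_norm)
    have "((\<lambda>z. 2 * norm (z - z0) / d ^ 3 * C) \<longlongrightarrow> 2 * norm (z0 - z0) / d ^ 3 * C) (at z0)"
      by (intro tendsto_intros) (use d in auto)
    then show "((\<lambda>z. 2 * norm (z - z0) / d ^ 3 * C) \<longlongrightarrow> 0) (at z0)" by simp
  qed
  then show "isCont ?K2 z0" unfolding isCont_def by (rule LIM_zero_cancel)
qed

end


text \<open>The planar counterpart of \<open>SHL0\<close>: \<open>ray_ok\<close> for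
  \<open>f z / z\<close> is integrability of \<open>f\<close> against \<open>dt / t\<close>.
  Symmetry under conjugation is kept apart because quotients such as \<open>f z / (z - \<i>)\<close>
  lack it.\<close>

definition H0 :: "real \<Rightarrow> (complex \<Rightarrow> complex) set" where
  "H0 \<theta> = {f. f holomorphic_on dcone (sin \<theta>) \<and> bounded (f ` dcone (sin \<theta>)) \<and>
     (\<forall>\<alpha>. \<bar>sin \<alpha>\<bar> < sin \<theta> \<longrightarrow> ray_ok (\<lambda>z. f z / z) \<alpha>)}"

lemma H0_holomorphic: "f \<in> H0 \<theta> \<Longrightarrow> f holomorphic_on dcone (sin \<theta>)"
  by (simp add: H0_def)

lemma H0_bound:
  assumes "f \<in> H0 \<theta>"
  shows "\<exists>M\<ge>0. \<forall>z\<in>dcone (sin \<theta>). norm (f z) \<le> M"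
proof -
  obtain M where M: "\<And>z. z \<in> dcone (sin \<theta>) \<Longrightarrow> norm (f z) \<le> M"
    using assms by (auto simp: H0_def bounded_iff)
  then show ?thesis by (intro exI[of _ "max 0 M"]) (auto intro: max.coboundedI2)
qed

lemma H0_ray_continuous:
  assumes "f \<in> H0 \<theta>" "\<bar>sin \<alpha>\<bar> < sin \<theta>"
  shows "continuous_on {0<..} (\<lambda>t. f (of_real t * cis \<alpha>))"
  by (rule continuous_on_compose2[OF holomorphic_on_imp_continuous_on[OF H0_holomorphic[OF assms(1)]]])
    (use assms(2) ray_in_dcone in \<open>auto intro!: continuous_intros\<close>)

text \<open>\<open>C\<close> bounds \<open>|z| / |z - w|\<close> along the ray, so the quotient is
  dominated by \<open>f z / z\<close>.\<close>

lemma H0_ray_ok_quotient: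
  assumes f: "f \<in> H0 \<theta>" and al: "\<bar>sin \<alpha>\<bar> < sin \<theta>"
    and C: "\<And>t. 0 < t \<Longrightarrow> t \<le> C * norm (of_real t * cis \<alpha> - w)"
  shows "ray_ok (\<lambda>z. f z / (z - w)) \<alpha>"
proof (rule ray_ok_bounded_by)
  show "ray_ok (\<lambda>z. f z / z) \<alpha>" using f al by (simp add: H0_def)
  have nz: "of_real t * cis \<alpha> - w \<noteq> 0" if "0 < t" for t
    using C[OF that] that by (metis leD mult_zero_right norm_zero)
  show "continuous_on {0<..} (\<lambda>t. f (of_real t * cis \<alpha>) / (of_real t * cis \<alpha> - w))"
    by (intro continuous_on_divide H0_ray_continuous[OF f al] continuous_intros) (use nz in auto)
  fix t :: real assume t: "0 < t"
  have "norm (f (of_real t * cis \<alpha>)) * t \<le> norm (f (of_real t * cis \<alpha>)) * (C * norm (of_real t * cis \<alpha> - w))"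
    using C[OF t] by (intro mult_left_mono) auto
  then show "norm (f (of_real t * cis \<alpha>) / (of_real t * cis \<alpha> - w)) \<le> C * norm (f (of_real t * cis \<alpha>) / (of_real t * cis \<alpha>))"
    using t nz[OF t] by (simp add: norm_divide norm_mult divide_simps mult_ac)
qed

lemma sin_mono_quarter: "0 < \<phi> \<Longrightarrow> \<phi> < \<theta> \<Longrightarrow> \<theta> < pi / 2 \<Longrightarrow> sin \<phi> < sin \<theta> \<and> 0 < sin \<phi> \<and> sin \<theta> < 1 \<and> 0 < cos \<phi>"
  using sin_monotone_2pi[of \<phi> \<theta>] sin_gt_zero[of \<phi>] sin_monotone_2pi[of \<theta> "pi/2"] cos_gt_zero[of \<phi>] by auto

text \<open>The half of the cone that contains \<open>w\<close> contributes the Cauchy value. In the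
  other half the quotient has no pole, and its two boundary rays cancel.\<close>

lemma gam_Cauchy_inside:
  assumes f: "f \<in> H0 \<theta>" and phi: "0 < \<phi>" "\<phi> < \<theta>" "\<theta> < pi / 2"
    and w: "\<bar>Im w\<bar> < sin \<phi> * norm w"
  shows "cx.gam (\<lambda>z. f z / (z - w)) \<phi> = 2 * of_real pi * \<i> * f w" and "cx.gam_ok (\<lambda>z. f z / (z - w)) \<phi>"
proof -
  note sn = sin_mono_quarter[OF phi]
  have w0: "w \<noteq> 0" using w by auto
  obtain M where M: "0 \<le> M" "\<And>z. z \<in> dcone (sin \<theta>) \<Longrightarrow> norm (f z) \<le> M" using H0_bound[OF f] by blast
  define a where "a = \<bar>Im w\<bar> / norm w"
  have a: "0 \<le> a" "a < sin \<phi>" "\<bar>Im w\<bar> \<le> a * norm w" using w w0 by (auto simp: a_def divide_simps)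
  have ok: "ray_ok (\<lambda>z. f z / (z - w)) \<alpha>" if "\<bar>sin \<alpha>\<bar> = sin \<phi>" for \<alpha>
  proof (rule H0_ray_ok_quotient[OF f])
    fix t :: real assume "0 < t"
    then have z: "sin \<phi> * norm (of_real t * cis \<alpha>) \<le> \<bar>Im (of_real t * cis \<alpha>)\<bar>" "norm (of_real t * cis \<alpha>) = t"
      using that by (simp_all add: norm_mult abs_mult)
    show "t \<le> (1 + a) / (sin \<phi> - a) * norm (of_real t * cis \<alpha> - w)"
      using cone_separation(1)[OF a(3) z(1) a(1)] a(2) z(2) by (simp add: pos_le_divide_eq norm_minus_commute mult.commute)
  qed (use that sn in auto)
  have sins: "\<bar>sin (\<mu> - \<phi>)\<bar> = sin \<phi>" "\<bar>sin (\<mu> + \<phi>)\<bar> = sin \<phi>" if "\<mu> \<in> {0, pi}" for \<mu>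
    using that sn by auto
  show "cx.gam_ok (\<lambda>z. f z / (z - w)) \<phi>" unfolding cx.gam_ok_def using ok sn by auto
  have Rew: "Re w \<noteq> 0"
  proof
    assume "Re w = 0"
    then have "norm w = \<bar>Im w\<bar>" by (simp add: cmod_def)
    moreover have "sin \<phi> * norm w \<le> 1 * norm w" using sn by (intro mult_right_mono) auto
    ultimately show False using w by linarith
  qed
  have hol: "f holomorphic_on dcone (sin \<theta>) \<inter> {z. 0 < cos \<mu> * Re z}" for \<mu>
    using H0_holomorphic[OF f] by (rule holomorphic_on_subset) auto
  have same: "cx.ray (\<lambda>z. f z / (z - w)) (\<mu> - \<phi>) - cx.ray (\<lambda>z. f z / (z - w)) (\<mu> + \<phi>) = 2 * of_real pi * \<i> * f w"
    if "\<mu> \<in> {0, pi}" "0 < cos \<mu> * Re w" for \<mu>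
    by (rule half_cone_Cauchy[OF _ _ that(1) _ hol M(2) w that(2)]) (use phi sn ok sins[OF that(1)] in auto)
  have other: "cx.ray (\<lambda>z. f z / (z - w)) (\<mu> - \<phi>) = cx.ray (\<lambda>z. f z / (z - w)) (\<mu> + \<phi>)"
    if mu: "\<mu> \<in> {0, pi}" "cos \<mu> * Re w < 0" for \<mu>
  proof (rule half_cone_rays_eq[OF _ _ mu(1)])
    have "z \<noteq> w" if "0 < cos \<mu> * Re z" for z using that mu(2) by auto
    then show "(\<lambda>z. f z / (z - w)) holomorphic_on dcone (sin \<theta>) \<inter> {z. 0 < cos \<mu> * Re z}"
      by (intro holomorphic_intros hol) auto
    fix z assume z: "\<bar>Im z\<bar> \<le> sin \<phi> * norm z" "0 < cos \<mu> * Re z"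
    have "norm z > 0" using z(2) by auto
    then have zc: "z \<in> dcone (sin \<theta>)" using z(1) sn by (auto simp: dcone_def intro: le_less_trans)
    \<comment> \<open>In the half without \<open>w\<close> the real parts of \<open>z\<close> and
      \<open>w\<close> have opposite signs, so \<open>|z - w|\<close> is at least
      \<open>|Re z|\<close> and hence at least \<open>cos \<phi> |z|\<close>.\<close>
    have "(Im z)\<^sup>2 \<le> (sin \<phi> * norm z)\<^sup>2" using z(1) by (metis abs_ge_zero power2_abs power_mono)
    then have "(cos \<phi> * norm z)\<^sup>2 \<le> (Re z)\<^sup>2"
      using cmod_power2[of z] by (simp add: power_mult_distrib cos_squared_eq algebra_simps)
    then have "cos \<phi> * norm z \<le> \<bar>Re z\<bar>" by (metis abs_ge_zero power2_abs power2_le_imp_le)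
    also have "\<bar>Re z\<bar> \<le> \<bar>Re (z - w)\<bar>" using z(2) mu by auto
    also have "\<dots> \<le> norm (z - w)" by (rule abs_Re_le_cmod)
    finally have d: "cos \<phi> * norm z \<le> norm (z - w)" .
    have d0: "0 < norm (z - w)" using d \<open>norm z > 0\<close> sn by (meson less_le_trans mult_pos_pos)
    have "norm z * norm (f z / (z - w)) = norm z / norm (z - w) * norm (f z)" by (simp add: norm_divide)
    also have "\<dots> \<le> (1 / cos \<phi>) * M"
      using d d0 sn M(1) by (intro mult_mono M(2) zc) (auto simp: divide_simps mult.commute)
    finally show "norm z * norm (f z / (z - w)) \<le> (1 / cos \<phi>) * M" .
  qed (use phi sn ok sins[OF mu(1)] in auto)
  show "cx.gam (\<lambda>z. f z / (z - w)) \<phi> = 2 * of_real pi * \<i> * f w"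
  proof (cases "0 < Re w")
    case True
    then show ?thesis using same[of 0] other[of pi] by (simp add: cx.gam_def)
  next
    case False
    then show ?thesis using same[of pi] other[of 0] Rew by (simp add: cx.gam_def)
  qed
qed

lemma gam_Cauchy_outside:
  assumes f: "f \<in> H0 \<theta>" and phi: "0 < \<phi>" "\<phi> < \<theta>" "\<theta> < pi / 2"
    and w: "sin \<phi> * norm w < \<bar>Im w\<bar>"
  shows "cx.gam (\<lambda>z. f z / (z - w)) \<phi> = 0" and "cx.gam_ok (\<lambda>z. f z / (z - w)) \<phi>"
proof -
  note sn = sin_mono_quarter[OF phi]
  have w0: "w \<noteq> 0" using w by auto
  obtain M where M: "0 \<le> M" "\<And>z. z \<in> dcone (sin \<theta>) \<Longrightarrow> norm (f z) \<le> M" using H0_bound[OF f] by blast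
  define b where "b = \<bar>Im w\<bar> / norm w"
  have b: "sin \<phi> < b" "b * norm w \<le> \<bar>Im w\<bar>" using w w0 by (auto simp: b_def divide_simps)
  \<comment> \<open>The cone is shrunk until \<open>w\<close> lies outside it, while it still has
    slope above \<open>sin \<phi>\<close>; there the quotient is holomorphic.\<close>
  define a where "a = min (sin \<theta>) b"
  have a: "sin \<phi> < a" "a \<le> sin \<theta>" "a \<le> b" using sn b by (auto simp: a_def)
  have wa: "w \<notin> dcone a" using w0 mult_right_mono[OF a(3), of "norm w"] b(2) by (auto simp: dcone_def b_def)
  have sub: "dcone a \<subseteq> dcone (sin \<theta>)"
  proof
    fix z assume "z \<in> dcone a"
    then show "z \<in> dcone (sin \<theta>)" using mult_right_mono[OF a(2), of "norm z"] by (auto simp: dcone_def)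
  qed
  have sep: "norm z \<le> (1 + b) / (b - sin \<phi>) * norm (z - w)" if "\<bar>Im z\<bar> \<le> sin \<phi> * norm z" for z
    using cone_separation(2)[OF that b(2)] sn b(1) by (simp add: pos_le_divide_eq mult.commute)
  have ok: "ray_ok (\<lambda>z. f z / (z - w)) \<alpha>" if "\<bar>sin \<alpha>\<bar> = sin \<phi>" for \<alpha>
  proof (rule H0_ray_ok_quotient[OF f])
    fix t :: real assume "0 < t"
    then show "t \<le> (1 + b) / (b - sin \<phi>) * norm (of_real t * cis \<alpha> - w)"
      using sep[of "of_real t * cis \<alpha>"] that by (simp add: norm_mult abs_mult)
  qed (use that sn in auto)
  have sins: "\<bar>sin (\<mu> - \<phi>)\<bar> = sin \<phi>" "\<bar>sin (\<mu> + \<phi>)\<bar> = sin \<phi>" if "\<mu> \<in> {0, pi}" for \<mu>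
    using that sn by auto
  show "cx.gam_ok (\<lambda>z. f z / (z - w)) \<phi>" unfolding cx.gam_ok_def using ok sn by auto
  have "cx.ray (\<lambda>z. f z / (z - w)) (\<mu> - \<phi>) = cx.ray (\<lambda>z. f z / (z - w)) (\<mu> + \<phi>)"
    if mu: "\<mu> \<in> {0, pi}" for \<mu>
  proof (rule half_cone_rays_eq[OF _ _ mu a(1)])
    show "(\<lambda>z. f z / (z - w)) holomorphic_on dcone a \<inter> {z. 0 < cos \<mu> * Re z}"
      by (intro holomorphic_intros holomorphic_on_subset[OF H0_holomorphic[OF f]]) (use wa sub in auto)
    fix z assume z: "\<bar>Im z\<bar> \<le> sin \<phi> * norm z" "0 < cos \<mu> * Re z"
    have z0: "norm z > 0" using z(2) by auto
    then have zc: "z \<in> dcone (sin \<theta>)" using z(1) sn by (auto simp: dcone_def intro: le_less_trans)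
    have zw: "z \<noteq> w" using z w by auto
    have "norm z * norm (f z / (z - w)) = norm z / norm (z - w) * norm (f z)" by (simp add: norm_divide)
    also have "\<dots> \<le> ((1 + b) / (b - sin \<phi>)) * M"
      using sep[OF z(1)] zw sn M(1) b(1) by (intro mult_mono M(2) zc) (auto simp: pos_divide_le_eq)
    finally show "norm z * norm (f z / (z - w)) \<le> ((1 + b) / (b - sin \<phi>)) * M" .
  qed (use phi sn ok sins[OF mu(1)] in auto)
  from this[of 0] this[of pi] show "cx.gam (\<lambda>z. f z / (z - w)) \<phi> = 0" by (simp add: cx.gam_def)
qed


lemma H0_mult_bounded:
  assumes f: "f \<in> H0 \<theta>" and k: "k holomorphic_on dcone (sin \<theta>)" "\<And>z. z \<in> dcone (sin \<theta>) \<Longrightarrow> norm (k z) \<le> B"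
  shows "(\<lambda>z. k z * f z) \<in> H0 \<theta>"
  unfolding H0_def
proof (intro CollectI conjI allI impI)
  show "(\<lambda>z. k z * f z) holomorphic_on dcone (sin \<theta>)"
    by (intro holomorphic_intros k H0_holomorphic f)
  obtain M where M: "0 \<le> M" "\<And>z. z \<in> dcone (sin \<theta>) \<Longrightarrow> norm (f z) \<le> M" using H0_bound[OF f] by blast
  have "norm (k z * f z) \<le> max B 0 * M" if "z \<in> dcone (sin \<theta>)" for z
    unfolding norm_mult using k(2)[OF that] M that by (intro mult_mono) auto
  then show "bounded ((\<lambda>z. k z * f z) ` dcone (sin \<theta>))" unfolding bounded_iff by blast
  fix \<alpha> assume al: "\<bar>sin \<alpha>\<bar> < sin \<theta>"
  have z: "0 < t \<Longrightarrow> of_real t * cis \<alpha> \<in> dcone (sin \<theta>)" for t by (rule ray_in_dcone[OF _ al])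
  show "ray_ok (\<lambda>z. k z * f z / z) \<alpha>"
  proof (rule ray_ok_bounded_by)
    show "ray_ok (\<lambda>z. f z / z) \<alpha>" using f al by (simp add: H0_def)
    have "continuous_on {0<..} (\<lambda>t. k (of_real t * cis \<alpha>))"
      by (rule continuous_on_compose2[OF holomorphic_on_imp_continuous_on[OF k(1)]])
        (use z in \<open>auto intro!: continuous_intros\<close>)
    then show "continuous_on {0<..} (\<lambda>t. k (of_real t * cis \<alpha>) * f (of_real t * cis \<alpha>) / (of_real t * cis \<alpha>))"
      by (intro continuous_intros H0_ray_continuous[OF f al]) auto
    fix t :: real assume "0 < t"
    then have "norm (k (of_real t * cis \<alpha>)) \<le> B" by (intro k z)
    then show "norm (k (of_real t * cis \<alpha>) * f (of_real t * cis \<alpha>) / (of_real t * cis \<alpha>)) \<le> B * norm (f (of_real t * cis \<alpha>) / (of_real t * cis \<alpha>))"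
      unfolding norm_mult times_divide_eq_right[symmetric] by (rule mult_right_mono) simp
  qed
qed

lemma H0_mult: "f \<in> H0 \<theta> \<Longrightarrow> g \<in> H0 \<theta> \<Longrightarrow> (\<lambda>z. f z * g z) \<in> H0 \<theta>"
  using H0_bound[of f \<theta>] H0_mult_bounded[of g \<theta> f] H0_holomorphic[of f \<theta>] by blast

lemma H0_scale: "f \<in> H0 \<theta> \<Longrightarrow> (\<lambda>z. c * f z) \<in> H0 \<theta>"
  by (rule H0_mult_bounded[where B = "norm c"]) auto

lemma H0_add:
  assumes "f \<in> H0 \<theta>" "g \<in> H0 \<theta>"
  shows "(\<lambda>z. f z + g z) \<in> H0 \<theta>"
  using assms bounded_plus_comp[of f "dcone (sin \<theta>)" g] ray_ok_add[of "\<lambda>z. f z / z" _ "\<lambda>z. g z / z"]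
  by (auto simp: H0_def add_divide_distrib intro!: holomorphic_intros)

text \<open>\<open>1 + z\<^sup>2\<close> factors into \<open>z - \<i>\<close> and
  \<open>z + \<i>\<close>. Both points have slope 1, so \<open>cone_separation_sum\<close> with
  \<open>b = 1\<close> bounds each factor below by \<open>(1 - sin \<theta>) / 4\<close> times
  \<open>|z| + 1\<close>.\<close>

lemma one_plus_square_bound:
  assumes th: "0 < \<theta>" "\<theta> < pi / 2" and z: "\<bar>Im z\<bar> \<le> sin \<theta> * norm z"
  shows "((1 - sin \<theta>) / 4)\<^sup>2 * (1 + (norm z)\<^sup>2) \<le> norm (1 + z\<^sup>2)"
proof -
  have s: "0 \<le> sin \<theta>" "sin \<theta> < 1" using sin_mono_quarter[of "\<theta>/2" \<theta>] th by auto
  define d where "d = (1 - sin \<theta>) / 4"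
  have d: "0 < d" using s by (simp add: d_def)
  have i: "1 * norm \<i> \<le> \<bar>Im \<i>\<bar>" "1 * norm (- \<i>) \<le> \<bar>Im (- \<i>)\<bar>" by auto
  have sep: "d * (norm z + 1) \<le> norm (z - \<i>)" "d * (norm z + 1) \<le> norm (z - (- \<i>))"
    using cone_separation_sum[OF z i(1) s(1)] cone_separation_sum[OF z i(2) s(1)] s by (auto simp: d_def)
  have "1 + (norm z)\<^sup>2 \<le> (norm z + 1) * (norm z + 1)" by (simp add: power2_eq_square algebra_simps)
  then have "d\<^sup>2 * (1 + (norm z)\<^sup>2) \<le> d\<^sup>2 * ((norm z + 1) * (norm z + 1))" by (intro mult_left_mono) auto
  also have "\<dots> = (d * (norm z + 1)) * (d * (norm z + 1))" by (simp add: power2_eq_square mult_ac)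
  also have "\<dots> \<le> norm (z - \<i>) * norm (z - (- \<i>))" using d by (intro mult_mono sep) auto
  also have "\<dots> = norm (1 + z\<^sup>2)" by (simp add: norm_mult[symmetric] power2_eq_square algebra_simps)
  finally show ?thesis by (simp add: d_def)
qed

lemma
  assumes th: "0 < \<theta>" "\<theta> < pi / 2"
  shows inverse_one_plus_square_holomorphic: "(\<lambda>z. 1 / (1 + z\<^sup>2)) holomorphic_on dcone (sin \<theta>)"
    and inverse_one_plus_square_bounded: "\<And>z. z \<in> dcone (sin \<theta>) \<Longrightarrow> norm (1 / (1 + z\<^sup>2)) \<le> 1 / ((1 - sin \<theta>) / 4)\<^sup>2"
    and one_plus_square_nonzero: "\<And>z. z \<in> dcone (sin \<theta>) \<Longrightarrow> 1 + z\<^sup>2 \<noteq> 0"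
    and H0_id_over_one_plus_square: "(\<lambda>z. z / (1 + z\<^sup>2)) \<in> H0 \<theta>"
proof -
  have s: "0 \<le> sin \<theta>" "sin \<theta> < 1" using sin_mono_quarter[of "\<theta>/2" \<theta>] th by auto
  define D where "D = ((1 - sin \<theta>) / 4)\<^sup>2"
  have D: "0 < D" using s by (simp add: D_def)
  have le: "D * (1 + (norm z)\<^sup>2) \<le> norm (1 + z\<^sup>2)" if "z \<in> dcone (sin \<theta>)" for z
    unfolding D_def by (rule one_plus_square_bound[OF th]) (use that in \<open>auto simp: dcone_def\<close>)
  have p: "0 < D * (1 + (norm z)\<^sup>2)" for z using D by (simp add: add_pos_nonneg)
  show nz: "1 + z\<^sup>2 \<noteq> 0" if "z \<in> dcone (sin \<theta>)" for z using le[OF that] p[of z] by auto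
  show "(\<lambda>z. 1 / (1 + z\<^sup>2)) holomorphic_on dcone (sin \<theta>)" by (intro holomorphic_intros) (use nz in auto)
  have b: "norm (1 / (1 + z\<^sup>2)) \<le> (1 / D) * (1 / (1 + (norm z)\<^sup>2))" if "z \<in> dcone (sin \<theta>)" for z
    using le[OF that] p[of z] by (simp add: norm_divide frac_le)
  show "norm (1 / (1 + z\<^sup>2)) \<le> 1 / ((1 - sin \<theta>) / 4)\<^sup>2" if "z \<in> dcone (sin \<theta>)" for z
  proof -
    have "(1 / D) * (1 / (1 + (norm z)\<^sup>2)) \<le> (1 / D) * 1" using D by (intro mult_left_mono) (auto simp: divide_simps add_pos_nonneg)
    then show ?thesis using b[OF that] by (simp add: D_def)
  qed
  show "(\<lambda>z. z / (1 + z\<^sup>2)) \<in> H0 \<theta>"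
    unfolding H0_def
  proof (intro CollectI conjI allI impI)
    show "(\<lambda>z. z / (1 + z\<^sup>2)) holomorphic_on dcone (sin \<theta>)" by (intro holomorphic_intros) (use nz in auto)
    have "norm (z / (1 + z\<^sup>2)) \<le> 1 / D" if z: "z \<in> dcone (sin \<theta>)" for z
    proof -
      have "norm (z / (1 + z\<^sup>2)) \<le> norm z * ((1 / D) * (1 / (1 + (norm z)\<^sup>2)))"
        using mult_left_mono[OF b[OF z], of "norm z"] by (simp add: norm_divide)
      also have "\<dots> = (1 / D) * (norm z / (1 + (norm z)\<^sup>2))" by simp
      also have "\<dots> \<le> (1 / D) * 1"
      proof (rule mult_left_mono)
        have "0 \<le> (norm z - 1/2)\<^sup>2" by simp
        then have "norm z \<le> 1 + (norm z)\<^sup>2" by (simp add: power2_eq_square algebra_simps)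
        then show "norm z / (1 + (norm z)\<^sup>2) \<le> 1" by (simp add: divide_simps add_pos_nonneg)
      qed (use D in auto)
      finally show ?thesis by simp
    qed
    then show "bounded ((\<lambda>z. z / (1 + z\<^sup>2)) ` dcone (sin \<theta>))" unfolding bounded_iff by blast
    fix \<alpha> assume "\<bar>sin \<alpha>\<bar> < sin \<theta>"
    then have z: "0 < t \<Longrightarrow> of_real t * cis \<alpha> \<in> dcone (sin \<theta>)" for t by (rule ray_in_dcone[rotated])
    have "ray_ok (\<lambda>z. 1 / (1 + z\<^sup>2)) \<alpha>"
    proof (rule ray_ok_quadratic_decay)
      show "continuous_on {0<..} (\<lambda>t. 1 / (1 + (complex_of_real t * cis \<alpha>)\<^sup>2))"
        using nz z by (auto intro!: continuous_intros)
      show "norm (1 / (1 + (complex_of_real t * cis \<alpha>)\<^sup>2)) \<le> (1 / D) / (1 + t\<^sup>2)" if "0 < t" for t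
        using b[OF z[OF that]] that by (simp add: norm_mult)
    qed
    then show "ray_ok (\<lambda>z. z / (1 + z\<^sup>2) / z) \<alpha>"
      by (subst ray_ok_cong[where G = "\<lambda>z. 1 / (1 + z\<^sup>2)"]) auto
  qed
qed

subsection \<open>The planar functional calculus of an operator with bisectorial resolvent\<close>

lemma blinfun_compose_assoc: "(A o\<^sub>L B) o\<^sub>L C = A o\<^sub>L (B o\<^sub>L C)"
  by (simp add: blinfun_eqI)

lemma blinfun_compose_id [simp]: "id_blinfun o\<^sub>L A = A" "A o\<^sub>L id_blinfun = A"
  by (simp_all add: blinfun_eqI)

lemmas blinfun_compose_simps =
  bounded_bilinear.add_left[OF bounded_bilinear_blinfun_compose]
  bounded_bilinear.add_right[OF bounded_bilinear_blinfun_compose]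
  bounded_bilinear.diff_left[OF bounded_bilinear_blinfun_compose]
  bounded_bilinear.diff_right[OF bounded_bilinear_blinfun_compose]
  bounded_bilinear.minus_left[OF bounded_bilinear_blinfun_compose]
  bounded_bilinear.minus_right[OF bounded_bilinear_blinfun_compose]
  bounded_bilinear.scaleR_left[OF bounded_bilinear_blinfun_compose]
  bounded_bilinear.scaleR_right[OF bounded_bilinear_blinfun_compose]

text \<open>The axioms of a resolvent in the sign convention of \<open>(z - T)^-1\<close>, linear
  over the scalars \<open>cs\<close>, with scale-invariant bounds outside every larger double cone.
  The operator is absent, so that the calculus rests on the resolvent equation alone.\<close>

locale bisector_resolvent =
  fixes cs :: "complex \<Rightarrow> ('x::banach \<Rightarrow>\<^sub>L 'x)" and R :: "complex \<Rightarrow> ('x \<Rightarrow>\<^sub>L 'x)" and \<omega> :: real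
  assumes cs_linear: "bounded_linear cs"
    and cs_one: "cs 1 = id_blinfun" and cs_mult: "cs (a * b) = cs a o\<^sub>L cs b"
    and omega: "0 < \<omega>" "\<omega> < pi / 2"
    and R_cs: "sin \<omega> * norm z < \<bar>Im z\<bar> \<Longrightarrow> R z o\<^sub>L cs c = cs c o\<^sub>L R z"
    and R_eq: "sin \<omega> * norm z < \<bar>Im z\<bar> \<Longrightarrow> sin \<omega> * norm w < \<bar>Im w\<bar> \<Longrightarrow>
      R z - R w = cs (w - z) o\<^sub>L (R z o\<^sub>L R w)"
    and R_bound_angle: "\<omega> < \<phi> \<Longrightarrow> \<phi> < pi / 2 \<Longrightarrow>
      \<exists>C\<ge>0. \<forall>z. z \<noteq> 0 \<longrightarrow> sin \<phi> * norm z \<le> \<bar>Im z\<bar> \<longrightarrow> norm z * norm (R z) \<le> C"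
begin

sublocale op: complex_module "\<lambda>c (A :: 'x \<Rightarrow>\<^sub>L 'x). cs c o\<^sub>L A"
proof (intro complex_module.intro complex_module_axioms.intro)
  show "bounded_bilinear (\<lambda>c (A :: 'x \<Rightarrow>\<^sub>L 'x). cs c o\<^sub>L A)"
    by (rule bounded_bilinear.comp[OF bounded_bilinear_blinfun_compose cs_linear bounded_linear_ident])
qed (auto simp: cs_one cs_mult blinfun_compose_assoc)

definition Om :: "complex set" where "Om = {z. sin \<omega> * norm z < \<bar>Im z\<bar>}"

lemma open_Om: "open Om"
  unfolding Om_def by (intro open_Collect_less continuous_intros)

lemma cs_comm: "cs a o\<^sub>L cs b = cs b o\<^sub>L cs a"
  by (simp add: cs_mult[symmetric] mult.commute)

lemma cs_inverse: "a \<noteq> 0 \<Longrightarrow> cs (1 / a) o\<^sub>L (cs a o\<^sub>L A) = A"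
  by (simp add: blinfun_compose_assoc[symmetric] cs_mult[symmetric] cs_one)

lemma cs_of_real: "cs (of_real r) = r *\<^sub>R id_blinfun"
  using linear_simps(5)[OF cs_linear, of r 1] by (simp add: cs_one scaleR_conv_of_real)

lemma cs_diff: "cs (a - b) = cs a - cs b" by (rule linear_simps(2)[OF cs_linear])
lemma cs_add: "cs (a + b) = cs a + cs b" by (rule linear_simps(1)[OF cs_linear])
lemma cs_minus: "cs (- a) = - cs a" by (rule linear_simps(4)[OF cs_linear])

lemma R_bound:
  assumes "sin \<omega> < b"
  shows "\<exists>C\<ge>0. \<forall>z. z \<noteq> 0 \<longrightarrow> b * norm z \<le> \<bar>Im z\<bar> \<longrightarrow> norm z * norm (R z) \<le> C"
proof -
  have so: "0 < sin \<omega>" "sin \<omega> < 1" using sin_mono_quarter[of "\<omega>/2" \<omega>] omega by auto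
  \<comment> \<open>\<open>b\<close> may exceed 1, where no angle has it as sine. The midpoint
    between \<open>sin \<omega>\<close> and \<open>min b 1\<close> is at most \<open>b\<close> and
    is the sine of an admissible angle.\<close>
  define p where "p = (sin \<omega> + min b 1) / 2"
  have p: "sin \<omega> < p" "p < 1" "p \<le> b" using so assms by (auto simp: p_def min_def)
  define \<phi> where "\<phi> = arcsin p"
  have sp: "sin \<phi> = p" unfolding \<phi>_def using p so by (intro sin_arcsin) auto
  have "\<omega> = arcsin (sin \<omega>)" using omega by (simp add: arcsin_sin)
  also have "\<dots> < \<phi>" unfolding \<phi>_def using p so by (intro arcsin_less_arcsin) auto
  finally have 1: "\<omega> < \<phi>" .
  have "arcsin p < arcsin 1" using p so by (intro arcsin_less_arcsin) auto
  then have 2: "\<phi> < pi / 2" by (simp add: \<phi>_def)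
  obtain C where C: "C \<ge> 0" "\<And>z. z \<noteq> 0 \<Longrightarrow> sin \<phi> * norm z \<le> \<bar>Im z\<bar> \<Longrightarrow> norm z * norm (R z) \<le> C"
    using R_bound_angle[OF 1 2] by blast
  have "norm z * norm (R z) \<le> C" if "z \<noteq> 0" "b * norm z \<le> \<bar>Im z\<bar>" for z
  proof (rule C(2)[OF that(1)])
    have "p * norm z \<le> b * norm z" using p by (intro mult_right_mono) auto
    then show "sin \<phi> * norm z \<le> \<bar>Im z\<bar>" unfolding sp using that(2) by (rule order_trans)
  qed
  then show ?thesis using C(1) by blast
qed

lemma R_comm: "z \<in> Om \<Longrightarrow> w \<in> Om \<Longrightarrow> R z o\<^sub>L R w = R w o\<^sub>L R z"
proof (cases "z = w")
  case False
  assume zw: "z \<in> Om" "w \<in> Om"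
  have "cs (w - z) o\<^sub>L (R z o\<^sub>L R w) = R z - R w" using R_eq zw by (simp add: Om_def)
  also have "\<dots> = - (cs (z - w) o\<^sub>L (R w o\<^sub>L R z))" using R_eq[of w z] zw by (simp add: Om_def) (metis minus_diff_eq)
  also have "\<dots> = cs (w - z) o\<^sub>L (R w o\<^sub>L R z)"
    using cs_minus[of "z - w"] by (simp add: blinfun_compose_simps)
  finally have "cs (w - z) o\<^sub>L (R z o\<^sub>L R w) = cs (w - z) o\<^sub>L (R w o\<^sub>L R z)" .
  then show ?thesis using cs_inverse[of "w - z"] False by (metis eq_iff_diff_eq_0)
qed simp

lemma R_mult:
  assumes "z \<in> Om" "w \<in> Om" "z \<noteq> w"
  shows "R z o\<^sub>L R w = cs (1 / (z - w)) o\<^sub>L (R w - R z)"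
proof -
  have "R w - R z = cs (z - w) o\<^sub>L (R w o\<^sub>L R z)" using assms R_eq[of w z] by (simp add: Om_def)
  then show ?thesis using cs_inverse[of "z - w" "R w o\<^sub>L R z"] assms R_comm by simp
qed

text \<open>The resolvent equation gives \<open>R w - R z\<close> the factor \<open>z - w\<close>,
  and the scale-invariant bound makes \<open>R w\<close> bounded near \<open>z\<close>. The slope
  \<open>b\<close> lies halfway between \<open>sin \<omega>\<close> and the slope of
  \<open>z\<close>, so that points near \<open>z\<close> share the bound.\<close>

lemma R_cont:
  assumes z: "z \<in> Om"
  shows "isCont R z"
proof -
  have z0: "z \<noteq> 0" using z by (auto simp: Om_def)
  define b where "b = (sin \<omega> + \<bar>Im z\<bar> / norm z) / 2"
  have sb: "sin \<omega> < \<bar>Im z\<bar> / norm z" using z z0 by (simp add: Om_def pos_less_divide_eq)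
  then have b: "sin \<omega> < b" "b * norm z < \<bar>Im z\<bar>" using z0 z by (auto simp: b_def Om_def field_simps)
  obtain C where C: "C \<ge> 0" "\<And>z. z \<noteq> 0 \<Longrightarrow> b * norm z \<le> \<bar>Im z\<bar> \<Longrightarrow> norm z * norm (R z) \<le> C"
    using R_bound[OF b(1)] by blast
  obtain K where K: "\<And>c (A :: 'x \<Rightarrow>\<^sub>L 'x). norm (cs c o\<^sub>L A) \<le> norm c * norm A * K" "0 \<le> K"
    using op.nonneg_bounded by blast
  have "open {w. b * norm w < \<bar>Im w\<bar>}" by (intro open_Collect_less continuous_intros)
  from eventually_at_in_open'[OF this, of z] have ev1: "\<forall>\<^sub>F w in at z. b * norm w < \<bar>Im w\<bar>"
    using b(2) by simp
  have "open {w. norm z / 2 < norm w}" by (intro open_Collect_less continuous_intros)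
  from eventually_at_in_open'[OF this, of z] have ev2: "\<forall>\<^sub>F w in at z. norm z / 2 < norm w"
    using z0 by simp
  have "\<forall>\<^sub>F w in at z. w \<in> Om" by (rule eventually_at_in_open'[OF open_Om z])
  with ev1 ev2 have ev: "\<forall>\<^sub>F w in at z. norm (R w - R z) \<le> norm (z - w) * ((2 * C / norm z) * norm (R z)) * K"
  proof eventually_elim
    case (elim w)
    have w0: "w \<noteq> 0" using elim(2) z0 by auto
    have "norm w * norm (R w) \<le> C" using C(2)[OF w0] elim by simp
    moreover have "norm z / 2 * norm (R w) \<le> norm w * norm (R w)" using elim by (intro mult_right_mono) auto
    ultimately have "norm (R w) \<le> 2 * C / norm z" using z0 by (simp add: field_simps)
    then have "norm (R w o\<^sub>L R z) \<le> (2 * C / norm z) * norm (R z)"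
      by (intro order_trans[OF norm_blinfun_compose] mult_right_mono) auto
    then have "norm (z - w) * norm (R w o\<^sub>L R z) * K \<le> norm (z - w) * ((2 * C / norm z) * norm (R z)) * K"
      using K by (intro mult_right_mono mult_left_mono) auto
    moreover have "R w - R z = cs (z - w) o\<^sub>L (R w o\<^sub>L R z)" using elim z R_eq[of w z] by (simp add: Om_def)
    ultimately show ?case using K(1)[of "z - w" "R w o\<^sub>L R z"] by simp
  qed
  have "((\<lambda>w. norm (z - w) * ((2 * C / norm z) * norm (R z)) * K) \<longlongrightarrow> norm (z - z) * ((2 * C / norm z) * norm (R z)) * K) (at z)"
    by (intro tendsto_intros) (use z0 in auto)
  then have "((\<lambda>w. norm (z - w) * ((2 * C / norm z) * norm (R z)) * K) \<longlongrightarrow> 0) (at z)" by simp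
  with ev have "((\<lambda>w. R w - R z) \<longlongrightarrow> 0) (at z)" by (rule Lim_null_comparison)
  then show ?thesis unfolding isCont_def by (rule LIM_zero_cancel)
qed

text \<open>By the resolvent equation the remainder is the increment times
  \<open>(R w - R z) R z\<close> up to sign, and continuity of \<open>R\<close> makes this
  small.\<close>

lemma R_mderiv:
  assumes z: "z \<in> Om"
  shows "op.mderiv R (- (R z o\<^sub>L R z)) z"
  unfolding has_derivative_at_alt
proof (intro conjI op.bounded_linear_left allI impI)
  obtain K where K: "\<And>c (A :: 'x \<Rightarrow>\<^sub>L 'x). norm (cs c o\<^sub>L A) \<le> norm c * norm A * K" "0 < K"
    using op.pos_bounded by blast
  fix e :: real assume e: "0 < e"
  define e' where "e' = e / (K * (norm (R z) + 1))"
  have n1: "0 < norm (R z) + 1" by (simp add: add_nonneg_pos)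
  have e': "0 < e'" using e K n1 by (simp add: e'_def)
  obtain r where r: "0 < r" "\<And>w. dist w z < r \<Longrightarrow> dist (R w) (R z) < e'"
    using R_cont[OF z] e' unfolding continuous_at_eps_delta by blast
  obtain r' where r': "0 < r'" "\<And>w. dist w z < r' \<Longrightarrow> w \<in> Om"
    using open_Om z unfolding open_dist by blast
  have "norm (R w - R z - (cs (w - z) o\<^sub>L - (R z o\<^sub>L R z))) \<le> e * norm (w - z)" if w: "norm (w - z) < min r r'" for w
  proof -
    have wO: "w \<in> Om" using r' w by (auto simp: dist_norm)
    have d: "norm (R w - R z) \<le> e'" using r(2)[of w] w by (auto simp: dist_norm)
    have eq: "R w - R z = - (cs (w - z) o\<^sub>L (R w o\<^sub>L R z))"
      using wO z R_eq[of w z] cs_minus[of "w - z"] by (simp add: Om_def blinfun_compose_simps)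
    have "R w - R z - (cs (w - z) o\<^sub>L - (R z o\<^sub>L R z)) = cs (w - z) o\<^sub>L - ((R w - R z) o\<^sub>L R z)"
    proof -
      have "cs (w - z) o\<^sub>L - ((R w - R z) o\<^sub>L R z) = - (cs (w - z) o\<^sub>L (R w o\<^sub>L R z)) + (cs (w - z) o\<^sub>L (R z o\<^sub>L R z))"
        by (simp add: blinfun_compose_simps)
      moreover have "cs (w - z) o\<^sub>L - (R z o\<^sub>L R z) = - (cs (w - z) o\<^sub>L (R z o\<^sub>L R z))"
        by (simp add: blinfun_compose_simps)
      ultimately show ?thesis by (simp only: eq minus_minus diff_minus_eq_add)
    qed
    also have "norm \<dots> \<le> norm (w - z) * norm (- ((R w - R z) o\<^sub>L R z)) * K" by (rule K)
    also have "\<dots> \<le> norm (w - z) * (e' * (norm (R z) + 1)) * K"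
    proof (intro mult_right_mono mult_left_mono)
      have "norm ((R w - R z) o\<^sub>L R z) \<le> norm (R w - R z) * norm (R z)" by (rule norm_blinfun_compose)
      also have "\<dots> \<le> e' * (norm (R z) + 1)" using d e' by (intro mult_mono) auto
      finally show "norm (- ((R w - R z) o\<^sub>L R z)) \<le> e' * (norm (R z) + 1)" by simp
    qed (use K in auto)
    also have "\<dots> = e * norm (w - z)" using K n1 by (simp add: e'_def)
    finally show ?thesis .
  qed
  then show "\<exists>d>0. \<forall>w. norm (w - z) < d \<longrightarrow> norm (R w - R z - (cs (w - z) o\<^sub>L - (R z o\<^sub>L R z))) \<le> e * norm (w - z)"
    using r(1) r'(1) by (intro exI[of _ "min r r'"]) auto
qed

lemma ray_R_ok:
  assumes f: "f \<in> H0 \<theta>" and al: "sin \<omega> < \<bar>sin \<alpha>\<bar>" "\<bar>sin \<alpha>\<bar> < sin \<theta>"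
  shows "ray_ok (\<lambda>z. cs (f z) o\<^sub>L R z) \<alpha>"
proof -
  obtain C where C: "C \<ge> 0" "\<And>z. z \<noteq> 0 \<Longrightarrow> \<bar>sin \<alpha>\<bar> * norm z \<le> \<bar>Im z\<bar> \<Longrightarrow> norm z * norm (R z) \<le> C"
    using R_bound[OF al(1)] by blast
  obtain K where K: "\<And>c (A :: 'x \<Rightarrow>\<^sub>L 'x). norm (cs c o\<^sub>L A) \<le> norm c * norm A * K" "0 \<le> K"
    using op.nonneg_bounded by blast
  show ?thesis
  proof (rule ray_ok_bounded_by)
    show "ray_ok (\<lambda>z. f z / z) \<alpha>" using f al by (simp add: H0_def)
    have "continuous_on Om R" using R_cont by (simp add: continuous_at_imp_continuous_on)
    then have "continuous_on {0<..} (\<lambda>t. R (of_real t * cis \<alpha>))"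
      by (rule continuous_on_compose2) (use al in \<open>auto intro!: continuous_intros simp: Om_def norm_mult abs_mult\<close>)
    then show "continuous_on {0<..} (\<lambda>t. cs (f (of_real t * cis \<alpha>)) o\<^sub>L R (of_real t * cis \<alpha>))"
      by (intro op.continuous_on H0_ray_continuous[OF f al(2)])
    fix t :: real assume t: "0 < t"
    let ?z = "of_real t * cis \<alpha>"
    have "norm ?z * norm (R ?z) \<le> C" by (rule C(2)) (use t in \<open>auto simp: norm_mult abs_mult\<close>)
    then have "norm (R ?z) \<le> C / t" using t by (simp add: norm_mult pos_le_divide_eq mult.commute)
    then have "norm (f ?z) * norm (R ?z) * K \<le> norm (f ?z) * (C / t) * K"
      using K by (intro mult_right_mono mult_left_mono) auto
    then show "norm (cs (f ?z) o\<^sub>L R ?z) \<le> (C * K) * norm (f ?z / ?z)"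
      using K(1)[of "f ?z" "R ?z"] t by (simp add: norm_divide norm_mult mult_ac)
  qed
qed

text \<open>Between the slopes \<open>b\<close> and \<open>sin \<theta>\<close> the function
  \<open>f R\<close> is holomorphic and \<open>|z| |f R|\<close> is bounded. Since the aperture is
  at most \<open>pi\<close>, the bisecting angle can serve as the axis in
  \<open>rays_eq\<close>.\<close>

lemma rays_R_eq:
  assumes f: "f \<in> H0 \<theta>" and al: "\<alpha>1 \<le> \<alpha>2" "\<alpha>2 - \<alpha>1 \<le> pi" and b: "sin \<omega> < b"
    and s: "\<And>\<alpha>. \<alpha>1 \<le> \<alpha> \<Longrightarrow> \<alpha> \<le> \<alpha>2 \<Longrightarrow> b \<le> \<bar>sin \<alpha>\<bar> \<and> \<bar>sin \<alpha>\<bar> < sin \<theta>"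
  shows "op.ray (\<lambda>z. cs (f z) o\<^sub>L R z) \<alpha>1 = op.ray (\<lambda>z. cs (f z) o\<^sub>L R z) \<alpha>2"
proof -
  obtain C where C: "C \<ge> 0" "\<And>z. z \<noteq> 0 \<Longrightarrow> b * norm z \<le> \<bar>Im z\<bar> \<Longrightarrow> norm z * norm (R z) \<le> C"
    using R_bound[OF b] by blast
  obtain M where M: "0 \<le> M" "\<And>z. z \<in> dcone (sin \<theta>) \<Longrightarrow> norm (f z) \<le> M" using H0_bound[OF f] by blast
  obtain K where K: "\<And>c (A :: 'x \<Rightarrow>\<^sub>L 'x). norm (cs c o\<^sub>L A) \<le> norm c * norm A * K" "0 \<le> K"
    using op.nonneg_bounded by blast
  have sec: "z \<noteq> 0 \<and> b * norm z \<le> \<bar>Im z\<bar> \<and> z \<in> Om \<and> z \<in> dcone (sin \<theta>)" if zs: "z \<in> sector \<alpha>1 \<alpha>2" for z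
  proof -
    obtain t \<alpha> where z: "z = of_real t * cis \<alpha>" "0 < t" "\<alpha>1 \<le> \<alpha>" "\<alpha> \<le> \<alpha>2" using zs by (auto simp: sector_def)
    have a: "b \<le> \<bar>sin \<alpha>\<bar>" "\<bar>sin \<alpha>\<bar> < sin \<theta>" using s z by auto
    have "sin \<omega> < \<bar>sin \<alpha>\<bar>" using a b by linarith
    then show ?thesis using a z by (auto simp: Om_def norm_mult abs_mult intro: ray_in_dcone)
  qed
  have hol: "f holomorphic_on dcone (sin \<theta>)" using f by (rule H0_holomorphic)
  have Rc: "continuous_on (sector \<alpha>1 \<alpha>2) R"
    using R_cont sec by (auto intro!: continuous_at_imp_continuous_on)
  have fc: "continuous_on (sector \<alpha>1 \<alpha>2) f" "continuous_on (sector \<alpha>1 \<alpha>2) (deriv f)"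
    using sec by (auto intro!: continuous_on_subset[OF holomorphic_on_imp_continuous_on] holomorphic_deriv hol open_dcone)
  show ?thesis
  proof (rule op.rays_eq[OF al(1), where \<mu> = "(\<alpha>1 + \<alpha>2) / 2" and F' = "\<lambda>z. (cs (deriv f z) o\<^sub>L R z) + (cs (f z) o\<^sub>L - (R z o\<^sub>L R z))"])
    show "0 \<le> cos (\<alpha> - (\<alpha>1 + \<alpha>2) / 2)" if "\<alpha>1 \<le> \<alpha>" "\<alpha> \<le> \<alpha>2" for \<alpha>
      using that al by (intro cos_ge_zero) (auto simp: field_simps)
    show "op.mderiv (\<lambda>z. cs (f z) o\<^sub>L R z) ((cs (deriv f z) o\<^sub>L R z) + (cs (f z) o\<^sub>L - (R z o\<^sub>L R z))) z" if "z \<in> sector \<alpha>1 \<alpha>2" for z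
      using sec[OF that] by (intro op.mderiv_mult R_mderiv holomorphic_derivI[OF hol open_dcone]) auto
    show "continuous_on (sector \<alpha>1 \<alpha>2) (\<lambda>z. (cs (deriv f z) o\<^sub>L R z) + (cs (f z) o\<^sub>L - (R z o\<^sub>L R z)))"
      by (intro continuous_intros op.continuous_on fc Rc bounded_bilinear.continuous_on[OF bounded_bilinear_blinfun_compose])
    show "norm z * norm (cs (f z) o\<^sub>L R z) \<le> M * C * K" if "z \<in> sector \<alpha>1 \<alpha>2" for z
    proof -
      have "norm z * norm (cs (f z) o\<^sub>L R z) \<le> norm z * (norm (f z) * norm (R z) * K)" by (intro mult_left_mono K) auto
      also have "\<dots> = norm (f z) * (norm z * norm (R z)) * K" by simp
      also have "\<dots> \<le> M * C * K" using sec[OF that] M C K by (intro mult_right_mono mult_mono) auto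
      finally show ?thesis .
    qed
    have "b \<le> \<bar>sin \<alpha>1\<bar> \<and> \<bar>sin \<alpha>1\<bar> < sin \<theta>" "b \<le> \<bar>sin \<alpha>2\<bar> \<and> \<bar>sin \<alpha>2\<bar> < sin \<theta>" using s al by auto
    then show "ray_ok (\<lambda>z. cs (f z) o\<^sub>L R z) \<alpha>1" "ray_ok (\<lambda>z. cs (f z) o\<^sub>L R z) \<alpha>2"
      using b by (auto intro!: ray_R_ok[OF f])
  qed
qed

definition Phi :: "(complex \<Rightarrow> complex) \<Rightarrow> real \<Rightarrow> 'x \<Rightarrow>\<^sub>L 'x" where
  "Phi f \<phi> = cs (1 / (2 * of_real pi * \<i>)) o\<^sub>L op.gam (\<lambda>z. cs (f z) o\<^sub>L R z) \<phi>"

lemma Phi_ok: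
  assumes f: "f \<in> H0 \<theta>" and phi: "\<omega> < \<phi>" "\<phi> < \<theta>" "\<theta> < pi / 2"
  shows "op.gam_ok (\<lambda>z. cs (f z) o\<^sub>L R z) \<phi>"
  using sin_mono_quarter[of \<omega> \<phi>] sin_mono_quarter[of \<phi> \<theta>] phi omega
  unfolding op.gam_ok_def by (auto intro!: ray_R_ok[OF f])

lemma Phi_cong:
  assumes "\<And>z. z \<in> dcone (sin \<theta>) \<Longrightarrow> f z = g z" "\<omega> < \<phi>" "\<phi> < \<theta>" "\<theta> < pi / 2"
  shows "Phi f \<phi> = Phi g \<phi>"
proof -
  have s: "\<bar>sin \<phi>\<bar> < sin \<theta>" using sin_mono_quarter[of \<phi> \<theta>] assms omega by auto
  have "z \<in> dcone (sin \<theta>)" if "z \<noteq> 0" "\<bar>Im z\<bar> = \<bar>sin \<phi>\<bar> * norm z" for z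
    using that s by (simp add: dcone_def)
  then show ?thesis
    unfolding Phi_def using assms(1) by (intro arg_cong2[where f = blinfun_compose] refl op.gam_cong) auto
qed

lemma Phi_add:
  assumes "f \<in> H0 \<theta>" "g \<in> H0 \<theta>" "\<omega> < \<phi>" "\<phi> < \<theta>" "\<theta> < pi / 2"
  shows "Phi (\<lambda>z. f z + g z) \<phi> = Phi f \<phi> + Phi g \<phi>"
  using op.gam_add[OF Phi_ok[OF assms(1,3-5)] Phi_ok[OF assms(2,3-5)]]
  by (simp add: Phi_def cs_add blinfun_compose_simps)

lemma Phi_scale:
  assumes "f \<in> H0 \<theta>" "\<omega> < \<phi>" "\<phi> < \<theta>" "\<theta> < pi / 2"
  shows "Phi (\<lambda>z. of_real r * f z) \<phi> = r *\<^sub>R Phi f \<phi>"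
  using op.gam_scale[OF Phi_ok[OF assms], of "of_real r"]
  by (simp add: Phi_def cs_mult cs_of_real blinfun_compose_assoc blinfun_compose_simps)

text \<open>Each of the four boundary rays is moved separately through the region outside the cone
  of slope \<open>sin \<omega>\<close>.\<close>

lemma Phi_angle_le:
  assumes f: "f \<in> H0 \<theta>" and phi: "\<omega> < \<phi>" "\<phi> \<le> \<phi>'" "\<phi>' < \<theta>" "\<theta> < pi / 2"
  shows "Phi f \<phi> = Phi f \<phi>'"
proof -
  have b: "sin \<omega> < sin \<phi>" using sin_mono_quarter[of \<omega> \<phi>] phi omega by auto
  have mono: "sin \<phi> \<le> \<bar>sin \<beta>\<bar> \<and> \<bar>sin \<beta>\<bar> < sin \<theta>" if "\<phi> \<le> \<beta>" "\<beta> \<le> \<phi>'" for \<beta>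
    using that phi omega sin_mono_quarter[of \<beta> \<theta>] sin_monotone_2pi_le[of \<phi> \<beta>] by auto
  let ?F = "\<lambda>z. cs (f z) o\<^sub>L R z"
  have 1: "op.ray ?F \<phi> = op.ray ?F \<phi>'"
    by (rule rays_R_eq[OF f phi(2) _ b]) (use mono phi omega in auto)
  have 2: "op.ray ?F (- \<phi>') = op.ray ?F (- \<phi>)"
  proof (rule rays_R_eq[OF f _ _ b])
    fix \<alpha> assume "- \<phi>' \<le> \<alpha>" "\<alpha> \<le> - \<phi>"
    then show "sin \<phi> \<le> \<bar>sin \<alpha>\<bar> \<and> \<bar>sin \<alpha>\<bar> < sin \<theta>" using mono[of "- \<alpha>"] by simp
  qed (use phi omega in auto)
  have 3: "op.ray ?F (pi - \<phi>') = op.ray ?F (pi - \<phi>)"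
  proof (rule rays_R_eq[OF f _ _ b])
    fix \<alpha> assume "pi - \<phi>' \<le> \<alpha>" "\<alpha> \<le> pi - \<phi>"
    then show "sin \<phi> \<le> \<bar>sin \<alpha>\<bar> \<and> \<bar>sin \<alpha>\<bar> < sin \<theta>" using mono[of "pi - \<alpha>"] by simp
  qed (use phi omega in auto)
  have 4: "op.ray ?F (pi + \<phi>) = op.ray ?F (pi + \<phi>')"
  proof (rule rays_R_eq[OF f _ _ b])
    fix \<alpha> assume "pi + \<phi> \<le> \<alpha>" "\<alpha> \<le> pi + \<phi>'"
    then show "sin \<phi> \<le> \<bar>sin \<alpha>\<bar> \<and> \<bar>sin \<alpha>\<bar> < sin \<theta>" using mono[of "\<alpha> - pi"] by (simp add: sin_diff)
  qed (use phi omega in auto)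
  show ?thesis unfolding Phi_def op.gam_def using 1 2 3 4 by simp
qed

lemma Phi_angle:
  assumes "f \<in> H0 \<theta>" "\<omega> < \<phi>" "\<phi> < \<theta>" "\<omega> < \<phi>'" "\<phi>' < \<theta>" "\<theta> < pi / 2"
  shows "Phi f \<phi> = Phi f \<phi>'"
proof (cases "\<phi> \<le> \<phi>'")
  case True
  then show ?thesis using assms by (intro Phi_angle_le)
next
  case False
  then show ?thesis using assms by (intro Phi_angle_le[symmetric]) auto
qed

end

section \<open>Commutation, products with resolvents, and multiplicativity\<close>

lemma blinfun_commute_compose:
  assumes "A o\<^sub>L B = B o\<^sub>L A" "A o\<^sub>L C = C o\<^sub>L A"
  shows "(B o\<^sub>L C) o\<^sub>L A = A o\<^sub>L (B o\<^sub>L C)"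
proof -
  have "(B o\<^sub>L C) o\<^sub>L A = B o\<^sub>L (C o\<^sub>L A)" by (rule blinfun_compose_assoc)
  also have "\<dots> = (B o\<^sub>L A) o\<^sub>L C" by (simp only: assms(2)[symmetric] blinfun_compose_assoc)
  also have "\<dots> = A o\<^sub>L (B o\<^sub>L C)" by (simp only: assms(1)[symmetric] blinfun_compose_assoc)
  finally show ?thesis .
qed

context bisector_resolvent
begin

lemma ray_compose_right:
  assumes "ray_ok F \<alpha>"
  shows "op.ray (\<lambda>z. F z o\<^sub>L A) \<alpha> = op.ray F \<alpha> o\<^sub>L A" "ray_ok (\<lambda>z. F z o\<^sub>L A) \<alpha>"
proof -
  have bl: "bounded_linear (\<lambda>X. X o\<^sub>L A)"
    by (rule bounded_bilinear.bounded_linear_left[OF bounded_bilinear_blinfun_compose])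
  show "op.ray (\<lambda>z. F z o\<^sub>L A) \<alpha> = op.ray F \<alpha> o\<^sub>L A"
    unfolding op.ray_def using integral_linear[OF op.ray_integrand(1)[OF assms] bl]
    by (simp add: o_def blinfun_compose_assoc)
  show "ray_ok (\<lambda>z. F z o\<^sub>L A) \<alpha>" by (rule ray_ok_bounded_linear[OF bl assms])
qed

lemma ray_compose_left:
  assumes "ray_ok F \<alpha>" and comm: "\<And>c. A o\<^sub>L cs c = cs c o\<^sub>L A"
  shows "op.ray (\<lambda>z. A o\<^sub>L F z) \<alpha> = A o\<^sub>L op.ray F \<alpha>" "ray_ok (\<lambda>z. A o\<^sub>L F z) \<alpha>"
proof -
  have bl: "bounded_linear (\<lambda>X. A o\<^sub>L X)"
    by (rule bounded_bilinear.bounded_linear_right[OF bounded_bilinear_blinfun_compose])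
  have swap: "cs c o\<^sub>L (A o\<^sub>L X) = A o\<^sub>L (cs c o\<^sub>L X)" for c and X :: "'x \<Rightarrow>\<^sub>L 'x"
    by (simp add: blinfun_compose_assoc[symmetric] comm)
  show "op.ray (\<lambda>z. A o\<^sub>L F z) \<alpha> = A o\<^sub>L op.ray F \<alpha>"
    unfolding op.ray_def using integral_linear[OF op.ray_integrand(1)[OF assms(1)] bl]
    by (simp add: o_def swap)
  show "ray_ok (\<lambda>z. A o\<^sub>L F z) \<alpha>" by (rule ray_ok_bounded_linear[OF bl assms(1)])
qed

lemma ray_scalar:
  fixes A :: "'x \<Rightarrow>\<^sub>L 'x"
  assumes "ray_ok k \<alpha>"
  shows "op.ray (\<lambda>z. cs (k z) o\<^sub>L A) \<alpha> = cs (cx.ray k \<alpha>) o\<^sub>L A" "ray_ok (\<lambda>z. cs (k z) o\<^sub>L A) \<alpha>"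
proof -
  have bl: "bounded_linear (\<lambda>c. cs c o\<^sub>L A)" by (rule op.bounded_linear_left)
  show "op.ray (\<lambda>z. cs (k z) o\<^sub>L A) \<alpha> = cs (cx.ray k \<alpha>) o\<^sub>L A"
    unfolding op.ray_def cx.ray_def using integral_linear[OF cx.ray_integrand(1)[OF assms] bl]
    by (simp add: o_def op.assoc)
  show "ray_ok (\<lambda>z. cs (k z) o\<^sub>L A) \<alpha>" by (rule ray_ok_bounded_linear[OF bl assms])
qed

lemma gam_compose_right:
  assumes "op.gam_ok F \<phi>"
  shows "op.gam (\<lambda>z. F z o\<^sub>L A) \<phi> = op.gam F \<phi> o\<^sub>L A" "op.gam_ok (\<lambda>z. F z o\<^sub>L A) \<phi>"
  using assms unfolding op.gam_def op.gam_ok_def by (simp_all add: ray_compose_right blinfun_compose_simps)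

lemma gam_compose_left:
  assumes "op.gam_ok F \<phi>" and "\<And>c. A o\<^sub>L cs c = cs c o\<^sub>L A"
  shows "op.gam (\<lambda>z. A o\<^sub>L F z) \<phi> = A o\<^sub>L op.gam F \<phi>" "op.gam_ok (\<lambda>z. A o\<^sub>L F z) \<phi>"
  using assms unfolding op.gam_def op.gam_ok_def by (simp_all add: ray_compose_left blinfun_compose_simps)

lemma gam_scalar:
  assumes "cx.gam_ok k \<phi>"
  shows "op.gam (\<lambda>z. cs (k z) o\<^sub>L (A :: 'x \<Rightarrow>\<^sub>L 'x)) \<phi> = cs (cx.gam k \<phi>) o\<^sub>L A" "op.gam_ok (\<lambda>z. cs (k z) o\<^sub>L A) \<phi>"
  using assms unfolding op.gam_def cx.gam_def op.gam_ok_def cx.gam_ok_def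
  by (simp_all add: ray_scalar blinfun_compose_simps cs_add cs_diff)

lemma Om_on_gam: "\<omega> < \<phi> \<Longrightarrow> \<phi> < pi / 2 \<Longrightarrow> z \<noteq> 0 \<Longrightarrow> \<bar>Im z\<bar> = \<bar>sin \<phi>\<bar> * norm z \<Longrightarrow> z \<in> Om"
  using sin_mono_quarter[of \<omega> \<phi>] omega by (simp add: Om_def)

lemma R_cs_Om: "z \<in> Om \<Longrightarrow> R z o\<^sub>L cs c = cs c o\<^sub>L R z"
  by (simp add: Om_def R_cs)

lemma Phi_cs_comm:
  assumes "f \<in> H0 \<theta>" "\<omega> < \<phi>" "\<phi> < \<theta>" "\<theta> < pi / 2"
  shows "Phi f \<phi> o\<^sub>L cs a = cs a o\<^sub>L Phi f \<phi>"
proof -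
  note ok = Phi_ok[OF assms]
  have "op.gam (\<lambda>z. cs (f z) o\<^sub>L R z) \<phi> o\<^sub>L cs a = op.gam (\<lambda>z. (cs (f z) o\<^sub>L R z) o\<^sub>L cs a) \<phi>"
    by (rule gam_compose_right(1)[OF ok, symmetric])
  also have "\<dots> = op.gam (\<lambda>z. cs a o\<^sub>L (cs (f z) o\<^sub>L R z)) \<phi>"
  proof (rule op.gam_cong)
    fix z :: complex assume "z \<noteq> 0" "\<bar>Im z\<bar> = \<bar>sin \<phi>\<bar> * norm z"
    then have "z \<in> Om" using assms by (intro Om_on_gam) auto
    then show "(cs (f z) o\<^sub>L R z) o\<^sub>L cs a = cs a o\<^sub>L (cs (f z) o\<^sub>L R z)"
      by (intro blinfun_commute_compose cs_comm R_cs_Om[symmetric])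
  qed
  also have "\<dots> = cs a o\<^sub>L op.gam (\<lambda>z. cs (f z) o\<^sub>L R z) \<phi>" by (rule op.gam_scale[OF ok])
  finally show ?thesis unfolding Phi_def by (intro blinfun_commute_compose cs_comm) simp
qed

lemma Phi_R_comm:
  assumes "f \<in> H0 \<theta>" "\<omega> < \<phi>" "\<phi> < \<theta>" "\<theta> < pi / 2" and w: "w \<in> Om"
  shows "Phi f \<phi> o\<^sub>L R w = R w o\<^sub>L Phi f \<phi>"
proof -
  note ok = Phi_ok[OF assms(1-4)]
  have "op.gam (\<lambda>z. cs (f z) o\<^sub>L R z) \<phi> o\<^sub>L R w = op.gam (\<lambda>z. (cs (f z) o\<^sub>L R z) o\<^sub>L R w) \<phi>"
    by (rule gam_compose_right(1)[OF ok, symmetric])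
  also have "\<dots> = op.gam (\<lambda>z. R w o\<^sub>L (cs (f z) o\<^sub>L R z)) \<phi>"
  proof (rule op.gam_cong)
    fix z :: complex assume "z \<noteq> 0" "\<bar>Im z\<bar> = \<bar>sin \<phi>\<bar> * norm z"
    then have "z \<in> Om" using assms by (intro Om_on_gam) auto
    then show "(cs (f z) o\<^sub>L R z) o\<^sub>L R w = R w o\<^sub>L (cs (f z) o\<^sub>L R z)"
      by (intro blinfun_commute_compose R_cs_Om[OF w] R_comm[OF w])
  qed
  also have "\<dots> = R w o\<^sub>L op.gam (\<lambda>z. cs (f z) o\<^sub>L R z) \<phi>" by (rule gam_compose_left(1)[OF ok R_cs_Om[OF w]])
  finally show ?thesis unfolding Phi_def by (intro blinfun_commute_compose R_cs_Om[OF w]) simp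
qed

text \<open>The resolvent equation rewrites \<open>f z R z R w\<close> as
  \<open>f z / (z - w)\<close> times \<open>R w - R z\<close>. The first part is a scalar Cauchy
  integral times \<open>R w\<close>, the second is the contour integral for
  \<open>f z / (z - w)\<close>; the latter is only a notation when \<open>w\<close> is a pole inside
  the cone.\<close>

lemma Phi_R:
  assumes f: "f \<in> H0 \<theta>" and phi: "\<omega> < \<phi>" "\<phi> < \<theta>" "\<theta> < pi / 2"
    and w: "w \<in> Om" "\<bar>Im w\<bar> \<noteq> sin \<phi> * norm w"
  shows "Phi f \<phi> o\<^sub>L R w = (cs (cx.gam (\<lambda>z. f z / (z - w)) \<phi> / (2 * of_real pi * \<i>)) o\<^sub>L R w) - Phi (\<lambda>z. f z / (z - w)) \<phi>"
    and "op.gam_ok (\<lambda>z. cs (f z / (z - w)) o\<^sub>L R z) \<phi>"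
proof -
  note ok = Phi_ok[OF f phi]
  have p0: "0 < \<phi>" using phi omega by auto
  have sp: "\<bar>sin \<phi>\<bar> = sin \<phi>" using sin_mono_quarter[of \<phi> \<theta>] phi p0 by auto
  have kok: "cx.gam_ok (\<lambda>z. f z / (z - w)) \<phi>"
    using gam_Cauchy_inside(2)[OF f p0 phi(2,3), of w] gam_Cauchy_outside(2)[OF f p0 phi(2,3), of w] w by linarith
  have eq: "cs (f z / (z - w)) o\<^sub>L R z = (cs (f z / (z - w)) o\<^sub>L R w) - ((cs (f z) o\<^sub>L R z) o\<^sub>L R w)"
    if "z \<noteq> 0" "\<bar>Im z\<bar> = \<bar>sin \<phi>\<bar> * norm z" for z
  proof -
    have zO: "z \<in> Om" using that phi by (intro Om_on_gam) auto
    have zw: "z \<noteq> w" using that w sp by auto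
    have "(cs (f z) o\<^sub>L R z) o\<^sub>L R w = cs (f z) o\<^sub>L (cs (1 / (z - w)) o\<^sub>L (R w - R z))"
      by (simp add: blinfun_compose_assoc R_mult[OF zO w(1) zw])
    also have "\<dots> = cs (f z / (z - w)) o\<^sub>L (R w - R z)"
      by (simp add: blinfun_compose_assoc[symmetric] cs_mult[symmetric])
    finally show ?thesis by (simp add: blinfun_compose_simps)
  qed
  have ok2: "op.gam_ok (\<lambda>z. (cs (f z / (z - w)) o\<^sub>L R w) - ((cs (f z) o\<^sub>L R z) o\<^sub>L R w)) \<phi>"
    by (intro op.gam_ok_diff gam_scalar(2)[OF kok] gam_compose_right(2)[OF ok])
  show "op.gam_ok (\<lambda>z. cs (f z / (z - w)) o\<^sub>L R z) \<phi>"
    using ok2 by (subst op.gam_ok_cong[OF eq])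
  have "op.gam (\<lambda>z. cs (f z / (z - w)) o\<^sub>L R z) \<phi> = op.gam (\<lambda>z. (cs (f z / (z - w)) o\<^sub>L R w) - ((cs (f z) o\<^sub>L R z) o\<^sub>L R w)) \<phi>"
    by (rule op.gam_cong[OF eq])
  also have "\<dots> = (cs (cx.gam (\<lambda>z. f z / (z - w)) \<phi>) o\<^sub>L R w) - (op.gam (\<lambda>z. cs (f z) o\<^sub>L R z) \<phi> o\<^sub>L R w)"
    by (simp add: op.gam_diff[OF gam_scalar(2)[OF kok] gam_compose_right(2)[OF ok]] gam_scalar(1)[OF kok] gam_compose_right(1)[OF ok])
  finally have "op.gam (\<lambda>z. cs (f z) o\<^sub>L R z) \<phi> o\<^sub>L R w = (cs (cx.gam (\<lambda>z. f z / (z - w)) \<phi>) o\<^sub>L R w) - op.gam (\<lambda>z. cs (f z / (z - w)) o\<^sub>L R z) \<phi>"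
    by simp
  then have "Phi f \<phi> o\<^sub>L R w = (cs (1 / (2 * of_real pi * \<i>)) o\<^sub>L (cs (cx.gam (\<lambda>z. f z / (z - w)) \<phi>) o\<^sub>L R w)) - Phi (\<lambda>z. f z / (z - w)) \<phi>"
    by (simp add: Phi_def blinfun_compose_assoc blinfun_compose_simps(4))
  also have "cs (1 / (2 * of_real pi * \<i>)) o\<^sub>L (cs (cx.gam (\<lambda>z. f z / (z - w)) \<phi>) o\<^sub>L R w) = cs (cx.gam (\<lambda>z. f z / (z - w)) \<phi> / (2 * of_real pi * \<i>)) o\<^sub>L R w"
    by (simp add: blinfun_compose_assoc[symmetric] cs_mult[symmetric])
  finally show "Phi f \<phi> o\<^sub>L R w = (cs (cx.gam (\<lambda>z. f z / (z - w)) \<phi> / (2 * of_real pi * \<i>)) o\<^sub>L R w) - Phi (\<lambda>z. f z / (z - w)) \<phi>" .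
qed

text \<open>Here the scalar Cauchy integral vanishes, so that multiplying the operator by
  \<open>R w\<close> multiplies the function by \<open>1 / (w - z)\<close>.\<close>

lemma Phi_R_outside:
  assumes f: "f \<in> H0 \<theta>" and phi: "\<omega> < \<phi>" "\<phi> < \<theta>" "\<theta> < pi / 2" and w: "sin \<phi> * norm w < \<bar>Im w\<bar>"
  shows "Phi f \<phi> o\<^sub>L R w = - Phi (\<lambda>z. f z / (z - w)) \<phi>"
proof -
  have "sin \<omega> * norm w \<le> sin \<phi> * norm w"
    using sin_mono_quarter[of \<omega> \<phi>] phi omega by (intro mult_right_mono) auto
  then have "w \<in> Om" using w by (simp add: Om_def)
  then show ?thesis using Phi_R(1)[OF f phi, of w] gam_Cauchy_outside(1)[OF f _ phi(2,3) w] w phi omega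
    by (simp add: linear_simps(3)[OF cs_linear])
qed

text \<open>Here the scalar Cauchy integral yields the extra term \<open>f w R w\<close>, from which
  products of functions arise in \<open>Phi_mult\<close>.\<close>

lemma Phi_R_inside:
  assumes f: "f \<in> H0 \<theta>" and phi: "\<omega> < \<phi>" "\<phi> < \<theta>" "\<theta> < pi / 2"
    and w: "w \<in> Om" "\<bar>Im w\<bar> < sin \<phi> * norm w"
  shows "Phi f \<phi> o\<^sub>L R w = (cs (f w) o\<^sub>L R w) - Phi (\<lambda>z. f z / (z - w)) \<phi>"
  using Phi_R(1)[OF f phi w(1)] gam_Cauchy_inside(1)[OF f _ phi(2,3) w(2)] w phi omega by simp

text \<open>
  For multiplicativity the inner integral is taken over a wider cone. As a function of \<open>z\<close> it is then
  holomorphic on the narrower one, so its outer integral vanishes without any appeal to Fubini.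
\<close>

lemma Phi_mult_aux:
  assumes f: "f \<in> H0 \<theta>" and g: "g \<in> H0 \<theta>" and phi: "\<omega> < \<phi>1" "\<phi>1 < \<phi>2" "\<phi>2 < \<theta>" "\<theta> < pi / 2"
  shows "op.gam_ok (\<lambda>z. cs (g z) o\<^sub>L op.gam (\<lambda>s. cs (1 / (z - s)) o\<^sub>L (cs (f s) o\<^sub>L R s)) \<phi>2) \<phi>1"
    and "op.gam (\<lambda>z. cs (g z) o\<^sub>L op.gam (\<lambda>s. cs (1 / (z - s)) o\<^sub>L (cs (f s) o\<^sub>L R s)) \<phi>2) \<phi>1 = 0"
proof -
  define F where "F s = cs (f s) o\<^sub>L R s" for s
  define K where "K z = op.gam (\<lambda>s. cs (1 / (z - s)) o\<^sub>L F s) \<phi>2" for z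
  define K' where "K' z = op.gam (\<lambda>s. cs (- 1 / (z - s)\<^sup>2) o\<^sub>L F s) \<phi>2" for z
  have s1: "sin \<phi>1 < sin \<phi>2" "0 < sin \<phi>1" "sin \<phi>2 < sin \<theta>" "sin \<phi>2 < 1"
    using sin_mono_quarter[of \<phi>1 \<phi>2] sin_mono_quarter[of \<phi>2 \<theta>] phi omega by auto
  have Fok: "ray_ok F \<alpha>" if "\<alpha> \<in> {- \<phi>2, \<phi>2, pi - \<phi>2, pi + \<phi>2}" for \<alpha>
    using Phi_ok[OF f _ phi(3,4)] phi that unfolding op.gam_ok_def F_def by auto
  have sep: "(sin \<phi>2 - sin \<phi>1) / 2 * norm z \<le> norm (z - of_real t * cis \<alpha>)"
    if z: "\<bar>Im z\<bar> \<le> sin \<phi>1 * norm z" and t: "0 < t" and al: "\<alpha> \<in> {- \<phi>2, \<phi>2, pi - \<phi>2, pi + \<phi>2}" for z t \<alpha>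
  proof -
    have "\<bar>sin \<alpha>\<bar> = sin \<phi>2" using al s1 by auto
    then have "sin \<phi>2 * norm (of_real t * cis \<alpha>) \<le> \<bar>Im (of_real t * cis \<alpha>)\<bar>" using t by (simp add: norm_mult abs_mult)
    from cone_separation(2)[OF z this] s1
    have "(sin \<phi>2 - sin \<phi>1) * norm z \<le> (1 + sin \<phi>2) * norm (z - of_real t * cis \<alpha>)" by simp
    also have "\<dots> \<le> 2 * norm (z - of_real t * cis \<alpha>)" using s1 by (intro mult_right_mono) auto
    finally show ?thesis by simp
  qed
  \<comment> \<open>Half of the lower bound in \<open>sep\<close>, which leaves the margin
    \<open>2 * d\<close> required by \<open>kernel_mderiv\<close>.\<close>
  define d where "d z = (sin \<phi>2 - sin \<phi>1) / 4 * norm z" for z :: complex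
  have d: "0 < d z" "\<And>t \<alpha>. 0 < t \<Longrightarrow> \<alpha> \<in> {- \<phi>2, \<phi>2, pi - \<phi>2, pi + \<phi>2} \<Longrightarrow> 2 * d z \<le> norm (z - of_real t * cis \<alpha>)"
    if "z \<noteq> 0" "\<bar>Im z\<bar> \<le> sin \<phi>1 * norm z" for z
  proof -
    show "0 < d z" using that(1) s1 by (simp add: d_def)
    show "2 * d z \<le> norm (z - of_real t * cis \<alpha>)" if "0 < t" "\<alpha> \<in> {- \<phi>2, \<phi>2, pi - \<phi>2, pi + \<phi>2}" for t \<alpha>
      using sep[OF \<open>\<bar>Im z\<bar> \<le> sin \<phi>1 * norm z\<close> that] by (simp add: d_def mult.commute)
  qed
  have Kd: "op.mderiv K (K' z) z" if z: "z \<noteq> 0" "\<bar>Im z\<bar> \<le> sin \<phi>1 * norm z" for z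
  proof -
    have *: "op.mderiv (\<lambda>z. op.ray (\<lambda>s. cs (1 / (z - s)) o\<^sub>L F s) \<alpha>) (op.ray (\<lambda>s. cs (- 1 / (z - s)\<^sup>2) o\<^sub>L F s) \<alpha>) z"
      if "\<alpha> \<in> {- \<phi>2, \<phi>2, pi - \<phi>2, pi + \<phi>2}" for \<alpha>
      by (rule op.kernel_mderiv(1)[OF Fok[OF that] d(1)[OF z] d(2)[OF z _ that]])
    show ?thesis unfolding K_def K'_def op.gam_def
      by (intro op.mderiv_add op.mderiv_diff *) auto
  qed
  have K'c: "isCont K' z" if z: "z \<noteq> 0" "\<bar>Im z\<bar> \<le> sin \<phi>1 * norm z" for z
  proof -
    have *: "isCont (\<lambda>z. op.ray (\<lambda>s. cs (- 1 / (z - s)\<^sup>2) o\<^sub>L F s) \<alpha>) z"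
      if "\<alpha> \<in> {- \<phi>2, \<phi>2, pi - \<phi>2, pi + \<phi>2}" for \<alpha>
      by (rule op.kernel_mderiv(2)[OF Fok[OF that] d(1)[OF z] d(2)[OF z _ that]])
    show ?thesis unfolding K'_def op.gam_def
      by (intro continuous_intros *) auto
  qed
  obtain B where B: "\<And>c (A :: 'x \<Rightarrow>\<^sub>L 'x). norm (cs c o\<^sub>L A) \<le> norm c * norm A * B" "0 \<le> B"
    using op.nonneg_bounded by blast
  define I where "I \<alpha> = integral {0<..} (\<lambda>t. norm (F (of_real t * cis \<alpha>)))" for \<alpha>
  define D where "D = B * B * (2 / (sin \<phi>2 - sin \<phi>1)) * (I (- \<phi>2) + I \<phi>2 + (I (pi - \<phi>2) + I (pi + \<phi>2)))"
  have Kb: "norm z * norm (K z) \<le> D" if z: "z \<noteq> 0" "\<bar>Im z\<bar> \<le> sin \<phi>1 * norm z" for z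
  proof -
    have r: "norm (op.ray (\<lambda>s. cs (1 / (z - s)) o\<^sub>L F s) \<alpha>) \<le> B * B * (1 / (2 * d z)) * I \<alpha>"
      if al: "\<alpha> \<in> {- \<phi>2, \<phi>2, pi - \<phi>2, pi + \<phi>2}" for \<alpha>
      unfolding I_def
    proof (rule op.kernel_ok(2)[OF Fok[OF al] _ _ B])
      fix t :: real assume t: "0 < t"
      show "norm (1 / (z - of_real t * cis \<alpha>)) \<le> 1 / (2 * d z)"
        using d(2)[OF z t al] d(1)[OF z] by (simp add: norm_divide frac_le)
    next
      have "z - of_real t * cis \<alpha> \<noteq> 0" if "0 < t" for t
        using d(2)[OF z that al] d(1)[OF z] by auto
      then show "continuous_on {0<..} (\<lambda>t. 1 / (z - of_real t * cis \<alpha>))"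
        by (intro continuous_intros) auto
    qed
    have tri: "norm ((a - b) + (c - e)) \<le> norm a + norm b + (norm c + norm e)" for a b c e :: "'x \<Rightarrow>\<^sub>L 'x"
      by (intro order_trans[OF norm_triangle_ineq] add_mono norm_triangle_ineq4)
    have "norm (K z) \<le> B * B * (1 / (2 * d z)) * I (- \<phi>2) + B * B * (1 / (2 * d z)) * I \<phi>2
        + (B * B * (1 / (2 * d z)) * I (pi - \<phi>2) + B * B * (1 / (2 * d z)) * I (pi + \<phi>2))"
      unfolding K_def op.gam_def by (rule order_trans[OF tri]) (intro add_mono r; simp)
    also have "\<dots> = D / norm z"
    proof -
      have "B * B * (1 / (2 * d z)) = B * B * (2 / (sin \<phi>2 - sin \<phi>1)) / norm z" by (simp add: d_def)
      then show ?thesis by (simp only: D_def distrib_left add_divide_distrib times_divide_eq_left)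
    qed
    finally show ?thesis using z by (simp add: pos_le_divide_eq mult.commute)
  qed
  have hol: "g holomorphic_on dcone (sin \<theta>)" using g by (rule H0_holomorphic)
  obtain M where M: "0 \<le> M" "\<And>z. z \<in> dcone (sin \<theta>) \<Longrightarrow> norm (g z) \<le> M" using H0_bound[OF g] by blast
  have inner: "z \<in> dcone (sin \<theta>)" if "z \<noteq> 0" "\<bar>Im z\<bar> \<le> sin \<phi>1 * norm z" for z
    unfolding dcone_def using that s1 by (auto intro: le_less_trans)
  have sins: "\<bar>sin (\<mu> - \<phi>1)\<bar> = sin \<phi>1" "\<bar>sin (\<mu> + \<phi>1)\<bar> = sin \<phi>1" if "\<mu> \<in> {0, pi}" for \<mu>
    using that s1 by auto
  have ok: "ray_ok (\<lambda>z. cs (g z) o\<^sub>L K z) \<alpha>" if al: "\<bar>sin \<alpha>\<bar> = sin \<phi>1" for \<alpha>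
  proof (rule ray_ok_bounded_by)
    have al2: "\<bar>sin \<alpha>\<bar> < sin \<theta>" using al s1 by simp
    show "ray_ok (\<lambda>z. g z / z) \<alpha>" using g al2 by (simp add: H0_def)
    have zz: "of_real t * cis \<alpha> \<noteq> 0 \<and> \<bar>Im (of_real t * cis \<alpha>)\<bar> \<le> sin \<phi>1 * norm (of_real t * cis \<alpha>)" if "0 < t" for t
      using that al by (auto simp: norm_mult abs_mult)
    have "continuous_on {z. z \<noteq> 0 \<and> \<bar>Im z\<bar> \<le> sin \<phi>1 * norm z} K"
      using Kd by (auto intro!: continuous_at_imp_continuous_on has_derivative_continuous)
    then have "continuous_on {0<..} (\<lambda>t. K (of_real t * cis \<alpha>))"
      by (rule continuous_on_compose2) (use zz in \<open>auto intro!: continuous_intros\<close>)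
    then show "continuous_on {0<..} (\<lambda>t. cs (g (of_real t * cis \<alpha>)) o\<^sub>L K (of_real t * cis \<alpha>))"
      by (intro op.continuous_on H0_ray_continuous[OF g al2])
    fix t :: real assume t: "0 < t"
    let ?z = "of_real t * cis \<alpha>"
    have "norm (K ?z) \<le> D / t" using Kb[of ?z] zz[OF t] t by (simp add: norm_mult pos_le_divide_eq mult.commute)
    then have "norm (g ?z) * norm (K ?z) * B \<le> norm (g ?z) * (D / t) * B"
      using B by (intro mult_right_mono mult_left_mono) auto
    then show "norm (cs (g ?z) o\<^sub>L K ?z) \<le> (D * B) * norm (g ?z / ?z)"
      using B(1)[of "g ?z" "K ?z"] t by (simp add: norm_divide norm_mult mult_ac)
  qed
  then show "op.gam_ok (\<lambda>z. cs (g z) o\<^sub>L op.gam (\<lambda>s. cs (1 / (z - s)) o\<^sub>L (cs (f s) o\<^sub>L R s)) \<phi>2) \<phi>1"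
    using s1 unfolding op.gam_ok_def K_def F_def by auto
  have "op.ray (\<lambda>z. cs (g z) o\<^sub>L K z) (\<mu> - \<phi>1) = op.ray (\<lambda>z. cs (g z) o\<^sub>L K z) (\<mu> + \<phi>1)" if mu: "\<mu> \<in> {0, pi}" for \<mu>
  proof (rule op.rays_eq[where \<mu> = \<mu> and F' = "\<lambda>z. (cs (deriv g z) o\<^sub>L K z) + (cs (g z) o\<^sub>L K' z)"])
    have p1: "0 < \<phi>1" "\<phi>1 < pi / 2" using phi omega by auto
    show "\<mu> - \<phi>1 \<le> \<mu> + \<phi>1" using p1 by simp
    show "0 \<le> cos (\<alpha> - \<mu>)" if "\<mu> - \<phi>1 \<le> \<alpha>" "\<alpha> \<le> \<mu> + \<phi>1" for \<alpha>
      using that p1 by (intro cos_ge_zero) auto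
    have sec: "z \<noteq> 0" "\<bar>Im z\<bar> \<le> sin \<phi>1 * norm z" "z \<in> dcone (sin \<theta>)" if "z \<in> sector (\<mu> - \<phi>1) (\<mu> + \<phi>1)" for z
      using sector_in_dcone[OF that mu p1] inner by auto
    have fc: "continuous_on (sector (\<mu> - \<phi>1) (\<mu> + \<phi>1)) g" "continuous_on (sector (\<mu> - \<phi>1) (\<mu> + \<phi>1)) (deriv g)"
      using sec by (auto intro!: continuous_on_subset[OF holomorphic_on_imp_continuous_on] holomorphic_deriv hol open_dcone)
    have Kc: "continuous_on (sector (\<mu> - \<phi>1) (\<mu> + \<phi>1)) K" "continuous_on (sector (\<mu> - \<phi>1) (\<mu> + \<phi>1)) K'"
      using sec K'c by (auto intro!: continuous_at_imp_continuous_on has_derivative_continuous[OF Kd])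
    show "op.mderiv (\<lambda>z. cs (g z) o\<^sub>L K z) ((cs (deriv g z) o\<^sub>L K z) + (cs (g z) o\<^sub>L K' z)) z" if "z \<in> sector (\<mu> - \<phi>1) (\<mu> + \<phi>1)" for z
      using sec[OF that] by (intro op.mderiv_mult Kd holomorphic_derivI[OF hol open_dcone]) auto
    show "continuous_on (sector (\<mu> - \<phi>1) (\<mu> + \<phi>1)) (\<lambda>z. (cs (deriv g z) o\<^sub>L K z) + (cs (g z) o\<^sub>L K' z))"
      by (intro continuous_on_add op.continuous_on fc Kc)
    show "norm z * norm (cs (g z) o\<^sub>L K z) \<le> M * D * B" if "z \<in> sector (\<mu> - \<phi>1) (\<mu> + \<phi>1)" for z
    proof -
      have "norm z * norm (cs (g z) o\<^sub>L K z) \<le> norm z * (norm (g z) * norm (K z) * B)" by (intro mult_left_mono B) auto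
      also have "\<dots> = norm (g z) * (norm z * norm (K z)) * B" by simp
      also have "\<dots> \<le> M * D * B" using sec[OF that] M Kb B by (intro mult_right_mono mult_mono) auto
      finally show ?thesis .
    qed
  qed (use ok sins[OF mu] in auto)
  from this[of 0] this[of pi]
  show "op.gam (\<lambda>z. cs (g z) o\<^sub>L op.gam (\<lambda>s. cs (1 / (z - s)) o\<^sub>L (cs (f s) o\<^sub>L R s)) \<phi>2) \<phi>1 = 0"
    unfolding K_def F_def by (simp add: op.gam_def[of _ \<phi>1])
qed

text \<open>The operator of \<open>f\<close> is written over the wider angle \<open>\<phi>2\<close>,
  so every \<open>z\<close> on the contour of \<open>g\<close> is inside and
  \<open>Phi_R_inside\<close> applies under the integral. Its first term integrates to the operator
  of the product; the second is the integral shown to vanish in \<open>Phi_mult_aux\<close>.\<close>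

lemma Phi_mult:
  assumes f: "f \<in> H0 \<theta>" and g: "g \<in> H0 \<theta>" and phi: "\<omega> < \<phi>" "\<phi> < \<theta>" "\<theta> < pi / 2"
  shows "Phi f \<phi> o\<^sub>L Phi g \<phi> = Phi (\<lambda>z. f z * g z) \<phi>"
proof -
  obtain \<phi>2 where phi2: "\<phi> < \<phi>2" "\<phi>2 < \<theta>" using dense phi by blast
  have p2: "\<omega> < \<phi>2" using phi phi2 by simp
  let ?c = "cs (1 / (2 * of_real pi * \<i>))"
  define K where "K z = op.gam (\<lambda>s. cs (1 / (z - s)) o\<^sub>L (cs (f s) o\<^sub>L R s)) \<phi>2" for z
  have s1: "sin \<phi> < sin \<phi>2" "0 < sin \<phi>"
    using sin_mono_quarter[of \<phi> \<phi>2] phi2 phi omega by auto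
  note gok = Phi_ok[OF g phi]
  note fgok = Phi_ok[OF H0_mult[OF f g] phi]
  note Kok = Phi_mult_aux(1)[OF f g phi(1) phi2 phi(3), folded K_def]
  have comm: "Phi f \<phi>2 o\<^sub>L cs c = cs c o\<^sub>L Phi f \<phi>2" for c by (rule Phi_cs_comm[OF f p2 phi2(2) phi(3)])
  have "Phi f \<phi>2 o\<^sub>L op.gam (\<lambda>z. cs (g z) o\<^sub>L R z) \<phi> = op.gam (\<lambda>z. Phi f \<phi>2 o\<^sub>L (cs (g z) o\<^sub>L R z)) \<phi>"
    by (rule gam_compose_left(1)[OF gok comm, symmetric])
  also have "\<dots> = op.gam (\<lambda>z. (cs (f z * g z) o\<^sub>L R z) + (?c o\<^sub>L (cs (g z) o\<^sub>L K z))) \<phi>"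
  proof (rule op.gam_cong)
    fix z :: complex assume z: "z \<noteq> 0" "\<bar>Im z\<bar> = \<bar>sin \<phi>\<bar> * norm z"
    then have zO: "z \<in> Om" using phi by (intro Om_on_gam) auto
    have zi: "\<bar>Im z\<bar> < sin \<phi>2 * norm z" using z s1 by simp
    have gok2: "op.gam_ok (\<lambda>s. cs (f s / (s - z)) o\<^sub>L R s) \<phi>2"
      by (rule Phi_R(2)[OF f p2 phi2(2) phi(3) zO]) (use zi in simp)
    have "cs (1 / (z - s)) o\<^sub>L (cs (f s) o\<^sub>L R s) = cs (- 1) o\<^sub>L (cs (f s / (s - z)) o\<^sub>L R s)" for s
    proof -
      have "1 / (z - s) * f s = - 1 * (f s / (s - z))" by (cases "z = s") (auto simp: field_simps)
      then show ?thesis by (simp only: blinfun_compose_assoc[symmetric] cs_mult[symmetric])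
    qed
    then have "K z = cs (- 1) o\<^sub>L op.gam (\<lambda>s. cs (f s / (s - z)) o\<^sub>L R s) \<phi>2"
      unfolding K_def by (simp only: op.gam_scale[OF gok2])
    then have cK: "?c o\<^sub>L K z = - Phi (\<lambda>s. f s / (s - z)) \<phi>2"
      by (simp add: Phi_def cs_minus cs_one blinfun_compose_simps)
    have "Phi f \<phi>2 o\<^sub>L (cs (g z) o\<^sub>L R z) = cs (g z) o\<^sub>L (Phi f \<phi>2 o\<^sub>L R z)"
      by (simp add: blinfun_compose_assoc[symmetric] comm)
    also have "\<dots> = cs (g z) o\<^sub>L ((cs (f z) o\<^sub>L R z) + (?c o\<^sub>L K z))"
      unfolding Phi_R_inside[OF f p2 phi2(2) phi(3) zO zi] cK by simp
    also have "\<dots> = (cs (f z * g z) o\<^sub>L R z) + (?c o\<^sub>L (cs (g z) o\<^sub>L K z))"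
      by (simp add: blinfun_compose_simps(2) blinfun_compose_assoc[symmetric] cs_mult[symmetric] mult.commute)
    finally show "Phi f \<phi>2 o\<^sub>L (cs (g z) o\<^sub>L R z) = (cs (f z * g z) o\<^sub>L R z) + (?c o\<^sub>L (cs (g z) o\<^sub>L K z))" .
  qed
  also have "\<dots> = op.gam (\<lambda>z. cs (f z * g z) o\<^sub>L R z) \<phi> + op.gam (\<lambda>z. ?c o\<^sub>L (cs (g z) o\<^sub>L K z)) \<phi>"
    by (rule op.gam_add[OF fgok op.gam_ok_scale[OF Kok]])
  also have "op.gam (\<lambda>z. ?c o\<^sub>L (cs (g z) o\<^sub>L K z)) \<phi> = 0"
    unfolding op.gam_scale[OF Kok] Phi_mult_aux(2)[OF f g phi(1) phi2 phi(3), folded K_def] by simp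
  finally have "Phi f \<phi>2 o\<^sub>L op.gam (\<lambda>z. cs (g z) o\<^sub>L R z) \<phi> = op.gam (\<lambda>z. cs (f z * g z) o\<^sub>L R z) \<phi>" by simp
  then have "Phi f \<phi>2 o\<^sub>L Phi g \<phi> = Phi (\<lambda>z. f z * g z) \<phi>"
    unfolding Phi_def[of g] Phi_def[of "\<lambda>z. f z * g z"] by (simp only: blinfun_compose_assoc[symmetric] comm) (simp only: blinfun_compose_assoc)
  then show ?thesis using Phi_angle[OF f phi(1,2) p2 phi2(2) phi(3)] by simp
qed

end

subsection \<open>Adjoining \<open>1 / (1 + z\<^sup>2)\<close>\<close>

lemma unit_separation:
  assumes th: "0 < \<theta>" "\<theta> < pi / 2" and z: "\<bar>Im z\<bar> \<le> sin \<theta> * norm z" and w: "w = \<i> \<or> w = - \<i>"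
  shows "(1 - sin \<theta>) / 4 * (1 + norm z) \<le> norm (z - w)"
proof -
  have s: "0 \<le> sin \<theta>" "sin \<theta> < 1" using sin_mono_quarter[of "\<theta>/2" \<theta>] th by auto
  have "1 * norm w \<le> \<bar>Im w\<bar>" using w by auto
  from cone_separation_sum[OF z this s(1)] s w show ?thesis by (auto simp: add.commute)
qed

lemma
  assumes th: "0 < \<theta>" "\<theta> < pi / 2" and w: "w = \<i> \<or> w = - \<i>"
  shows inverse_diff_i_holomorphic: "(\<lambda>z. 1 / (z - w)) holomorphic_on dcone (sin \<theta>)"
    and inverse_diff_i_bounded: "\<And>z. z \<in> dcone (sin \<theta>) \<Longrightarrow> norm (1 / (z - w)) \<le> 4 / (1 - sin \<theta>)"
    and diff_i_nonzero: "\<And>z. z \<in> dcone (sin \<theta>) \<Longrightarrow> z \<noteq> w"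
proof -
  have s: "sin \<theta> < 1" using sin_mono_quarter[of "\<theta>/2" \<theta>] th by auto
  have le: "(1 - sin \<theta>) / 4 \<le> norm (z - w)" if "z \<in> dcone (sin \<theta>)" for z
  proof -
    have "(1 - sin \<theta>) / 4 * 1 \<le> (1 - sin \<theta>) / 4 * (1 + norm z)" using s by (intro mult_left_mono) auto
    also have "\<dots> \<le> norm (z - w)" by (rule unit_separation[OF th _ w]) (use that in \<open>simp add: dcone_def\<close>)
    finally show ?thesis by simp
  qed
  show nz: "z \<noteq> w" if "z \<in> dcone (sin \<theta>)" for z using le[OF that] s by auto
  show "(\<lambda>z. 1 / (z - w)) holomorphic_on dcone (sin \<theta>)" by (intro holomorphic_intros) (use nz in auto)
  show "norm (1 / (z - w)) \<le> 4 / (1 - sin \<theta>)" if "z \<in> dcone (sin \<theta>)" for z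
  proof -
    have "1 / norm (z - w) \<le> 1 / ((1 - sin \<theta>) / 4)" using le[OF that] s by (intro frac_le) auto
    then show ?thesis by (simp add: norm_divide)
  qed
qed

text \<open>The difference equals \<open>f z / (z - 1)\<close> with
  \<open>f z = (w - 1) / 2 / (z - w)\<close> holomorphic on the cone and
  \<open>f 1 = - 1 / 2\<close>. This \<open>f\<close> does not vanish at 0 and so is not in
  \<open>H0\<close>; hence Cauchy's formula is applied on the right half cone itself, and the left
  half contributes nothing.\<close>

lemma gam_partial_fraction:
  assumes phi: "0 < \<phi>" "\<phi> < \<theta>" "\<theta> < pi / 2" and w: "w = \<i> \<or> w = - \<i>"
  shows "cx.gam (\<lambda>z. (1 / (z - w) - 1 / (z - 1)) / 2) \<phi> = - of_real pi * \<i>"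
    and "cx.gam_ok (\<lambda>z. (1 / (z - w) - 1 / (z - 1)) / 2) \<phi>"
proof -
  note sn = sin_mono_quarter[OF phi]
  have th: "0 < \<theta>" using phi by simp
  define f where "f z = (w - 1) / 2 / (z - w)" for z
  define q where "q z = (1 / (z - w) - 1 / (z - 1)) / 2" for z
  have w1: "w \<noteq> 1" using w by (auto simp: complex_eq_iff)
  have q: "q z = f z / (z - 1)" if "z \<noteq> w" "z \<noteq> 1" for z
    using that by (simp add: q_def f_def diff_frac_eq)
  have out: "z \<noteq> w \<and> z \<noteq> 1" if "z \<noteq> 0" "\<bar>Im z\<bar> = \<bar>sin \<phi>\<bar> * norm z" for z
    using that sn w by auto
  have qf: "cx.gam q \<phi> = cx.gam (\<lambda>z. f z / (z - 1)) \<phi>" "cx.gam_ok q \<phi> = cx.gam_ok (\<lambda>z. f z / (z - 1)) \<phi>"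
    by (intro cx.gam_cong cx.gam_ok_cong q; use out in auto)+
  have fh: "f holomorphic_on dcone (sin \<theta>) \<inter> {z. 0 < cos \<mu> * Re z}" for \<mu>
    unfolding f_def using diff_i_nonzero[OF th phi(3) w] by (intro holomorphic_intros) auto
  define M where "M = norm (w - 1) / 2 * (4 / (1 - sin \<theta>))"
  have fb: "norm (f z) \<le> M" if "z \<in> dcone (sin \<theta>)" for z
  proof -
    have "norm (f z) = norm ((w - 1) / 2) * norm (1 / (z - w))"
      by (simp only: f_def norm_mult[symmetric] times_divide_eq_right mult_1_right)
    then have "norm (f z) = norm (w - 1) / 2 * norm (1 / (z - w))" by (simp only: norm_divide norm_numeral)
    also have "\<dots> \<le> M" unfolding M_def by (intro mult_left_mono inverse_diff_i_bounded[OF th phi(3) w that]) auto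
    finally show ?thesis .
  qed
  define c where "c = (1 - sin \<theta>) / 4 * (sin \<phi> / 4)"
  have c: "0 < c" using sn by (simp add: c_def)
  have ok: "ray_ok (\<lambda>z. f z / (z - 1)) \<alpha>" if al: "\<bar>sin \<alpha>\<bar> = sin \<phi>" for \<alpha>
  proof (rule ray_ok_quadratic_decay)
    let ?z = "\<lambda>t. complex_of_real t * cis \<alpha>"
    have im: "\<bar>Im (?z t)\<bar> = sin \<phi> * norm (?z t)" "norm (?z t) = t" "?z t \<noteq> 0" if "0 < t" for t
      using that al by (simp_all add: norm_mult abs_mult)
    have nz: "?z t \<noteq> w \<and> ?z t \<noteq> 1" if "0 < t" for t using out[of "?z t"] im[OF that] sn by simp
    show "continuous_on {0<..} (\<lambda>t. f (?z t) / (?z t - 1))"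
      unfolding f_def by (intro continuous_intros) (use nz in auto)
    fix t :: real assume t: "0 < t"
    have "sin \<phi> * norm (?z t) \<le> sin \<theta> * norm (?z t)" using sn by (intro mult_right_mono) auto
    then have "(1 - sin \<theta>) / 4 * (1 + norm (?z t)) \<le> norm (?z t - w)"
      by (intro unit_separation[OF th phi(3) _ w]) (use im(1)[OF t] in linarith)
    then have 1: "(1 - sin \<theta>) / 4 * (1 + t) \<le> norm (?z t - w)" by (simp only: im(2)[OF t])
    have "(sin \<phi> - 0) * (norm (1::complex) + norm (?z t)) \<le> 4 * norm (1 - ?z t)"
      by (rule cone_separation_sum) (use im[OF t] sn in auto)
    then have 2: "sin \<phi> / 4 * (1 + t) \<le> norm (?z t - 1)" using im(2)[OF t] by (simp add: norm_minus_commute)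
    have "c * (1 + t\<^sup>2) \<le> c * ((1 + t) * (1 + t))" using c t by (intro mult_left_mono) (auto simp: power2_eq_square algebra_simps)
    also have "\<dots> = ((1 - sin \<theta>) / 4 * (1 + t)) * (sin \<phi> / 4 * (1 + t))" by (simp add: c_def mult_ac)
    also have "\<dots> \<le> norm (?z t - w) * norm (?z t - 1)" using sn t by (intro mult_mono 1 2) auto
    finally have le: "c * (1 + t\<^sup>2) \<le> norm (?z t - w) * norm (?z t - 1)" .
    have p: "0 < c * (1 + t\<^sup>2)" using c by (simp add: add_pos_nonneg)
    have "norm (f (?z t) / (?z t - 1)) = (norm (w - 1) / 2) / (norm (?z t - w) * norm (?z t - 1))"
      by (simp only: f_def norm_divide norm_mult norm_numeral divide_divide_eq_left mult.assoc)
    also have "\<dots> \<le> (norm (w - 1) / 2) / (c * (1 + t\<^sup>2))" using le p by (intro divide_left_mono[OF le] mult_pos_pos[OF order_less_le_trans[OF p le] p]) auto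
    finally show "norm (f (?z t) / (?z t - 1)) \<le> (norm (w - 1) / 2 / c) / (1 + t\<^sup>2)" by simp
  qed
  then have ok2: "cx.gam_ok (\<lambda>z. f z / (z - 1)) \<phi>" unfolding cx.gam_ok_def using sn by auto
  then show "cx.gam_ok (\<lambda>z. (1 / (z - w) - 1 / (z - 1)) / 2) \<phi>" using qf(2) by (simp add: q_def[abs_def])
  have right: "cx.ray (\<lambda>z. f z / (z - 1)) (0 - \<phi>) - cx.ray (\<lambda>z. f z / (z - 1)) (0 + \<phi>) = 2 * of_real pi * \<i> * f 1"
    by (rule half_cone_Cauchy[OF _ _ _ _ fh fb]) (use phi sn ok in auto)
  have f1: "f 1 = - 1 / 2" using w1 by (simp add: f_def divide_simps)
  have left: "cx.ray (\<lambda>z. f z / (z - 1)) (pi - \<phi>) = cx.ray (\<lambda>z. f z / (z - 1)) (pi + \<phi>)"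
  proof (rule half_cone_rays_eq)
    show "(\<lambda>z. f z / (z - 1)) holomorphic_on dcone (sin \<theta>) \<inter> {z. 0 < cos pi * Re z}"
      by (intro holomorphic_intros fh) auto
    fix z assume z: "\<bar>Im z\<bar> \<le> sin \<phi> * norm z" "0 < cos pi * Re z"
    have z0: "0 < norm z" using z(2) by auto
    then have zc: "z \<in> dcone (sin \<theta>)" using z(1) sn by (auto simp: dcone_def intro: le_less_trans)
    have "(norm z)\<^sup>2 \<le> (norm (z - 1))\<^sup>2" unfolding cmod_power2 using z(2) by (simp add: power2_eq_square algebra_simps)
    then have "norm z \<le> norm (z - 1)" by (rule power2_le_imp_le) simp
    then have "norm z / norm (z - 1) \<le> 1" using z0 by (simp add: divide_simps)
    then have "norm z / norm (z - 1) * norm (f z) \<le> 1 * M" by (intro mult_mono fb zc) auto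
    then show "norm z * norm (f z / (z - 1)) \<le> M" by (simp add: norm_divide)
  qed (use phi sn ok in auto)
  have "cx.gam q \<phi> = 2 * of_real pi * \<i> * (- 1 / 2)"
    unfolding qf(1) using right left f1 by (simp add: cx.gam_def)
  then show "cx.gam (\<lambda>z. (1 / (z - w) - 1 / (z - 1)) / 2) \<phi> = - of_real pi * \<i>"
    by (simp add: q_def[abs_def])
qed

context bisector_resolvent
begin

text \<open>This is \<open>(1 + T^2)^-1\<close>, since \<open>(i - T)(- i - T) = 1 + T^2\<close>;
  the identification is \<open>Q_eq\<close>.\<close>

definition Q :: "'x \<Rightarrow>\<^sub>L 'x" where "Q = R \<i> o\<^sub>L R (- \<i>)"

lemma i_in_Om: "\<i> \<in> Om" "- \<i> \<in> Om"
  using sin_mono_quarter[of "\<omega>/2" \<omega>] omega by (auto simp: Om_def)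

text \<open>Both \<open>\<i>\<close> and \<open>- \<i>\<close> lie outside the contour, so two
  applications of \<open>Phi_R_outside\<close> multiply \<open>f\<close> by
  \<open>1 / ((z - \<i>) (z + \<i>))\<close>.\<close>

lemma Phi_Q:
  assumes f: "f \<in> H0 \<theta>" and phi: "\<omega> < \<phi>" "\<phi> < \<theta>" "\<theta> < pi / 2"
  shows "Phi f \<phi> o\<^sub>L Q = Phi (\<lambda>z. 1 / (1 + z\<^sup>2) * f z) \<phi>" "Q o\<^sub>L Phi f \<phi> = Phi f \<phi> o\<^sub>L Q"
proof -
  have th: "0 < \<theta>" using phi omega by simp
  have sn: "sin \<phi> < 1" using sin_mono_quarter[of \<phi> \<theta>] phi omega by auto
  have 1: "(\<lambda>z. f z / (z - \<i>)) \<in> H0 \<theta>"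
    using H0_mult_bounded[OF f inverse_diff_i_holomorphic[OF th phi(3)] inverse_diff_i_bounded[OF th phi(3)], of \<i>] by simp
  have "Phi f \<phi> o\<^sub>L Q = (Phi f \<phi> o\<^sub>L R \<i>) o\<^sub>L R (- \<i>)" by (simp add: Q_def blinfun_compose_assoc)
  also have "\<dots> = - (Phi (\<lambda>z. f z / (z - \<i>)) \<phi> o\<^sub>L R (- \<i>))"
    using Phi_R_outside[OF f phi, of \<i>] sn by (simp add: blinfun_compose_simps)
  also have "\<dots> = Phi (\<lambda>z. f z / (z - \<i>) / (z - (- \<i>))) \<phi>"
    using Phi_R_outside[OF 1 phi, of "- \<i>"] sn by simp
  also have "\<dots> = Phi (\<lambda>z. 1 / (1 + z\<^sup>2) * f z) \<phi>"
  proof (rule Phi_cong[OF _ phi])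
    fix z
    have "(z - \<i>) * (z - (- \<i>)) = 1 + z\<^sup>2" by (simp add: algebra_simps power2_eq_square)
    then show "f z / (z - \<i>) / (z - (- \<i>)) = 1 / (1 + z\<^sup>2) * f z" by (simp only: divide_divide_eq_left) simp
  qed
  finally show "Phi f \<phi> o\<^sub>L Q = Phi (\<lambda>z. 1 / (1 + z\<^sup>2) * f z) \<phi>" .
  show "Q o\<^sub>L Phi f \<phi> = Phi f \<phi> o\<^sub>L Q"
    unfolding Q_def by (intro blinfun_commute_compose Phi_R_comm[OF f phi] i_in_Om)
qed

text \<open>
  By the resolvent equation \<open>S R(z) - S / (z - 1)\<close>, which is holomorphic off the double cone, differs from
  \<open>z / (1 + z\<^sup>2) R(z)\<close> by scalar multiples of \<open>R(\<plusminus>i)\<close>. The pole at 1 only serves to make these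
  multiples integrable at infinity.
\<close>

lemma Phi_id_over_one_plus_square:
  assumes phi: "\<omega> < \<phi>" "\<phi> < \<theta>" "\<theta> < pi / 2"
  shows "Phi (\<lambda>z. z / (1 + z\<^sup>2)) \<phi> = (- 1 / 2) *\<^sub>R (R \<i> + R (- \<i>))"
proof -
  \<comment> \<open>The expected value: \<open>z / (1 + z\<^sup>2)\<close> is half the sum of
    \<open>1 / (z - \<i>)\<close> and \<open>1 / (z + \<i>)\<close>, and \<open>1 / (z - w)\<close>
    corresponds to \<open>- R w\<close>.\<close>
  define S where "S = (- 1 / 2) *\<^sub>R (R \<i> + R (- \<i>))"
  define h where "h z = z / (1 + z\<^sup>2)" for z :: complex
  define q where "q w z = (1 / (z - w) - 1 / (z - 1)) / 2" for w z :: complex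
  define F where "F z = (S o\<^sub>L R z) - (cs (1 / (z - 1)) o\<^sub>L S)" for z
  define G where "G z = (cs (h z) o\<^sub>L R z) - (cs (q \<i> z) o\<^sub>L R \<i>) - (cs (q (- \<i>) z) o\<^sub>L R (- \<i>))" for z
  have p0: "0 < \<phi>" "0 < \<theta>" "\<phi> < pi / 2" using phi omega by auto
  note sn = sin_mono_quarter[OF p0(1) phi(2,3)]
  have so: "sin \<omega> < sin \<phi>" using sin_mono_quarter[of \<omega> \<phi>] phi omega by auto
  have hH: "h \<in> H0 \<theta>" unfolding h_def[abs_def] by (rule H0_id_over_one_plus_square[OF p0(2) phi(3)])
  have FG: "F z = G z" if z: "z \<noteq> 0" "\<bar>Im z\<bar> = \<bar>sin \<phi>\<bar> * norm z" for z
  proof -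
    have zO: "z \<in> Om" by (rule Om_on_gam[OF phi(1) p0(3) z])
    have zi: "z \<noteq> \<i>" "z \<noteq> - \<i>" "z \<noteq> 1" using z sn by auto
    have m: "R w o\<^sub>L R z = (cs (1 / (w - z)) o\<^sub>L R z) - (cs (1 / (w - z)) o\<^sub>L R w)" if "w \<in> Om" "w \<noteq> z" for w
      using R_mult[OF that(1) zO that(2)] by (simp add: blinfun_compose_simps)
    have half: "(- 1 / 2) *\<^sub>R A = cs (- 1 / 2) o\<^sub>L A" for A :: "'x \<Rightarrow>\<^sub>L 'x"
      using cs_of_real[of "- 1 / 2"] by (simp add: blinfun_compose_simps)
    have e: "cs a o\<^sub>L (cs b o\<^sub>L A) = cs (a * b) o\<^sub>L A" for a b and A :: "'x \<Rightarrow>\<^sub>L 'x"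
      by (simp add: cs_mult blinfun_compose_assoc)
    have nz: "\<i> - z \<noteq> 0" "- \<i> - z \<noteq> 0" "1 + z\<^sup>2 \<noteq> 0" "z - \<i> \<noteq> 0" "z - (- \<i>) \<noteq> 0"
    proof -
      show "\<i> - z \<noteq> 0" "- \<i> - z \<noteq> 0" "z - \<i> \<noteq> 0" "z - (- \<i>) \<noteq> 0" using zi by (auto simp: algebra_simps add_eq_0_iff)
      have "1 + z\<^sup>2 = (z - \<i>) * (z + \<i>)" by (simp add: algebra_simps power2_eq_square)
      moreover have "z + \<i> \<noteq> 0" using zi by (auto simp: add_eq_0_iff2)
      ultimately show "1 + z\<^sup>2 \<noteq> 0" using zi by simp
    qed
    have hz: "- 1 / 2 * (1 / (\<i> - z)) + - 1 / 2 * (1 / (- \<i> - z)) = h z"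
    proof -
      have "(\<i> - z) * (- \<i> - z) = 1 + z\<^sup>2" by (simp add: algebra_simps power2_eq_square)
      then show ?thesis using nz unfolding h_def by (simp add: divide_simps) (simp add: algebra_simps)
    qed
    have q1: "- 1 / 2 * (1 / (w - z)) + 1 / (z - 1) * (- 1 / 2) = q w z" if "z - w \<noteq> 0" for w
      using that zi unfolding q_def by (simp add: divide_simps) (simp add: algebra_simps)
    have "S o\<^sub>L R z = cs (- 1 / 2) o\<^sub>L ((R \<i> o\<^sub>L R z) + (R (- \<i>) o\<^sub>L R z))"
      by (simp only: S_def half blinfun_compose_assoc blinfun_compose_simps(1))
    also have "\<dots> = (cs (- 1 / 2 * (1 / (\<i> - z))) o\<^sub>L R z) - (cs (- 1 / 2 * (1 / (\<i> - z))) o\<^sub>L R \<i>)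
        + ((cs (- 1 / 2 * (1 / (- \<i> - z))) o\<^sub>L R z) - (cs (- 1 / 2 * (1 / (- \<i> - z))) o\<^sub>L R (- \<i>)))"
      unfolding m[OF i_in_Om(1) zi(1)[symmetric]] m[OF i_in_Om(2) zi(2)[symmetric]]
      by (simp only: blinfun_compose_simps(2,4) e)
    also have "\<dots> = (cs (h z) o\<^sub>L R z) - (cs (- 1 / 2 * (1 / (\<i> - z))) o\<^sub>L R \<i>) - (cs (- 1 / 2 * (1 / (- \<i> - z))) o\<^sub>L R (- \<i>))"
      unfolding hz[symmetric] cs_add blinfun_compose_simps(1) by simp
    finally have 1: "S o\<^sub>L R z = \<dots>" .
    have 2: "cs (1 / (z - 1)) o\<^sub>L S = (cs (1 / (z - 1) * (- 1 / 2)) o\<^sub>L R \<i>) + (cs (1 / (z - 1) * (- 1 / 2)) o\<^sub>L R (- \<i>))"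
      by (simp only: S_def half blinfun_compose_simps(2) e)
    show ?thesis
      unfolding F_def G_def 1 2 q1[OF nz(4), symmetric] q1[OF nz(5), symmetric] cs_add blinfun_compose_simps(1) by simp
  qed
  note qok = gam_partial_fraction(2)[OF p0(1) phi(2,3), folded q_def]
  note qv = gam_partial_fraction(1)[OF p0(1) phi(2,3), folded q_def]
  have okG: "op.gam_ok G \<phi>"
    unfolding G_def[abs_def] by (intro op.gam_ok_diff Phi_ok[OF hH phi] gam_scalar(2) qok) auto
  have okF: "op.gam_ok F \<phi>" using okG op.gam_ok_cong[OF FG] by simp
  have Scs: "S o\<^sub>L cs c = cs c o\<^sub>L S" for c
    unfolding S_def by (simp add: blinfun_compose_simps R_cs_Om i_in_Om)
  obtain C where C: "C \<ge> 0" "\<And>z. z \<noteq> 0 \<Longrightarrow> sin \<phi> * norm z \<le> \<bar>Im z\<bar> \<Longrightarrow> norm z * norm (R z) \<le> C"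
    using R_bound[OF so] by blast
  obtain B where B: "\<And>c (A :: 'x \<Rightarrow>\<^sub>L 'x). norm (cs c o\<^sub>L A) \<le> norm c * norm A * B" "0 \<le> B"
    using op.nonneg_bounded by blast
  have rays: "op.ray F \<alpha>1 = op.ray F \<alpha>2"
    if al: "\<alpha>1 \<le> \<alpha>2" "\<alpha>2 - \<alpha>1 \<le> pi" and s: "\<And>\<alpha>. \<alpha>1 \<le> \<alpha> \<Longrightarrow> \<alpha> \<le> \<alpha>2 \<Longrightarrow> sin \<phi> \<le> \<bar>sin \<alpha>\<bar>"
      and ok: "ray_ok F \<alpha>1" "ray_ok F \<alpha>2" for \<alpha>1 \<alpha>2
  proof (rule op.rays_eq[OF al(1) _ _ _ _ ok, where \<mu> = "(\<alpha>1 + \<alpha>2) / 2"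
        and F' = "\<lambda>z. (S o\<^sub>L - (R z o\<^sub>L R z)) - ((cs (- 1 / (z - 1)\<^sup>2) o\<^sub>L S) + (cs (1 / (z - 1)) o\<^sub>L 0))"])
    show "0 \<le> cos (\<alpha> - (\<alpha>1 + \<alpha>2) / 2)" if "\<alpha>1 \<le> \<alpha>" "\<alpha> \<le> \<alpha>2" for \<alpha>
      using that al by (intro cos_ge_zero) (auto simp: field_simps)
    have sec: "z \<noteq> 0 \<and> sin \<phi> * norm z \<le> \<bar>Im z\<bar> \<and> z \<in> Om \<and> z \<noteq> 1" if zs: "z \<in> sector \<alpha>1 \<alpha>2" for z
    proof -
      obtain t \<alpha> where z: "z = of_real t * cis \<alpha>" "0 < t" "\<alpha>1 \<le> \<alpha>" "\<alpha> \<le> \<alpha>2" using zs by (auto simp: sector_def)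
      have a: "sin \<phi> \<le> \<bar>sin \<alpha>\<bar>" using s z by auto
      have i: "sin \<phi> * norm z \<le> \<bar>Im z\<bar>" "z \<noteq> 0" using a z by (auto simp: norm_mult abs_mult)
      have "sin \<omega> * norm z < sin \<phi> * norm z" using so i by simp
      from less_le_trans[OF this i(1)] have "z \<in> Om" by (simp add: Om_def)
      moreover have "z \<noteq> 1" using i(1) sn by auto
      ultimately show ?thesis using i by blast
    qed
    have Rc: "continuous_on (sector \<alpha>1 \<alpha>2) R"
      using R_cont sec by (auto intro!: continuous_at_imp_continuous_on)
    show "continuous_on (sector \<alpha>1 \<alpha>2) (\<lambda>z. (S o\<^sub>L - (R z o\<^sub>L R z)) - ((cs (- 1 / (z - 1)\<^sup>2) o\<^sub>L S) + (cs (1 / (z - 1)) o\<^sub>L 0)))"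
      by (intro continuous_intros op.continuous_on Rc bounded_bilinear.continuous_on[OF bounded_bilinear_blinfun_compose])
        (use sec in auto)
    show "op.mderiv F ((S o\<^sub>L - (R z o\<^sub>L R z)) - ((cs (- 1 / (z - 1)\<^sup>2) o\<^sub>L S) + (cs (1 / (z - 1)) o\<^sub>L 0))) z"
      if zs: "z \<in> sector \<alpha>1 \<alpha>2" for z
      unfolding F_def
    proof (intro op.mderiv_diff op.mderiv_mult)
      have "((\<lambda>z. S o\<^sub>L R z) has_derivative (\<lambda>h. S o\<^sub>L (cs h o\<^sub>L - (R z o\<^sub>L R z)))) (at z)"
        using sec[OF zs]
        by (intro bounded_linear.has_derivative[OF bounded_bilinear.bounded_linear_right[OF bounded_bilinear_blinfun_compose]] R_mderiv) auto
      then show "op.mderiv (\<lambda>z. S o\<^sub>L R z) (S o\<^sub>L - (R z o\<^sub>L R z)) z"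
        by (simp only: blinfun_compose_assoc[symmetric] Scs)
      show "((\<lambda>z. 1 / (z - 1)) has_field_derivative - 1 / (z - 1)\<^sup>2) (at z)"
        using sec[OF zs] by (auto intro!: derivative_eq_intros simp: power2_eq_square)
      show "op.mderiv (\<lambda>z. S) 0 z" by simp
    qed
    show "norm z * norm (F z) \<le> norm S * C + (1 / sin \<phi>) * norm S * B" if zs: "z \<in> sector \<alpha>1 \<alpha>2" for z
    proof -
      have z: "z \<noteq> 0" "sin \<phi> * norm z \<le> \<bar>Im z\<bar>" "z \<noteq> 1" using sec[OF zs] by auto
      have "norm z * norm (S o\<^sub>L R z) \<le> norm z * (norm S * norm (R z))" by (intro mult_left_mono norm_blinfun_compose) auto
      also have "\<dots> = norm S * (norm z * norm (R z))" by simp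
      also have "\<dots> \<le> norm S * C" using C z by (intro mult_left_mono) auto
      finally have 1: "norm z * norm (S o\<^sub>L R z) \<le> norm S * C" .
      have "(sin \<phi> - 0) * norm z \<le> (1 + 0) * norm (1 - z)"
        by (rule cone_separation(1)) (use z sn in auto)
      then have "norm z / norm (z - 1) \<le> 1 / sin \<phi>"
        using sn z by (simp add: divide_simps norm_minus_commute mult.commute)
      then have "norm z / norm (z - 1) * norm S * B \<le> (1 / sin \<phi>) * norm S * B" using B by (intro mult_right_mono) auto
      moreover have "norm z * norm (cs (1 / (z - 1)) o\<^sub>L S) \<le> norm z * (norm (1 / (z - 1)) * norm S * B)" by (intro mult_left_mono B) auto
      ultimately have 2: "norm z * norm (cs (1 / (z - 1)) o\<^sub>L S) \<le> (1 / sin \<phi>) * norm S * B" by (simp add: norm_divide)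
      have "norm z * norm (F z) \<le> norm z * (norm (S o\<^sub>L R z) + norm (cs (1 / (z - 1)) o\<^sub>L S))"
        unfolding F_def by (intro mult_left_mono norm_triangle_ineq4) auto
      then show ?thesis using 1 2 by (simp add: distrib_left)
    qed
  qed
  have F_ok: "ray_ok F (- \<phi>)" "ray_ok F \<phi>" "ray_ok F (pi - \<phi>)" "ray_ok F (pi + \<phi>)"
    using okF unfolding op.gam_ok_def by auto
  \<comment> \<open>The complementary sector below the real axis reaches from
    \<open>\<phi> - pi\<close> to \<open>- \<phi>\<close>; its first edge is the boundary ray listed
    in \<open>gam\<close> under the angle \<open>pi + \<phi>\<close>.\<close>
  have cisp: "cis (\<phi> - pi) = cis (pi + \<phi>)" by (simp add: complex_eq_iff cos_diff sin_diff)
  have per: "op.ray F (\<phi> - pi) = op.ray F (pi + \<phi>)" "ray_ok F (\<phi> - pi)"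
    using F_ok(4) by (simp_all only: op.ray_def ray_ok_def cisp)
  have mono: "sin \<phi> \<le> sin \<alpha>" if "\<phi> \<le> \<alpha>" "\<alpha> \<le> pi - \<phi>" for \<alpha>
  proof (cases "\<alpha> \<le> pi / 2")
    case True then show ?thesis using that p0 by (intro sin_monotone_2pi_le) auto
  next
    case False
    then have "sin \<phi> \<le> sin (pi - \<alpha>)" using that p0 by (intro sin_monotone_2pi_le) auto
    then show ?thesis by simp
  qed
  \<comment> \<open>Instead of closing the contour inside the cone, the rays are joined across the
    complement, where \<open>R\<close> is holomorphic.\<close>
  have up: "op.ray F \<phi> = op.ray F (pi - \<phi>)"
    by (rule rays[OF _ _ _ F_ok(2,3)]) (use p0 mono in \<open>auto intro: order_trans[OF _ abs_ge_self]\<close>)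
  have down: "op.ray F (\<phi> - pi) = op.ray F (- \<phi>)"
  proof (rule rays[OF _ _ _ per(2) F_ok(1)])
    fix \<alpha> assume "\<phi> - pi \<le> \<alpha>" "\<alpha> \<le> - \<phi>"
    then show "sin \<phi> \<le> \<bar>sin \<alpha>\<bar>" using mono[of "- \<alpha>"] by simp
  qed (use p0 in auto)
  have "op.gam G \<phi> = op.gam F \<phi>" by (rule op.gam_cong[OF FG, symmetric])
  also have "\<dots> = 0" unfolding op.gam_def using up down per by simp
  finally have "op.gam G \<phi> = 0" .
  moreover have "op.gam G \<phi> = op.gam (\<lambda>z. cs (h z) o\<^sub>L R z) \<phi> - (cs (- of_real pi * \<i>) o\<^sub>L R \<i>) - (cs (- of_real pi * \<i>) o\<^sub>L R (- \<i>))"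
  proof -
    note a = Phi_ok[OF hH phi] and b = gam_scalar(2)[OF qok[OF disjI1[OF refl]], of "R \<i>"]
      and c = gam_scalar(2)[OF qok[OF disjI2[OF refl]], of "R (- \<i>)"]
    show ?thesis
      unfolding G_def op.gam_diff[OF op.gam_ok_diff[OF a b] c] op.gam_diff[OF a b]
      by (simp add: gam_scalar(1) qok qv)
  qed
  ultimately have "op.gam (\<lambda>z. cs (h z) o\<^sub>L R z) \<phi> = cs (- of_real pi * \<i>) o\<^sub>L (R \<i> + R (- \<i>))"
    by (simp add: blinfun_compose_simps(2) diff_eq_eq)
  then have "Phi h \<phi> = cs (1 / (2 * of_real pi * \<i>) * (- of_real pi * \<i>)) o\<^sub>L (R \<i> + R (- \<i>))"
    by (simp only: Phi_def cs_mult blinfun_compose_assoc)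
  also have "1 / (2 * of_real pi * \<i>) * (- of_real pi * \<i>) = of_real (- 1 / 2)" by simp
  finally show ?thesis by (simp only: cs_of_real h_def[abs_def] blinfun_compose_simps(7) blinfun_compose_id)
qed

text \<open>With \<open>a = R \<i>\<close> and \<open>b = R (- \<i>)\<close>, the value is a quarter
  of \<open>(a + b)\<^sup>2 = (a - b)\<^sup>2 + 4 a b\<close>. Here \<open>a b = Q\<close>, and the
  resolvent equation gives \<open>a - b = - 2 i Q\<close>.\<close>

lemma Phi_square:
  assumes phi: "\<omega> < \<phi>" "\<phi> < \<theta>" "\<theta> < pi / 2"
  shows "Phi (\<lambda>z. z / (1 + z\<^sup>2) * (z / (1 + z\<^sup>2))) \<phi> = Q - (Q o\<^sub>L Q)"
proof -
  have th: "0 < \<theta>" using phi omega by simp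
  have comm: "R (- \<i>) o\<^sub>L R \<i> = Q" unfolding Q_def by (rule R_comm[OF i_in_Om(2,1)])
  have d: "R \<i> - R (- \<i>) = cs (- (2 * \<i>)) o\<^sub>L Q"
    using R_eq[of \<i> "- \<i>"] i_in_Om by (simp add: Om_def Q_def)
  have Qcs: "Q o\<^sub>L cs c = cs c o\<^sub>L Q" for c
    unfolding Q_def by (intro blinfun_commute_compose R_cs_Om[symmetric] i_in_Om)
  have "(R \<i> - R (- \<i>)) o\<^sub>L (R \<i> - R (- \<i>)) = cs (- (2 * \<i>)) o\<^sub>L (Q o\<^sub>L cs (- (2 * \<i>))) o\<^sub>L Q"
    unfolding d by (simp only: blinfun_compose_assoc)
  also have "\<dots> = (cs (- (2 * \<i>)) o\<^sub>L cs (- (2 * \<i>))) o\<^sub>L (Q o\<^sub>L Q)" by (simp only: Qcs blinfun_compose_assoc)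
  also have "cs (- (2 * \<i>)) o\<^sub>L cs (- (2 * \<i>)) = cs (of_real (- 4))" by (simp add: cs_mult[symmetric])
  also have "\<dots> = (- 4) *\<^sub>R id_blinfun" by (rule cs_of_real)
  finally have "(R \<i> - R (- \<i>)) o\<^sub>L (R \<i> - R (- \<i>)) = (- 4) *\<^sub>R (Q o\<^sub>L Q)" by (simp add: blinfun_compose_simps)
  moreover have "((R \<i> + R (- \<i>)) o\<^sub>L (R \<i> + R (- \<i>))) - ((R \<i> - R (- \<i>)) o\<^sub>L (R \<i> - R (- \<i>))) = 4 *\<^sub>R Q"
    by (simp add: blinfun_compose_simps(1-4) comm Q_def[symmetric] scaleR_conv_of_real) (simp add: scaleR_left_distrib[of 2 2 Q, simplified] scaleR_2)
  ultimately have e: "(R \<i> + R (- \<i>)) o\<^sub>L (R \<i> + R (- \<i>)) = 4 *\<^sub>R (Q - (Q o\<^sub>L Q))"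
    by (simp add: eq_diff_eq scaleR_diff_right)
  have "Phi (\<lambda>z. z / (1 + z\<^sup>2) * (z / (1 + z\<^sup>2))) \<phi> = Phi (\<lambda>z. z / (1 + z\<^sup>2)) \<phi> o\<^sub>L Phi (\<lambda>z. z / (1 + z\<^sup>2)) \<phi>"
    using Phi_mult[OF H0_id_over_one_plus_square[OF th phi(3)] H0_id_over_one_plus_square[OF th phi(3)] phi] by simp
  also have "\<dots> = (1 / 4) *\<^sub>R ((R \<i> + R (- \<i>)) o\<^sub>L (R \<i> + R (- \<i>)))"
    unfolding Phi_id_over_one_plus_square[OF phi] by (simp only: blinfun_compose_simps(7,8) scaleR_scaleR) simp
  finally show ?thesis unfolding e by simp
qed

text \<open>\<open>c\<close> is the value at infinity, and \<open>d\<close> is the value at 0 minus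
  the value at infinity.\<close>

definition Psi :: "real \<Rightarrow> real \<Rightarrow> (complex \<Rightarrow> complex) \<Rightarrow> real \<Rightarrow> 'x \<Rightarrow>\<^sub>L 'x" where
  "Psi c d f \<phi> = c *\<^sub>R id_blinfun + d *\<^sub>R Q + Phi f \<phi>"

text \<open>The first term of \<open>k\<close> comes from \<open>(1 / (1 + z\<^sup>2))\<^sup>2 = 1 / (1 + z\<^sup>2) - (z / (1 + z\<^sup>2))\<^sup>2\<close>.\<close>

lemma Psi_mult:
  fixes c d c' d' :: real
  assumes f: "f \<in> H0 \<theta>" and g: "g \<in> H0 \<theta>" and phi: "\<omega> < \<phi>" "\<phi> < \<theta>" "\<theta> < pi / 2"
  defines "k \<equiv> \<lambda>z. of_real (- (d * d')) * (z / (1 + z\<^sup>2) * (z / (1 + z\<^sup>2))) + of_real c * g z + of_real c' * f z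
      + of_real d * (1 / (1 + z\<^sup>2) * g z) + of_real d' * (1 / (1 + z\<^sup>2) * f z) + f z * g z"
  shows "k \<in> H0 \<theta>" and "Psi c d f \<phi> o\<^sub>L Psi c' d' g \<phi> = Psi (c * c') (c * d' + d * c' + d * d') k \<phi>"
proof -
  have th: "0 < \<theta>" using phi omega by simp
  note hH = H0_id_over_one_plus_square[OF th phi(3)]
  have r: "(\<lambda>z. 1 / (1 + z\<^sup>2) * f z) \<in> H0 \<theta>" if "f \<in> H0 \<theta>" for f
    by (rule H0_mult_bounded[OF that inverse_one_plus_square_holomorphic[OF th phi(3)] inverse_one_plus_square_bounded[OF th phi(3)]])
  note H = H0_add H0_scale H0_mult[OF hH hH] H0_mult[OF f g] f g r[OF f] r[OF g]
  show "k \<in> H0 \<theta>" unfolding k_def by (intro H)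
  have "Phi k \<phi> = (- (d * d')) *\<^sub>R (Q - (Q o\<^sub>L Q)) + c *\<^sub>R Phi g \<phi> + c' *\<^sub>R Phi f \<phi>
      + d *\<^sub>R (Phi g \<phi> o\<^sub>L Q) + d' *\<^sub>R (Phi f \<phi> o\<^sub>L Q) + (Phi f \<phi> o\<^sub>L Phi g \<phi>)"
  proof -
    have "Phi k \<phi> = (- (d * d')) *\<^sub>R Phi (\<lambda>z. z / (1 + z\<^sup>2) * (z / (1 + z\<^sup>2))) \<phi> + c *\<^sub>R Phi g \<phi> + c' *\<^sub>R Phi f \<phi>
      + d *\<^sub>R Phi (\<lambda>z. 1 / (1 + z\<^sup>2) * g z) \<phi> + d' *\<^sub>R Phi (\<lambda>z. 1 / (1 + z\<^sup>2) * f z) \<phi> + Phi (\<lambda>z. f z * g z) \<phi>"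
      unfolding k_def
      by ((subst Phi_add[where \<theta> = \<theta>], (intro H phi)+) | (subst Phi_scale[where \<theta> = \<theta>], (intro H phi)+))+ (rule refl)
    then show ?thesis
      by (simp only: Phi_square[OF phi] Phi_Q(1)[OF f phi] Phi_Q(1)[OF g phi] Phi_mult[OF f g phi])
  qed
  then show "Psi c d f \<phi> o\<^sub>L Psi c' d' g \<phi> = Psi (c * c') (c * d' + d * c' + d * d') k \<phi>"
    by (simp add: Psi_def blinfun_compose_simps scaleR_add_left scaleR_add_right scaleR_diff_right Phi_Q(2)[OF g phi] algebra_simps)
qed

end

subsection \<open>Right complex structure and resolvents of a bisectorial operator\<close>

text \<open>By Baire's theorem the closure of some sublevel set \<open>A n\<close> contains a ball.
  Hence small vectors are approximated by vectors with controlled image, and closedness of the graph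
  passes the bound to the limit of a series of such approximations.\<close>

lemma closed_graph_bounded_linear:
  fixes f :: "'a::banach \<Rightarrow> 'b::banach"
  assumes lin: "linear f" and closed: "closed {(x, y). f x = y}"
  shows "bounded_linear f"
proof -
  interpret linear f by (rule lin)
  define A where "A n = {x. norm (f x) \<le> real n}" for n :: nat
  have "interior (\<Union>(range (\<lambda>n. closure (A n)))) = {}" if "\<And>n. interior (closure (A n)) = {}"
  proof -
    have "Met_TC.mtopology interior_of \<Union>(range (\<lambda>n. closure (A n))) = {}"
      by (rule Met_TC.metric_Baire_category_alt) (use that in \<open>auto simp: complete_UNIV\<close>)
    then show ?thesis by simp
  qed
  moreover have "(\<Union>(range (\<lambda>n. closure (A n)))) = UNIV"
  proof -
    have "\<exists>n. x \<in> closure (A n)" for x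
    proof -
      obtain m where "norm (f x) \<le> real m" using real_arch_simple by blast
      then have "x \<in> A m" by (simp add: A_def)
      then show ?thesis using closure_subset[of "A m"] by blast
    qed
    then show ?thesis by auto
  qed
  ultimately obtain n where "interior (closure (A n)) \<noteq> {}" by auto
  then obtain x0 r where r: "0 < r" "ball x0 r \<subseteq> closure (A n)"
    by (meson ex_in_conv mem_interior)
  define N where "N = 2 * real n"
  \<comment> \<open>Differences of two elements of \<open>A n\<close> recentre the ball at 0, which
    doubles the bound; \<open>k\<close> rescales it.\<close>
  have approx: "\<exists>y. norm (f y) \<le> N * k \<and> norm (x - y) < e" if x: "norm x < r * k" and k: "0 < k" and e: "0 < e" for x k e
  proof -
    have "norm (x /\<^sub>R k) < r" using x k by (simp add: field_simps)
    then have "x0 \<in> closure (A n)" "x0 + x /\<^sub>R k \<in> closure (A n)" using r by (auto simp: dist_norm subset_iff)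
    then obtain a b where ab: "a \<in> A n" "dist a x0 < e / (2 * k)" "b \<in> A n" "dist b (x0 + x /\<^sub>R k) < e / (2 * k)"
      using e k unfolding closure_approachable by (metis divide_pos_pos mult_pos_pos zero_less_numeral)
    let ?y = "k *\<^sub>R (b - a)"
    have "norm (f ?y) = k * norm (f b - f a)" using k by (simp add: scaleR diff)
    also have "\<dots> \<le> k * (real n + real n)"
      using ab k by (intro mult_left_mono order_trans[OF norm_triangle_ineq4] add_mono) (auto simp: A_def)
    finally have 1: "norm (f ?y) \<le> N * k" by (simp add: N_def mult.commute)
    have "x - ?y = k *\<^sub>R ((a - x0) - (b - (x0 + x /\<^sub>R k)))" using k by (simp add: algebra_simps)
    then have "norm (x - ?y) = k * norm ((a - x0) - (b - (x0 + x /\<^sub>R k)))" using k by simp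
    also have "\<dots> \<le> k * (norm (a - x0) + norm (b - (x0 + x /\<^sub>R k)))"
      using k by (intro mult_left_mono norm_triangle_ineq4) auto
    also have "\<dots> < k * (e / (2 * k) + e / (2 * k))"
      using ab k by (intro mult_strict_left_mono add_strict_mono) (auto simp: dist_norm)
    also have "\<dots> = e" using k by simp
    finally show ?thesis using 1 by blast
  qed
  have bd: "norm (f x) \<le> 2 * N" if x: "norm x < r" for x
  proof -
    \<comment> \<open>Each correction halves the admissible size of the remainder
      \<open>X k\<close>. The corrections then sum to \<open>x\<close>, and their images are
      dominated by a geometric series.\<close>
    define g where "g k x = (SOME y. norm (f y) \<le> N * (1/2)^k \<and> norm (x - y) < r * (1/2)^(Suc k))" for k x
    have g: "norm (f (g k x)) \<le> N * (1/2)^k \<and> norm (x - g k x) < r * (1/2)^(Suc k)" if "norm x < r * (1/2)^k" for k x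
      unfolding g_def by (rule someI_ex, rule approx[OF that]) (use r in auto)
    define X where "X = rec_nat x (\<lambda>k x. x - g k x)"
    have X0: "X 0 = x" and XS: "\<And>k. X (Suc k) = X k - g k (X k)" by (simp_all add: X_def)
    have Xb: "norm (X k) < r * (1/2)^k" for k
    proof (induction k)
      case (Suc k) then show ?case using g[OF Suc] by (simp only: XS)
    qed (use x in \<open>simp add: X0\<close>)
    define y where "y k = g k (X k)" for k
    have yb: "norm (f (y k)) \<le> N * (1/2)^k" for k using g[OF Xb] by (simp add: y_def)
    have sums: "(\<Sum>j<k. y j) = x - X k" for k
      by (induction k) (simp_all add: X0 XS y_def)
    have s: "summable (\<lambda>k. N * (1/2::real)^k)" by (intro summable_mult summable_geometric) auto
    have sm: "summable (\<lambda>k. f (y k))" by (rule summable_comparison_test'[OF s yb])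
    have snm: "summable (\<lambda>k. norm (f (y k)))" by (rule summable_comparison_test'[OF s]) (use yb in simp)
    have "(\<lambda>k. r * (1/2::real)^k) \<longlonglongrightarrow> r * 0" by (intro tendsto_intros LIMSEQ_power_zero) auto
    then have "X \<longlonglongrightarrow> 0"
      by (intro LIMSEQ_norm_le_null[of X "\<lambda>k. r * (1/2)^k"]) (use Xb in \<open>auto intro: less_imp_le\<close>)
    then have "(\<lambda>k. x - X k) \<longlonglongrightarrow> x - 0" by (intro tendsto_intros)
    then have l1: "(\<lambda>k. \<Sum>j<k. y j) \<longlonglongrightarrow> x" by (simp add: sums)
    have l2: "(\<lambda>k. f (\<Sum>j<k. y j)) \<longlonglongrightarrow> (\<Sum>k. f (y k))"
      using summable_LIMSEQ[OF sm] by (simp add: sum)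
    have "(x, \<Sum>k. f (y k)) \<in> {(x, y). f x = y}"
      by (rule closed_sequentially[OF closed _ tendsto_Pair[OF l1 l2]]) simp
    then have "norm (f x) = norm (\<Sum>k. f (y k))" by simp
    also have "\<dots> \<le> (\<Sum>k. norm (f (y k)))" by (rule summable_norm[OF snm])
    also have "\<dots> \<le> (\<Sum>k. N * (1/2::real)^k)" by (rule suminf_le[OF yb snm s])
    also have "\<dots> = 2 * N" using suminf_geometric[of "1/2::real"] by (simp add: suminf_mult)
    finally show ?thesis .
  qed
  show ?thesis
  proof (rule bounded_linear_intro)
    fix x :: 'a
    show "norm (f x) \<le> norm x * (4 * N / r)"
    proof (cases "x = 0")
      case False
      define c where "c = r / (2 * norm x)"
      have c: "0 < c" using False r by (simp add: c_def)
      have "norm (c *\<^sub>R x) < r" using False r by (simp add: c_def)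
      from bd[OF this] have "c * norm (f x) \<le> 2 * N" using c by (simp add: scaleR)
      then show ?thesis using False r by (simp add: c_def field_simps)
    qed (simp add: zero)
  qed (simp_all add: add scaleR)
qed

section \<open>Multiplications on the Clifford module and the right complex structure\<close>

lemma norm_axis_le: "norm (axis i x) \<le> norm (x :: 'a::real_normed_vector)"
proof -
  have "norm (axis i x) = sqrt (\<Sum>j\<in>UNIV. if j = i then (norm x)\<^sup>2 else 0)"
    unfolding norm_vec_def L2_set_def by (intro arg_cong[where f = sqrt] sum.cong) (auto simp: axis_def)
  then show ?thesis by simp
qed

lemma bounded_linear_axis_component:
  fixes i j :: "'i::finite"
  shows "bounded_linear (\<lambda>v :: 'a::real_normed_vector ^ 'i. axis i (r *\<^sub>R (v $ j)))"
proof (rule bounded_linear_intro)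
  show "norm (axis i (r *\<^sub>R (v $ j))) \<le> norm v * \<bar>r\<bar>" for v :: "'a ^ 'i"
    by (intro order_trans[OF norm_axis_le]) (simp add: mult.commute[of _ "\<bar>r\<bar>"] mult_left_mono Finite_Cartesian_Product.norm_nth_le)
qed (simp_all add: axis_def vec_eq_iff scaleR_add_right scaleR_left_commute)

lemma bounded_linear_cl_left: "bounded_linear (\<lambda>v :: ('v::real_normed_vector, 'n::{finite,linorder}) cmodule. a \<triangleright> v)"
  unfolding cl_left_def by (intro bounded_linear_sum bounded_linear_axis_component)

lemma bounded_linear_cl_right: "bounded_linear (\<lambda>v :: ('v::real_normed_vector, 'n::{finite,linorder}) cmodule. v \<triangleleft> a)"
  unfolding cl_right_def by (intro bounded_linear_sum bounded_linear_axis_component)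

lemma cl_right_axis_nth:
  fixes v :: "('v::real_vector, 'n::{finite,linorder}) cmodule"
  shows "(v \<triangleleft> axis B r) $ C = (csign (sym_diff C B) B * r) *\<^sub>R (v $ sym_diff C B)"
proof -
  have eq: "C = sym_diff A D \<longleftrightarrow> A = sym_diff C D" for A D :: "'n set" by blast
  have "(v \<triangleleft> axis B r) $ C = (\<Sum>D\<in>UNIV. \<Sum>A\<in>UNIV. if A = sym_diff C D then (csign A D * (axis B r $ D)) *\<^sub>R (v $ A) else 0)"
    unfolding cl_right_def by (subst sum.swap) (simp add: axis_def eq)
  also have "\<dots> = (\<Sum>D\<in>UNIV. if D = B then (csign (sym_diff C B) B * r) *\<^sub>R (v $ sym_diff C B) else 0)"
    by (intro sum.cong refl) (simp add: axis_def)
  finally show ?thesis by simp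
qed

lemma cl_right_of_real: "v \<triangleleft> cl_of_real r = r *\<^sub>R (v :: ('v::real_vector, 'n::{finite,linorder}) cmodule)"
  unfolding cl_of_real_def by (simp add: vec_eq_iff cl_right_axis_nth csign_prod)

text \<open>Right multiplication by a fixed generator turns \<open>V\<close> into a complex space on which right-linear operators are complex linear.\<close>

definition jr :: "('v::real_normed_vector, 'n::{finite,linorder}) cmodule \<Rightarrow>\<^sub>L ('v, 'n) cmodule" where
  "jr = Blinfun (\<lambda>v. v \<triangleleft> axis {undefined} 1)"

lemma jr_apply: "blinfun_apply jr v = v \<triangleleft> axis {undefined} 1"
  unfolding jr_def by (subst bounded_linear_Blinfun_apply[OF bounded_linear_cl_right]) simp

lemma jr_jr:
  fixes v :: "('v::real_normed_vector, 'n::{finite,linorder}) cmodule"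
  shows "jr (jr v) = - v"
proof -
  have "(jr (jr v)) $ C = - (v $ C)" for C
  proof -
    let ?i = "{undefined} :: 'n set"
    have sq: "csign C ?i * csign C ?i = 1" by (simp add: csign_def power_add[symmetric])
    have s: "csign (sym_diff C ?i) ?i = - csign C ?i" by (simp add: csign_sym_diff csign_generator)
    have t: "sym_diff (sym_diff C ?i) ?i = C" by blast
    show ?thesis unfolding jr_apply cl_right_axis_nth t s using sq by simp
  qed
  then show ?thesis by (simp add: vec_eq_iff)
qed

definition cr :: "complex \<Rightarrow> ('v::real_normed_vector, 'n::{finite,linorder}) cmodule \<Rightarrow>\<^sub>L ('v, 'n) cmodule" where
  "cr c = Re c *\<^sub>R id_blinfun + Im c *\<^sub>R jr"

lemma cr_apply: "cr c v = Re c *\<^sub>R v + Im c *\<^sub>R jr v"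
  by (simp add: cr_def blinfun.add_left blinfun.scaleR_left)

lemma bounded_linear_cr: "bounded_linear cr"
  unfolding cr_def[abs_def]
  by (intro bounded_linear_add bounded_linear_scaleR_left[THEN bounded_linear_compose] bounded_linear_Re bounded_linear_Im)

lemma cr_mult: "cr (a * b) = cr a o\<^sub>L cr b"
  by (rule blinfun_eqI)
    (simp add: cr_apply blinfun.add_right blinfun.scaleR_right jr_jr algebra_simps scaleR_add_left scaleR_add_right)

lemma cr_one: "cr 1 = id_blinfun"
  by (rule blinfun_eqI) (simp add: cr_apply)

section \<open>Complex slices of the paravectors and the double sector\<close>

lemma cl_of_real_nth: "cl_of_real x $ A = (if A = {} then x else 0)"
  by (simp add: cl_of_real_def axis_def)

lemma slice_pt_nth: "slice_pt J x y $ A = (if A = {} then x else 0) + y * (J $ A)"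
  by (simp add: slice_pt_def cl_of_real_nth)

lemma slice_pt_paravector: "J \<in> imag_sphere \<Longrightarrow> slice_pt J x y \<in> paravectors"
  by (auto simp: imag_sphere_def paravectors_def slice_pt_nth)

lemma slice_pt_empty: "J \<in> imag_sphere \<Longrightarrow> slice_pt J x y $ {} = x"
  by (simp add: imag_sphere_def slice_pt_nth)

lemma norm_clifford_square: "(norm (s :: 'n::finite clifford))\<^sup>2 = (\<Sum>A\<in>UNIV. (s $ A)\<^sup>2)"
  by (simp add: norm_vec_def L2_set_def sum_nonneg)

lemma norm_slice_pt:
  assumes "J \<in> imag_sphere"
  shows "norm (slice_pt J x y) = norm (Complex x y)"
proof -
  have J: "J $ {} = 0" "(\<Sum>A\<in>UNIV. (J $ A)\<^sup>2) = 1"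
    using assms norm_clifford_square[of J] by (auto simp: imag_sphere_def)
  have "(norm (slice_pt J x y))\<^sup>2 = (\<Sum>A\<in>UNIV. (if A = {} then x\<^sup>2 else 0) + y\<^sup>2 * (J $ A)\<^sup>2)"
    unfolding norm_clifford_square by (intro sum.cong refl) (simp add: slice_pt_nth J power_mult_distrib)
  also have "\<dots> = x\<^sup>2 + y\<^sup>2" by (simp add: sum.distrib sum_distrib_left[symmetric] J)
  finally show ?thesis by (simp add: cmod_def real_sqrt_unique)
qed

lemma cl_conj_slice_pt: "J \<in> imag_sphere \<Longrightarrow> cl_conj (slice_pt J x y) = slice_pt J x (- y)"
  by (auto simp: cl_conj_def vec_eq_iff slice_pt_nth imag_sphere_def)

lemma cl_left_add: "(a + b) \<triangleright> v = a \<triangleright> v + b \<triangleright> (v :: ('v::real_vector, 'n::{finite,linorder}) cmodule)"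
  by (simp add: vec_eq_iff cl_left_nth algebra_simps sum.distrib scaleR_add_left)

lemma cl_left_scaleR: "(r *\<^sub>R a) \<triangleright> v = r *\<^sub>R (a \<triangleright> (v :: ('v::real_vector, 'n::{finite,linorder}) cmodule))"
  by (simp add: vec_eq_iff cl_left_nth scaleR_sum_right mult_ac)

lemma cl_left_of_real: "cl_of_real r \<triangleright> v = r *\<^sub>R (v :: ('v::real_vector, 'n::{finite,linorder}) cmodule)"
proof -
  have "(cl_of_real r \<triangleright> v) $ C = (\<Sum>A\<in>(UNIV :: 'n set set). if A = {} then r *\<^sub>R (v $ C) else 0)" for C
    unfolding cl_left_nth by (intro sum.cong refl) (simp add: cl_of_real_nth csign_prod)
  then show ?thesis by (simp add: vec_eq_iff)
qed

lemma cl_left_slice_pt: "slice_pt J x y \<triangleright> v = x *\<^sub>R v + y *\<^sub>R (J \<triangleright> (v :: ('v::real_vector, 'n::{finite,linorder}) cmodule))"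
  by (simp add: slice_pt_def cl_left_add cl_left_scaleR cl_left_of_real)

lemma imag_sphere_square:
  fixes J :: "'n::{finite,linorder} clifford"
  assumes "J \<in> imag_sphere"
  shows "J \<odot> J = - cl_one"
proof -
  have c: "cl_conj J = - J" using assms by (auto simp: cl_conj_def vec_eq_iff imag_sphere_def)
  have "J \<odot> cl_conj J = - (J \<odot> J)"
    unfolding c cl_mult_eq_left using linear_simps(4)[OF bounded_linear_cl_left[of J], of J] .
  moreover have "J \<odot> cl_conj J = cl_one" using assms cl_mult_conj[of J] by (simp add: imag_sphere_def)
  ultimately show ?thesis by (metis minus_minus)
qed

lemma imag_sphere_left_left: "J \<in> imag_sphere \<Longrightarrow> J \<triangleright> J \<triangleright> v = - (v :: ('v::real_normed_vector, 'n::{finite,linorder}) cmodule)"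
proof -
  assume "J \<in> imag_sphere"
  then have "J \<triangleright> J \<triangleright> v = (- cl_one) \<triangleright> v" by (simp add: cl_left_assoc[symmetric] imag_sphere_square)
  also have "- cl_one = (- 1) *\<^sub>R (cl_one :: 'n clifford)" by simp
  finally show ?thesis by (simp only: cl_left_scaleR cl_left_of_real) simp
qed

lemma axis_in_imag_sphere: "axis {i} 1 \<in> imag_sphere"
proof -
  have "(norm (axis {i} 1 :: 'a clifford))\<^sup>2 = 1" unfolding norm_clifford_square
  proof -
    have "(\<Sum>A\<in>UNIV. (axis {i} 1 $ A :: real)\<^sup>2) = (\<Sum>A\<in>UNIV. if A = {i} then 1 else 0)"
      by (intro sum.cong refl) (simp add: axis_def)
    then show "(\<Sum>A\<in>UNIV. (axis {i} 1 $ A :: real)\<^sup>2) = 1" by simp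
  qed
  then have "norm (axis {i} 1 :: 'a clifford) = 1" by (metis norm_ge_zero power2_eq_1_iff neg_0_le_iff_le not_one_le_zero)
  then show ?thesis by (auto simp: imag_sphere_def paravectors_def axis_def)
qed

lemma cl_exp_slice: "r *\<^sub>R cl_exp J \<alpha> = slice_pt J (r * cos \<alpha>) (r * sin \<alpha>)"
  by (simp add: cl_exp_def vec_eq_iff slice_pt_nth algebra_simps)

lemma sin_sector_angles:
  assumes "\<alpha> \<in> sector_angles \<phi>" "0 < \<phi>" "\<phi> < pi / 2"
  shows "\<bar>sin \<alpha>\<bar> < sin \<phi>"
proof -
  have *: "\<bar>sin \<beta>\<bar> < sin \<phi>" if "- \<phi> < \<beta>" "\<beta> < \<phi>" for \<beta>
    using that assms sin_monotone_2pi[of \<beta> \<phi>] sin_monotone_2pi[of "-\<phi>" \<beta>] by (auto simp: abs_less_iff)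
  show ?thesis using assms(1) *[of \<alpha>] *[of "\<alpha> - pi"] by (auto simp: sector_angles_def sin_diff)
qed

text \<open>The arcsine of \<open>Im z / |z|\<close> is the angle in the right half of the cone; in
  the left half it is reflected to \<open>pi - \<beta>\<close>.\<close>

lemma sector_angles_exists:
  assumes "z \<in> dcone (sin \<phi>)" "0 < \<phi>" "\<phi> < pi / 2"
  shows "\<exists>\<alpha>\<in>sector_angles \<phi>. z = of_real (norm z) * cis \<alpha>"
proof -
  have z0: "0 < norm z" using dcone_nonzero[OF assms(1)] by simp
  define k where "k = Im z / norm z"
  have k: "\<bar>k\<bar> < sin \<phi>" using assms(1) z0 by (simp add: dcone_def k_def abs_divide pos_divide_less_eq)
  have s1: "sin \<phi> < 1" using sin_monotone_2pi[of \<phi> "pi/2"] assms by simp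
  define \<beta> where "\<beta> = arcsin k"
  have kb: "- 1 \<le> k" "k \<le> 1" using k s1 by auto
  have sb: "sin \<beta> = k" unfolding \<beta>_def using kb by (rule sin_arcsin)
  have "arcsin k < arcsin (sin \<phi>)" "arcsin (- sin \<phi>) < arcsin k"
    using k s1 kb by (intro arcsin_less_arcsin; auto simp: abs_less_iff)+
  then have b: "- \<phi> < \<beta>" "\<beta> < \<phi>"
    using assms arcsin_sin[of \<phi>] arcsin_sin[of "- \<phi>"] by (auto simp: \<beta>_def)
  have cb: "0 < cos \<beta>" using b assms by (intro cos_gt_zero_pi) auto
  have n2: "(Re z)\<^sup>2 + (Im z)\<^sup>2 = (norm z)\<^sup>2" by (simp add: cmod_power2)
  have "(norm z * cos \<beta>)\<^sup>2 = (norm z)\<^sup>2 - (norm z * k)\<^sup>2"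
    using sb by (simp add: power_mult_distrib cos_squared_eq algebra_simps)
  also have "norm z * k = Im z" using z0 by (simp add: k_def)
  also have "(norm z)\<^sup>2 - (Im z)\<^sup>2 = (Re z)\<^sup>2" using n2 by simp
  finally have "\<bar>norm z * cos \<beta>\<bar> = \<bar>Re z\<bar>" by (metis real_sqrt_abs)
  then have r: "norm z * cos \<beta> = \<bar>Re z\<bar>" using z0 cb by (simp add: abs_mult)
  have im: "norm z * sin \<beta> = Im z" using z0 by (simp add: sb k_def)
  show ?thesis
  proof (cases "0 \<le> Re z")
    case True
    then show ?thesis using b r im by (intro bexI[of _ \<beta>]) (auto simp: complex_eq_iff sector_angles_def)
  next
    case False
    then show ?thesis using b r im by (intro bexI[of _ "pi - \<beta>"]) (auto simp: complex_eq_iff sector_angles_def)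
  qed
qed

text \<open>A point of the slice of \<open>J\<close> may be given in \<open>double_sector\<close>
  through another unit \<open>K\<close> and another angle. Its real part and norm are nevertheless
  determined, hence so is \<open>|Im z|\<close>, and \<open>dcone\<close> depends on nothing
  else.\<close>

lemma double_sector_slice:
  assumes J: "J \<in> imag_sphere" and phi: "0 < \<phi>" "\<phi> < pi / 2"
  shows "slice_pt J (Re z) (Im z) \<in> double_sector \<phi> \<longleftrightarrow> z \<in> dcone (sin \<phi>)"
proof
  assume "slice_pt J (Re z) (Im z) \<in> double_sector \<phi>"
  then obtain r K \<alpha> where *: "slice_pt J (Re z) (Im z) = slice_pt K (r * cos \<alpha>) (r * sin \<alpha>)" "0 < r" "K \<in> imag_sphere" "\<alpha> \<in> sector_angles \<phi>"
    by (auto simp: double_sector_def cl_exp_slice)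
  have re: "Re z = r * cos \<alpha>" using slice_pt_empty[OF J, of "Re z" "Im z"] slice_pt_empty[OF *(3)] *(1) by simp
  have "norm z = norm (Complex (r * cos \<alpha>) (r * sin \<alpha>))"
    using norm_slice_pt[OF J, of "Re z" "Im z"] norm_slice_pt[OF *(3)] *(1) by simp
  also have "\<dots> = norm (of_real r * cis \<alpha>)" by (rule arg_cong[where f = norm]) (simp add: complex_eq_iff)
  also have "\<dots> = r" using *(2) by (simp add: norm_mult)
  finally have n: "norm z = r" .
  have "(Im z)\<^sup>2 = r\<^sup>2 - (r * cos \<alpha>)\<^sup>2" using cmod_power2[of z] by (simp add: n re)
  also have "\<dots> = (r * sin \<alpha>)\<^sup>2" by (simp add: power_mult_distrib sin_squared_eq algebra_simps)
  finally have "\<bar>Im z\<bar> = r * \<bar>sin \<alpha>\<bar>" using *(2) by (metis abs_mult abs_of_pos power2_eq_iff abs_minus_cancel)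
  then show "z \<in> dcone (sin \<phi>)" using sin_sector_angles[OF *(4) phi] *(2) by (simp add: dcone_def n mult.commute[of _ r])
next
  assume z: "z \<in> dcone (sin \<phi>)"
  then obtain \<alpha> where a: "\<alpha> \<in> sector_angles \<phi>" "z = of_real (norm z) * cis \<alpha>" using sector_angles_exists phi by blast
  have "Re z = norm z * cos \<alpha>" "Im z = norm z * sin \<alpha>" using arg_cong[OF a(2), of Re] arg_cong[OF a(2), of Im] by simp_all
  then have "slice_pt J (Re z) (Im z) = norm z *\<^sub>R cl_exp J \<alpha>" by (simp add: cl_exp_slice)
  then show "slice_pt J (Re z) (Im z) \<in> double_sector \<phi>"
    unfolding double_sector_def mem_Collect_eq using J a(1) dcone_nonzero[OF z]
    by (intro exI[of _ "norm z"] exI[of _ J] exI[of _ \<alpha>]) auto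
qed

text \<open>The double sector lies in the closed set \<open>C\<close> where the norm of the
  imaginary part is at most \<open>sin \<phi>\<close> times the norm, and the point violates this
  inequality.\<close>

lemma double_sector_closure:
  fixes J :: "'n::finite clifford"
  assumes J: "J \<in> imag_sphere" and phi: "0 < \<phi>" "\<phi> < pi / 2" and z: "sin \<phi> * norm z < \<bar>Im z\<bar>"
  shows "slice_pt J (Re z) (Im z) \<notin> closure (double_sector \<phi>)"
proof
  define C where "C = {s :: 'n clifford. norm (s - cl_of_real (s $ {})) \<le> sin \<phi> * norm s}"
  have nJ: "norm (slice_pt K x y - cl_of_real (slice_pt K x y $ {})) = \<bar>y\<bar>" if K: "K \<in> imag_sphere" for K :: "'n clifford" and x y
  proof -
    have "slice_pt K x y - cl_of_real (slice_pt K x y $ {}) = y *\<^sub>R K"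
      using slice_pt_empty[OF K] by (simp add: slice_pt_def)
    then show ?thesis using K by (simp add: imag_sphere_def)
  qed
  have cont: "continuous_on UNIV (\<lambda>s :: 'n clifford. cl_of_real (s $ {}) :: 'n clifford)"
    unfolding cl_of_real_def
    using linear_continuous_on[OF bounded_linear_axis_component[where i = "{} :: 'n set" and j = "{}" and r = 1 and 'a = real]] by simp
  have "closed C" unfolding C_def by (intro closed_Collect_le continuous_intros cont)
  moreover have "double_sector \<phi> \<subseteq> C"
  proof
    fix s :: "'n clifford" assume "s \<in> double_sector \<phi>"
    then obtain r K \<alpha> where s: "s = slice_pt K (r * cos \<alpha>) (r * sin \<alpha>)" "0 < r" "K \<in> imag_sphere" "\<alpha> \<in> sector_angles \<phi>"
      by (auto simp: double_sector_def cl_exp_slice)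
    have "norm s = norm (of_real r * cis \<alpha>)"
      unfolding s norm_slice_pt[OF s(3)] by (rule arg_cong[where f = norm]) (simp add: complex_eq_iff)
    then have "norm s = r" using s(2) by (simp add: norm_mult)
    then show "s \<in> C" using sin_sector_angles[OF s(4) phi] s(2) unfolding C_def s(1) by (simp add: nJ[OF s(3)] abs_mult mult.commute[of _ r])
  qed
  ultimately have "closure (double_sector \<phi>) \<subseteq> C" by (intro closure_minimal)
  moreover assume "slice_pt J (Re z) (Im z) \<in> closure (double_sector \<phi>)"
  ultimately have "\<bar>Im z\<bar> \<le> sin \<phi> * norm z" using nJ[OF J] norm_slice_pt[OF J, of "Re z" "Im z"] by (auto simp: C_def)
  then show False using z by simp
qed

section \<open>The resolvent of a bisectorial operator on the right complex space\<close>

lemma norm_square_Re_Im: "(norm z)\<^sup>2 = Re z * Re z + Im z * Im z"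
  unfolding cmod_power2 by (simp add: power2_eq_square)

lemma scaleR_two: "(2 * r) *\<^sub>R a = r *\<^sub>R a + r *\<^sub>R (a :: 'a::real_vector)"
  by (simp add: scaleR_left_distrib[symmetric])

locale bisectorial_op =
  fixes T :: "('v::banach, 'n::{finite,linorder}) oper" and \<omega> :: real
  assumes omega_bounds: "0 < \<omega>" "\<omega> < pi / 2"
    and T_closed: "T \<in> closed_ops" and T_bisectorial: "bisectorial \<omega> T"
begin

lemma T_right_linear: "right_linear T" and T_graph_closed: "closed {(v, w). T v = Some w}"
  using T_closed by (auto simp: closed_ops_def)

lemma T_zero: "T 0 = Some 0"
proof -
  have "0 \<in> dom T" using T_right_linear by (simp add: right_linear_def)
  then have "T (0 + 0) = Some (the (T 0) + the (T 0))" using T_right_linear unfolding right_linear_def by blast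
  then show ?thesis by (cases "T 0") auto
qed

lemma T_add: "T v = Some v' \<Longrightarrow> T w = Some w' \<Longrightarrow> T (v + w) = Some (v' + w')"
  using T_right_linear by (auto simp: right_linear_def dom_def)

lemma T_cl_right: "T v = Some v' \<Longrightarrow> T (v \<triangleleft> a) = Some (v' \<triangleleft> a)"
  using T_right_linear by (auto simp: right_linear_def dom_def)

lemma T_scaleR: "T v = Some v' \<Longrightarrow> T (r *\<^sub>R v) = Some (r *\<^sub>R v')"
  using T_cl_right[of v v' "cl_of_real r"] by (simp add: cl_right_of_real)

lemma T_cr: "T v = Some v' \<Longrightarrow> T (cr c v) = Some (cr c v')"
  unfolding cr_apply jr_apply by (intro T_add T_scaleR T_cl_right)

lemma T_diff: "T v = Some v' \<Longrightarrow> T w = Some w' \<Longrightarrow> T (v - w) = Some (v' - w')"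
  using T_add[of v v' "(- 1) *\<^sub>R w" "(- 1) *\<^sub>R w'"] T_scaleR[of w w' "- 1"] by simp

text \<open>The operator \<open>Q_op s T\<close> depends on \<open>s\<close> only through its real
  part and norm, so it is the same for all units \<open>J\<close>.\<close>

definition Qc :: "complex \<Rightarrow> ('v, 'n) oper" where
  "Qc z = op_add (op_add (op_pow T 2) (op_scale (- 2 * Re z) T)) (op_scale ((norm z)\<^sup>2) Some)"

lemma Q_op_slice: "J \<in> imag_sphere \<Longrightarrow> Q_op (slice_pt J (Re z) (Im z)) T = Qc z"
  by (simp add: Q_op_def Qc_def slice_pt_empty norm_slice_pt)

lemma Qc_Some: "Qc z v = Some w \<longleftrightarrow> (\<exists>a b. T v = Some a \<and> T a = Some b \<and> w = b - (2 * Re z) *\<^sub>R a + (norm z)\<^sup>2 *\<^sub>R v)"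
  by (auto simp: Qc_def op_add_def op_scale_def numeral_2_eq_2 map_comp_def dom_def split: option.splits if_splits)

definition Omega :: "complex set" where "Omega = {z. sin \<omega> * norm z < \<bar>Im z\<bar>}"

lemma Omega_resolvent:
  assumes "z \<in> Omega"
  shows "op_inj (Qc z)" "op_inv (Qc z) \<in> bounded_ops"
proof -
  define J :: "'n clifford" where "J = axis {undefined} 1"
  have J: "J \<in> imag_sphere" by (simp add: J_def axis_in_imag_sphere)
  have "slice_pt J (Re z) (Im z) \<notin> closure (double_sector \<omega>)"
    using assms by (intro double_sector_closure J omega_bounds) (simp add: Omega_def)
  then have "slice_pt J (Re z) (Im z) \<in> S_resolvent_set T"
    using T_bisectorial slice_pt_paravector[OF J] by (auto simp: bisectorial_def S_spectrum_def)
  then show "op_inj (Qc z)" "op_inv (Qc z) \<in> bounded_ops"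
    by (auto simp: S_resolvent_set_def Q_op_slice[OF J])
qed

definition q :: "complex \<Rightarrow> ('v, 'n) cmodule \<Rightarrow>\<^sub>L ('v, 'n) cmodule" where
  "q z = to_blinfun (op_inv (Qc z))"

lemma q_inv:
  assumes z: "z \<in> Omega"
  shows "op_inv (Qc z) v = Some (q z v)" "Qc z (q z v) = Some v"
proof -
  have b: "op_inv (Qc z) \<in> bounded_ops" by (rule Omega_resolvent(2)[OF z])
  then have bl: "bounded_linear (\<lambda>v. the (op_inv (Qc z) v))" and d: "dom (op_inv (Qc z)) = UNIV"
    by (auto simp: bounded_ops_def)
  then show 1: "op_inv (Qc z) v = Some (q z v)"
    by (metis (mono_tags) q_def to_blinfun_def bounded_linear_Blinfun_apply domD UNIV_I option.sel)
  have r: "v \<in> ran (Qc z)" using 1 by (auto simp: op_inv_def split: if_splits)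
  then have "\<exists>x. Qc z x = Some v" by (auto simp: ran_def)
  from someI_ex[OF this] show "Qc z (q z v) = Some v" using 1 r by (simp add: op_inv_def)
qed

lemma q_cl_right: "z \<in> Omega \<Longrightarrow> q z (v \<triangleleft> a) = q z v \<triangleleft> a"
  using Omega_resolvent(2)[of z] q_inv(1)[of z] by (auto simp: bounded_ops_def right_linear_def)

definition tqf :: "complex \<Rightarrow> ('v, 'n) cmodule \<Rightarrow> ('v, 'n) cmodule" where
  "tqf z v = the (T (q z v))"

definition tq :: "complex \<Rightarrow> ('v, 'n) cmodule \<Rightarrow>\<^sub>L ('v, 'n) cmodule" where
  "tq z = Blinfun (tqf z)"

lemma T_q:
  assumes z: "z \<in> Omega"
  shows "T (q z v) = Some (tqf z v)" "T (tqf z v) = Some (v + (2 * Re z) *\<^sub>R tqf z v - (norm z)\<^sup>2 *\<^sub>R q z v)"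
proof -
  obtain a b where *: "T (q z v) = Some a" "T a = Some b" "v = b - (2 * Re z) *\<^sub>R a + (norm z)\<^sup>2 *\<^sub>R q z v"
    using q_inv(2)[OF z, of v] Qc_Some by blast
  then have a: "tqf z v = a" by (simp add: tqf_def)
  show "T (q z v) = Some (tqf z v)" using * a by simp
  have "b = v + (2 * Re z) *\<^sub>R a - (norm z)\<^sup>2 *\<^sub>R q z v" using *(3) by (simp add: algebra_simps)
  then show "T (tqf z v) = Some (v + (2 * Re z) *\<^sub>R tqf z v - (norm z)\<^sup>2 *\<^sub>R q z v)" using *(2) a by simp
qed

text \<open>\<open>T\<close> is closed and \<open>q z\<close> is continuous, so the graph is the
  preimage of the graph of \<open>T\<close> under \<open>(v, w) \<mapsto> (q z v, w)\<close>; the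
  closed graph theorem applies.\<close>

lemma tqf_bounded_linear:
  assumes z: "z \<in> Omega"
  shows "bounded_linear (tqf z)"
proof (rule closed_graph_bounded_linear)
  show "linear (tqf z)"
  proof (rule linearI)
    fix v w and r :: real
    have "T (q z (v + w)) = Some (tqf z v + tqf z w)"
      unfolding blinfun.add_right by (rule T_add[OF T_q(1)[OF z] T_q(1)[OF z]])
    then show "tqf z (v + w) = tqf z v + tqf z w" by (simp add: tqf_def[of z "v + w"])
    have "T (q z (r *\<^sub>R v)) = Some (r *\<^sub>R tqf z v)"
      unfolding blinfun.scaleR_right by (rule T_scaleR[OF T_q(1)[OF z]])
    then show "tqf z (r *\<^sub>R v) = r *\<^sub>R tqf z v" by (simp add: tqf_def[of z "r *\<^sub>R v"])
  qed
  have "closed ((\<lambda>p. (q z (fst p), snd p)) -` {(v, w). T v = Some w})"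
    by (intro continuous_closed_vimage T_graph_closed) (auto intro!: continuous_intros)
  moreover have "(\<lambda>p. (q z (fst p), snd p)) -` {(v, w). T v = Some w} = {(v, w). tqf z v = w}"
    using T_q(1)[OF z] by auto
  ultimately show "closed {(v, w). tqf z v = w}" by simp
qed

lemma tq_apply: "z \<in> Omega \<Longrightarrow> tq z v = tqf z v"
  by (simp add: tq_def bounded_linear_Blinfun_apply tqf_bounded_linear)

lemma tq_cl_right: "z \<in> Omega \<Longrightarrow> tq z (v \<triangleleft> a) = tq z v \<triangleleft> a"
  using T_cl_right[OF T_q(1), of z v a] T_q(1)[of z "v \<triangleleft> a"] by (simp add: tq_apply q_cl_right)

lemma S_resolvent_slice:
  assumes z: "z \<in> Omega" and J: "J \<in> imag_sphere"
  shows "S_resolvent (slice_pt J (Re z) (Im z)) T v = Some (q z (slice_pt J (Re z) (- Im z) \<triangleright> v) - tq z v)"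
  using q_inv(1)[OF z] T_q(1)[OF z]
  by (simp add: S_resolvent_def Q_op_slice[OF J] cl_conj_slice_pt[OF J] op_add_def op_scale_def op_cl_def tq_apply[OF z] map_comp_def dom_def)

text \<open>The left S-resolvent with the left multiplication by the conjugate of \<open>s\<close>
  replaced by the right scalar \<open>cnj z\<close>. On the complex space this is
  \<open>(cnj z - T)\<close> applied to the inverse of \<open>(z - T)(cnj z - T)\<close>, that is,
  \<open>(z - T)^-1\<close>.\<close>

definition R :: "complex \<Rightarrow> ('v, 'n) cmodule \<Rightarrow>\<^sub>L ('v, 'n) cmodule" where
  "R z = (cr (cnj z) o\<^sub>L q z) - tq z"

lemma R_apply: "R z v = cr (cnj z) (q z v) - tq z v"
  by (simp add: R_def blinfun.diff_left)

lemma q_jr: "z \<in> Omega \<Longrightarrow> q z (jr v) = jr (q z v)" and tq_jr: "z \<in> Omega \<Longrightarrow> tq z (jr v) = jr (tq z v)"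
  by (simp_all add: jr_apply q_cl_right tq_cl_right)

lemma q_cr: "z \<in> Omega \<Longrightarrow> q z (cr c v) = cr c (q z v)" and tq_cr: "z \<in> Omega \<Longrightarrow> tq z (cr c v) = cr c (tq z v)"
  by (simp_all add: cr_apply blinfun.add_right blinfun.scaleR_right q_jr tq_jr)

lemma cr_cr: "cr a (cr b v) = cr (a * b) v"
  by (simp add: cr_mult)

lemma T_R:
  assumes z: "z \<in> Omega"
  shows "T (R z v) = Some (cr z (R z v) - v)"
proof -
  have "T (cr (cnj z) (q z v) - tqf z v) = Some (cr (cnj z) (tqf z v) - (v + (2 * Re z) *\<^sub>R tqf z v - (norm z)\<^sup>2 *\<^sub>R q z v))"
    by (rule T_diff[OF T_cr[OF T_q(1)[OF z]] T_q(2)[OF z]])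
  moreover have "cr (cnj z) (tqf z v) - (v + (2 * Re z) *\<^sub>R tqf z v - (norm z)\<^sup>2 *\<^sub>R q z v) = cr z (cr (cnj z) (q z v) - tqf z v) - v"
    unfolding scaleR_two norm_square_Re_Im
    by (simp add: cr_apply blinfun.add_right blinfun.diff_right blinfun.scaleR_right jr_jr algebra_simps)
  ultimately show ?thesis by (simp add: R_apply tq_apply[OF z])
qed

text \<open>By \<open>T_R\<close> the difference \<open>d\<close> of the two sides satisfies
  \<open>T d = z d\<close>. Then \<open>Qc z d = 0\<close>, because \<open>Qc z\<close> has the
  factor \<open>T - z\<close>, and injectivity of \<open>Qc z\<close> gives
  \<open>d = 0\<close>.\<close>

lemma R_T:
  assumes z: "z \<in> Omega" and u: "T u = Some w"
  shows "R z (cr z u - w) = u"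
proof -
  define d where "d = R z (cr z u - w) - u"
  have "T d = Some (cr z (R z (cr z u - w)) - (cr z u - w) - w)"
    unfolding d_def by (rule T_diff[OF T_R[OF z] u])
  then have Td: "T d = Some (cr z d)" by (simp add: d_def blinfun.diff_right)
  then have TTd: "T (cr z d) = Some (cr z (cr z d))" by (rule T_cr)
  have "cr z (cr z d) - (2 * Re z) *\<^sub>R cr z d + (norm z)\<^sup>2 *\<^sub>R d = 0"
    unfolding scaleR_two norm_square_Re_Im
    by (simp add: cr_apply blinfun.add_right blinfun.scaleR_right jr_jr algebra_simps)
  then have "Qc z d = Some 0" using Td TTd Qc_Some by metis
  moreover have "Qc z 0 = Some 0" using T_zero Qc_Some[of z 0 0] by simp
  ultimately have "d = 0" using Omega_resolvent(1)[OF z] by (auto simp: op_inj_def inj_on_def dom_def)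
  then show ?thesis by (simp add: d_def)
qed

text \<open>Apply \<open>R_T\<close> to \<open>a = R w v\<close>, for which
  \<open>z a - T a = v - (w - z) a\<close>.\<close>

lemma R_resolvent_equation:
  assumes z: "z \<in> Omega" and w: "w \<in> Omega"
  shows "R z - R w = cr (w - z) o\<^sub>L (R z o\<^sub>L R w)"
proof (rule blinfun_eqI)
  fix v
  define a where "a = R w v"
  have "T a = Some (cr w a - v)" unfolding a_def by (rule T_R[OF w])
  from R_T[OF z this] have "R z (cr z a - (cr w a - v)) = a" .
  moreover have "cr z a - (cr w a - v) = v - cr (w - z) a" by (simp add: cr_apply algebra_simps scaleR_diff_left)
  ultimately have "R z v - R z (cr (w - z) a) = a" by (simp add: blinfun.diff_right)
  moreover have "R z (cr (w - z) a) = cr (w - z) (R z a)"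
    by (simp add: R_apply q_cr[OF z] tq_cr[OF z] cr_cr blinfun.diff_right mult.commute)
  ultimately show "(R z - R w) v = (cr (w - z) o\<^sub>L (R z o\<^sub>L R w)) v"
    by (simp add: a_def blinfun.diff_left algebra_simps)
qed

lemma to_blinfun_S_resolvent:
  assumes z: "z \<in> Omega" and J: "J \<in> imag_sphere"
  shows "to_blinfun (S_resolvent (slice_pt J (Re z) (Im z)) T) = Re z *\<^sub>R q z - Im z *\<^sub>R (q z o\<^sub>L Blinfun (\<lambda>v. J \<triangleright> v)) - tq z"
proof -
  have "(\<lambda>v. the (S_resolvent (slice_pt J (Re z) (Im z)) T v)) = blinfun_apply (Re z *\<^sub>R q z - Im z *\<^sub>R (q z o\<^sub>L Blinfun (\<lambda>v. J \<triangleright> v)) - tq z)"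
    by (rule ext) (simp add: S_resolvent_slice[OF z J] blinfun.diff_left blinfun.scaleR_left
        bounded_linear_Blinfun_apply[OF bounded_linear_cl_left] cl_left_slice_pt blinfun.add_right blinfun.scaleR_right blinfun.diff_right blinfun.minus_right)
  then show ?thesis by (simp add: to_blinfun_def blinfun_apply_inverse)
qed

text \<open>The hypothesis bounds the S-resolvent, which carries a left multiplication
  \<open>L\<close> by \<open>J\<close>. At \<open>z\<close> and at \<open>cnj z\<close> it equals
  \<open>P - N\<close> and \<open>P + N\<close> with \<open>P = Re z q - T q\<close> and
  \<open>N = Im z q L\<close>, so both parts are bounded. As \<open>L\<close> squares to -1,
  composing \<open>N\<close> with \<open>L\<close> recovers \<open>Im z q\<close>, and
  \<open>R z\<close> is \<open>P\<close> minus \<open>jr\<close> composed with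
  \<open>Im z q\<close>.\<close>

lemma R_angle_bound:
  assumes phi: "\<omega> < \<phi>" "\<phi> < pi / 2"
  shows "\<exists>C\<ge>0. \<forall>z. z \<noteq> 0 \<longrightarrow> sin \<phi> * norm z \<le> \<bar>Im z\<bar> \<longrightarrow> norm z * norm (R z) \<le> C"
proof -
  define J :: "'n clifford" where "J = axis {undefined} 1"
  have J: "J \<in> imag_sphere" by (simp add: J_def axis_in_imag_sphere)
  define L where "L = (Blinfun (\<lambda>v. J \<triangleright> v) :: ('v, 'n) cmodule \<Rightarrow>\<^sub>L ('v, 'n) cmodule)"
  have L: "L v = J \<triangleright> v" for v by (simp add: L_def bounded_linear_Blinfun_apply[OF bounded_linear_cl_left])
  have LL: "(A o\<^sub>L L) o\<^sub>L L = - A" for A :: "('v, 'n) cmodule \<Rightarrow>\<^sub>L ('v, 'n) cmodule"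
    by (rule blinfun_eqI) (simp add: L imag_sphere_left_left[OF J] blinfun.minus_right blinfun.minus_left)
  obtain C where C: "C \<ge> 0" "\<And>s. s \<in> paravectors - (double_sector \<phi> \<union> {0}) \<Longrightarrow> norm (to_blinfun (S_resolvent s T)) \<le> C / norm s"
    using T_bisectorial phi unfolding bisectorial_def by force
  define D where "D = C + norm (jr :: ('v, 'n) cmodule \<Rightarrow>\<^sub>L ('v, 'n) cmodule) * (C * norm L)"
  have D: "0 \<le> D" using C by (simp add: D_def)
  have so: "sin \<omega> < sin \<phi>" using sin_mono_quarter[of \<omega> \<phi>] phi omega_bounds by auto
  have X: "norm z * norm (Re z *\<^sub>R q z - Im z *\<^sub>R (q z o\<^sub>L L) - tq z) \<le> C" if z: "z \<noteq> 0" "sin \<phi> * norm z \<le> \<bar>Im z\<bar>" for z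
  proof -
    have "sin \<omega> * norm z < sin \<phi> * norm z" using so z by simp
    from less_le_trans[OF this z(2)] have zO: "z \<in> Omega" by (simp add: Omega_def)
    have "z \<notin> dcone (sin \<phi>)" using z by (simp add: dcone_def)
    then have "slice_pt J (Re z) (Im z) \<in> paravectors - (double_sector \<phi> \<union> {0})"
      using slice_pt_paravector[OF J] double_sector_slice[OF J, of \<phi> z] phi omega_bounds norm_slice_pt[OF J, of "Re z" "Im z"] z(1)
      by auto
    from C(2)[OF this] have "norm (to_blinfun (S_resolvent (slice_pt J (Re z) (Im z)) T)) \<le> C / norm z"
      by (simp add: norm_slice_pt[OF J])
    then show ?thesis using z(1) unfolding to_blinfun_S_resolvent[OF zO J] L_def[symmetric]
      by (simp add: pos_le_divide_eq mult.commute)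
  qed
  have "norm z * norm (R z) \<le> D" if z: "z \<noteq> 0" "sin \<phi> * norm z \<le> \<bar>Im z\<bar>" for z
  proof -
    have cz: "cnj z \<noteq> 0" "sin \<phi> * norm (cnj z) \<le> \<bar>Im (cnj z)\<bar>" using z by auto
    have "Qc (cnj z) = Qc z" by (simp add: Qc_def)
    then have qq: "q (cnj z) = q z" "tq (cnj z) = tq z" by (simp_all add: q_def tq_def tqf_def[abs_def])
    define P where "P = Re z *\<^sub>R q z - tq z"
    define N where "N = Im z *\<^sub>R (q z o\<^sub>L L)"
    have "norm z * norm (P - N) \<le> C" using X[OF z] by (simp add: P_def N_def algebra_simps)
    moreover have "norm z * norm (P + N) \<le> C" using X[OF cz] by (simp add: P_def N_def qq algebra_simps)
    ultimately have s: "norm z * norm (P + N) + norm z * norm (P - N) \<le> 2 * C" by linarith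
    have "2 *\<^sub>R P = (P + N) + (P - N)" "2 *\<^sub>R N = (P + N) - (P - N)" by (simp_all add: scaleR_2)
    then have "norm (2 *\<^sub>R P) \<le> norm (P + N) + norm (P - N)" "norm (2 *\<^sub>R N) \<le> norm (P + N) + norm (P - N)"
      using norm_triangle_ineq[of "P + N" "P - N"] norm_triangle_ineq4[of "P + N" "P - N"] by simp_all
    then have "norm z * norm (2 *\<^sub>R P) \<le> norm z * (norm (P + N) + norm (P - N))" "norm z * norm (2 *\<^sub>R N) \<le> norm z * (norm (P + N) + norm (P - N))"
      by (intro mult_left_mono; simp)+
    then have P: "norm z * norm P \<le> C" and N: "norm z * norm N \<le> C" using s by (simp_all add: distrib_left)
    have "Im z *\<^sub>R q z = - (N o\<^sub>L L)"
      unfolding N_def bounded_bilinear.scaleR_left[OF bounded_bilinear_blinfun_compose] LL by simp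
    then have "norm z * norm (Im z *\<^sub>R q z) \<le> norm z * (norm N * norm L)"
      using norm_blinfun_compose[of N L] by (intro mult_left_mono) auto
    also have "\<dots> \<le> C * norm L" using mult_right_mono[OF N, of "norm L"] by (simp add: mult.assoc)
    finally have 1: "norm z * norm (Im z *\<^sub>R q z) \<le> C * norm L" .
    have "R z = P - (jr o\<^sub>L (Im z *\<^sub>R q z))"
      by (rule blinfun_eqI) (simp add: R_apply P_def cr_apply blinfun.diff_left blinfun.scaleR_left blinfun.scaleR_right)
    then have "norm (R z) \<le> norm P + norm (jr :: ('v, 'n) cmodule \<Rightarrow>\<^sub>L ('v, 'n) cmodule) * norm (Im z *\<^sub>R q z)"
      using norm_triangle_ineq4[of P "jr o\<^sub>L (Im z *\<^sub>R q z)"] norm_blinfun_compose[of jr "Im z *\<^sub>R q z"] by simp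
    then have "norm z * norm (R z) \<le> norm z * (norm P + norm (jr :: ('v, 'n) cmodule \<Rightarrow>\<^sub>L ('v, 'n) cmodule) * norm (Im z *\<^sub>R q z))"
      by (intro mult_left_mono) auto
    also have "\<dots> = norm z * norm P + norm (jr :: ('v, 'n) cmodule \<Rightarrow>\<^sub>L ('v, 'n) cmodule) * (norm z * norm (Im z *\<^sub>R q z))"
      by (simp add: algebra_simps)
    also have "\<dots> \<le> D" unfolding D_def by (intro add_mono P mult_left_mono 1) auto
    finally show ?thesis .
  qed
  then show ?thesis using D by blast
qed

sublocale bisector_resolvent cr R \<omega>
proof (rule bisector_resolvent.intro)
  show "bounded_linear (cr :: complex \<Rightarrow> ('v, 'n) cmodule \<Rightarrow>\<^sub>L ('v, 'n) cmodule)" by (rule bounded_linear_cr)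
  show "cr 1 = (id_blinfun :: ('v, 'n) cmodule \<Rightarrow>\<^sub>L ('v, 'n) cmodule)" by (rule cr_one)
  show "cr (a * b) = cr a o\<^sub>L (cr b :: ('v, 'n) cmodule \<Rightarrow>\<^sub>L ('v, 'n) cmodule)" for a b by (rule cr_mult)
  show "0 < \<omega>" "\<omega> < pi / 2" by (rule omega_bounds)+
  show "R z o\<^sub>L cr c = cr c o\<^sub>L R z" if "sin \<omega> * norm z < \<bar>Im z\<bar>" for z c
  proof (rule blinfun_eqI)
    fix v
    have z: "z \<in> Omega" using that by (simp add: Omega_def)
    show "(R z o\<^sub>L cr c) v = (cr c o\<^sub>L R z) v"
      by (simp add: R_apply q_cr[OF z] tq_cr[OF z] cr_cr blinfun.diff_right mult.commute)
  qed
  show "R z - R w = cr (w - z) o\<^sub>L (R z o\<^sub>L R w)" if "sin \<omega> * norm z < \<bar>Im z\<bar>" "sin \<omega> * norm w < \<bar>Im w\<bar>" for z w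
    using that by (intro R_resolvent_equation) (auto simp: Omega_def)
  show "\<exists>C\<ge>0. \<forall>z. z \<noteq> 0 \<longrightarrow> sin \<phi> * norm z \<le> \<bar>Im z\<bar> \<longrightarrow> norm z * norm (R z) \<le> C" if "\<omega> < \<phi>" "\<phi> < pi / 2" for \<phi>
    using that by (rule R_angle_bound)
qed

end

subsection \<open>The slice integral as a planar integral\<close>

lemma has_integral_reflect_halfline:
  fixes f :: "real \<Rightarrow> 'b::banach"
  assumes "((\<lambda>t. f (- t)) has_integral b) {0<..}"
  shows "(f has_integral b) {..<0}"
proof -
  define g where "g x = (if x \<in> {0<..} then f (- x) else 0)" for x
  have e: "(\<lambda>x. if x \<in> {..<0} then f x else 0) = (\<lambda>x. g (- x))" by (auto simp: g_def)
  note A = assms[unfolded has_integral_alt'[of "\<lambda>t. f (- t)"], folded g_def]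
  show ?thesis
    unfolding has_integral_alt'[of f] e
  proof (intro conjI allI impI)
    fix a b :: real
    have "g integrable_on cbox (- b) (- a)" using A by blast
    then show "(\<lambda>x. g (- x)) integrable_on cbox a b"
      using has_integral_reflect_real[of g _ "- a" "- b"] by (auto simp: integrable_on_def)
  next
    fix e :: real assume "e > 0"
    then obtain B where B: "B > 0" "\<And>c d. ball 0 B \<subseteq> cbox c d \<Longrightarrow> norm (integral (cbox c d) g - b) < e" using A by blast
    show "\<exists>B>0. \<forall>c d. ball 0 B \<subseteq> cbox c d \<longrightarrow> norm (integral (cbox c d) (\<lambda>x. g (- x)) - b) < e"
    proof (intro exI[of _ B] conjI allI impI B(1))
      fix c d :: real assume s: "ball 0 B \<subseteq> cbox c d"
      have "ball 0 B \<subseteq> cbox (- d) (- c)"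
      proof
        fix x :: real assume "x \<in> ball 0 B"
        then have "- x \<in> ball 0 B" by simp
        then have "- x \<in> cbox c d" using s by blast
        then show "x \<in> cbox (- d) (- c)" by auto
      qed
      then have "norm (integral (cbox (- d) (- c)) g - b) < e" by (rule B)
      moreover have "integral (cbox c d) (\<lambda>x. g (- x)) = integral (cbox (- d) (- c)) g"
      proof (rule integral_unique)
        have "g integrable_on {- d..- c}" using A by simp
        then show "((\<lambda>x. g (- x)) has_integral integral (cbox (- d) (- c)) g) (cbox c d)"
          using has_integral_reflect_real[of g "integral {- d..- c} g" "- c" "- d"] by (simp add: integrable_integral)
      qed
      ultimately show "norm (integral (cbox c d) (\<lambda>x. g (- x)) - b) < e" by simp
    qed
  qed
qed

lemma integral_UNIV_symmetrized:
  fixes f :: "real \<Rightarrow> 'b::banach"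
  assumes "f integrable_on {0<..}" "(\<lambda>t. f (- t)) integrable_on {0<..}"
  shows "integral UNIV f = integral {0<..} (\<lambda>t. f t + f (- t))"
proof -
  have "{0<..} \<inter> {..<0::real} = {}" by auto
  then have "(f has_integral (integral {0<..} f + integral {0<..} (\<lambda>t. f (- t)))) ({0<..} \<union> {..<0})"
    by (intro has_integral_Un[OF integrable_integral[OF assms(1)] has_integral_reflect_halfline[OF integrable_integral[OF assms(2)]]]) simp
  then have "(f has_integral (integral {0<..} f + integral {0<..} (\<lambda>t. f (- t)))) UNIV"
    by (rule has_integral_spike_set_eq[THEN iffD1, rotated 2]) (auto intro: negligible_subset[of "{0}"])
  then show ?thesis using integral_add[OF assms] by (simp add: integral_unique)
qed

abbreviation sl :: "'n::finite clifford \<Rightarrow> complex \<Rightarrow> 'n clifford" where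
  "sl J z \<equiv> slice_pt J (Re z) (Im z)"

lemma cl_mult_of_real:
  fixes J :: "'n::{finite,linorder} clifford"
  shows "J \<odot> cl_of_real r = r *\<^sub>R J"
proof -
  have "(J \<odot> cl_of_real r) $ C = (\<Sum>A\<in>UNIV. if A = C then r * (J $ C) else 0)" for C
    unfolding cl_mult_eq_left cl_left_nth
    by (intro sum.cong refl) (auto simp: cl_of_real_nth csign_prod)
  then show ?thesis by (simp add: vec_eq_iff)
qed

lemma sl_mult:
  fixes J :: "'n::{finite,linorder} clifford"
  assumes "J \<in> imag_sphere"
  shows "sl J a \<odot> sl J b = sl J (a * b)"
proof -
  have "sl J a \<odot> sl J b = Re a *\<^sub>R sl J b + Im a *\<^sub>R (J \<odot> sl J b)"
    unfolding cl_mult_eq_left by (rule cl_left_slice_pt)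
  also have "J \<odot> sl J b = J \<odot> cl_of_real (Re b) + Im b *\<^sub>R (J \<odot> J)"
    unfolding cl_mult_eq_left slice_pt_def
    using linear_simps(1,5)[OF bounded_linear_cl_left[of J]] by (metis (no_types))
  also have "Re a *\<^sub>R sl J b + Im a *\<^sub>R (J \<odot> cl_of_real (Re b) + Im b *\<^sub>R (J \<odot> J)) = sl J (a * b)"
    by (simp add: cl_mult_of_real imag_sphere_square[OF assms] vec_eq_iff slice_pt_nth cl_of_real_nth algebra_simps)
  finally show ?thesis .
qed

text \<open>A complex number \<open>F z\<close> encodes the pair \<open>(f\<^sub>0, f\<^sub>1)\<close> of real slice components of an intrinsic function.\<close>

definition rep :: "real \<Rightarrow> ('n::finite clifford \<Rightarrow> 'n clifford) \<Rightarrow> (complex \<Rightarrow> complex) \<Rightarrow> bool" where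
  "rep \<theta> f F \<longleftrightarrow> (\<forall>J\<in>imag_sphere. \<forall>z\<in>dcone (sin \<theta>). f (sl J z) = sl J (F z))"

text \<open>The parity conditions on the slice components: the real part is even and the imaginary
  part odd in the second coordinate.\<close>

definition cnj_sym :: "real \<Rightarrow> (complex \<Rightarrow> complex) \<Rightarrow> bool" where
  "cnj_sym \<theta> F \<longleftrightarrow> (\<forall>z\<in>dcone (sin \<theta>). F (cnj z) = cnj (F z))"

text \<open>The planar form of \<open>bisector_path\<close>; \<open>path_deriv\<close> is its
  derivative away from \<open>t = 0\<close>.\<close>

definition path_pt :: "real \<Rightarrow> real \<Rightarrow> real \<Rightarrow> complex" where
  "path_pt \<phi> \<epsilon> t = of_real (\<epsilon> * \<bar>t\<bar>) * cis (- sgn t * \<phi>)"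

definition path_deriv :: "real \<Rightarrow> real \<Rightarrow> real \<Rightarrow> complex" where
  "path_deriv \<phi> \<epsilon> t = of_real (\<epsilon> * sgn t) * cis (- sgn t * \<phi>)"

lemma bisector_path_eq: "bisector_path \<phi> J \<epsilon> t = sl J (path_pt \<phi> \<epsilon> t)"
  by (simp add: bisector_path_def path_pt_def cl_exp_slice)

lemma bisector_path_derivative:
  assumes "t \<noteq> 0"
  shows "vector_derivative (bisector_path \<phi> J \<epsilon>) (at t) = sl J (path_deriv \<phi> \<epsilon> t)"
proof (rule vector_derivative_at)
  have "((\<lambda>u. (\<epsilon> * (sgn t * u)) *\<^sub>R cl_exp J (- sgn t * \<phi>)) has_vector_derivative (\<epsilon> * sgn t) *\<^sub>R cl_exp J (- sgn t * \<phi>)) (at t)"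
    by (auto intro!: derivative_eq_intros simp: has_vector_derivative_def mult_ac)
  then have "(bisector_path \<phi> J \<epsilon> has_vector_derivative (\<epsilon> * sgn t) *\<^sub>R cl_exp J (- sgn t * \<phi>)) (at t)"
  proof (rule has_vector_derivative_transform_within_open[of _ _ _ "{u. 0 < sgn t * u}"])
    show "open {u. 0 < sgn t * u}" by (intro open_Collect_less continuous_intros)
    show "t \<in> {u. 0 < sgn t * u}" using assms by (simp add: sgn_if)
    fix u assume "u \<in> {u. 0 < sgn t * u}"
    then have "sgn u = sgn t" "\<bar>u\<bar> = sgn t * u" by (auto simp: sgn_if abs_if split: if_splits)
    then show "(\<epsilon> * (sgn t * u)) *\<^sub>R cl_exp J (- sgn t * \<phi>) = bisector_path \<phi> J \<epsilon> u"
      by (simp add: bisector_path_def)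
  qed
  then show "(bisector_path \<phi> J \<epsilon> has_vector_derivative sl J (path_deriv \<phi> \<epsilon> t)) (at t)"
    by (simp add: cl_exp_slice path_deriv_def)
qed

lemma cl_inv_imag: "J \<in> imag_sphere \<Longrightarrow> cl_inv J = sl J (- \<i>)"
  by (auto simp: cl_inv_def cl_conj_def vec_eq_iff slice_pt_nth imag_sphere_def)

definition lc :: "'n clifford \<Rightarrow> complex \<Rightarrow> ('v::real_normed_vector, 'n::{finite,linorder}) cmodule \<Rightarrow>\<^sub>L ('v, 'n) cmodule" where
  "lc J c = Re c *\<^sub>R id_blinfun + Im c *\<^sub>R Blinfun (\<lambda>v. J \<triangleright> v)"

lemma lc_apply: "lc J c v = sl J c \<triangleright> v"
  by (simp add: lc_def blinfun.add_left blinfun.scaleR_left bounded_linear_Blinfun_apply[OF bounded_linear_cl_left] cl_left_slice_pt)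

text \<open>In a conjugate pair the \<open>J\<close> parts cancel and a real scalar is left, which
  acts alike from the left and from the right. This is how left multiplications become right
  ones.\<close>

lemma lc_add_cnj: "lc J c + lc J (cnj c) = (2 * Re c) *\<^sub>R id_blinfun"
  by (simp add: lc_def scaleR_two)

lemma norm_lc:
  "norm (lc J c :: ('v::real_normed_vector, 'n::{finite,linorder}) cmodule \<Rightarrow>\<^sub>L ('v, 'n) cmodule)
    \<le> norm c * (1 + norm (Blinfun (\<lambda>v. J \<triangleright> v) :: ('v, 'n) cmodule \<Rightarrow>\<^sub>L ('v, 'n) cmodule))" (is "?l \<le> _ * (1 + ?B)")
proof -
  have "?l \<le> \<bar>Re c\<bar> * norm (id_blinfun :: ('v, 'n) cmodule \<Rightarrow>\<^sub>L ('v, 'n) cmodule) + \<bar>Im c\<bar> * ?B"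
    unfolding lc_def by (intro order_trans[OF norm_triangle_ineq]) simp
  also have "\<dots> \<le> norm c * 1 + norm c * ?B"
    by (intro add_mono mult_mono abs_Re_le_cmod abs_Im_le_cmod norm_blinfun_id_le) auto
  finally show ?thesis by (simp add: distrib_left)
qed

lemma bounded_linear_lc: "bounded_linear (lc J)"
  unfolding lc_def[abs_def]
  by (intro bounded_linear_add bounded_linear_scaleR_left[THEN bounded_linear_compose] bounded_linear_Re bounded_linear_Im)

context bisectorial_op
begin

lemma Om_Omega: "Om = Omega"
  by (simp add: Om_def Omega_def)

lemma Qc_cnj: "Qc (cnj z) = Qc z" by (simp add: Qc_def)

lemma q_cnj: "q (cnj z) = q z" by (simp add: q_def Qc_cnj)

lemma tq_cnj: "tq (cnj z) = tq z" by (simp add: tq_def tqf_def[abs_def] q_cnj)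

text \<open>\<open>q\<close> and \<open>tq\<close> agree at \<open>z\<close> and
  \<open>cnj z\<close>, so \<open>R z - R (cnj z)\<close> retains only \<open>q z\<close>.
  Continuity and bounds of \<open>q\<close> and \<open>tq\<close> are thereby inherited from
  \<open>R\<close>.\<close>

lemma q_eq_R:
  assumes "z \<in> Omega"
  shows "q z = cr (1 / (cnj z - z)) o\<^sub>L (R z - R (cnj z))"
proof -
  have "Im z \<noteq> 0"
  proof
    assume "Im z = 0"
    then have "sin \<omega> * norm z < 0" using assms by (simp add: Omega_def)
    moreover have "0 \<le> sin \<omega>" using omega_bounds by (intro sin_ge_zero) auto
    ultimately show False by (simp add: mult_less_0_iff)
  qed
  then have nz: "cnj z - z \<noteq> 0" by (simp add: complex_eq_iff)
  have "R z - R (cnj z) = cr (cnj z - z) o\<^sub>L q z"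
    by (simp add: R_def q_cnj tq_cnj linear_simps(2)[OF bounded_linear_cr] blinfun_compose_simps)
  then show ?thesis using cs_inverse[OF nz, of "q z"] by simp
qed

lemma tq_eq_R: "tq z = (cr (cnj z) o\<^sub>L q z) - R z"
  by (simp add: R_def)

text \<open>On the ray \<open>q\<close> is of order \<open>1 / t\<^sup>2\<close> and
  \<open>tq\<close> of order \<open>1 / t\<close>, so both halves of the slice integrand, taken
  before symmetrisation, are dominated by \<open>F z / z\<close>.\<close>

lemma ray_ok_left:
  fixes J :: "'n clifford"
  assumes F: "F \<in> H0 \<theta>" and al: "sin \<omega> < \<bar>sin \<alpha>\<bar>" "\<bar>sin \<alpha>\<bar> < sin \<theta>"
  shows "ray_ok (\<lambda>z. (q z o\<^sub>L lc J (cnj z * (k * F z))) - (tq z o\<^sub>L lc J (k * F z))) \<alpha>"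
proof -
  have ok0: "ray_ok (\<lambda>z. F z / z) \<alpha>" using F al by (simp add: H0_def)
  define a where "a = \<bar>sin \<alpha>\<bar>"
  have so: "0 < sin \<omega>" using omega_bounds by (intro sin_gt_zero) auto
  have a: "0 < a" "sin \<omega> < a" using so al by (auto simp: a_def)
  let ?z = "\<lambda>t. complex_of_real t * cis \<alpha>"
  have z: "?z t \<in> Omega" "cnj (?z t) \<in> Omega" "\<bar>Im (?z t)\<bar> = a * t" "norm (?z t) = t" "?z t \<noteq> 0" "cnj (?z t) - ?z t \<noteq> 0" if "0 < t" for t
    using that al a by (auto simp: Omega_def norm_mult abs_mult a_def complex_eq_iff)
  have Rc: "continuous_on Omega R" using R_cont by (simp add: continuous_at_imp_continuous_on Om_Omega)
  have c1: "continuous_on {0<..} (\<lambda>t. R (?z t))"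
    by (rule continuous_on_compose2[OF Rc]) (use z in \<open>auto intro!: continuous_intros\<close>)
  have c2: "continuous_on {0<..} (\<lambda>t. R (cnj (?z t)))"
    by (rule continuous_on_compose2[OF Rc]) (use z in \<open>auto intro!: continuous_intros simp del: complex_cnj_mult\<close>)
  have "continuous_on {0<..} (\<lambda>t. cr (1 / (cnj (?z t) - ?z t)) o\<^sub>L (R (?z t) - R (cnj (?z t))))"
    using z by (intro op.continuous_on continuous_intros c1 c2) auto
  then have cq: "continuous_on {0<..} (\<lambda>t. q (?z t))"
    by (rule continuous_on_eq) (use q_eq_R z in simp)
  have ct: "continuous_on {0<..} (\<lambda>t. tq (?z t))"
    unfolding tq_eq_R by (intro op.continuous_on continuous_intros c1 cq)
  note cF = H0_ray_continuous[OF F al(2)]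
  have okc: "continuous_on {0<..} (\<lambda>t. (q (?z t) o\<^sub>L lc J (cnj (?z t) * (k * F (?z t)))) - (tq (?z t) o\<^sub>L lc J (k * F (?z t))))"
    by (intro continuous_on_diff bounded_bilinear.continuous_on[OF bounded_bilinear_blinfun_compose] cq ct
        bounded_linear.continuous_on[OF bounded_linear_lc] continuous_intros cF)
  obtain C where C: "C \<ge> 0" "\<And>z. z \<noteq> 0 \<Longrightarrow> a * norm z \<le> \<bar>Im z\<bar> \<Longrightarrow> norm z * norm (R z) \<le> C"
    using R_bound[OF a(2)] by blast
  obtain K where K: "\<And>c (A :: ('v, 'n) cmodule \<Rightarrow>\<^sub>L ('v, 'n) cmodule). norm (cr c o\<^sub>L A) \<le> norm c * norm A * K" "0 \<le> K"
    using op.nonneg_bounded by blast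
  define L where "L = 1 + norm (Blinfun (\<lambda>v. J \<triangleright> v) :: ('v, 'n) cmodule \<Rightarrow>\<^sub>L ('v, 'n) cmodule)"
  have L: "0 \<le> L" by (simp add: L_def)
  define D where "D = C / a * K"
  have D: "0 \<le> D" using C a K by (simp add: D_def)
  have bnd: "norm ((q (?z t) o\<^sub>L lc J (cnj (?z t) * (k * F (?z t)))) - (tq (?z t) o\<^sub>L lc J (k * F (?z t))))
    \<le> ((D + D * K + C) * norm k * L) * norm (F (?z t) / ?z t)" if t: "0 < t" for t
  proof -
  have Rb: "norm (R (?z t)) \<le> C / t" "norm (R (cnj (?z t))) \<le> C / t"
    using C(2)[of "?z t"] C(2)[of "cnj (?z t)"] z[OF t] t
    by (simp_all add: pos_le_divide_eq mult.commute[of t] del: complex_cnj_mult)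
  have n2: "norm (cnj (?z t) - ?z t) = 2 * (a * t)"
  proof -
    have "cnj (?z t) - ?z t = of_real (- 2 * Im (?z t)) * \<i>" by (simp add: complex_eq_iff)
    then have "norm (cnj (?z t) - ?z t) = 2 * \<bar>Im (?z t)\<bar>" by (simp only: norm_mult norm_of_real) (simp add: abs_mult)
    then show ?thesis using z(3)[OF t] by simp
  qed
  have qb: "norm (q (?z t)) \<le> D / t\<^sup>2"
  proof -
    have "norm (q (?z t)) \<le> norm (1 / (cnj (?z t) - ?z t)) * norm (R (?z t) - R (cnj (?z t))) * K"
      unfolding q_eq_R[OF z(1)[OF t]] by (rule K)
    also have "norm (1 / (cnj (?z t) - ?z t)) = 1 / (2 * (a * t))" by (simp only: norm_divide norm_one n2)
    also have "1 / (2 * (a * t)) * norm (R (?z t) - R (cnj (?z t))) * K \<le> 1 / (2 * (a * t)) * (C / t + C / t) * K"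
      using K t a by (intro mult_right_mono mult_left_mono order_trans[OF norm_triangle_ineq4] add_mono Rb) auto
    also have "\<dots> = D / t\<^sup>2" using t a by (simp add: D_def power2_eq_square field_simps)
    finally show ?thesis .
  qed
  have tb: "norm (tq (?z t)) \<le> (D * K + C) / t"
  proof -
    have "norm (tq (?z t)) \<le> norm (cr (cnj (?z t)) o\<^sub>L q (?z t)) + norm (R (?z t))"
      unfolding tq_eq_R by (rule norm_triangle_ineq4)
    also have "\<dots> \<le> norm (cnj (?z t)) * norm (q (?z t)) * K + C / t" by (intro add_mono K Rb)
    also have "norm (cnj (?z t)) = t" by (simp only: complex_mod_cnj z(4)[OF t])
    also have "t * norm (q (?z t)) * K + C / t \<le> t * (D / t\<^sup>2) * K + C / t"
      using K t by (intro add_mono mult_right_mono mult_left_mono qb) auto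
    also have "\<dots> = (D * K + C) / t" using t by (simp add: power2_eq_square field_simps)
    finally show ?thesis .
  qed
  let ?F = "F (?z t)"
  have "norm ((q (?z t) o\<^sub>L lc J (cnj (?z t) * (k * ?F))) - (tq (?z t) o\<^sub>L lc J (k * ?F)))
      \<le> norm (q (?z t)) * norm (lc J (cnj (?z t) * (k * ?F)) :: ('v, 'n) cmodule \<Rightarrow>\<^sub>L ('v, 'n) cmodule) + norm (tq (?z t)) * norm (lc J (k * ?F) :: ('v, 'n) cmodule \<Rightarrow>\<^sub>L ('v, 'n) cmodule)"
    by (intro order_trans[OF norm_triangle_ineq4] add_mono norm_blinfun_compose)
  also have "\<dots> \<le> (D / t\<^sup>2) * ((t * (norm k * norm ?F)) * L) + ((D * K + C) / t) * ((norm k * norm ?F) * L)"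
  proof (intro add_mono mult_mono qb tb)
    show "norm (lc J (cnj (?z t) * (k * ?F)) :: ('v, 'n) cmodule \<Rightarrow>\<^sub>L ('v, 'n) cmodule) \<le> (t * (norm k * norm ?F)) * L"
      using norm_lc[of J "cnj (?z t) * (k * ?F)"] z(4)[OF t] t by (simp add: L_def norm_mult)
    show "norm (lc J (k * ?F) :: ('v, 'n) cmodule \<Rightarrow>\<^sub>L ('v, 'n) cmodule) \<le> (norm k * norm ?F) * L"
      using norm_lc[of J "k * ?F"] by (simp add: L_def norm_mult)
  qed (use D C K t in auto)
  also have "\<dots> = ((D + D * K + C) * norm k * L) * norm (?F / ?z t)"
    using t by (simp add: norm_divide norm_mult power2_eq_square field_simps)
  finally show ?thesis .
  qed
  show ?thesis by (rule ray_ok_bounded_by[OF ok0 okc bnd])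
qed

text \<open>Both sides equal \<open>2 Re (cnj z * c)\<close> times \<open>q z\<close> minus
  \<open>2 Re c\<close> times \<open>tq z\<close>: pairing \<open>c\<close> with
  \<open>cnj c\<close> turns left and right scalars alike into real ones.\<close>

lemma symmetrized_integrand:
  assumes z: "z \<in> Omega"
  shows "((q z o\<^sub>L lc J (cnj z * c)) - (tq z o\<^sub>L lc J c)) + ((q z o\<^sub>L lc J (z * cnj c)) - (tq z o\<^sub>L lc J (cnj c)))
    = (cr c o\<^sub>L R z) + (cr (cnj c) o\<^sub>L R (cnj z))"
proof -
  have 1: "(q z o\<^sub>L lc J (cnj z * c)) + (q z o\<^sub>L lc J (z * cnj c)) = (2 * Re (cnj z * c)) *\<^sub>R q z"
    using arg_cong[OF lc_add_cnj[of J "cnj z * c"], of "\<lambda>A. q z o\<^sub>L A"] by (simp add: blinfun_compose_simps)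
  have 2: "(tq z o\<^sub>L lc J c) + (tq z o\<^sub>L lc J (cnj c)) = (2 * Re c) *\<^sub>R tq z"
    using arg_cong[OF lc_add_cnj[of J c], of "\<lambda>A. tq z o\<^sub>L A"] by (simp add: blinfun_compose_simps)
  have cc: "(cr c o\<^sub>L A) + (cr (cnj c) o\<^sub>L A) = (2 * Re c) *\<^sub>R A" for c and A :: "('v, 'n) cmodule \<Rightarrow>\<^sub>L ('v, 'n) cmodule"
    by (rule blinfun_eqI) (simp add: blinfun.add_left blinfun.scaleR_left cr_apply scaleR_two)
  have "(cr c o\<^sub>L R z) + (cr (cnj c) o\<^sub>L R (cnj z))
      = ((cr (cnj z * c) o\<^sub>L q z) + (cr (cnj (cnj z * c)) o\<^sub>L q z)) - ((cr c o\<^sub>L tq z) + (cr (cnj c) o\<^sub>L tq z))"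
    by (simp add: R_def q_cnj tq_cnj blinfun_compose_simps cr_mult blinfun_compose_assoc[symmetric] cs_comm)
  also have "\<dots> = (2 * Re (cnj z * c)) *\<^sub>R q z - (2 * Re c) *\<^sub>R tq z" by (simp only: cc)
  finally show ?thesis using 1 2 by (simp add: algebra_simps)
qed


text \<open>The number \<open>k\<close> encodes the derivative of the path divided by
  \<open>J\<close>, since the inverse of \<open>J\<close> is \<open>- J\<close>.\<close>

lemma integrand_eq:
  fixes J :: "'n clifford"
  assumes J: "J \<in> imag_sphere" and f: "rep \<theta> f F" and t: "t \<noteq> 0"
    and z: "path_pt \<phi> \<epsilon> t \<in> Omega" "path_pt \<phi> \<epsilon> t \<in> dcone (sin \<theta>)"
  defines "z \<equiv> path_pt \<phi> \<epsilon> t" and "k \<equiv> path_deriv \<phi> \<epsilon> t * (- \<i>)"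
  shows "to_blinfun (S_resolvent (bisector_path \<phi> J \<epsilon> t) T \<circ>\<^sub>m
       op_cl (vector_derivative (bisector_path \<phi> J \<epsilon>) (at t) \<odot> cl_inv J) \<circ>\<^sub>m
       op_cl (f (bisector_path \<phi> J \<epsilon> t)))
    = (q z o\<^sub>L lc J (cnj z * (k * F z))) - (tq z o\<^sub>L lc J (k * F z))" (is "to_blinfun ?A = ?B")
proof -
  have d: "vector_derivative (bisector_path \<phi> J \<epsilon>) (at t) \<odot> cl_inv J = sl J k"
    unfolding bisector_path_derivative[OF t] cl_inv_imag[OF J] k_def by (rule sl_mult[OF J])
  have fz: "f (bisector_path \<phi> J \<epsilon> t) = sl J (F z)"
    using f J z unfolding rep_def bisector_path_eq z_def by blast
  have zO: "z \<in> Omega" using z by (simp add: z_def)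
  have sc: "slice_pt J (Re z) (- Im z) = sl J (cnj z)" by simp
  have S: "S_resolvent (bisector_path \<phi> J \<epsilon> t) T w = Some (q z (sl J (cnj z) \<triangleright> w) - tq z w)" for w
    using S_resolvent_slice[OF zO J, of w] unfolding bisector_path_eq z_def[symmetric] sc .
  have w: "sl J k \<triangleright> sl J (F z) \<triangleright> v = sl J (k * F z) \<triangleright> v" for v :: "('v, 'n) cmodule"
    by (simp only: cl_left_assoc[symmetric] sl_mult[OF J])
  have w2: "sl J (cnj z) \<triangleright> sl J (k * F z) \<triangleright> v = sl J (cnj z * (k * F z)) \<triangleright> v" for v :: "('v, 'n) cmodule"
    by (simp only: cl_left_assoc[symmetric] sl_mult[OF J])
  have "the (?A v) = ?B v" for v
  proof -
    have "?A v = Some (q z (sl J (cnj z) \<triangleright> sl J k \<triangleright> sl J (F z) \<triangleright> v) - tq z (sl J k \<triangleright> sl J (F z) \<triangleright> v))"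
      unfolding d fz by (simp only: map_comp_def op_cl_def option.simps S)
    then show ?thesis unfolding w w2 by (simp only: option.sel blinfun.diff_left blinfun_apply_blinfun_compose lc_apply)
  qed
  then have "(\<lambda>v. the (?A v)) = blinfun_apply ?B" by (rule ext)
  then show ?thesis by (simp only: to_blinfun_def blinfun_apply_inverse)
qed

text \<open>\<open>\<alpha>\<close> and \<open>\<beta>\<close> are the angles of the two rays of one
  path; for \<open>\<epsilon> = -1\<close> they are \<open>pi - \<phi>\<close> and
  \<open>pi + \<phi>\<close>. The rays are conjugate, so the values at \<open>t\<close> and
  \<open>- t\<close> can be paired as in \<open>symmetrized_integrand\<close>, and division by
  \<open>J\<close> becomes multiplication by \<open>- i\<close> from the right.\<close>

lemma half_path_integral:
  fixes J :: "'n clifford"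
  assumes J: "J \<in> imag_sphere" and f: "rep \<theta> f F" and F: "F \<in> H0 \<theta>" "cnj_sym \<theta> F"
    and al: "of_real \<epsilon> * cis (- \<phi>) = cis \<alpha>" "of_real \<epsilon> * cis \<phi> = cis \<beta>"
    and s: "sin \<omega> < \<bar>sin \<alpha>\<bar>" "\<bar>sin \<alpha>\<bar> < sin \<theta>"
  shows "integral UNIV (\<lambda>t. to_blinfun (S_resolvent (bisector_path \<phi> J \<epsilon> t) T \<circ>\<^sub>m
       op_cl (vector_derivative (bisector_path \<phi> J \<epsilon>) (at t) \<odot> cl_inv J) \<circ>\<^sub>m
       op_cl (f (bisector_path \<phi> J \<epsilon> t))))
    = cr (- \<i>) o\<^sub>L (op.ray (\<lambda>z. cr (F z) o\<^sub>L R z) \<alpha> - op.ray (\<lambda>z. cr (F z) o\<^sub>L R z) \<beta>)"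
proof -
  define X where "X t = to_blinfun (S_resolvent (bisector_path \<phi> J \<epsilon> t) T \<circ>\<^sub>m
       op_cl (vector_derivative (bisector_path \<phi> J \<epsilon>) (at t) \<odot> cl_inv J) \<circ>\<^sub>m
       op_cl (f (bisector_path \<phi> J \<epsilon> t)))" for t
  define W where "W k z = (q z o\<^sub>L lc J (cnj z * (k * F z))) - (tq z o\<^sub>L lc J (k * F z))" for k z
  let ?G = "\<lambda>z. cr (F z) o\<^sub>L R z"
  have conj: "cnj (cis \<alpha>) = cis \<beta>"
    unfolding al[symmetric] by (simp add: cis_cnj)
  have sb: "\<bar>sin \<beta>\<bar> = \<bar>sin \<alpha>\<bar>" using arg_cong[OF conj, of Im] by simp
  have pos: "of_real t * cis \<alpha> \<in> Omega" "of_real t * cis \<alpha> \<in> dcone (sin \<theta>)"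
    "of_real t * cis \<beta> \<in> Omega" "of_real t * cis \<beta> \<in> dcone (sin \<theta>)" if "0 < t" for t
    using that s sb by (auto simp: Omega_def dcone_def norm_mult abs_mult)
  have p1: "path_pt \<phi> \<epsilon> t = of_real t * cis \<alpha>" "path_deriv \<phi> \<epsilon> t = cis \<alpha>" if "0 < t" for t
    using that by (simp_all add: path_pt_def path_deriv_def al(1)[symmetric] mult_ac)
  have p2: "path_pt \<phi> \<epsilon> (- t) = of_real t * cis \<beta>" "path_deriv \<phi> \<epsilon> (- t) = - cis \<beta>" if "0 < t" for t
    using that by (simp_all add: path_pt_def path_deriv_def al(2)[symmetric] mult_ac)
  have X1: "X t = W (cis \<alpha> * (- \<i>)) (of_real t * cis \<alpha>)" if t: "0 < t" for t
    using integrand_eq[OF J f, of t \<phi> \<epsilon>] pos[OF t] t unfolding X_def W_def p1[OF t] by simp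
  have X2: "X (- t) = W (- cis \<beta> * (- \<i>)) (of_real t * cis \<beta>)" if t: "0 < t" for t
    using integrand_eq[OF J f, of "- t" \<phi> \<epsilon>] pos[OF t] t unfolding X_def W_def p2[OF t] by simp
  have okI: "(\<lambda>t. W k (of_real t * cis \<gamma>)) integrable_on {0<..}" if "\<bar>sin \<gamma>\<bar> = \<bar>sin \<alpha>\<bar>" for k \<gamma>
  proof -
    have "ray_ok (W k) \<gamma>" unfolding W_def by (rule ray_ok_left[OF F(1)]) (use s that in auto)
    then show ?thesis
      using integrable_dominated(1)[of "\<lambda>t. W k (of_real t * cis \<gamma>)" "\<lambda>t. norm (W k (of_real t * cis \<gamma>))"]
      unfolding ray_ok_def by blast
  qed
  have i1: "X integrable_on {0<..}" using okI[of \<alpha> "cis \<alpha> * (- \<i>)"] by (rule integrable_eq) (auto simp: X1)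
  have i2: "(\<lambda>t. X (- t)) integrable_on {0<..}" using okI[OF sb, of "- cis \<beta> * (- \<i>)"] by (rule integrable_eq) (simp only: X2 greaterThan_iff)
  have Fa: "ray_ok ?G \<alpha>" by (rule ray_R_ok[OF F(1) s])
  have Fb: "ray_ok ?G \<beta>" by (rule ray_R_ok[OF F(1)]) (use s sb in auto)
  have "X t + X (- t) = (cr (- \<i>) o\<^sub>L (cr (cis \<alpha>) o\<^sub>L ?G (of_real t * cis \<alpha>))) - (cr (- \<i>) o\<^sub>L (cr (cis \<beta>) o\<^sub>L ?G (of_real t * cis \<beta>)))"
    if t: "0 < t" for t
  proof -
    define z where "z = of_real t * cis \<alpha>"
    have cz: "cnj z = of_real t * cis \<beta>" by (simp add: z_def conj)
    have z: "z \<in> Omega" "z \<in> dcone (sin \<theta>)" using pos[OF t] by (simp_all add: z_def)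
    define c where "c = cis \<alpha> * (- \<i>) * F z"
    have Fc: "F (cnj z) = cnj (F z)" using F(2) z by (simp add: cnj_sym_def)
    \<comment> \<open>On negative parameters the path runs towards 0. The resulting minus sign makes
      the weight at \<open>- t\<close> the conjugate of the weight at \<open>t\<close>.\<close>
    have cc: "cnj c = - cis \<beta> * (- \<i>) * F (cnj z)" by (simp add: c_def conj Fc)
    have "X t + X (- t) = ((q z o\<^sub>L lc J (cnj z * c)) - (tq z o\<^sub>L lc J c)) + ((q z o\<^sub>L lc J (z * cnj c)) - (tq z o\<^sub>L lc J (cnj c)))"
      unfolding X1[OF t] X2[OF t] W_def z_def[symmetric] cz[symmetric] c_def[symmetric] cc[symmetric] q_cnj tq_cnj by simp
    also have "\<dots> = (cr c o\<^sub>L R z) + (cr (cnj c) o\<^sub>L R (cnj z))" by (rule symmetrized_integrand[OF z(1)])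
    also have "cr c o\<^sub>L R z = cr (- \<i>) o\<^sub>L (cr (cis \<alpha>) o\<^sub>L ?G z)"
    proof -
      have "c = - \<i> * (cis \<alpha> * F z)" by (simp add: c_def)
      then show ?thesis by (simp only: cr_mult blinfun_compose_assoc)
    qed
    also have "cr (cnj c) o\<^sub>L R (cnj z) = - (cr (- \<i>) o\<^sub>L (cr (cis \<beta>) o\<^sub>L ?G (cnj z)))"
    proof -
      have "cnj c = - 1 * (- \<i> * (cis \<beta> * F (cnj z)))" by (simp add: cc)
      then have "cr (cnj c) o\<^sub>L R (cnj z) = cr (- 1) o\<^sub>L (cr (- \<i>) o\<^sub>L (cr (cis \<beta>) o\<^sub>L ?G (cnj z)))"
        by (simp only: cr_mult blinfun_compose_assoc)
      then show ?thesis by (simp add: cs_minus cs_one blinfun_compose_simps)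
    qed
    finally show ?thesis unfolding z_def[symmetric] cz[symmetric] by simp
  qed
  then have "integral UNIV X = integral {0<..} (\<lambda>t. (cr (- \<i>) o\<^sub>L (cr (cis \<alpha>) o\<^sub>L ?G (of_real t * cis \<alpha>))) - (cr (- \<i>) o\<^sub>L (cr (cis \<beta>) o\<^sub>L ?G (of_real t * cis \<beta>))))"
    unfolding integral_UNIV_symmetrized[OF i1 i2] by (intro integral_cong) simp
  also have "\<dots> = integral {0<..} (\<lambda>t. cr (- \<i>) o\<^sub>L (cr (cis \<alpha>) o\<^sub>L ?G (of_real t * cis \<alpha>))) - integral {0<..} (\<lambda>t. cr (- \<i>) o\<^sub>L (cr (cis \<beta>) o\<^sub>L ?G (of_real t * cis \<beta>)))"
    using integrable_linear[OF op.ray_integrand(1)[OF Fa] op.bounded_linear_right[of "- \<i>"]]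
      integrable_linear[OF op.ray_integrand(1)[OF Fb] op.bounded_linear_right[of "- \<i>"]]
    by (intro integral_diff) (simp_all only: o_def)
  also have "\<dots> = (cr (- \<i>) o\<^sub>L op.ray ?G \<alpha>) - (cr (- \<i>) o\<^sub>L op.ray ?G \<beta>)"
    using integral_linear[OF op.ray_integrand(1)[OF Fa] op.bounded_linear_right[of "- \<i>"]]
      integral_linear[OF op.ray_integrand(1)[OF Fb] op.bounded_linear_right[of "- \<i>"]]
    by (simp only: o_def op.ray_def)
  finally show ?thesis unfolding X_def by (simp only: blinfun_compose_simps(4))
qed

lemma omega_integral_eq_Phi:
  fixes J :: "'n clifford"
  assumes J: "J \<in> imag_sphere" and f: "rep \<theta> f F" and F: "F \<in> H0 \<theta>" "cnj_sym \<theta> F"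
    and phi: "\<omega> < \<phi>" "\<phi> < \<theta>" "\<theta> < pi / 2"
  shows "omega_integral \<phi> J T f = Phi F \<phi>"
proof -
  let ?G = "\<lambda>z. cr (F z) o\<^sub>L R z"
  have s: "sin \<omega> < sin \<phi>" "0 < sin \<phi>" "sin \<phi> < sin \<theta>"
    using sin_mono_quarter[of \<omega> \<phi>] sin_mono_quarter[of \<phi> \<theta>] phi omega_bounds by auto
  have 1: "of_real 1 * cis (- \<phi>) = cis (- \<phi>)" "of_real 1 * cis \<phi> = cis \<phi>" by simp_all
  have 2: "of_real (- 1) * cis (- \<phi>) = cis (pi - \<phi>)" "of_real (- 1) * cis \<phi> = cis (pi + \<phi>)"
    by (simp_all add: complex_eq_iff)
  have "omega_integral \<phi> J T f = (1 / (2 * pi)) *\<^sub>R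
     ((cr (- \<i>) o\<^sub>L (op.ray ?G (- \<phi>) - op.ray ?G \<phi>)) + (cr (- \<i>) o\<^sub>L (op.ray ?G (pi - \<phi>) - op.ray ?G (pi + \<phi>))))"
    unfolding omega_integral_def
    using half_path_integral[OF J f F 1] half_path_integral[OF J f F 2] s by simp
  also have "\<dots> = (1 / (2 * pi)) *\<^sub>R (cr (- \<i>) o\<^sub>L op.gam ?G \<phi>)"
    by (simp only: op.gam_def blinfun_compose_simps(2))
  also have "\<dots> = cr (of_real (1 / (2 * pi))) o\<^sub>L (cr (- \<i>) o\<^sub>L op.gam ?G \<phi>)"
    unfolding cs_of_real by (simp add: blinfun_compose_simps)
  also have "\<dots> = cr (1 / (2 * of_real pi * \<i>)) o\<^sub>L op.gam ?G \<phi>"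
  proof -
    have e: "1 / (2 * of_real pi * \<i>) = of_real (1 / (2 * pi)) * (- \<i>)" by (simp add: complex_eq_iff Re_divide Im_divide power2_eq_square)
    show ?thesis by (simp only: e cr_mult blinfun_compose_assoc)
  qed
  finally show ?thesis by (simp only: Phi_def)
qed

end

subsection \<open>Intrinsic functions\<close>

lemma double_sector_sl:
  assumes "s \<in> double_sector \<theta>" "0 < \<theta>" "\<theta> < pi / 2"
  shows "\<exists>J\<in>imag_sphere. \<exists>z\<in>dcone (sin \<theta>). s = sl J z"
proof -
  obtain r J \<alpha> where s: "s = slice_pt J (r * cos \<alpha>) (r * sin \<alpha>)" "0 < r" "J \<in> imag_sphere" "\<alpha> \<in> sector_angles \<theta>"
    using assms(1) by (auto simp: double_sector_def cl_exp_slice)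
  have "of_real r * cis \<alpha> \<in> dcone (sin \<theta>)"
    using s(2) sin_sector_angles[OF s(4) assms(2,3)] by (rule ray_in_dcone)
  then show ?thesis using s(1,3) by (intro bexI[of _ J] bexI[of _ "of_real r * cis \<alpha>"]) auto
qed

lemma slice_domain_double_sector:
  assumes "0 < \<theta>" "\<theta> < pi / 2"
  shows "slice_domain (double_sector \<theta> :: 'n::{finite,linorder} clifford set) = {(x, y). Complex x y \<in> dcone (sin \<theta>)}"
proof -
  have "slice_pt J x y \<in> double_sector \<theta> \<longleftrightarrow> Complex x y \<in> dcone (sin \<theta>)" if "J \<in> imag_sphere" for J :: "'n clifford" and x y
    using double_sector_slice[OF that assms, of "Complex x y"] by simp
  then show ?thesis using axis_in_imag_sphere[of "undefined :: 'n"] by (auto simp: slice_domain_def)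
qed

lemma sl_inj:
  assumes J: "J \<in> imag_sphere" and eq: "sl J a = sl J b"
  shows "a = b"
proof -
  have r: "Re a = Re b" using slice_pt_empty[OF J, of "Re a" "Im a"] slice_pt_empty[OF J, of "Re b" "Im b"] eq by simp
  have "(Im a - Im b) *\<^sub>R J = 0" using eq r by (simp add: slice_pt_def algebra_simps)
  moreover have "J \<noteq> 0" using J by (auto simp: imag_sphere_def)
  ultimately show ?thesis using r by (simp add: complex_eq_iff)
qed

lemma rep_unique:
  fixes f :: "'n::{finite,linorder} clifford \<Rightarrow> 'n clifford"
  assumes "rep \<theta> f F" "rep \<theta> f G" "z \<in> dcone (sin \<theta>)"
  shows "F z = G z"
proof -
  have J: "(axis {undefined} 1 :: 'n clifford) \<in> imag_sphere" by (rule axis_in_imag_sphere)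
  show ?thesis
    by (rule sl_inj[OF J]) (use assms J in \<open>auto simp: rep_def\<close>)
qed

lemma bounded_linear_cl_of_real: "bounded_linear (cl_of_real :: real \<Rightarrow> 'n::finite clifford)"
proof (rule bounded_linear_intro)
  show "norm (cl_of_real x :: 'n clifford) \<le> norm x * 1" for x
    unfolding cl_of_real_def using norm_axis_le[of "{} :: 'n set" x] by simp
qed (simp_all add: vec_eq_iff cl_of_real_nth)

text \<open>\<open>F\<close> has the real slice components as real and imaginary part. The
  Cauchy-Riemann equations say that its real derivative is multiplication by the complex number with
  parts \<open>u\<close> and \<open>v\<close>.\<close>

lemma intrinsic_imp_rep:
  fixes f :: "'n::{finite,linorder} clifford \<Rightarrow> 'n clifford"
  assumes f: "f \<in> slice_intrinsic (double_sector \<theta>)" and th: "0 < \<theta>" "\<theta> < pi / 2"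
  shows "\<exists>F. F holomorphic_on dcone (sin \<theta>) \<and> rep \<theta> f F \<and> cnj_sym \<theta> F"
proof -
  let ?D = "slice_domain (double_sector \<theta> :: 'n clifford set)"
  have dom: "(x, y) \<in> ?D \<longleftrightarrow> Complex x y \<in> dcone (sin \<theta>)" for x y
    unfolding slice_domain_double_sector[OF th] by simp
  obtain f0 f1 where c: "slice_components (double_sector \<theta>) f f0 f1"
    and re: "\<forall>z\<in>?D. f0 z \<in> range cl_of_real \<and> f1 z \<in> range cl_of_real"
    using f by (auto simp: slice_intrinsic_def)
  obtain f0' f1' :: "real \<times> real \<Rightarrow> (real \<times> real) \<Rightarrow>\<^sub>L 'n clifford" where
    d: "\<forall>z\<in>?D. (f0 has_derivative blinfun_apply (f0' z)) (at z) \<and> (f1 has_derivative blinfun_apply (f1' z)) (at z) \<and>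
          blinfun_apply (f0' z) (1, 0) = blinfun_apply (f1' z) (0, 1) \<and>
          blinfun_apply (f0' z) (0, 1) = - blinfun_apply (f1' z) (1, 0)"
    using c unfolding slice_components_def by blast
  have p: "\<forall>(x, y)\<in>?D. (\<forall>J\<in>imag_sphere. f (slice_pt J x y) = f0 (x, y) + J \<odot> f1 (x, y)) \<and>
       f0 (x, - y) = f0 (x, y) \<and> f1 (x, - y) = - f1 (x, y)"
    using c unfolding slice_components_def by blast
  define F where "F z = Complex (f0 (Re z, Im z) $ {}) (f1 (Re z, Im z) $ {})" for z
  have zD: "(Re z, Im z) \<in> ?D" if "z \<in> dcone (sin \<theta>)" for z using dom that by simp
  have real: "f0 (Re z, Im z) = cl_of_real (Re (F z))" "f1 (Re z, Im z) = cl_of_real (Im (F z))" if "z \<in> dcone (sin \<theta>)" for z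
    using re zD[OF that] by (auto simp: F_def cl_of_real_nth)
  have "rep \<theta> f F"
    unfolding rep_def
  proof (intro ballI)
    fix J :: "'n clifford" and z assume J: "J \<in> imag_sphere" and z: "z \<in> dcone (sin \<theta>)"
    have "f (sl J z) = f0 (Re z, Im z) + J \<odot> f1 (Re z, Im z)" using p zD[OF z] J by auto
    then show "f (sl J z) = sl J (F z)" unfolding real[OF z] cl_mult_of_real by (simp add: slice_pt_def)
  qed
  moreover have "cnj_sym \<theta> F"
    unfolding cnj_sym_def
  proof
    fix z assume z: "z \<in> dcone (sin \<theta>)"
    have "f0 (Re z, - Im z) = f0 (Re z, Im z)" "f1 (Re z, - Im z) = - f1 (Re z, Im z)" using p zD[OF z] by auto
    then show "F (cnj z) = cnj (F z)" by (simp add: F_def complex_eq_iff)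
  qed
  moreover have "F holomorphic_on dcone (sin \<theta>)"
  proof -
    have "\<exists>D. (F has_field_derivative D) (at z)" if z: "z \<in> dcone (sin \<theta>)" for z
    proof -
      let ?p = "(Re z, Im z)"
      have bl: "bounded_linear (\<lambda>z. (Re z, Im z))" by (intro bounded_linear_Pair bounded_linear_Re bounded_linear_Im)
      have bn: "bounded_linear (\<lambda>v :: 'n clifford. v $ {})" by (rule bounded_linear_vec_nth)
      have d0: "((\<lambda>z. f0 (Re z, Im z) $ {}) has_derivative (\<lambda>h. f0' ?p (Re h, Im h) $ {})) (at z)"
        by (rule bounded_linear.has_derivative[OF bn], rule has_derivative_compose[OF bounded_linear_imp_has_derivative[OF bl]])
          (use d zD[OF z] in auto)
      have d1: "((\<lambda>z. f1 (Re z, Im z) $ {}) has_derivative (\<lambda>h. f1' ?p (Re h, Im h) $ {})) (at z)"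
        by (rule bounded_linear.has_derivative[OF bn], rule has_derivative_compose[OF bounded_linear_imp_has_derivative[OF bl]])
          (use d zD[OF z] in auto)
      define u v where "u = f0' ?p (1, 0) $ {}" and "v = f1' ?p (1, 0) $ {}"
      have cr: "f0' ?p (0, 1) $ {} = - v" "f1' ?p (0, 1) $ {} = u"
        using d zD[OF z] by (auto simp: u_def v_def)
      have lin: "B (a, b) $ {} = a * (B (1, 0) $ {}) + b * (B (0, 1) $ {})" for B :: "(real \<times> real) \<Rightarrow>\<^sub>L 'n clifford" and a b
      proof -
        have "B (a *\<^sub>R (1, 0) + b *\<^sub>R (0, 1)) = a *\<^sub>R B (1, 0) + b *\<^sub>R B (0, 1)"
          by (simp only: blinfun.add_right blinfun.scaleR_right)
        then show ?thesis by simp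
      qed
      have lf: "f0' ?p (Re h, Im h) $ {} = Re h * u - Im h * v" "f1' ?p (Re h, Im h) $ {} = Re h * v + Im h * u" for h
        unfolding lin[of _ "Re h" "Im h"] cr u_def v_def by simp_all
      have "((\<lambda>z. of_real (f0 (Re z, Im z) $ {}) + \<i> * of_real (f1 (Re z, Im z) $ {})) has_derivative
          (\<lambda>h. of_real (f0' ?p (Re h, Im h) $ {}) + \<i> * of_real (f1' ?p (Re h, Im h) $ {}))) (at z)"
        by (intro has_derivative_add has_derivative_mult_right has_derivative_of_real d0 d1)
      moreover have "(\<lambda>z. of_real (f0 (Re z, Im z) $ {}) + \<i> * of_real (f1 (Re z, Im z) $ {})) = F"
        by (rule ext) (simp add: F_def complex_eq_iff)
      moreover have "(\<lambda>h. of_real (f0' ?p (Re h, Im h) $ {}) + \<i> * of_real (f1' ?p (Re h, Im h) $ {})) = (*) (Complex u v)"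
      proof
        fix h
        show "of_real (f0' ?p (Re h, Im h) $ {}) + \<i> * of_real (f1' ?p (Re h, Im h) $ {}) = Complex u v * h"
          unfolding lf by (simp add: complex_eq_iff algebra_simps)
      qed
      ultimately show ?thesis unfolding has_field_derivative_def by auto
    qed
    then show ?thesis
      unfolding holomorphic_on_def field_differentiable_def using has_field_derivative_at_within by blast
  qed
  ultimately show ?thesis by blast
qed

lemma rep_imp_intrinsic:
  fixes f :: "'n::{finite,linorder} clifford \<Rightarrow> 'n clifford"
  assumes F: "F holomorphic_on dcone (sin \<theta>)" "rep \<theta> f F" "cnj_sym \<theta> F" and th: "0 < \<theta>" "\<theta> < pi / 2"
  shows "f \<in> slice_intrinsic (double_sector \<theta>)" "f \<in> slice_hyperhol (double_sector \<theta>)"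
proof -
  let ?D = "slice_domain (double_sector \<theta> :: 'n clifford set)"
  have dom: "(x, y) \<in> ?D \<longleftrightarrow> Complex x y \<in> dcone (sin \<theta>)" for x y
    unfolding slice_domain_double_sector[OF th] by simp
  define cx :: "real \<times> real \<Rightarrow> complex" where "cx p = of_real (fst p) + \<i> * of_real (snd p)" for p
  have cx: "Re (cx p) = fst p" "Im (cx p) = snd p" "cx (x, y) = Complex x y" for p x y
    by (auto simp: cx_def complex_eq_iff)
  have dom2: "p \<in> ?D \<longleftrightarrow> cx p \<in> dcone (sin \<theta>)" for p using dom[of "fst p" "snd p"] cx(3)[of "fst p" "snd p"] by simp
  have blc: "bounded_linear cx" unfolding cx_def
    by (intro bounded_linear_add bounded_linear_const_mult bounded_linear_compose[OF bounded_linear_of_real] bounded_linear_fst bounded_linear_snd)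
  define f0 f1 :: "real \<times> real \<Rightarrow> 'n clifford" where
    "f0 p = cl_of_real (Re (F (cx p)))" and "f1 p = cl_of_real (Im (F (cx p)))" for p
  define A B :: "(real \<times> real) \<Rightarrow>\<^sub>L 'n clifford" where
    "A = Blinfun (\<lambda>h. cl_of_real (fst h))" and "B = Blinfun (\<lambda>h. cl_of_real (snd h))"
  have A: "A h = cl_of_real (fst h)" and B: "B h = cl_of_real (snd h)" for h
    unfolding A_def B_def
    by (subst bounded_linear_Blinfun_apply; intro bounded_linear_compose[OF bounded_linear_cl_of_real] bounded_linear_fst bounded_linear_snd refl)+
  define D where "D p = deriv F (cx p)" for p
  \<comment> \<open>The two rows of the real matrix of multiplication by \<open>D p\<close>.\<close>
  define f0' f1' :: "real \<times> real \<Rightarrow> (real \<times> real) \<Rightarrow>\<^sub>L 'n clifford" where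
    "f0' p = Re (D p) *\<^sub>R A - Im (D p) *\<^sub>R B" and "f1' p = Im (D p) *\<^sub>R A + Re (D p) *\<^sub>R B" for p
  have Dc: "continuous_on ?D D"
    unfolding D_def
    by (rule continuous_on_compose2[OF holomorphic_on_imp_continuous_on[OF holomorphic_deriv[OF F(1) open_dcone]]])
      (use dom2 linear_continuous_on[OF blc] in auto)
  have ders: "(f0 has_derivative blinfun_apply (f0' p)) (at p)" "(f1 has_derivative blinfun_apply (f1' p)) (at p)" if p: "p \<in> ?D" for p
  proof -
    have "(F has_derivative (*) (D p)) (at (cx p))"
      using holomorphic_derivI[OF F(1) open_dcone, of "cx p"] dom2 p by (simp add: has_field_derivative_def D_def)
    from has_derivative_compose[OF bounded_linear_imp_has_derivative[OF blc] this]
    have 1: "((\<lambda>p. F (cx p)) has_derivative (\<lambda>h. D p * cx h)) (at p)" .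
    have 2: "(f0 has_derivative (\<lambda>h. cl_of_real (Re (D p * cx h)))) (at p)"
      unfolding f0_def by (intro bounded_linear.has_derivative[OF bounded_linear_cl_of_real] bounded_linear.has_derivative[OF bounded_linear_Re] 1)
    have 3: "(f1 has_derivative (\<lambda>h. cl_of_real (Im (D p * cx h)))) (at p)"
      unfolding f1_def by (intro bounded_linear.has_derivative[OF bounded_linear_cl_of_real] bounded_linear.has_derivative[OF bounded_linear_Im] 1)
    have "(\<lambda>h. cl_of_real (Re (D p * cx h))) = blinfun_apply (f0' p)" "(\<lambda>h. cl_of_real (Im (D p * cx h))) = blinfun_apply (f1' p)"
      by (auto simp: f0'_def f1'_def cx A B blinfun.diff_left blinfun.add_left blinfun.scaleR_left vec_eq_iff cl_of_real_nth)
    then show "(f0 has_derivative blinfun_apply (f0' p)) (at p)" "(f1 has_derivative blinfun_apply (f1' p)) (at p)" using 2 3 by simp_all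
  qed
  have comp: "slice_components (double_sector \<theta>) f f0 f1"
    unfolding slice_components_def
  proof (rule conjI[OF _ exI[of _ f0', OF exI[of _ f1']]]; (intro conjI ballI)?)
    show "case p of (x, y) \<Rightarrow> (\<forall>J\<in>imag_sphere. f (slice_pt J x y) = f0 (x, y) + J \<odot> f1 (x, y)) \<and>
       f0 (x, - y) = f0 (x, y) \<and> f1 (x, - y) = - f1 (x, y)" if "p \<in> ?D" for p
    proof (cases p)
      case (Pair x y)
      have z: "Complex x y \<in> dcone (sin \<theta>)" using dom that Pair by simp
      have s: "F (Complex x (- y)) = cnj (F (Complex x y))"
        using F(3) z unfolding cnj_sym_def by (metis complex_cnj)
      have m: "cl_of_real (- r) = - (cl_of_real r :: 'n clifford)" for r by (simp add: vec_eq_iff cl_of_real_nth)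
      have r: "f (slice_pt J x y) = sl J (F (Complex x y))" if "J \<in> imag_sphere" for J
        using F(2) z that unfolding rep_def by force
      show ?thesis using r s Pair by (simp add: f0_def f1_def cx(3) cl_mult_of_real m) (simp add: slice_pt_def)
    qed
    show "continuous_on ?D f0'" "continuous_on ?D f1'"
      unfolding f0'_def f1'_def by (intro continuous_intros Dc)+
    show "(f0 has_derivative blinfun_apply (f0' z)) (at z)" "(f1 has_derivative blinfun_apply (f1' z)) (at z)" if "z \<in> ?D" for z
      using ders that by auto
    show "blinfun_apply (f0' z) (1, 0) = blinfun_apply (f1' z) (0, 1)" "blinfun_apply (f0' z) (0, 1) = - blinfun_apply (f1' z) (1, 0)" for z
      by (auto simp: f0'_def f1'_def A B blinfun.diff_left blinfun.add_left blinfun.scaleR_left vec_eq_iff cl_of_real_nth)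
  qed
  then show "f \<in> slice_hyperhol (double_sector \<theta>)" by (auto simp: slice_hyperhol_def)
  show "f \<in> slice_intrinsic (double_sector \<theta>)"
  proof -
    have "\<forall>z\<in>?D. f0 z \<in> range cl_of_real \<and> f1 z \<in> range cl_of_real" by (auto simp: f0_def f1_def)
    then show ?thesis unfolding slice_intrinsic_def using comp by blast
  qed
qed

text \<open>Translates the Lebesgue condition in \<open>SHL0\<close> into the gauge integrability on
  which \<open>ray_ok\<close> is built.\<close>

lemma nn_integral_halfline_finite_iff:
  fixes h :: "real \<Rightarrow> real"
  assumes c: "continuous_on {0<..} h" and nn: "\<And>t. 0 < t \<Longrightarrow> 0 \<le> h t"
  shows "(\<integral>\<^sup>+ t\<in>{0<..}. ennreal (h t) \<partial>lborel) < \<infinity> \<longleftrightarrow> h integrable_on {0<..}"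
proof -
  define g where "g t = indicator {0<..} t * h t" for t
  have gm: "g \<in> borel_measurable borel"
    unfolding g_def using borel_measurable_continuous_on_indicator[OF _ c] by simp
  have g0: "0 \<le> g t" for t using nn by (simp add: g_def indicator_def)
  have e: "(\<integral>\<^sup>+ t\<in>{0<..}. ennreal (h t) \<partial>lborel) = (\<integral>\<^sup>+ t. ennreal (g t) \<partial>lborel)"
    by (intro nn_integral_cong) (auto simp: g_def indicator_def)
  have gr: "g = (\<lambda>t. if t \<in> {0<..} then h t else 0)" by (auto simp: g_def fun_eq_iff indicator_def)
  have i: "h integrable_on {0<..} \<longleftrightarrow> g integrable_on UNIV"
    unfolding gr using integrable_restrict_UNIV[of "{0<..}" h] by blast
  show ?thesis
  proof
    assume "(\<integral>\<^sup>+ t\<in>{0<..}. ennreal (h t) \<partial>lborel) < \<infinity>"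
    then show "h integrable_on {0<..}"
      unfolding e i using gm g0 by (intro nn_integral_integrable_on) auto
  next
    assume "h integrable_on {0<..}"
    then have "(g has_integral integral UNIV g) UNIV" unfolding i by (rule integrable_integral)
    from nn_integral_has_integral_lborel[OF gm g0 this]
    show "(\<integral>\<^sup>+ t\<in>{0<..}. ennreal (h t) \<partial>lborel) < \<infinity>" unfolding e by simp
  qed
qed

lemma N0_iff:
  fixes f :: "'n::{finite,linorder} clifford \<Rightarrow> 'n clifford"
  assumes th: "0 < \<theta>" "\<theta> < pi / 2"
  shows "f \<in> N0 \<theta> \<longleftrightarrow> (\<exists>F\<in>H0 \<theta>. rep \<theta> f F \<and> cnj_sym \<theta> F)"
proof -
  have sub: "sin \<theta> < 1" using sin_mono_quarter[of "\<theta>/2" \<theta>] th by auto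
  have fint: "(\<integral>\<^sup>+ t\<in>{0<..}. ennreal (norm (f (t *\<^sub>R cl_exp J \<alpha>)) / t) \<partial>lborel) < \<infinity> \<longleftrightarrow> ray_ok (\<lambda>z. F z / z) \<alpha>"
    if F: "F holomorphic_on dcone (sin \<theta>)" "rep \<theta> f F" and J: "J \<in> imag_sphere" and a: "\<bar>sin \<alpha>\<bar> < sin \<theta>" for F J \<alpha>
  proof -
    let ?z = "\<lambda>t. complex_of_real t * cis \<alpha>"
    have z: "?z t \<in> dcone (sin \<theta>)" if "0 < t" for t using that a by (rule ray_in_dcone)
    have c: "continuous_on {0<..} (\<lambda>t. F (?z t))"
      by (rule continuous_on_compose2[OF holomorphic_on_imp_continuous_on[OF F(1)]]) (use z in \<open>auto intro!: continuous_intros\<close>)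
    have fe: "norm (f (t *\<^sub>R cl_exp J \<alpha>)) / t = norm (F (?z t) / ?z t)" if t: "0 < t" for t
    proof -
      have "t *\<^sub>R cl_exp J \<alpha> = sl J (?z t)" by (simp add: cl_exp_slice)
      then have "f (t *\<^sub>R cl_exp J \<alpha>) = sl J (F (?z t))" using F(2) J z[OF t] unfolding rep_def by metis
      then show ?thesis using t by (simp add: norm_slice_pt[OF J] norm_divide norm_mult)
    qed
    have "(\<integral>\<^sup>+ t\<in>{0<..}. ennreal (norm (f (t *\<^sub>R cl_exp J \<alpha>)) / t) \<partial>lborel) = (\<integral>\<^sup>+ t\<in>{0<..}. ennreal (norm (F (?z t) / ?z t)) \<partial>lborel)"
      by (intro nn_integral_cong) (auto simp: indicator_def fe)
    moreover have cc: "continuous_on {0<..} (\<lambda>t. F (?z t) / ?z t)" by (intro continuous_intros c) auto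
    ultimately show ?thesis
      using nn_integral_halfline_finite_iff[OF continuous_on_norm[OF cc]] by (simp add: ray_ok_def)
  qed
  show ?thesis
  proof
    assume f: "f \<in> N0 \<theta>"
    then obtain F where F: "F holomorphic_on dcone (sin \<theta>)" "rep \<theta> f F" "cnj_sym \<theta> F"
      using intrinsic_imp_rep[OF _ th] by (auto simp: N0_def)
    define J :: "'n clifford" where "J = axis {undefined} 1"
    have J: "J \<in> imag_sphere" by (simp add: J_def axis_in_imag_sphere)
    have "F \<in> H0 \<theta>"
      unfolding H0_def
    proof (intro CollectI conjI allI impI F(1))
      obtain M where M: "\<And>s. s \<in> double_sector \<theta> \<Longrightarrow> norm (f s) \<le> M"
        using f by (auto simp: N0_def SHL0_def bounded_iff)
      have "norm (F z) \<le> M" if z: "z \<in> dcone (sin \<theta>)" for z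
        using M[of "sl J z"] double_sector_slice[OF J th, of z] z F(2) J norm_slice_pt[OF J, of "Re (F z)" "Im (F z)"]
        by (auto simp: rep_def)
      then show "bounded (F ` dcone (sin \<theta>))" unfolding bounded_iff by blast
      \<comment> \<open>\<open>H0\<close> admits every real angle with small sine,
        \<open>SHL0\<close> only those in \<open>sector_angles\<close>; both describe the same rays
        because the ray depends only on \<open>cis \<alpha>\<close>.\<close>
      fix \<alpha> assume a: "\<bar>sin \<alpha>\<bar> < sin \<theta>"
      then have "cis \<alpha> \<in> dcone (sin \<theta>)" using ray_in_dcone[of 1 \<alpha> "sin \<theta>"] by simp
      from sector_angles_exists[OF this th] obtain \<beta> where b: "\<beta> \<in> sector_angles \<theta>" "cis \<alpha> = cis \<beta>" by auto
      have "ray_ok (\<lambda>z. F z / z) \<beta>"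
        using fint[OF F(1,2) J sin_sector_angles[OF b(1) th]] f J b(1) by (auto simp: N0_def SHL0_def)
      then show "ray_ok (\<lambda>z. F z / z) \<alpha>" by (simp only: ray_ok_def b(2))
    qed
    then show "\<exists>F\<in>H0 \<theta>. rep \<theta> f F \<and> cnj_sym \<theta> F" using F by blast
  next
    assume "\<exists>F\<in>H0 \<theta>. rep \<theta> f F \<and> cnj_sym \<theta> F"
    then obtain F where F: "F \<in> H0 \<theta>" "rep \<theta> f F" "cnj_sym \<theta> F" by blast
    have hol: "F holomorphic_on dcone (sin \<theta>)" by (rule H0_holomorphic[OF F(1)])
    obtain M where M: "\<And>z. z \<in> dcone (sin \<theta>) \<Longrightarrow> norm (F z) \<le> M" using H0_bound[OF F(1)] by blast
    have "norm (f s) \<le> M" if s: "s \<in> double_sector \<theta>" for s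
    proof -
      obtain J z where J: "J \<in> imag_sphere" "z \<in> dcone (sin \<theta>)" "s = sl J z" using double_sector_sl[OF s th] by blast
      then show ?thesis using F(2) M[of z] norm_slice_pt[OF J(1), of "Re (F z)" "Im (F z)"] by (auto simp: rep_def)
    qed
    then have "bounded (f ` double_sector \<theta>)" unfolding bounded_iff by blast
    moreover have "\<forall>J\<in>imag_sphere. \<forall>\<phi>\<in>sector_angles \<theta>. (\<integral>\<^sup>+ t\<in>{0<..}. ennreal (norm (f (t *\<^sub>R cl_exp J \<phi>)) / t) \<partial>lborel) < \<infinity>"
      using fint[OF hol F(2) _ sin_sector_angles[OF _ th]] F(1) sin_sector_angles[OF _ th] by (auto simp: H0_def)
    ultimately show "f \<in> N0 \<theta>"
      using rep_imp_intrinsic[OF hol F(2,3) th] by (auto simp: N0_def SHL0_def)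
  qed
qed

text \<open>The integral of \<open>1 / t\<close> depends only on the logarithmic length of the
  interval, so a lower bound \<open>\<delta> / t\<close> on long intervals forces a large
  integral.\<close>

lemma integrable_log_bound:
  fixes h :: "real \<Rightarrow> real"
  assumes h: "h integrable_on {0<..}" "\<And>t. 0 < t \<Longrightarrow> 0 \<le> h t"
    and ab: "0 < a" "a \<le> b" "\<And>t. a \<le> t \<Longrightarrow> t \<le> b \<Longrightarrow> \<delta> / t \<le> h t"
  shows "\<delta> * ln (b / a) \<le> integral {0<..} h"
proof -
  have "((\<lambda>t. \<delta> * (1 / t)) has_integral (\<delta> * ln b - \<delta> * ln a)) {a..b}"
    by (rule fundamental_theorem_of_calculus[OF ab(2)])
      (use ab in \<open>auto intro!: derivative_eq_intros simp: has_real_derivative_iff_has_vector_derivative[symmetric]\<close>)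
  moreover have hi: "h integrable_on {a..b}"
  proof -
    have "(\<lambda>t. if t \<in> {0<..} then h t else 0) integrable_on UNIV"
      using h(1) integrable_restrict_UNIV[of "{0<..}" h] by blast
    then have "(\<lambda>t. if t \<in> {0<..} then h t else 0) integrable_on cbox a b" by (rule integrable_on_subcbox) simp
    then have "(\<lambda>t. if t \<in> {0<..} then h t else 0) integrable_on {a..b}" by simp
    then show ?thesis by (rule integrable_eq) (use ab in auto)
  qed
  ultimately have "\<delta> * ln b - \<delta> * ln a \<le> integral {a..b} h"
    by (intro has_integral_le[OF _ integrable_integral]) (use ab in auto)
  also have "\<dots> \<le> integral {0<..} h"
    by (rule integral_subset_le) (use ab h hi in auto)
  finally show ?thesis using ab by (simp add: ln_div algebra_simps)
qed

text \<open>On the positive axis \<open>- G\<close> equals \<open>A + B / (1 + t\<^sup>2)\<close>,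
  with limits \<open>A\<close> at infinity and \<open>A + B\<close> at 0. A nonzero limit at either
  end contradicts integrability against \<open>dt / t\<close>.\<close>

lemma H0_bnd_components_unique:
  assumes th: "0 < \<theta>" "\<theta> < pi / 2" and G: "G \<in> H0 \<theta>"
    and eq: "\<And>z. z \<in> dcone (sin \<theta>) \<Longrightarrow> of_real A + of_real B * (1 / (1 + z\<^sup>2)) + G z = 0"
  shows "A = 0" "B = 0"
proof -
  have s: "0 < sin \<theta>" using sin_mono_quarter[of "\<theta>/2" \<theta>] th by auto
  define h where "h t = \<bar>A + B / (1 + t\<^sup>2)\<bar> / t" for t :: real
  have he: "norm (G (of_real t) / of_real t) = h t" if "0 < t" for t
  proof -
    have "complex_of_real t \<in> dcone (sin \<theta>)" using that s by (simp add: dcone_def)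
    from eq[OF this] have "G (of_real t) = - of_real (A + B / (1 + t\<^sup>2))" by (simp add: add_eq_0_iff algebra_simps)
    then have "norm (G (of_real t)) = \<bar>A + B / (1 + t\<^sup>2)\<bar>" by (simp only: norm_minus_cancel norm_of_real)
    then show ?thesis using that by (simp add: h_def norm_divide)
  qed
  have "ray_ok (\<lambda>z. G z / z) 0" using G s by (simp add: H0_def)
  then have "(\<lambda>t. norm (G (of_real t) / of_real t)) integrable_on {0<..}" by (simp add: ray_ok_def)
  then have hi: "h integrable_on {0<..}" by (rule integrable_eq) (simp add: he)
  have h0: "0 \<le> h t" if "0 < t" for t using that by (simp add: h_def)
  define I where "I = integral {0<..} h"
  \<comment> \<open>If \<open>h\<close> is at least \<open>d / t\<close> on an interval of
    logarithmic length \<open>(I + 1) / d\<close>, then \<open>I + 1\<close> is at most the integral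
    \<open>I\<close>.\<close>
  have bad: False if d: "0 < d" and far: "\<And>K. 0 < K \<Longrightarrow> \<exists>a b. 0 < a \<and> a \<le> b \<and> ln (b / a) = K \<and> (\<forall>t. a \<le> t \<longrightarrow> t \<le> b \<longrightarrow> d \<le> \<bar>A + B / (1 + t\<^sup>2)\<bar>)" for d
  proof -
    have "0 \<le> I" unfolding I_def by (rule integral_nonneg[OF hi]) (use h0 in auto)
    then have K: "0 < (I + 1) / d" using d by simp
    obtain a b where ab: "0 < a" "a \<le> b" "ln (b / a) = (I + 1) / d" "\<And>t. a \<le> t \<Longrightarrow> t \<le> b \<Longrightarrow> d \<le> \<bar>A + B / (1 + t\<^sup>2)\<bar>"
      using far[OF K] by blast
    have "d * ln (b / a) \<le> I" unfolding I_def
      by (rule integrable_log_bound[OF hi h0 ab(1,2)]) (use ab in \<open>auto simp: h_def intro!: divide_right_mono\<close>)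
    then show False using d ab(3) by simp
  qed
  have A: "A = 0"
  proof (rule ccontr)
    assume "A \<noteq> 0"
    have "((\<lambda>t. A + B / (1 + t\<^sup>2)) \<longlongrightarrow> A) at_top" by real_asymp
    then have "((\<lambda>t. \<bar>A + B / (1 + t\<^sup>2)\<bar>) \<longlongrightarrow> \<bar>A\<bar>) at_top" by (rule tendsto_rabs)
    then have "\<forall>\<^sub>F t in at_top. \<bar>A\<bar> / 2 < \<bar>A + B / (1 + t\<^sup>2)\<bar>" using \<open>A \<noteq> 0\<close> by (intro order_tendstoD(1)) auto
    then obtain N where N: "\<And>t. N \<le> t \<Longrightarrow> \<bar>A\<bar> / 2 < \<bar>A + B / (1 + t\<^sup>2)\<bar>" by (auto simp: eventually_at_top_linorder)
    show False
    proof (rule bad[of "\<bar>A\<bar> / 2"])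
      fix K :: real assume "0 < K"
      show "\<exists>a b. 0 < a \<and> a \<le> b \<and> ln (b / a) = K \<and> (\<forall>t. a \<le> t \<longrightarrow> t \<le> b \<longrightarrow> \<bar>A\<bar> / 2 \<le> \<bar>A + B / (1 + t\<^sup>2)\<bar>)"
      proof (rule exI[of _ "max 1 N"], rule exI[of _ "max 1 N * exp K"], intro conjI allI impI)
        show m: "0 < max 1 N" by simp
        have "1 \<le> exp K" using \<open>0 < K\<close> by simp
        then show "max 1 N \<le> max 1 N * exp K" using mult_left_mono[of 1 "exp K" "max 1 N"] m by linarith
        show "ln (max 1 N * exp K / max 1 N) = K" using m by simp
        fix t assume "max 1 N \<le> t"
        then show "\<bar>A\<bar> / 2 \<le> \<bar>A + B / (1 + t\<^sup>2)\<bar>" by (intro less_imp_le[OF N]) simp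
      qed
    qed (use \<open>A \<noteq> 0\<close> in auto)
  qed
  then show "A = 0" .
  show "B = 0"
  proof (rule ccontr)
    assume "B \<noteq> 0"
    have "((\<lambda>t. A + B / (1 + t\<^sup>2)) \<longlongrightarrow> A + B) (at_right 0)" by real_asymp
    then have "((\<lambda>t. \<bar>A + B / (1 + t\<^sup>2)\<bar>) \<longlongrightarrow> \<bar>A + B\<bar>) (at_right 0)" by (rule tendsto_rabs)
    then have "\<forall>\<^sub>F t in at_right 0. \<bar>B\<bar> / 2 < \<bar>A + B / (1 + t\<^sup>2)\<bar>" using \<open>B \<noteq> 0\<close> A by (intro order_tendstoD(1)) auto
    then obtain N where N: "0 < N" "\<And>t. 0 < t \<Longrightarrow> t < N \<Longrightarrow> \<bar>B\<bar> / 2 < \<bar>A + B / (1 + t\<^sup>2)\<bar>"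
      by (auto simp: eventually_at_right_field)
    show False
    proof (rule bad[of "\<bar>B\<bar> / 2"])
      fix K :: real assume "0 < K"
      show "\<exists>a b. 0 < a \<and> a \<le> b \<and> ln (b / a) = K \<and> (\<forall>t. a \<le> t \<longrightarrow> t \<le> b \<longrightarrow> \<bar>B\<bar> / 2 \<le> \<bar>A + B / (1 + t\<^sup>2)\<bar>)"
      \<comment> \<open>An interval of logarithmic length \<open>K\<close> ending at
        \<open>N / 2\<close>, where the lower bound near 0 holds.\<close>
      proof (rule exI[of _ "N / 2 * exp (- K)"], rule exI[of _ "N / 2"], intro conjI allI impI)
        show p: "0 < N / 2 * exp (- K)" using N(1) by simp
        have "exp (- K) \<le> 1" using \<open>0 < K\<close> by simp
        then show "N / 2 * exp (- K) \<le> N / 2" using N(1) by (intro mult_left_le) auto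
        show "ln (N / 2 / (N / 2 * exp (- K))) = K" using N(1) by (simp add: ln_div ln_mult)
        fix t assume t: "N / 2 * exp (- K) \<le> t" "t \<le> N / 2"
        show "\<bar>B\<bar> / 2 \<le> \<bar>A + B / (1 + t\<^sup>2)\<bar>"
          by (rule less_imp_le, rule N(2)) (use p t N(1) in linarith)+
      qed
    qed (use \<open>B \<noteq> 0\<close> in auto)
  qed
qed

subsection \<open>The bounded and the \<open>H\<^sup>\<infinity>\<close>-calculus\<close>

lemma cl_inv_sl:
  assumes J: "J \<in> imag_sphere"
  shows "cl_inv (sl J w) = sl J (1 / w)"
proof -
  have "cl_inv (sl J w) = (1 / (norm w)\<^sup>2) *\<^sub>R sl J (cnj w)"
    using norm_slice_pt[OF J, of "Re w" "Im w"] cl_conj_slice_pt[OF J, of "Re w" "Im w"] by (simp add: cl_inv_def)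
  also have "1 / w = of_real (1 / (norm w)\<^sup>2) * cnj w"
    by (simp add: complex_div_cnj[of 1 w])
  ultimately show ?thesis by (simp add: slice_pt_def vec_eq_iff cl_of_real_nth algebra_simps)
qed

lemma cl_pow_sl:
  fixes J :: "'n::{finite,linorder} clifford"
  assumes "J \<in> imag_sphere"
  shows "cl_pow (sl J z) k = sl J (z ^ k)"
  by (induction k) (simp_all add: sl_mult[OF assms], simp add: slice_pt_def)

lemma cl_poly_sl:
  fixes J :: "'n::{finite,linorder} clifford"
  assumes J: "J \<in> imag_sphere"
  shows "cl_poly p (sl J z) = sl J (\<Sum>i\<le>degree p. of_real (coeff p i) * z ^ i)"
  unfolding cl_poly_def cl_pow_sl[OF J]
  by (simp add: vec_eq_iff slice_pt_nth sum.distrib sum_distrib_right sum_distrib_left mult.assoc distrib_left if_distrib)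

lemma cl_inv_one_plus_square_sl:
  fixes J :: "'n::{finite,linorder} clifford"
  assumes J: "J \<in> imag_sphere"
  shows "cl_inv (cl_one + sl J z \<odot> sl J z) = sl J (1 / (1 + z\<^sup>2))"
proof -
  have "cl_one + sl J z \<odot> sl J z = sl J (1 + z\<^sup>2)"
    unfolding sl_mult[OF J] by (simp add: slice_pt_def power2_eq_square vec_eq_iff cl_of_real_nth)
  then show ?thesis by (simp only: cl_inv_sl[OF J])
qed

lemma sl_affine: "cl_of_real c + d *\<^sub>R sl J a + sl J b = sl J (of_real c + of_real d * a + b)"
  by (simp add: vec_eq_iff slice_pt_nth cl_of_real_nth algebra_simps)

lemma rep_mult:
  fixes f g :: "'n::{finite,linorder} clifford \<Rightarrow> 'n clifford"
  assumes "rep \<theta> f F" "rep \<theta> g G"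
  shows "rep \<theta> (\<lambda>s. f s \<odot> g s) (\<lambda>z. F z * G z)"
  using assms by (auto simp: rep_def sl_mult)

section \<open>The extended calculus in planar form\<close>

locale bisectorial_calc = bisectorial_op T \<omega>
  for T :: "('v::banach, 'n::{finite,linorder}) oper" and \<omega> +
  fixes \<theta> :: real
  assumes theta: "\<omega> < \<theta>" "\<theta> < pi / 2"
begin

lemma theta_pos: "0 < \<theta>" using theta omega_bounds by simp

abbreviation \<phi>0 :: real where "\<phi>0 \<equiv> (\<omega> + \<theta>) / 2"

lemma phi0: "\<omega> < \<phi>0" "\<phi>0 < \<theta>" using theta by simp_all

text \<open>At \<open>\<i>\<close> the real part is 0 and the norm 1, so \<open>Qc \<i>\<close> is
  \<open>1 + T^2\<close>. The difference \<open>R \<i> - R (- \<i>)\<close> is \<open>- 2 i\<close>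
  times \<open>Q\<close> by the resolvent equation and \<open>- 2 i\<close> times
  \<open>q \<i>\<close> by the definition of \<open>R\<close>.\<close>

lemma Q_eq: "to_blinfun (op_inv (op_add Some (op_pow T 2))) = Q"
proof -
  have O: "\<i> \<in> Omega" "- \<i> \<in> Omega" using i_in_Om by (simp_all add: Om_def Omega_def)
  have "op_add Some (op_pow T 2) = Qc \<i>"
    by (auto simp: Qc_def op_add_def op_scale_def numeral_2_eq_2 map_comp_def dom_def fun_eq_iff split: option.splits)
  then have 1: "to_blinfun (op_inv (op_add Some (op_pow T 2))) = q \<i>" by (simp add: q_def)
  have c: "q (- \<i>) = q \<i>" "tq (- \<i>) = tq \<i>" using q_cnj[of \<i>] tq_cnj[of \<i>] by simp_all
  have "cr (- 2 * \<i>) o\<^sub>L Q = R \<i> - R (- \<i>)"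
    unfolding Q_def using R_eq[of \<i> "- \<i>"] O by (simp add: Omega_def)
  also have "\<dots> = (cr (- \<i>) o\<^sub>L q \<i>) - (cr \<i> o\<^sub>L q \<i>)" by (simp add: R_def c)
  also have "\<dots> = cr (- 2 * \<i>) o\<^sub>L q \<i>"
    using cs_diff[of "- \<i>" \<i>] by (simp add: blinfun_compose_simps)
  finally have "cr (- 2 * \<i>) o\<^sub>L Q = cr (- 2 * \<i>) o\<^sub>L q \<i>" .
  then have "Q = q \<i>" using cs_inverse[of "- 2 * \<i>" Q] cs_inverse[of "- 2 * \<i>" "q \<i>"] by simp
  then show ?thesis using 1 by simp
qed

text \<open>The extended calculus on the level of planar functions, as a relation between function and operator.\<close>

definition planar_calc :: "(complex \<Rightarrow> complex) \<Rightarrow> ('v, 'n) cmodule \<Rightarrow>\<^sub>L ('v, 'n) cmodule \<Rightarrow> bool" where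
  "planar_calc F A \<longleftrightarrow> (\<exists>c d G. G \<in> H0 \<theta> \<and> cnj_sym \<theta> G \<and>
     (\<forall>z\<in>dcone (sin \<theta>). F z = of_real c + of_real d * (1 / (1 + z\<^sup>2)) + G z) \<and> A = Psi c d G \<phi>0)"

text \<open>The components are unique on the cone, so the function determines the operator. All
  later identities between operators are read off from identities between functions in this
  way.\<close>

lemma planar_calc_unique:
  assumes A: "planar_calc F A" and B: "planar_calc F' B" and eq: "\<And>z. z \<in> dcone (sin \<theta>) \<Longrightarrow> F z = F' z"
  shows "A = B"
proof -
  obtain c d G where 1: "G \<in> H0 \<theta>" "\<And>z. z \<in> dcone (sin \<theta>) \<Longrightarrow> F z = of_real c + of_real d * (1 / (1 + z\<^sup>2)) + G z" "A = Psi c d G \<phi>0"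
    using A by (auto simp: planar_calc_def)
  obtain c' d' G' where 2: "G' \<in> H0 \<theta>" "\<And>z. z \<in> dcone (sin \<theta>) \<Longrightarrow> F' z = of_real c' + of_real d' * (1 / (1 + z\<^sup>2)) + G' z" "B = Psi c' d' G' \<phi>0"
    using B by (auto simp: planar_calc_def)
  have H: "(\<lambda>z. G z + - 1 * G' z) \<in> H0 \<theta>" by (intro H0_add H0_scale 1 2)
  have "of_real (c - c') + of_real (d - d') * (1 / (1 + z\<^sup>2)) + (G z + - 1 * G' z) = 0" if z: "z \<in> dcone (sin \<theta>)" for z
  proof -
    define u where "u = 1 / (1 + z\<^sup>2)"
    have "of_real c + of_real d * u + G z = of_real c' + of_real d' * u + G' z"
      using 1(2)[OF z] 2(2)[OF z] eq[OF z] by (simp add: u_def)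
    then show ?thesis unfolding u_def[symmetric] of_real_diff by algebra
  qed
  from H0_bnd_components_unique[OF theta_pos theta(2) H this] have cd: "c = c'" "d = d'" by auto
  have "Phi G \<phi>0 = Phi G' \<phi>0"
  proof (rule Phi_cong[OF _ phi0 theta(2)])
    show "G z = G' z" if z: "z \<in> dcone (sin \<theta>)" for z using 1(2)[OF z] 2(2)[OF z] eq[OF z] cd by simp
  qed
  then show ?thesis by (simp add: 1(3) 2(3) cd Psi_def)
qed

lemma planar_calc_cong: "planar_calc F A \<Longrightarrow> (\<And>z. z \<in> dcone (sin \<theta>) \<Longrightarrow> F' z = F z) \<Longrightarrow> planar_calc F' A"
  unfolding planar_calc_def by (metis (no_types, lifting))

lemma planar_calc_mult:
  assumes A: "planar_calc F A" and B: "planar_calc F' B"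
  shows "planar_calc (\<lambda>z. F z * F' z) (A o\<^sub>L B)"
proof -
  obtain c d f where 1: "f \<in> H0 \<theta>" "cnj_sym \<theta> f" "\<And>z. z \<in> dcone (sin \<theta>) \<Longrightarrow> F z = of_real c + of_real d * (1 / (1 + z\<^sup>2)) + f z" "A = Psi c d f \<phi>0"
    using A by (auto simp: planar_calc_def)
  obtain c' d' g where 2: "g \<in> H0 \<theta>" "cnj_sym \<theta> g" "\<And>z. z \<in> dcone (sin \<theta>) \<Longrightarrow> F' z = of_real c' + of_real d' * (1 / (1 + z\<^sup>2)) + g z" "B = Psi c' d' g \<phi>0"
    using B by (auto simp: planar_calc_def)
  define k where "k = (\<lambda>z. of_real (- (d * d')) * (z / (1 + z\<^sup>2) * (z / (1 + z\<^sup>2))) + of_real c * g z + of_real c' * f z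
      + of_real d * (1 / (1 + z\<^sup>2) * g z) + of_real d' * (1 / (1 + z\<^sup>2) * f z) + f z * g z)"
  note P = Psi_mult[OF 1(1) 2(1) phi0 theta(2), where c = c and d = d and c' = c' and d' = d', folded k_def]
  have "cnj_sym \<theta> k" using 1(2) 2(2) by (auto simp: cnj_sym_def k_def)
  moreover have "F z * F' z = of_real (c * c') + of_real (c * d' + d * c' + d * d') * (1 / (1 + z\<^sup>2)) + k z"
    if z: "z \<in> dcone (sin \<theta>)" for z
  proof -
    define u where "u = 1 / (1 + z\<^sup>2)"
    have "u * (1 + z\<^sup>2) = 1" using one_plus_square_nonzero[OF theta_pos theta(2) z] by (simp add: u_def)
    \<comment> \<open>The square of \<open>u\<close> is not of the form constant times
      \<open>u\<close> plus \<open>H0\<close> at first sight; this splits it into \<open>u\<close>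
      and the square of a function in \<open>H0\<close>.\<close>
    then have "u * u = u - (z * u) * (z * u)" by algebra
    moreover have "z / (1 + z\<^sup>2) = z * u" by (simp add: u_def)
    ultimately show ?thesis unfolding 1(3)[OF z] 2(3)[OF z] k_def u_def[symmetric] of_real_add of_real_mult of_real_minus
      by (simp only:) algebra
  qed
  ultimately show ?thesis
    unfolding planar_calc_def using P unfolding 1(4) 2(4) by blast
qed

lemma planar_calc_add:
  assumes A: "planar_calc F A" and B: "planar_calc F' B"
  shows "planar_calc (\<lambda>z. F z + F' z) (A + B)"
proof -
  obtain c d f where 1: "f \<in> H0 \<theta>" "cnj_sym \<theta> f" "\<And>z. z \<in> dcone (sin \<theta>) \<Longrightarrow> F z = of_real c + of_real d * (1 / (1 + z\<^sup>2)) + f z" "A = Psi c d f \<phi>0"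
    using A by (auto simp: planar_calc_def)
  obtain c' d' g where 2: "g \<in> H0 \<theta>" "cnj_sym \<theta> g" "\<And>z. z \<in> dcone (sin \<theta>) \<Longrightarrow> F' z = of_real c' + of_real d' * (1 / (1 + z\<^sup>2)) + g z" "B = Psi c' d' g \<phi>0"
    using B by (auto simp: planar_calc_def)
  have "A + B = Psi (c + c') (d + d') (\<lambda>z. f z + g z) \<phi>0"
    by (simp add: 1(4) 2(4) Psi_def Phi_add[OF 1(1) 2(1) phi0 theta(2)] scaleR_add_left)
  moreover have "cnj_sym \<theta> (\<lambda>z. f z + g z)" using 1(2) 2(2) by (simp add: cnj_sym_def)
  moreover have "F z + F' z = of_real (c + c') + of_real (d + d') * (1 / (1 + z\<^sup>2)) + (f z + g z)" if "z \<in> dcone (sin \<theta>)" for z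
    unfolding 1(3)[OF that] 2(3)[OF that] of_real_add by algebra
  ultimately show ?thesis unfolding planar_calc_def using H0_add[OF 1(1) 2(1)] by blast
qed

lemma planar_calc_scale:
  assumes A: "planar_calc F A"
  shows "planar_calc (\<lambda>z. of_real r * F z) (r *\<^sub>R A)"
proof -
  obtain c d f where 1: "f \<in> H0 \<theta>" "cnj_sym \<theta> f" "\<And>z. z \<in> dcone (sin \<theta>) \<Longrightarrow> F z = of_real c + of_real d * (1 / (1 + z\<^sup>2)) + f z" "A = Psi c d f \<phi>0"
    using A by (auto simp: planar_calc_def)
  have "r *\<^sub>R A = Psi (r * c) (r * d) (\<lambda>z. of_real r * f z) \<phi>0"
    by (simp add: 1(4) Psi_def Phi_scale[OF 1(1) phi0 theta(2)] scaleR_add_right)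
  moreover have "cnj_sym \<theta> (\<lambda>z. of_real r * f z)" using 1(2) by (simp add: cnj_sym_def)
  moreover have "of_real r * F z = of_real (r * c) + of_real (r * d) * (1 / (1 + z\<^sup>2)) + of_real r * f z" if "z \<in> dcone (sin \<theta>)" for z
    unfolding 1(3)[OF that] of_real_mult by algebra
  ultimately show ?thesis unfolding planar_calc_def using H0_scale[OF 1(1)] by blast
qed

lemma planar_calc_one: "planar_calc (\<lambda>_. 1) id_blinfun"
proof -
  let ?h = "\<lambda>z :: complex. z / (1 + z\<^sup>2)"
  have h: "?h \<in> H0 \<theta>" by (rule H0_id_over_one_plus_square[OF theta_pos theta(2)])
  have z: "(\<lambda>z. of_real 0 * ?h z) \<in> H0 \<theta>" by (rule H0_scale[OF h])
  have "id_blinfun = Psi 1 0 (\<lambda>z. of_real 0 * ?h z) \<phi>0"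
    unfolding Psi_def Phi_scale[OF h phi0 theta(2)] by simp
  then show ?thesis unfolding planar_calc_def using z
    by (intro exI[of _ "1::real"] exI[of _ "0::real"] exI[of _ "\<lambda>z. of_real 0 * ?h z"]) (simp add: cnj_sym_def)
qed

lemma planar_calc_sum:
  fixes m :: nat
  assumes "\<And>i. i \<le> m \<Longrightarrow> planar_calc (F i) (A i)"
  shows "planar_calc (\<lambda>z. \<Sum>i\<le>m. F i z) (\<Sum>i\<le>m. A i)"
  using assms by (induction m) (simp_all add: planar_calc_add)

definition bpow :: "('v, 'n) cmodule \<Rightarrow>\<^sub>L ('v, 'n) cmodule \<Rightarrow> nat \<Rightarrow> ('v, 'n) cmodule \<Rightarrow>\<^sub>L ('v, 'n) cmodule" where
  "bpow A k = ((\<lambda>B. A o\<^sub>L B) ^^ k) id_blinfun"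

lemma bpow_apply: "bpow A k v = (blinfun_apply A ^^ k) v"
  by (induction k) (simp_all add: bpow_def)

lemma planar_calc_bpow: "planar_calc F A \<Longrightarrow> planar_calc (\<lambda>z. F z ^ k) (bpow A k)"
  by (induction k) (simp_all add: bpow_def planar_calc_one planar_calc_mult)

text \<open>Both choices meet their specification; the planar integral contains no \<open>J\<close>
  and does not change with the angle.\<close>

lemma omega_calc_eq_Phi:
  assumes "rep \<theta> f F" "F \<in> H0 \<theta>" "cnj_sym \<theta> F"
  shows "omega_calc \<omega> \<theta> T f = Phi F \<phi>0"
proof -
  have "(SOME \<phi>. \<phi> \<in> {\<omega><..<\<theta>}) \<in> {\<omega><..<\<theta>}" by (rule someI[of _ "\<phi>0"]) (use phi0 in simp)
  moreover have "(SOME J :: 'n clifford. J \<in> imag_sphere) \<in> imag_sphere" by (rule someI[of "\<lambda>J. J \<in> imag_sphere", OF axis_in_imag_sphere])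
  ultimately show ?thesis
    unfolding omega_calc_def
    using omega_integral_eq_Phi[OF _ assms] Phi_angle[OF assms(2)] phi0 theta by (metis greaterThanLessThan_iff)
qed

lemma Nbnd_planar_calc:
  assumes "g \<in> Nbnd \<theta>"
  shows "\<exists>F. rep \<theta> g F \<and> planar_calc F (bnd_calc \<omega> \<theta> T g)"
proof -
  define t where "t = (SOME (g0, ginf, gt). bnd_components \<theta> g g0 ginf gt)"
  obtain g0 c gt where t: "t = (g0, c, gt)" by (cases t)
  have "\<exists>t. case t of (g0, ginf, gt) \<Rightarrow> bnd_components \<theta> g g0 ginf gt" using assms by (auto simp: Nbnd_def)
  from someI_ex[OF this] have bc: "bnd_components \<theta> g g0 c gt" unfolding t_def[symmetric] t by simp
  then obtain G where G: "G \<in> H0 \<theta>" "rep \<theta> gt G" "cnj_sym \<theta> G"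
    using N0_iff[OF theta_pos theta(2)] by (auto simp: bnd_components_def)
  define F where "F z = of_real c + of_real (g0 - c) * (1 / (1 + z\<^sup>2)) + G z" for z
  have "rep \<theta> g F"
    unfolding rep_def
  proof (intro ballI)
    fix J :: "'n clifford" and z assume J: "J \<in> imag_sphere" and z: "z \<in> dcone (sin \<theta>)"
    have "sl J z \<in> double_sector \<theta>" using double_sector_slice[OF J theta_pos theta(2)] z by simp
    then have "g (sl J z) = cl_of_real c + (g0 - c) *\<^sub>R cl_inv (cl_one + sl J z \<odot> sl J z) + gt (sl J z)"
      using bc unfolding bnd_components_def by blast
    moreover have "gt (sl J z) = sl J (G z)" using G(2) J z by (simp add: rep_def)
    ultimately show "g (sl J z) = sl J (F z)"
      unfolding cl_inv_one_plus_square_sl[OF J] F_def by (simp only: sl_affine)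
  qed
  moreover have "bnd_calc \<omega> \<theta> T g = Psi c (g0 - c) G \<phi>0"
    unfolding bnd_calc_def t_def[symmetric] t Psi_def by (simp add: Q_eq omega_calc_eq_Phi[OF G(2,1,3)])
  ultimately show ?thesis unfolding planar_calc_def using G F_def by blast
qed

lemma Nbnd_planar_calc_rep:
  assumes "g \<in> Nbnd \<theta>" "rep \<theta> g F"
  shows "planar_calc F (bnd_calc \<omega> \<theta> T g)"
proof -
  obtain F' where F': "rep \<theta> g F'" "planar_calc F' (bnd_calc \<omega> \<theta> T g)" using Nbnd_planar_calc[OF assms(1)] by blast
  show ?thesis by (rule planar_calc_cong[OF F'(2) rep_unique[OF assms(2) F'(1)]])
qed

text \<open>A planar decomposition gives slice components with \<open>g0 = c + d\<close>. The
  components selected in \<open>bnd_calc\<close> may be others, but they yield the same operator by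
  uniqueness.\<close>

lemma planar_calc_Nbnd:
  assumes g: "rep \<theta> g F" and A: "planar_calc F A"
  shows "g \<in> Nbnd \<theta>" "bnd_calc \<omega> \<theta> T g = A"
proof -
  obtain c d G where 1: "G \<in> H0 \<theta>" "cnj_sym \<theta> G" "\<And>z. z \<in> dcone (sin \<theta>) \<Longrightarrow> F z = of_real c + of_real d * (1 / (1 + z\<^sup>2)) + G z"
    using A by (auto simp: planar_calc_def)
  define gt where "gt s = g s - cl_of_real c - d *\<^sub>R cl_inv (cl_one + s \<odot> s)" for s
  have "rep \<theta> gt G"
    unfolding rep_def
  proof (intro ballI)
    fix J :: "'n clifford" and z assume J: "J \<in> imag_sphere" and z: "z \<in> dcone (sin \<theta>)"
    have "g (sl J z) = sl J (F z)" using g J z by (simp add: rep_def)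
    then have "g (sl J z) = cl_of_real c + d *\<^sub>R sl J (1 / (1 + z\<^sup>2)) + sl J (G z)"
      by (simp only: 1(3)[OF z] sl_affine)
    then show "gt (sl J z) = sl J (G z)" unfolding gt_def cl_inv_one_plus_square_sl[OF J] by simp
  qed
  then have "gt \<in> N0 \<theta>" using N0_iff[OF theta_pos theta(2)] 1 by blast
  then have "bnd_components \<theta> g (c + d) c gt" by (simp add: bnd_components_def gt_def)
  then show "g \<in> Nbnd \<theta>" by (auto simp: Nbnd_def)
  from planar_calc_unique[OF Nbnd_planar_calc_rep[OF this g] A] show "bnd_calc \<omega> \<theta> T g = A" by simp
qed

text \<open>Let \<open>E0\<close> be the planar form of the regularizer selected in
  \<open>H_calc\<close>. The functions \<open>E E0 = E0 E\<close> and
  \<open>E (E0 G) = E0 (E G)\<close> give \<open>A A0 = A0 A\<close> and \<open>A B0 = A0 B\<close>,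
  so by injectivity of both \<open>A\<close> and \<open>A0\<close> the equation
  \<open>A u = B v\<close> is equivalent to \<open>A0 u = B0 v\<close>.\<close>

lemma H_calc_iff:
  assumes g: "rep \<theta> g G" "g \<in> Nreg \<omega> \<theta> T"
    and e: "planar_calc E A" "planar_calc (\<lambda>z. E z * G z) B" "inj (blinfun_apply A)"
  shows "H_calc \<omega> \<theta> T g v = Some u \<longleftrightarrow> A u = B v"
proof -
  define e0 where "e0 = (SOME e. regularizer \<omega> \<theta> T g e)"
  have r: "regularizer \<omega> \<theta> T g e0"
  proof -
    obtain e' where "regularizer \<omega> \<theta> T g e'" using g(2) by (auto simp: Nreg_def)
    then show ?thesis unfolding e0_def by (rule someI[of "regularizer \<omega> \<theta> T g"])
  qed
  define A0 B0 where "A0 = bnd_calc \<omega> \<theta> T e0" and "B0 = bnd_calc \<omega> \<theta> T (\<lambda>s. e0 s \<odot> g s)"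
  obtain E0 where E0: "rep \<theta> e0 E0" "planar_calc E0 A0" using Nbnd_planar_calc[of e0] r by (auto simp: regularizer_def A0_def)
  have B0: "planar_calc (\<lambda>z. E0 z * G z) B0"
    unfolding B0_def by (rule Nbnd_planar_calc_rep[OF _ rep_mult[OF E0(1) g(1)]]) (use r in \<open>simp add: regularizer_def\<close>)
  have inj0: "inj (blinfun_apply A0)" using r by (simp add: regularizer_def A0_def)
  have c1: "A o\<^sub>L A0 = A0 o\<^sub>L A"
    by (rule planar_calc_unique[OF planar_calc_mult[OF e(1) E0(2)] planar_calc_mult[OF E0(2) e(1)]]) simp
  have c2: "A o\<^sub>L B0 = A0 o\<^sub>L B"
    by (rule planar_calc_unique[OF planar_calc_mult[OF e(1) B0] planar_calc_mult[OF E0(2) e(2)]]) simp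
  have c1': "A (A0 w) = A0 (A w)" for w using arg_cong[OF c1, of "\<lambda>X. blinfun_apply X w"] by simp
  have c2': "A (B0 w) = A0 (B w)" for w using arg_cong[OF c2, of "\<lambda>X. blinfun_apply X w"] by simp
  have "A u = B v \<longleftrightarrow> A0 (A u) = A0 (B v)" using inj0 by (auto simp: inj_def)
  also have "\<dots> \<longleftrightarrow> A0 u = B0 v" unfolding c1'[symmetric] c2'[symmetric] using e(3) by (auto simp: inj_def)
  finally have eq: "A u = B v \<longleftrightarrow> A0 u = B0 v" .
  have "H_calc \<omega> \<theta> T g v = op_inv (of_blinfun A0) (B0 v)"
    unfolding H_calc_def e0_def[symmetric] A0_def B0_def by (simp add: of_blinfun_def map_comp_def)
  also have "\<dots> = Some u \<longleftrightarrow> A0 u = B0 v"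
  proof
    assume h: "op_inv (of_blinfun A0) (B0 v) = Some u"
    then have "B0 v \<in> ran (of_blinfun A0)" by (auto simp: op_inv_def split: if_splits)
    then have "\<exists>x. of_blinfun A0 x = Some (B0 v)" by (auto simp: ran_def)
    from someI_ex[OF this] show "A0 u = B0 v" using h by (auto simp: op_inv_def of_blinfun_def split: if_splits)
  next
    assume h: "A0 u = B0 v"
    then have "(SOME x. A0 x = B0 v) = u" using inj0 by (intro some_equality) (auto simp: inj_def)
    moreover have "B0 v \<in> ran (of_blinfun A0)" using h by (auto simp: ran_def of_blinfun_def)
    ultimately show "op_inv (of_blinfun A0) (B0 v) = Some u" by (simp add: op_inv_def of_blinfun_def)
  qed
  finally show ?thesis using eq by simp
qed

section \<open>Polynomials of the operator \<open>g(T)\<close>\<close>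

lemma op_pow_dom_mono:
  assumes "op_pow H m v \<noteq> None" "i \<le> m"
  shows "op_pow H i v \<noteq> None"
  using assms(2,1)
proof (induction rule: dec_induct)
  case (step k)
  have "op_pow H k v \<noteq> None" using step.prems by (auto simp: map_comp_def split: option.splits)
  then show ?case by (rule step.IH)
qed

lemma poly_H_calc:
  fixes p :: "real poly"
  assumes g: "g \<in> Nreg \<omega> \<theta> T"
  defines "h \<equiv> \<lambda>s. cl_poly p (g s)"
  shows "h \<in> Nreg \<omega> \<theta> T" "op_poly p (H_calc \<omega> \<theta> T g) \<subseteq>\<^sub>m H_calc \<omega> \<theta> T h"
proof -
  let ?m = "degree p"
  obtain G where G: "G holomorphic_on dcone (sin \<theta>)" "rep \<theta> g G" "cnj_sym \<theta> G"
    using intrinsic_imp_rep[OF _ theta_pos theta(2)] g by (auto simp: Nreg_def)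
  obtain e where e: "regularizer \<omega> \<theta> T g e" using g by (auto simp: Nreg_def)
  define A B where "A = bnd_calc \<omega> \<theta> T e" and "B = bnd_calc \<omega> \<theta> T (\<lambda>s. e s \<odot> g s)"
  obtain E where E: "rep \<theta> e E" "planar_calc E A" using Nbnd_planar_calc[of e] e by (auto simp: regularizer_def A_def)
  have B: "planar_calc (\<lambda>z. E z * G z) B"
    unfolding B_def by (rule Nbnd_planar_calc_rep[OF _ rep_mult[OF E(1) G(2)]]) (use e in \<open>simp add: regularizer_def\<close>)
  have inj: "inj (blinfun_apply A)" using e by (simp add: regularizer_def A_def)
  define P where "P z = (\<Sum>i\<le>?m. of_real (coeff p i) * G z ^ i)" for z
  have Ph: "P holomorphic_on dcone (sin \<theta>)" unfolding P_def by (intro holomorphic_intros G)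
  have Pr: "rep \<theta> h P" using G(2) by (auto simp: rep_def h_def P_def cl_poly_sl)
  have Pc: "cnj_sym \<theta> P" using G(3) by (auto simp: cnj_sym_def P_def)
  define C where "C = (\<Sum>i\<le>?m. coeff p i *\<^sub>R (bpow A (?m - i) o\<^sub>L bpow B i))"
  have Em: "planar_calc (\<lambda>z. E z ^ ?m) (bpow A ?m)" by (rule planar_calc_bpow[OF E(2)])
  have EP: "planar_calc (\<lambda>z. E z ^ ?m * P z) C"
  proof (rule planar_calc_cong)
    show "planar_calc (\<lambda>z. \<Sum>i\<le>?m. of_real (coeff p i) * (E z ^ (?m - i) * (E z * G z) ^ i)) C"
      unfolding C_def by (intro planar_calc_sum planar_calc_scale planar_calc_mult planar_calc_bpow E(2) B)
    show "E z ^ ?m * P z = (\<Sum>i\<le>?m. of_real (coeff p i) * (E z ^ (?m - i) * (E z * G z) ^ i))" for z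
      unfolding P_def sum_distrib_left
    proof (rule sum.cong[OF refl])
      fix i assume "i \<in> {..?m}"
      then have "E z ^ ?m = E z ^ (?m - i) * E z ^ i" by (simp add: power_add[symmetric])
      then show "E z ^ ?m * (of_real (coeff p i) * G z ^ i) = of_real (coeff p i) * (E z ^ (?m - i) * (E z * G z) ^ i)"
        by (simp add: power_mult_distrib)
    qed
  qed
  have injm: "inj (blinfun_apply (bpow A ?m))"
    unfolding bpow_apply[abs_def] by (rule inj_fn[OF inj])
  define e' where "e' = (\<lambda>s. cl_pow (e s) ?m)"
  have e': "rep \<theta> e' (\<lambda>z. E z ^ ?m)" using E(1) by (auto simp: rep_def e'_def cl_pow_sl)
  have "regularizer \<omega> \<theta> T h e'"
    unfolding regularizer_def planar_calc_Nbnd(2)[OF e' Em]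
    using planar_calc_Nbnd(1)[OF e' Em] planar_calc_Nbnd(1)[OF rep_mult[OF e' Pr] EP] injm by simp
  then show h: "h \<in> Nreg \<omega> \<theta> T"
    using rep_imp_intrinsic(1)[OF Ph Pr Pc theta_pos theta(2)] by (auto simp: Nreg_def)
  \<comment> \<open>Commutation of the operators is read off from the commuting functions
    \<open>E\<close> and \<open>E G\<close>.\<close>
  have c: "A o\<^sub>L B = B o\<^sub>L A"
    by (rule planar_calc_unique[OF planar_calc_mult[OF E(2) B] planar_calc_mult[OF B E(2)]]) simp
  have AB: "B ((blinfun_apply A ^^ i) w) = (blinfun_apply A ^^ i) (B w)" for i w
  proof -
    have "B (A x) = A (B x)" for x using arg_cong[OF c, of "\<lambda>X. blinfun_apply X x"] by simp
    then show ?thesis by (induction i) simp_all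
  qed
  let ?H = "H_calc \<omega> \<theta> T g"
  show "op_poly p ?H \<subseteq>\<^sub>m H_calc \<omega> \<theta> T h"
    unfolding map_le_def
  proof
    fix v assume "v \<in> dom (op_poly p ?H)"
    then have d: "op_pow ?H ?m v \<noteq> None" by (auto simp: op_poly_def split: if_splits)
    define w where "w i = the (op_pow ?H i v)" for i
    have w: "op_pow ?H i v = Some (w i)" if "i \<le> ?m" for i
      using op_pow_dom_mono[OF d that] by (auto simp: w_def)
    have pw: "(blinfun_apply B ^^ i) v = (blinfun_apply A ^^ i) (w i)" if "i \<le> ?m" for i
      using that
    proof (induction i)
      case 0
      then show ?case using w[of 0] by simp
    next
      case (Suc i)
      have "?H (w i) = Some (w (Suc i))" using w[of i] w[of "Suc i"] Suc.prems by (simp add: map_comp_def)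
      then have "A (w (Suc i)) = B (w i)" using H_calc_iff[OF G(2) g E(2) B inj] by blast
      then have "(blinfun_apply A ^^ Suc i) (w (Suc i)) = (blinfun_apply A ^^ i) (B (w i))"
        by (simp only: funpow_Suc_right o_apply)
      also have "\<dots> = B ((blinfun_apply A ^^ i) (w i))" by (simp only: AB)
      finally show ?case using Suc by simp
    qed
    have tm: "(bpow A (?m - i) o\<^sub>L bpow B i) v = bpow A ?m (w i)" if "i \<le> ?m" for i
    proof -
      have "(blinfun_apply A ^^ (?m - i)) ((blinfun_apply A ^^ i) (w i)) = (blinfun_apply A ^^ ?m) (w i)"
        using that by (simp add: funpow_add[THEN fun_cong, simplified, symmetric])
      then show ?thesis by (simp add: bpow_apply pw[OF that])
    qed
    have "C v = bpow A ?m (\<Sum>i\<le>?m. coeff p i *\<^sub>R w i)"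
      unfolding C_def by (simp add: blinfun.sum_left blinfun.sum_right blinfun.scaleR_left blinfun.scaleR_right tm cong: sum.cong_simp del: blinfun_apply_blinfun_compose)
    \<comment> \<open>\<open>H_calc_iff\<close> allows the regularizer \<open>e'\<close> here,
      although \<open>H_calc\<close> is defined by an unspecified choice.\<close>
    then have "H_calc \<omega> \<theta> T h v = Some (\<Sum>i\<le>?m. coeff p i *\<^sub>R w i)"
      using H_calc_iff[OF Pr h Em EP injm] by simp
    moreover have "op_poly p ?H v = Some (\<Sum>i\<le>?m. coeff p i *\<^sub>R w i)"
      using d by (simp add: op_poly_def w_def dom_def)
    ultimately show "op_poly p ?H v = H_calc \<omega> \<theta> T h v" by simp
  qed
qed

end

theorem corollary5p8:
  fixes T :: "('v::banach, 'n::{finite,linorder}) oper"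
    and g :: "'n clifford \<Rightarrow> 'n clifford"
    and p :: "real poly"
    and \<omega> \<theta> :: real
  assumes "0 < \<omega>" "\<omega> < pi / 2"
    and "T \<in> closed_ops" "bisectorial \<omega> T"
    and "\<omega> < \<theta>" "\<theta> < pi / 2"
    and "g \<in> Nreg \<omega> \<theta> T"
    and "p \<noteq> 0"
  shows "(\<lambda>s. cl_poly p (g s)) \<in> Nreg \<omega> \<theta> T \<and>
         op_poly p (H_calc \<omega> \<theta> T g) \<subseteq>\<^sub>m H_calc \<omega> \<theta> T (\<lambda>s. cl_poly p (g s))"
proof -
  interpret bisectorial_calc T \<omega> \<theta>
    using assms by unfold_locales
  show ?thesis using poly_H_calc[OF assms(7), of p] by blast
qed

end
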